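(* Let $A$ be a basic finite-dimensional algebra over a field $\mathbb{K}$, $E$ a basic generating-cogenerating $A$-module and $\Gamma\cong\operatorname{End}_A(E)^{\mathrm{op}}$, so $\operatorname{domdim}\Gamma=d+1$ with $d\geq1$, and let $\Pi$ be a maximal projective-injective summand of $\Gamma$. For $0\leq k\leq d+1$, let $C^k$ be the $k$-coshifted module of $\Gamma$, $B^k=\operatorname{End}_\Gamma(C^k)^{\mathrm{op}}$, and let $c^k$ be the intermediate extension functor from $A$-modules to $B^k$-modules. Write $P^k=\operatorname{Hom}_\Gamma(C^k,\Pi)$ and $I^k=D\operatorname{Hom}_\Gamma(\Pi,C^k)$. Then $$DC^k\in\operatorname{gen}_{k-1}(P^k)\cap\operatorname{cogen}^{d-k}(I^k).$$ If $1\leq k\leq d$, it follows that $$DC^k\cong c^k(E).$$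
   Context: Modules are finitely generated left modules; morphisms are composed right-to-left; $D=\operatorname{Hom}_{\mathbb{K}}(-,\mathbb{K})$. $E$ is generating-cogenerating if $A,DA\in\operatorname{add}E$. $\operatorname{domdim}\Gamma\geq k$ if ${}_\Gamma\Gamma$ has an injective resolution whose first $k$ terms are projective-injective; $\operatorname{domdim}\Gamma=k$ if moreover not $\geq k+1$. A $\Gamma$-module $C$ is $k$-cotilting if $\operatorname{idim}C\leq k$, $\operatorname{Ext}^i_\Gamma(C,C)=0$ for $i>0$, and there is an exact sequence $0\to c^k\to\cdots\to c^0\to D\Gamma\to0$ with all $c^j\in\operatorname{add}C$. It is $I$-special, for $I$ injective, if $I\in\operatorname{add}C$ and there is such a sequence with $c^j\in\operatorname{add}I$ for $0\leq j\leq k-1$. For $0\leq k\leq\operatorname{domdim}\Gamma$, $C^k$ is the basic $\Pi$-special $k$-cotilting module (unique up to isomorphism); it has $\Pi$ as a summand. Let $e^k\in B^k$ be the idempotent given by projection onto $\Pi$. By the Morita--Tachikawa correspondence we identify $A=\operatorname{End}_\Gamma(\Pi)^{\mathrm{op}}=e^kB^ke^k$ and $E=D\Pi$. For a module $X$ and $m\geq0$, $\operatorname{gen}_m(X)$ is the full subcategory of modules $M$ admitting an exact sequence $X^m\to\cdots\to X^0\to M\to0$ with all $X^i\in\operatorname{add}X$ that stays exact under $\operatorname{Hom}(X,-)$. $\operatorname{cogen}^m(X)$ is the full subcategory of modules $N$ admitting an exact sequence $0\to N\to X_0\to\cdots\to X_m$ with all $X_i\in\operatorname{add}X$ that stays exact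 under $\operatorname{Hom}(-,X)$. $\operatorname{gen}_{-1}(X)=\operatorname{cogen}^{-1}(X)$ is the whole module category. Intermediate extension: for an algebra $B$ with idempotent $e$ and $A=eBe$, let $\ell=Be\otimes_A-$ and $r=\operatorname{Hom}_A(eB,-)$, the left and right adjoints of $N\mapsto eN$. Let $\zeta_M:\ell M\to rM$ be the canonical map corresponding to $\mathrm{id}_M$ under $\operatorname{Hom}_B(\ell M,rM)\cong\operatorname{Hom}_A(M,M)$, i.e. $be\otimes m\mapsto(eb'\mapsto eb'be\cdot m)$. Then $c(M)=\operatorname{im}\zeta_M$. The functor $c^k$ is $c$ for $(B,e)=(B^k,e^k)$. *)

theory Defs
  imports "HOL-Algebra.Module" "HOL-Algebra.Ring" "HOL-Algebra.QuotRing"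
    "HOL-Algebra.Generated_Groups" "HOL-Algebra.Free_Abelian_Groups"
begin

section \<open>Algebras and modules\<close>

text \<open>
  The record type \<^type>\<open>module\<close> is used both for \<open>K\<close>-algebras (with their multiplication) and for
  modules. In the latter case the fields \<^const>\<open>monoid.mult\<close> and \<^const>\<open>one\<close> carry no information.
  The library locale \<^locale>\<open>module\<close> only covers commutative rings of scalars.
\<close>

locale left_module = R?: ring R + M?: abelian_group M for R (structure) and M (structure) +
  assumes smult_closed:
      "\<lbrakk>a \<in> carrier R; x \<in> carrier M\<rbrakk> \<Longrightarrow> a \<odot>\<^bsub>M\<^esub> x \<in> carrier M"
    and smult_l_distr:
      "\<lbrakk>a \<in> carrier R; b \<in> carrier R; x \<in> carrier M\<rbrakk> \<Longrightarrow>
        (a \<oplus> b) \<odot>\<^bsub>M\<^esub> x = a \<odot>\<^bsub>M\<^esub> x \<oplus>\<^bsub>M\<^esub> b \<odot>\<^bsub>M\<^esub> x"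
    and smult_r_distr:
      "\<lbrakk>a \<in> carrier R; x \<in> carrier M; y \<in> carrier M\<rbrakk> \<Longrightarrow>
        a \<odot>\<^bsub>M\<^esub> (x \<oplus>\<^bsub>M\<^esub> y) = a \<odot>\<^bsub>M\<^esub> x \<oplus>\<^bsub>M\<^esub> a \<odot>\<^bsub>M\<^esub> y"
    and smult_assoc1:
      "\<lbrakk>a \<in> carrier R; b \<in> carrier R; x \<in> carrier M\<rbrakk> \<Longrightarrow>
        (a \<otimes> b) \<odot>\<^bsub>M\<^esub> x = a \<odot>\<^bsub>M\<^esub> (b \<odot>\<^bsub>M\<^esub> x)"
    and smult_one: "x \<in> carrier M \<Longrightarrow> \<one> \<odot>\<^bsub>M\<^esub> x = x"

definition fin_gen :: "('r, 'z) ring_scheme \<Rightarrow> ('r, 'm) module \<Rightarrow> bool" where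
  "fin_gen R M \<longleftrightarrow> (\<exists>S. finite S \<and> S \<subseteq> carrier M \<and>
     (\<forall>x\<in>carrier M. \<exists>c \<in> S \<rightarrow> carrier R. x = (\<Oplus>\<^bsub>M\<^esub>s\<in>S. c s \<odot>\<^bsub>M\<^esub> s)))"

definition fg_module :: "('r, 'z) ring_scheme \<Rightarrow> ('r, 'm) module \<Rightarrow> bool" where
  "fg_module R M \<longleftrightarrow> left_module R M \<and> fin_gen R M"

locale fd_algebra = field K + module K A + A: ring A
  for K :: "'k ring" (structure) and A :: "('k, 'a) module" (structure) +
  assumes smult_mult_left:
      "\<lbrakk>c \<in> carrier K; x \<in> carrier A; y \<in> carrier A\<rbrakk> \<Longrightarrow>
        (c \<odot>\<^bsub>A\<^esub> x) \<otimes>\<^bsub>A\<^esub> y = c \<odot>\<^bsub>A\<^esub> (x \<otimes>\<^bsub>A\<^esub> y)"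
    and smult_mult_right:
      "\<lbrakk>c \<in> carrier K; x \<in> carrier A; y \<in> carrier A\<rbrakk> \<Longrightarrow>
        x \<otimes>\<^bsub>A\<^esub> (c \<odot>\<^bsub>A\<^esub> y) = c \<odot>\<^bsub>A\<^esub> (x \<otimes>\<^bsub>A\<^esub> y)"
    and finite_dim: "fin_gen K A"

definition opp :: "('k, 'a) module \<Rightarrow> ('k, 'a) module" where
  "opp A = A\<lparr>monoid.mult := (\<lambda>x y. y \<otimes>\<^bsub>A\<^esub> x)\<rparr>"

definition alg_iso :: "'k ring \<Rightarrow> ('k, 'a) module \<Rightarrow> ('k, 'b) module \<Rightarrow> ('a \<Rightarrow> 'b) set" where
  "alg_iso K A B = {h \<in> ring_iso A B.
     \<forall>c\<in>carrier K. \<forall>x\<in>carrier A. h (c \<odot>\<^bsub>A\<^esub> x) = c \<odot>\<^bsub>B\<^esub> h x}"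

definition with_smult :: "('r \<Rightarrow> 'm \<Rightarrow> 'm) \<Rightarrow> ('m, 'z) ring_scheme \<Rightarrow> ('r, 'm) module" where
  "with_smult s M = \<lparr>carrier = carrier M, monoid.mult = monoid.mult M, one = one M,
     ring.zero = ring.zero M, ring.add = ring.add M, smult = s\<rparr>"

definition regular :: "('r, 'z) ring_scheme \<Rightarrow> ('r, 'r) module" where
  "regular R = with_smult (monoid.mult R) R"

definition scal :: "('k, 'a) module \<Rightarrow> ('a, 'm) module \<Rightarrow> 'k \<Rightarrow> 'm \<Rightarrow> 'm" where
  "scal A M c x = (c \<odot>\<^bsub>A\<^esub> \<one>\<^bsub>A\<^esub>) \<odot>\<^bsub>M\<^esub> x"

subsection \<open>Homomorphisms and duality\<close>

definition hom_set :: "('r, 'z) ring_scheme \<Rightarrow> ('r, 'm) module \<Rightarrow> ('r, 'n) module \<Rightarrow> ('m \<Rightarrow> 'n) set" where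
  "hom_set R M N = {f \<in> carrier M \<rightarrow>\<^sub>E carrier N.
     (\<forall>x\<in>carrier M. \<forall>y\<in>carrier M. f (x \<oplus>\<^bsub>M\<^esub> y) = f x \<oplus>\<^bsub>N\<^esub> f y) \<and>
     (\<forall>r\<in>carrier R. \<forall>x\<in>carrier M. f (r \<odot>\<^bsub>M\<^esub> x) = r \<odot>\<^bsub>N\<^esub> f x)}"

definition mod_iso :: "('r, 'z) ring_scheme \<Rightarrow> ('r, 'm) module \<Rightarrow> ('r, 'n) module \<Rightarrow> bool" where
  "mod_iso R M N \<longleftrightarrow> (\<exists>f\<in>hom_set R M N. bij_betw f (carrier M) (carrier N))"

definition hom_space :: "('k, 'a) module \<Rightarrow> ('a, 'm) module \<Rightarrow> ('a, 'n) module \<Rightarrow> ('k, 'm \<Rightarrow> 'n) module" where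
  "hom_space A M N = \<lparr>carrier = hom_set A M N, monoid.mult = undefined, one = undefined,
     ring.zero = (\<lambda>x\<in>carrier M. \<zero>\<^bsub>N\<^esub>),
     ring.add = (\<lambda>f g. \<lambda>x\<in>carrier M. f x \<oplus>\<^bsub>N\<^esub> g x),
     smult = (\<lambda>c f. \<lambda>x\<in>carrier M. scal A N c (f x))\<rparr>"

definition end_alg :: "('k, 'a) module \<Rightarrow> ('a, 'm) module \<Rightarrow> ('k, 'm \<Rightarrow> 'm) module" where
  "end_alg A M = (hom_space A M M)\<lparr>monoid.mult := compose (carrier M), one := (\<lambda>x\<in>carrier M. x)\<rparr>"

text \<open>
  \<open>M\<close> is a left \<open>End(M)\<close>-module by evaluation, i.e. a right module over the opposite algebra.
\<close>

definition eval_module :: "('a, 'm) module \<Rightarrow> ('m \<Rightarrow> 'm, 'm) module" where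
  "eval_module M = with_smult (\<lambda>f x. f x) M"

text \<open>
  \<open>D = Hom\<^sub>K(-,K)\<close>. Right modules over \<open>A\<close> are left modules over \<open>opp A\<close>. The definition covers
  both sides: it takes left \<open>opp A\<close>-modules to left \<open>A\<close>-modules, and left \<open>A\<close>-modules to left
  \<open>opp A\<close>-modules.
\<close>

definition dual :: "'k ring \<Rightarrow> ('k, 'a) module \<Rightarrow> ('a, 'm) module \<Rightarrow> ('a, 'm \<Rightarrow> 'k) module" where
  "dual K A M = with_smult (\<lambda>a f. \<lambda>x\<in>carrier M. f (a \<odot>\<^bsub>M\<^esub> x))
     (hom_space (regular K) (with_smult (scal A M) M) (regular K))"

definition dual_regular :: "'k ring \<Rightarrow> ('k, 'a) module \<Rightarrow> ('a, 'a \<Rightarrow> 'k) module" where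
  "dual_regular K A = dual K A (regular (opp A))"

subsection \<open>Direct sums\<close>

definition prod_module :: "('r, 'm) module \<Rightarrow> ('r, 'n) module \<Rightarrow> ('r, 'm \<times> 'n) module" where
  "prod_module M N = \<lparr>carrier = carrier M \<times> carrier N, monoid.mult = undefined, one = undefined,
     ring.zero = (\<zero>\<^bsub>M\<^esub>, \<zero>\<^bsub>N\<^esub>),
     ring.add = (\<lambda>x y. (fst x \<oplus>\<^bsub>M\<^esub> fst y, snd x \<oplus>\<^bsub>N\<^esub> snd y)),
     smult = (\<lambda>r x. (r \<odot>\<^bsub>M\<^esub> fst x, r \<odot>\<^bsub>N\<^esub> snd x))\<rparr>"

definition dsum :: "nat \<Rightarrow> (nat \<Rightarrow> ('r, 'm) module) \<Rightarrow> ('r, nat \<Rightarrow> 'm) module" where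
  "dsum n N = \<lparr>carrier = (\<Pi>\<^sub>E i\<in>{..<n}. carrier (N i)), monoid.mult = undefined, one = undefined,
     ring.zero = (\<lambda>i\<in>{..<n}. \<zero>\<^bsub>N i\<^esub>),
     ring.add = (\<lambda>x y. \<lambda>i\<in>{..<n}. x i \<oplus>\<^bsub>N i\<^esub> y i),
     smult = (\<lambda>r x. \<lambda>i\<in>{..<n}. r \<odot>\<^bsub>N i\<^esub> x i)\<rparr>"

definition zero_module :: "('r, 'm) module \<Rightarrow> bool" where
  "zero_module M \<longleftrightarrow> carrier M = {\<zero>\<^bsub>M\<^esub>}"

text \<open>
  From here on quantifiers over the category of finitely generated \<open>A\<close>-modules range over modules
  whose carrier is a set of lists of elements of \<open>K\<close>. Every finitely generated module over a
  finite-dimensional \<open>K\<close>-algebra is isomorphic to one with carrier \<open>K\<^sup>n\<close>, the lists of length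
  \<open>n\<close> over \<open>K\<close>, so this is no restriction.
\<close>

definition summand :: "('k, 'a) module \<Rightarrow> ('a, 'm) module \<Rightarrow> ('a, 'n) module \<Rightarrow> bool" where
  "summand A M N \<longleftrightarrow>
     (\<exists>L :: ('a, 'k list) module. fg_module A L \<and> mod_iso A (prod_module M L) N)"

definition in_add :: "('k, 'a) module \<Rightarrow> ('a, 'x) module \<Rightarrow> ('a, 'm) module \<Rightarrow> bool" where
  "in_add A X M \<longleftrightarrow> fg_module A M \<and> (\<exists>n. summand A M (dsum n (\<lambda>_. X)))"

definition indecomposable :: "('k, 'a) module \<Rightarrow> ('a, 'm) module \<Rightarrow> bool" where
  "indecomposable A M \<longleftrightarrow> fg_module A M \<and> \<not> zero_module M \<and>
     (\<forall>(L :: ('a, 'k list) module) (N :: ('a, 'k list) module).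
        fg_module A L \<and> fg_module A N \<and> mod_iso A M (prod_module L N) \<longrightarrow>
        zero_module L \<or> zero_module N)"

definition basic :: "('k, 'a) module \<Rightarrow> ('a, 'm) module \<Rightarrow> bool" where
  "basic A M \<longleftrightarrow> (\<exists>n (N :: nat \<Rightarrow> ('a, 'k list) module).
     (\<forall>i<n. indecomposable A (N i)) \<and>
     (\<forall>i<n. \<forall>j<n. i \<noteq> j \<longrightarrow> \<not> mod_iso A (N i) (N j)) \<and>
     mod_iso A M (dsum n N))"

definition gen_cogen :: "'k ring \<Rightarrow> ('k, 'a) module \<Rightarrow> ('a, 'm) module \<Rightarrow> bool" where
  "gen_cogen K A E \<longleftrightarrow> in_add A E (regular A) \<and> in_add A E (dual_regular K A)"

section \<open>Homological notions\<close>

definition projective :: "('k, 'a) module \<Rightarrow> ('a, 'm) module \<Rightarrow> bool" where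
  "projective A P \<longleftrightarrow> fg_module A P \<and>
     (\<forall>(X :: ('a, 'k list) module) (Y :: ('a, 'k list) module).
        fg_module A X \<longrightarrow> fg_module A Y \<longrightarrow>
        (\<forall>g\<in>hom_set A X Y. \<forall>f\<in>hom_set A P Y. g ` carrier X = carrier Y \<longrightarrow>
           (\<exists>h\<in>hom_set A P X. \<forall>p\<in>carrier P. g (h p) = f p)))"

definition injective :: "('k, 'a) module \<Rightarrow> ('a, 'm) module \<Rightarrow> bool" where
  "injective A I \<longleftrightarrow> fg_module A I \<and>
     (\<forall>(X :: ('a, 'k list) module) (Y :: ('a, 'k list) module).
        fg_module A X \<longrightarrow> fg_module A Y \<longrightarrow>
        (\<forall>g\<in>hom_set A X Y. \<forall>f\<in>hom_set A X I. inj_on g (carrier X) \<longrightarrow>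
           (\<exists>h\<in>hom_set A Y I. \<forall>x\<in>carrier X. h (g x) = f x)))"

text \<open>
  \<open>exact_onto m X d M p\<close>: exactness of
  \<open>X\<^sub>m \<rightarrow> \<dots> \<rightarrow> X\<^sub>1 \<rightarrow> X\<^sub>0 \<rightarrow> M \<rightarrow> 0\<close> at \<open>X\<^sub>m\<^sub>-\<^sub>1, \<dots>, X\<^sub>0\<close> and \<open>M\<close>, with maps
  \<open>d i : X\<^sub>i\<^sub>+\<^sub>1 \<rightarrow> X\<^sub>i\<close> and \<open>p : X\<^sub>0 \<rightarrow> M\<close>.
  \<open>exact_from m N j X d\<close>: exactness of
  \<open>0 \<rightarrow> N \<rightarrow> X\<^sub>0 \<rightarrow> X\<^sub>1 \<rightarrow> \<dots> \<rightarrow> X\<^sub>m\<close> at \<open>N\<close> and \<open>X\<^sub>0, \<dots>, X\<^sub>m\<^sub>-\<^sub>1\<close>, with maps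
  \<open>j : N \<rightarrow> X\<^sub>0\<close> and \<open>d i : X\<^sub>i \<rightarrow> X\<^sub>i\<^sub>+\<^sub>1\<close>.
\<close>

definition exact_onto ::
    "nat \<Rightarrow> (nat \<Rightarrow> ('r, 'x) module) \<Rightarrow> (nat \<Rightarrow> 'x \<Rightarrow> 'x) \<Rightarrow> ('r, 'm) module \<Rightarrow> ('x \<Rightarrow> 'm) \<Rightarrow> bool" where
  "exact_onto m X d M p \<longleftrightarrow>
     p ` carrier (X 0) = carrier M \<and>
     (0 < m \<longrightarrow> d 0 ` carrier (X 1) = a_kernel (X 0) M p) \<and>
     (\<forall>i. Suc i < m \<longrightarrow>
        d (Suc i) ` carrier (X (Suc (Suc i))) = a_kernel (X (Suc i)) (X i) (d i))"

definition exact_from ::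
    "nat \<Rightarrow> ('r, 'n) module \<Rightarrow> ('n \<Rightarrow> 'x) \<Rightarrow> (nat \<Rightarrow> ('r, 'x) module) \<Rightarrow> (nat \<Rightarrow> 'x \<Rightarrow> 'x) \<Rightarrow> bool" where
  "exact_from m N j X d \<longleftrightarrow>
     inj_on j (carrier N) \<and>
     (0 < m \<longrightarrow> j ` carrier N = a_kernel (X 0) (X 1) (d 0)) \<and>
     (\<forall>i. Suc i < m \<longrightarrow>
        d i ` carrier (X i) = a_kernel (X (Suc i)) (X (Suc (Suc i))) (d (Suc i)))"

definition left_seq ::
    "('k, 'a) module \<Rightarrow> nat \<Rightarrow> (nat \<Rightarrow> ('a, 'x) module) \<Rightarrow> (nat \<Rightarrow> 'x \<Rightarrow> 'x) \<Rightarrow> ('a, 'm) module \<Rightarrow> ('x \<Rightarrow> 'm) \<Rightarrow> bool" where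
  "left_seq A m X d M p \<longleftrightarrow>
     (\<forall>i\<le>m. fg_module A (X i)) \<and> (\<forall>i<m. d i \<in> hom_set A (X (Suc i)) (X i)) \<and>
     p \<in> hom_set A (X 0) M \<and> exact_onto m X d M p"

definition right_seq ::
    "('k, 'a) module \<Rightarrow> nat \<Rightarrow> ('a, 'n) module \<Rightarrow> ('n \<Rightarrow> 'x) \<Rightarrow> (nat \<Rightarrow> ('a, 'x) module) \<Rightarrow> (nat \<Rightarrow> 'x \<Rightarrow> 'x) \<Rightarrow> bool" where
  "right_seq A m N j X d \<longleftrightarrow>
     (\<forall>i\<le>m. fg_module A (X i)) \<and> (\<forall>i<m. d i \<in> hom_set A (X i) (X (Suc i))) \<and>
     j \<in> hom_set A N (X 0) \<and> exact_from m N j X d"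

definition proj_resolution ::
    "('k, 'a) module \<Rightarrow> (nat \<Rightarrow> ('a, 'k list) module) \<Rightarrow> (nat \<Rightarrow> 'k list \<Rightarrow> 'k list) \<Rightarrow> ('a, 'm) module \<Rightarrow> ('k list \<Rightarrow> 'm) \<Rightarrow> bool" where
  "proj_resolution A P d M p \<longleftrightarrow> (\<forall>i. projective A (P i)) \<and> (\<forall>m. left_seq A m P d M p)"

definition inj_resolution ::
    "('k, 'a) module \<Rightarrow> ('a, 'n) module \<Rightarrow> ('n \<Rightarrow> 'k list) \<Rightarrow> (nat \<Rightarrow> ('a, 'k list) module) \<Rightarrow> (nat \<Rightarrow> 'k list \<Rightarrow> 'k list) \<Rightarrow> bool" where
  "inj_resolution A N j I d \<longleftrightarrow> (\<forall>i. injective A (I i)) \<and> (\<forall>m. right_seq A m N j I d)"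

definition idim_le :: "('k, 'a) module \<Rightarrow> ('a, 'm) module \<Rightarrow> nat \<Rightarrow> bool" where
  "idim_le A M k \<longleftrightarrow> (\<exists>j I d. inj_resolution A M j I d \<and> (\<forall>i>k. zero_module (I i)))"

definition domdim_ge :: "('k, 'a) module \<Rightarrow> nat \<Rightarrow> bool" where
  "domdim_ge A k \<longleftrightarrow>
     (\<exists>j I d. inj_resolution A (regular A) j I d \<and> (\<forall>i<k. projective A (I i)))"

definition domdim_eq :: "('k, 'a) module \<Rightarrow> nat \<Rightarrow> bool" where
  "domdim_eq A k \<longleftrightarrow> domdim_ge A k \<and> \<not> domdim_ge A (Suc k)"

text \<open>
  \<open>Ext\<^sup>i(M,N)\<close> is the \<open>i\<close>-th cohomology of \<open>Hom(P,N)\<close> for a projective resolution \<open>P\<close> of \<open>M\<close>;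
  it does not depend on the resolution.
\<close>

definition cocycles ::
    "('k, 'a) module \<Rightarrow> (nat \<Rightarrow> ('a, 'x) module) \<Rightarrow> (nat \<Rightarrow> 'x \<Rightarrow> 'x) \<Rightarrow> ('a, 'n) module \<Rightarrow> nat \<Rightarrow> ('x \<Rightarrow> 'n) set" where
  "cocycles A P d N i =
     {f \<in> hom_set A (P i) N. \<forall>x\<in>carrier (P (Suc i)). f (d i x) = \<zero>\<^bsub>N\<^esub>}"

fun coboundaries ::
    "('k, 'a) module \<Rightarrow> (nat \<Rightarrow> ('a, 'x) module) \<Rightarrow> (nat \<Rightarrow> 'x \<Rightarrow> 'x) \<Rightarrow> ('a, 'n) module \<Rightarrow> nat \<Rightarrow> ('x \<Rightarrow> 'n) set" where
  "coboundaries A P d N 0 = {\<lambda>x\<in>carrier (P 0). \<zero>\<^bsub>N\<^esub>}"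
| "coboundaries A P d N (Suc i) =
     (\<lambda>f. compose (carrier (P (Suc i))) f (d i)) ` hom_set A (P i) N"

definition ext_vanishes :: "('k, 'a) module \<Rightarrow> nat \<Rightarrow> ('a, 'm) module \<Rightarrow> ('a, 'n) module \<Rightarrow> bool" where
  "ext_vanishes A i M N \<longleftrightarrow>
     (\<exists>P d p. proj_resolution A P d M p \<and> cocycles A P d N i = coboundaries A P d N i)"

subsection \<open>Cotilting modules\<close>

text \<open>\<open>0 \<rightarrow> X\<^sub>k \<rightarrow> \<dots> \<rightarrow> X\<^sub>0 \<rightarrow> D A \<rightarrow> 0\<close> is exact.\<close>

definition cotilting_seq ::
    "'k ring \<Rightarrow> ('k, 'a) module \<Rightarrow> nat \<Rightarrow> (nat \<Rightarrow> ('a, 'k list) module) \<Rightarrow> (nat \<Rightarrow> 'k list \<Rightarrow> 'k list) \<Rightarrow> ('k list \<Rightarrow> 'a \<Rightarrow> 'k) \<Rightarrow> bool" where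
  "cotilting_seq K A k X d p \<longleftrightarrow> left_seq A k X d (dual_regular K A) p \<and>
     (case k of 0 \<Rightarrow> inj_on p (carrier (X 0)) | Suc l \<Rightarrow> inj_on (d l) (carrier (X k)))"

definition cotilting :: "'k ring \<Rightarrow> ('k, 'a) module \<Rightarrow> nat \<Rightarrow> ('a, 'm) module \<Rightarrow> bool" where
  "cotilting K A k C \<longleftrightarrow> fg_module A C \<and> idim_le A C k \<and>
     (\<forall>i>0. ext_vanishes A i C C) \<and>
     (\<exists>X d p. cotilting_seq K A k X d p \<and> (\<forall>j\<le>k. in_add A C (X j)))"

definition special_cotilting ::
    "'k ring \<Rightarrow> ('k, 'a) module \<Rightarrow> nat \<Rightarrow> ('a, 'i) module \<Rightarrow> ('a, 'm) module \<Rightarrow> bool" where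
  "special_cotilting K A k I C \<longleftrightarrow> cotilting K A k C \<and> in_add A C I \<and>
     (\<exists>X d p. cotilting_seq K A k X d p \<and> (\<forall>j\<le>k. in_add A C (X j)) \<and>
        (\<forall>j<k. in_add A I (X j)))"

definition proj_inj_summand :: "('k, 'a) module \<Rightarrow> ('a, 'm) module \<Rightarrow> bool" where
  "proj_inj_summand A P \<longleftrightarrow> projective A P \<and> injective A P \<and> summand A P (regular A)"

definition max_proj_inj_summand :: "('k, 'a) module \<Rightarrow> ('a, 'm) module \<Rightarrow> bool" where
  "max_proj_inj_summand A P \<longleftrightarrow> proj_inj_summand A P \<and>
     (\<forall>Q :: ('a, 'k list) module. proj_inj_summand A Q \<and> summand A P Q \<longrightarrow> mod_iso A P Q)"

text \<open>
  The coshifted module is determined up to isomorphism only, hence a predicate on \<open>C\<close>.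
\<close>

definition coshifted ::
    "'k ring \<Rightarrow> ('k, 'a) module \<Rightarrow> ('a, 'i) module \<Rightarrow> nat \<Rightarrow> ('a, 'm) module \<Rightarrow> bool" where
  "coshifted K A P k C \<longleftrightarrow> basic A C \<and> special_cotilting K A k P C"

subsection \<open>The categories \<open>gen\<close> and \<open>cogen\<close>\<close>

text \<open>The index is an integer because \<open>-1\<close> is allowed, where no condition is imposed.\<close>

definition in_gen :: "('k, 'a) module \<Rightarrow> int \<Rightarrow> ('a, 'x) module \<Rightarrow> ('a, 'm) module \<Rightarrow> bool" where
  "in_gen A m X M \<longleftrightarrow> fg_module A M \<and> (0 \<le> m \<longrightarrow>
     (\<exists>(Y :: nat \<Rightarrow> ('a, 'k list) module) d p.
        left_seq A (nat m) Y d M p \<and> (\<forall>i\<le>nat m. in_add A X (Y i)) \<and>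
        exact_onto (nat m) (\<lambda>i. hom_space A X (Y i)) (\<lambda>i f. compose (carrier X) (d i) f)
          (hom_space A X M) (\<lambda>f. compose (carrier X) p f)))"

definition in_cogen :: "('k, 'a) module \<Rightarrow> int \<Rightarrow> ('a, 'x) module \<Rightarrow> ('a, 'n) module \<Rightarrow> bool" where
  "in_cogen A m X N \<longleftrightarrow> fg_module A N \<and> (0 \<le> m \<longrightarrow>
     (\<exists>(Y :: nat \<Rightarrow> ('a, 'k list) module) d j.
        right_seq A (nat m) N j Y d \<and> (\<forall>i\<le>nat m. in_add A X (Y i)) \<and>
        exact_onto (nat m) (\<lambda>i. hom_space A (Y i) X) (\<lambda>i f. compose (carrier (Y i)) f (d i))
          (hom_space A N X) (\<lambda>f. compose (carrier N) f j)))"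

section \<open>Intermediate extension\<close>

text \<open>
  \<open>X \<otimes>\<^sub>R M\<close> as the free abelian group on \<open>X \<times> M\<close> modulo the balancing relations. Here \<open>X\<close> is a right
  \<open>R\<close>-module, given as a left \<open>opp R\<close>-module, so \<open>r \<odot>\<^bsub>X\<^esub> x\<close> is the element \<open>x r\<close>.
\<close>

definition tensor_rels ::
    "('k, 'a) module \<Rightarrow> ('a, 'x) module \<Rightarrow> ('a, 'm) module \<Rightarrow> (('x \<times> 'm) \<Rightarrow>\<^sub>0 int) set" where
  "tensor_rels R X M =
     {frag_of (x \<oplus>\<^bsub>X\<^esub> y, m) - frag_of (x, m) - frag_of (y, m) | x y m.
        x \<in> carrier X \<and> y \<in> carrier X \<and> m \<in> carrier M} \<union>
     {frag_of (x, m \<oplus>\<^bsub>M\<^esub> n) - frag_of (x, m) - frag_of (x, n) | x m n.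
        x \<in> carrier X \<and> m \<in> carrier M \<and> n \<in> carrier M} \<union>
     {frag_of (r \<odot>\<^bsub>X\<^esub> x, m) - frag_of (x, r \<odot>\<^bsub>M\<^esub> m) | r x m.
        r \<in> carrier R \<and> x \<in> carrier X \<and> m \<in> carrier M}"

definition tensor_null ::
    "('k, 'a) module \<Rightarrow> ('a, 'x) module \<Rightarrow> ('a, 'm) module \<Rightarrow> (('x \<times> 'm) \<Rightarrow>\<^sub>0 int) set" where
  "tensor_null R X M =
     generate (free_Abelian_group (carrier X \<times> carrier M)) (tensor_rels R X M)"

text \<open>
  \<open>l\<close> is a left action of some ring on \<open>X\<close>, commuting with the right action of \<open>R\<close>. It acts on
  \<open>X \<otimes>\<^sub>R M\<close> by \<open>b(x \<otimes> m) = bx \<otimes> m\<close>. The image of a coset under the induced map of the free group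
  need not be a full coset, so the subgroup of relations has to be added.
\<close>

definition tensor ::
    "('k, 'a) module \<Rightarrow> ('b \<Rightarrow> 'x \<Rightarrow> 'x) \<Rightarrow> ('a, 'x) module \<Rightarrow> ('a, 'm) module \<Rightarrow> ('b, (('x \<times> 'm) \<Rightarrow>\<^sub>0 int) set) module" where
  "tensor R l X M =
     (let F = free_Abelian_group (carrier X \<times> carrier M); H = tensor_null R X M
      in \<lparr>carrier = carrier (F Mod H), monoid.mult = undefined, one = undefined,
          ring.zero = \<one>\<^bsub>F Mod H\<^esub>, ring.add = monoid.mult (F Mod H),
          smult = (\<lambda>b U. H <#>\<^bsub>F\<^esub> (frag_extend (\<lambda>(x, m). frag_of (l b x, m)) ` U))\<rparr>)"

text \<open>
  The map out of a tensor product induced by a balanced map \<open>h\<close> into \<open>N\<close>: the additive extension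
  of \<open>h\<close> to the free group is constant on cosets.
\<close>

definition tensor_lift ::
    "('r, 'n) module \<Rightarrow> ('x \<times> 'm \<Rightarrow> 'n) \<Rightarrow> (('x \<times> 'm) \<Rightarrow>\<^sub>0 int) set \<Rightarrow> 'n" where
  "tensor_lift N h U = the_elem
     ((\<lambda>u. \<Oplus>\<^bsub>N\<^esub>z\<in>Poly_Mapping.keys u. [Poly_Mapping.lookup u z] \<cdot>\<^bsub>N\<^esub> h z) ` U)"

definition corner :: "('k, 'b) module \<Rightarrow> 'b \<Rightarrow> ('k, 'b) module" where
  "corner B e = B\<lparr>carrier := {e \<otimes>\<^bsub>B\<^esub> b \<otimes>\<^bsub>B\<^esub> e | b. b \<in> carrier B}, one := e\<rparr>"

text \<open>\<open>Be\<close> as a right \<open>eBe\<close>-module, and \<open>eB\<close> as a left \<open>eBe\<close>-module.\<close>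

definition Be :: "('k, 'b) module \<Rightarrow> 'b \<Rightarrow> ('b, 'b) module" where
  "Be B e = (regular (opp B))\<lparr>carrier := {b \<otimes>\<^bsub>B\<^esub> e | b. b \<in> carrier B}\<rparr>"

definition eB :: "('k, 'b) module \<Rightarrow> 'b \<Rightarrow> ('b, 'b) module" where
  "eB B e = (regular B)\<lparr>carrier := {e \<otimes>\<^bsub>B\<^esub> b | b. b \<in> carrier B}\<rparr>"

definition ell :: "('k, 'b) module \<Rightarrow> 'b \<Rightarrow> ('b, 'm) module \<Rightarrow> ('b, (('b \<times> 'm) \<Rightarrow>\<^sub>0 int) set) module" where
  "ell B e M = tensor (corner B e) (monoid.mult B) (Be B e) M"

definition arr :: "('k, 'b) module \<Rightarrow> 'b \<Rightarrow> ('b, 'm) module \<Rightarrow> ('b, 'b \<Rightarrow> 'm) module" where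
  "arr B e M = with_smult (\<lambda>b f. \<lambda>y\<in>carrier (eB B e). f (y \<otimes>\<^bsub>B\<^esub> b))
     (hom_space (corner B e) (eB B e) M)"

definition zeta :: "('k, 'b) module \<Rightarrow> 'b \<Rightarrow> ('b, 'm) module \<Rightarrow> (('b \<times> 'm) \<Rightarrow>\<^sub>0 int) set \<Rightarrow> 'b \<Rightarrow> 'm" where
  "zeta B e M = tensor_lift (arr B e M)
     (\<lambda>(x, m). \<lambda>y\<in>carrier (eB B e). (y \<otimes>\<^bsub>B\<^esub> x) \<odot>\<^bsub>M\<^esub> m)"

definition intermediate_ext :: "('k, 'b) module \<Rightarrow> 'b \<Rightarrow> ('b, 'm) module \<Rightarrow> ('b, 'b \<Rightarrow> 'm) module" where
  "intermediate_ext B e M = (arr B e M)\<lparr>carrier := zeta B e M ` carrier (ell B e M)\<rparr>"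

section \<open>The coshifted algebra and its modules\<close>

text \<open>
  \<open>B = End(C)\<^sup>o\<^sup>p\<close>. Since \<open>C\<close> and \<open>Hom(P,C)\<close> are left \<open>End(C)\<close>-modules, that is, right \<open>B\<close>-modules,
  their duals are left \<open>B\<close>-modules.
\<close>

definition Bk :: "('k, 'g) module \<Rightarrow> ('g, 'c) module \<Rightarrow> ('k, 'c \<Rightarrow> 'c) module" where
  "Bk G C = opp (end_alg G C)"

definition DCk :: "'k ring \<Rightarrow> ('k, 'g) module \<Rightarrow> ('g, 'c) module \<Rightarrow> ('c \<Rightarrow> 'c, 'c \<Rightarrow> 'k) module" where
  "DCk K G C = dual K (Bk G C) (eval_module C)"

definition Pk :: "('k, 'g) module \<Rightarrow> ('g, 'p) module \<Rightarrow> ('g, 'c) module \<Rightarrow> ('c \<Rightarrow> 'c, 'c \<Rightarrow> 'p) module" where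
  "Pk G P C = with_smult (\<lambda>b f. compose (carrier C) f b) (hom_space G C P)"

definition Ik :: "'k ring \<Rightarrow> ('k, 'g) module \<Rightarrow> ('g, 'p) module \<Rightarrow> ('g, 'c) module \<Rightarrow> ('c \<Rightarrow> 'c, ('p \<Rightarrow> 'c) \<Rightarrow> 'k) module" where
  "Ik K G P C = dual K (Bk G C)
     (with_smult (\<lambda>b f. compose (carrier P) b f) (hom_space G P C))"

text \<open>
  The data by which \<open>A = End(P)\<^sup>o\<^sup>p = eBe\<close> and \<open>E = D P\<close> are identified: \<open>s\<close> and \<open>q\<close> present \<open>P\<close>
  as a summand of \<open>C\<close>, so that the idempotent \<open>e\<close> is \<open>s \<circ> q\<close>; \<open>\<phi>\<close> is an isomorphism
  \<open>A \<rightarrow> End(P)\<^sup>o\<^sup>p\<close> along which \<open>D P\<close> becomes isomorphic to \<open>E\<close>. As \<open>\<phi>\<close> is determined only up to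
  automorphisms of \<open>A\<close> that fix the isomorphism class of \<open>E\<close>, it is kept as a parameter.
\<close>

definition identification ::
    "'k ring \<Rightarrow> ('k, 'a) module \<Rightarrow> ('a, 'e) module \<Rightarrow> ('k, 'g) module \<Rightarrow> ('g, 'p) module \<Rightarrow> ('g, 'c) module \<Rightarrow>
     ('p \<Rightarrow> 'c) \<Rightarrow> ('c \<Rightarrow> 'p) \<Rightarrow> ('a \<Rightarrow> 'p \<Rightarrow> 'p) \<Rightarrow> bool" where
  "identification K A E G P C s q \<phi> \<longleftrightarrow>
     s \<in> hom_set G P C \<and> q \<in> hom_set G C P \<and> (\<forall>x\<in>carrier P. q (s x) = x) \<and>
     \<phi> \<in> alg_iso K A (opp (end_alg G P)) \<and>
     (let DP = dual K (opp (end_alg G P)) (eval_module P)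
      in mod_iso A E (with_smult (\<lambda>a x. \<phi> a \<odot>\<^bsub>DP\<^esub> x) DP))"

definition idem :: "('g, 'c) module \<Rightarrow> ('p \<Rightarrow> 'c) \<Rightarrow> ('c \<Rightarrow> 'p) \<Rightarrow> 'c \<Rightarrow> 'c" where
  "idem C s q = compose (carrier C) s q"

text \<open>
  An \<open>A\<close>-module as a module over \<open>eBe\<close>, along \<open>eBe \<rightarrow> End(P)\<^sup>o\<^sup>p \<rightarrow> A\<close>, \<open>b \<mapsto> \<phi>\<^sup>-\<^sup>1(q \<circ> b \<circ> s)\<close>.
\<close>

definition as_corner_module ::
    "('k, 'a) module \<Rightarrow> ('g, 'p) module \<Rightarrow> ('p \<Rightarrow> 'c) \<Rightarrow> ('c \<Rightarrow> 'p) \<Rightarrow> ('a \<Rightarrow> 'p \<Rightarrow> 'p) \<Rightarrow> ('a, 'm) module \<Rightarrow>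
     ('c \<Rightarrow> 'c, 'm) module" where
  "as_corner_module A P s q \<phi> M = with_smult
     (\<lambda>b x. inv_into (carrier A) \<phi> (\<lambda>y\<in>carrier P. q (b (s y))) \<odot>\<^bsub>M\<^esub> x) M"

definition ck ::
    "('k, 'a) module \<Rightarrow> ('k, 'g) module \<Rightarrow> ('g, 'p) module \<Rightarrow> ('g, 'c) module \<Rightarrow>
     ('p \<Rightarrow> 'c) \<Rightarrow> ('c \<Rightarrow> 'p) \<Rightarrow> ('a \<Rightarrow> 'p \<Rightarrow> 'p) \<Rightarrow> ('a, 'm) module \<Rightarrow> ('c \<Rightarrow> 'c, ('c \<Rightarrow> 'c) \<Rightarrow> 'm) module" where
  "ck A G P C s q \<phi> M =
     intermediate_ext (Bk G C) (idem C s q) (as_corner_module A P s q \<phi> M)"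

end

theory Submission
  imports Defs
begin

section \<open>Idea of the proof\<close>

text \<open>
  Applying \<open>Hom(C,-)\<close> to the special cotilting sequence \<open>0 \<rightarrow> X\<^sub>k \<rightarrow> \<dots> \<rightarrow> X\<^sub>0 \<rightarrow> D G \<rightarrow> 0\<close> resolves
  \<open>D C = Hom(C, D G)\<close> by \<open>add P\<^sup>k\<close>, since \<open>Ext(C,C) = 0\<close> and the \<open>X\<^sub>j\<close> with \<open>j < k\<close> are injective.
  Dually, \<open>idim C \<le> k\<close> makes \<open>Hom(-,C)\<close> exact on the projective part of the injective resolution of \<open>G\<close>,
  and the dual complex coresolves \<open>D C\<close> by \<open>add I\<^sup>k\<close>.
  Hence every functional on \<open>C\<close> and every element of \<open>C\<close> factors through sums of copies of \<open>P\<close>, which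
  identifies \<open>D C\<close> with the image of \<open>\<zeta>\<close> on \<open>E = D P\<close>.
  Since all algebras are basic, retracts can be found by means of orthogonal primitive idempotents and
  the Jacobson radical instead of the Krull-Schmidt theorem.
\<close>

section \<open>Notation\<close>

text \<open>The maximal projective-injective summand \<open>P\<close> is known only through
  maximality, so it is compared with the concrete module \<open>D E\<close>. Since \<open>A\<close>
  is in \<open>add E\<close>, \<open>D E\<close> is injective over \<open>G\<close>; since
  \<open>D A\<close> is in \<open>add E\<close>, it is projective; and every projective-injective
  module lies in \<open>add (D E)\<close>. Membership in \<open>add\<close> yields maps through
  several copies only, while maximality of \<open>P\<close> and the splitting
  \<open>P -> C -> P\<close> concern a single copy; basicness bridges this gap. The isomorphism of
  \<open>P\<close> with \<open>D E\<close> puts the terms \<open>I 0, ..., I d\<close> of the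
  injective resolution of \<open>G\<close> into \<open>add P\<close>, and a double centralizer
  argument turns it into an identification of \<open>A\<close> with
  \<open>End(P)\<^sup>o\<^sup>p\<close>. A second obstacle: quantifiers over modules range over
  carriers made of lists, whereas the modules that occur consist of functions. Hence finite
  dimension over \<open>K\<close> is carried along, and coordinate copies are taken whenever such a
  definition is unfolded. Finally, \<open>Ext\<close> is only a statement about one resolution, so
  lifts are corrected step by step along that resolution.\<close>

abbreviation (input) add_in ("_ +[_] _" [65, 0, 66] 65) where "x +[M] y \<equiv> x \<oplus>\<^bsub>M\<^esub> y"
abbreviation (input) minus_in ("_ -[_] _" [65, 0, 66] 65) where "x -[M] y \<equiv> x \<ominus>\<^bsub>M\<^esub> y"
abbreviation (input) uminus_in ("-[_] _" [0, 81] 80) where "-[M] x \<equiv> \<ominus>\<^bsub>M\<^esub> x"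
abbreviation (input) mult_in ("_ *[_] _" [70, 0, 71] 70) where "x *[R] y \<equiv> x \<otimes>\<^bsub>R\<^esub> y"
abbreviation (input) smult_in ("_ .[_] _" [70, 0, 71] 70) where "r .[M] x \<equiv> r \<odot>\<^bsub>M\<^esub> x"
abbreviation (input) zero_in ("0[_]") where "0[M] \<equiv> \<zero>\<^bsub>M\<^esub>"
abbreviation (input) one_in ("1[_]") where "1[R] \<equiv> \<one>\<^bsub>R\<^esub>"
abbreviation (input) mem_carrier (infix ":." 50) where "x :. M \<equiv> x \<in> carrier M"

abbreviation Hom where "Hom \<equiv> hom_set"

lemmas (in left_module) M_group = M.abelian_group_axioms

lemma carrier_eqI:
  "[|f : extensional (carrier M); g : extensional (carrier M); !!x. x :. M ==> f x = g x|] ==> f = g" for M :: "('m, 'z) ring_scheme"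
  by (rule extensionalityI)

section \<open>Modules and homomorphisms\<close>

lemma with_smult_simps [simp]:
  "carrier (with_smult s M) = carrier M" "0[with_smult s M] = 0[M]"
  "x +[with_smult s M] y = x +[M] y" "r .[with_smult s M] x = s r x"
  "x *[with_smult s M] y = x *[M] y" "1[with_smult s M] = 1[M]"
  by (simp_all add: with_smult_def)

lemma regular_simps [simp]:
  "carrier (regular R) = carrier R" "0[regular R] = 0[R]"
  "x +[regular R] y = x +[R] y" "r .[regular R] x = r *[R] x"
  "x *[regular R] y = x *[R] y" "1[regular R] = 1[R]"
  by (simp_all add: regular_def)

lemma opp_simps [simp]:
  "carrier (opp R) = carrier R" "0[opp R] = 0[R]"
  "x +[opp R] y = x +[R] y" "r .[opp R] x = r .[R] x"
  "x *[opp R] y = y *[R] x" "1[opp R] = 1[R]" "opp (opp R) = R"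
  by (simp_all add: opp_def)

lemma scal_opp [simp]: "scal (opp R) M = scal R M"
  by (simp add: scal_def fun_eq_iff)

lemma abelian_group_cong:
  assumes "abelian_group M" "carrier N = carrier M" "0[N] = 0[M]"
    "!!x y. x +[N] y = x +[M] y"
  shows "abelian_group N"
  using abelian_groupE[OF assms(1)] assms(2-) by (intro abelian_groupI) auto

lemma add_with_smult [simp]: "add (with_smult s M) = add M" "add (regular R) = add R"
  "add (opp A) = add A"
  by (simp_all add: fun_eq_iff)

lemma a_inv_with_smult [simp]: "-[with_smult s M] x = -[M] x" "-[regular R] y = -[R] y"
  "-[opp A] z = -[A] z"
  by (simp_all add: a_inv_def m_inv_def)

lemma abelian_group_with_smult [simp]:
  "abelian_group (with_smult s M) \<longleftrightarrow> abelian_group M"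
  "abelian_group (regular R) \<longleftrightarrow> abelian_group R"
  "abelian_group (opp A) \<longleftrightarrow> abelian_group A"
  by (auto intro: abelian_group_cong)

lemma finsum_with_smult [simp]: "finsum (with_smult s M) f S = finsum M f S"
  "finsum (regular R) f S = finsum R f S" "finsum (opp A) f S = finsum A f S"
  by (simp_all add: finsum_def finprod_def)

lemma left_moduleI:
  assumes "ring R" "abelian_group M"
    "!!a x. [|a :. R; x :. M|] ==> a .[M] x :. M"
    "!!a b x. [|a :. R; b :. R; x :. M|] ==>
        (a +[R] b) .[M] x = a .[M] x +[M] b .[M] x"
    "!!a x y. [|a :. R; x :. M; y :. M|] ==>
        a .[M] (x +[M] y) = a .[M] x +[M] a .[M] y"
    "!!a b x. [|a :. R; b :. R; x :. M|] ==>
        (a *[R] b) .[M] x = a .[M] (b .[M] x)"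
    "!!x. x :. M ==> 1[R] .[M] x = x"
  shows "left_module R M"
  using assms by (auto intro!: left_module.intro left_module_axioms.intro)

context left_module
begin

lemma smult_zero_left: "x :. M ==> \<zero> .[M] x = 0[M]"
  by (metis M.add.l_cancel_one R.zero_closed R.l_zero smult_closed smult_l_distr)

lemma smult_zero_right: "a :. R ==> a .[M] 0[M] = 0[M]"
  by (metis M.add.l_cancel_one M.zero_closed M.l_zero smult_closed smult_r_distr)

lemma smult_minus_left:
  "[|a :. R; x :. M|] ==> (\<ominus> a) .[M] x = -[M] (a .[M] x)"
  by (metis M.minus_equality R.a_inv_closed R.l_neg smult_closed smult_l_distr smult_zero_left)

lemma smult_minus_right:
  "[|a :. R; x :. M|] ==> a .[M] (-[M] x) = -[M] (a .[M] x)"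
  by (metis M.minus_equality M.a_inv_closed M.l_neg smult_closed smult_r_distr smult_zero_right)

lemma minus_one_smult: "x :. M ==> (\<ominus> \<one>) .[M] x = -[M] x"
  by (simp add: smult_minus_left smult_one)

lemma smult_finsum:
  assumes "a :. R" "f : S \<rightarrow> carrier M"
  shows "a .[M] (\<Oplus>\<^bsub>M\<^esub>i\<in>S. f i) = (\<Oplus>\<^bsub>M\<^esub>i\<in>S. a .[M] f i)"
  using assms(2)
proof (induction S rule: infinite_finite_induct)
  case (insert x F)
  then show ?case using assms(1)
    by (simp add: M.finsum_insert smult_closed smult_r_distr Pi_def)
qed (use assms(1) in "simp_all add: M.finsum_infinite smult_zero_right")

lemma finsum_smult:
  assumes "x :. M" "f : S \<rightarrow> carrier R"
  shows "(\<Oplus>i\<in>S. f i) .[M] x = (\<Oplus>\<^bsub>M\<^esub>i\<in>S. f i .[M] x)"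
  using assms(2)
proof (induction S rule: infinite_finite_induct)
  case (insert y F)
  then show ?case using assms(1)
    by (simp add: M.finsum_insert R.finsum_insert smult_closed smult_l_distr Pi_def)
qed (use assms(1) in "simp_all add: M.finsum_infinite R.finsum_infinite smult_zero_left")

end

lemma (in abelian_monoid) finsum_lessThan_Suc:
  fixes f :: "nat => _"
  assumes "!!i. i <= n ==> f i :. G"
  shows "(\<Oplus>i\<in>{..<Suc n}. f i) = (\<Oplus>i\<in>{..<n}. f i) \<oplus> f n"
  using assms by (subst lessThan_Suc, subst finsum_insert) (auto simp: a_comm finsum_closed)

lemma (in abelian_monoid) finsum_in_set:
  assumes "\<zero> : U" "!!x y. [|x : U; y : U|] ==> x \<oplus> y : U" "U \<subseteq> carrier G"
    "!!i. i : S ==> f i : U"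
  shows "finsum G f S : U"
  using assms(4)
proof (induction S rule: infinite_finite_induct)
  case (insert x F)
  then have "f x : U" "f : F \<rightarrow> carrier G" "f x :. G" "finsum G f F : U"
    using assms(3) by auto
  then show ?case using insert assms(2) by (simp add: finsum_insert)
qed (use assms(1) in "simp_all add: finsum_infinite")

lemma hom_setI:
  assumes "f : extensional (carrier M)" "!!x. x :. M ==> f x :. N"
    "!!x y. [|x :. M; y :. M|] ==> f (x +[M] y) = f x +[N] f y"
    "!!r x. [|r :. R; x :. M|] ==> f (r .[M] x) = r .[N] f x"
  shows "f : Hom R M N"
  using assms by (auto simp: hom_set_def PiE_def)

lemma hom_closed: "[|f : Hom R M N; x :. M|] ==> f x :. N"
  and hom_add: "[|f : Hom R M N; x :. M; y :. M|] ==> f (x +[M] y) = f x +[N] f y"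
  and hom_smult: "[|f : Hom R M N; r :. R; x :. M|] ==> f (r .[M] x) = r .[N] f x"
  and hom_ext: "f : Hom R M N ==> f : extensional (carrier M)"
  by (auto simp: hom_set_def PiE_def)

lemma hom_eqI:
  assumes "f : Hom R M N" "g : Hom S M L" "!!x. x :. M ==> f x = g x"
  shows "f = g"
  using hom_ext[OF assms(1)] hom_ext[OF assms(2)] assms(3) by (rule extensionalityI)

lemma hom_zero:
  assumes "f : Hom R M N" "abelian_group M" "abelian_group N"
  shows "f 0[M] = 0[N]"
proof -
  interpret M: abelian_group M by fact
  interpret N: abelian_group N by fact
  have "f 0[M] +[N] f 0[M] = f 0[M]"
    using hom_add[OF assms(1), of "0[M]" "0[M]"] by simp
  then show ?thesis using hom_closed[OF assms(1), of "0[M]"] by simp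
qed

lemma hom_minus:
  assumes "f : Hom R M N" "abelian_group M" "abelian_group N" "x :. M"
  shows "f (-[M] x) = -[N] f x"
proof -
  interpret M: abelian_group M by fact
  interpret N: abelian_group N by fact
  have "f (-[M] x) +[N] f x = 0[N]"
    using hom_add[OF assms(1), of "-[M] x" x] assms hom_zero[OF assms(1)] by (simp add: M.l_neg)
  then show ?thesis using hom_closed[OF assms(1)] assms(4)
    by (simp add: N.minus_equality)
qed

lemma hom_diff:
  assumes "f : Hom R M N" "abelian_group M" "abelian_group N" "x :. M" "y :. M"
  shows "f (x -[M] y) = f x -[N] f y"
proof -
  interpret M: abelian_group M by fact
  show ?thesis using assms by (simp add: a_minus_def hom_add hom_minus)
qed

lemma hom_finsum:
  assumes "f : Hom R M N" "abelian_group M" "abelian_group N" "g : S \<rightarrow> carrier M"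
  shows "f (\<Oplus>\<^bsub>M\<^esub>i\<in>S. g i) = (\<Oplus>\<^bsub>N\<^esub>i\<in>S. f (g i))"
proof -
  interpret M: abelian_group M by fact
  interpret N: abelian_group N by fact
  show ?thesis using assms(4)
  proof (induction S rule: infinite_finite_induct)
    case (insert y F)
    then show ?case using assms(1)
      by (simp add: M.finsum_insert N.finsum_insert Pi_def hom_add hom_closed)
  qed (use hom_zero[OF assms(1-3)] in "simp_all add: M.finsum_infinite N.finsum_infinite")
qed

lemma hom_compose:
  assumes "left_module R M" "f : Hom R M N" "g : Hom R N L"
  shows "compose (carrier M) g f : Hom R M L"
proof -
  interpret left_module R M by fact
  show ?thesis
    by (rule hom_setI)
      (simp_all add: compose_eq smult_closed hom_closed[OF assms(2)] hom_add[OF assms(2)]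
        hom_smult[OF assms(2)] hom_closed[OF assms(3)] hom_add[OF assms(3)] hom_smult[OF assms(3)])
qed

lemma hom_id: "left_module R M ==> (\<lambda>x\<in>carrier M. x) : Hom R M M"
proof -
  assume "left_module R M"
  then interpret left_module R M .
  show ?thesis by (rule hom_setI) (simp_all add: smult_closed)
qed

section \<open>Submodules and finite generation\<close>

definition submod :: "('r, 'z) ring_scheme => ('r, 'm, 'w) module_scheme => 'm set => bool" where
  "submod R M U \<longleftrightarrow> U \<subseteq> carrier M & 0[M] : U & (ALL x:U. ALL y:U. x +[M] y : U) &
     (ALL r:carrier R. ALL x:U. r .[M] x : U)"

context left_module
begin

lemma submod_minus: "[|submod R M U; x : U|] ==> -[M] x : U"
  using minus_one_smult[of x] unfolding submod_def by (metis R.add.inv_closed R.one_closed subsetD)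

lemma submod_diff: "[|submod R M U; x : U; y : U|] ==> x -[M] y : U"
  using submod_minus[of U y] unfolding submod_def a_minus_def by blast

lemma submod_finsum: "[|submod R M U; !!i. i : S ==> f i : U|] ==> finsum M f S : U"
  by (rule M.finsum_in_set) (auto simp: submod_def)

lemma left_module_submod:
  assumes "submod R M U"
  shows "left_module R (M\<lparr>carrier := U\<rparr>)"
proof -
  have U: "x :. M" if "x : U" for x using assms that by (auto simp: submod_def)
  show ?thesis
  proof (intro left_moduleI abelian_groupI R.ring_axioms)
    fix x assume "x :. (M\<lparr>carrier := U\<rparr>)"
    then show "EX y:carrier (M\<lparr>carrier := U\<rparr>). y +[M\<lparr>carrier := U\<rparr>] x = 0[M\<lparr>carrier := U\<rparr>]"
      using submod_minus[OF assms, of x] by (auto simp: U M.l_neg intro!: bexI[of _ "-[M] x"])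
  next
    fix x y assume "x :. (M\<lparr>carrier := U\<rparr>)" "y :. (M\<lparr>carrier := U\<rparr>)"
    then show "x +[M\<lparr>carrier := U\<rparr>] y = y +[M\<lparr>carrier := U\<rparr>] x" by (simp add: U M.a_comm)
  qed (use assms in "simp_all add: submod_def U M.a_assoc smult_l_distr smult_r_distr smult_assoc1 smult_one")
qed

end

text \<open>Closure under submodules replaces coefficient families from here on. For the converse,
  the linear combinations of \<open>S\<close> form a submodule that contains
  \<open>S\<close>.\<close>

lemma fin_gen_iff:
  fixes R (structure)
  assumes "left_module R M"
  shows "fin_gen R M \<longleftrightarrow>
    (EX S. finite S & S \<subseteq> carrier M & (ALL U. submod R M U --> S \<subseteq> U --> carrier M \<subseteq> U))"
proof
  interpret left_module R M by fact
  assume "fin_gen R M"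
  then obtain S where S: "finite S" "S \<subseteq> carrier M"
    "ALL x:carrier M. EX c : S \<rightarrow> carrier R. x = (\<Oplus>\<^bsub>M\<^esub>s\<in>S. c s .[M] s)"
    unfolding fin_gen_def by blast
  have "x : U" if U: "submod R M U" "S \<subseteq> U" and x: "x :. M" for U x
  proof -
    obtain c where c: "c : S \<rightarrow> carrier R" "x = (\<Oplus>\<^bsub>M\<^esub>s\<in>S. c s .[M] s)" using S(3)[rule_format, OF x] by blast
    have "(\<Oplus>\<^bsub>M\<^esub>s\<in>S. c s .[M] s) : U"
      by (rule submod_finsum[OF U(1)]) (use c(1) U in "auto simp: submod_def Pi_iff subset_iff")
    then show ?thesis using c by simp
  qed
  then show "EX S. finite S & S \<subseteq> carrier M & (ALL U. submod R M U --> S \<subseteq> U --> carrier M \<subseteq> U)"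
    using S(1,2) by blast
next
  interpret left_module R M by fact
  assume "EX S. finite S & S \<subseteq> carrier M & (ALL U. submod R M U --> S \<subseteq> U --> carrier M \<subseteq> U)"
  then obtain S where S: "finite S" "S \<subseteq> carrier M" "!!U. submod R M U ==> S \<subseteq> U ==> carrier M \<subseteq> U"
    by blast
  let ?f = "%c. \<Oplus>\<^bsub>M\<^esub>s\<in>S. c s .[M] s"
  let ?U = "?f ` (S \<rightarrow> carrier R)"
  have cl: "(%s. c s .[M] s) : S \<rightarrow> carrier M" if "c : S \<rightarrow> carrier R" for c
    using that S(2) by (auto intro!: smult_closed)
  have "submod R M ?U" unfolding submod_def
  proof (intro conjI ballI)
    show "?U \<subseteq> carrier M" using cl by (auto intro!: M.finsum_closed)
    show "0[M] : ?U"
    proof (rule image_eqI[where x = "%_. \<zero>"])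
      have "?f (%_. \<zero>) = (\<Oplus>\<^bsub>M\<^esub>s\<in>S. 0[M])"
        by (rule M.finsum_cong') (use S(2) in "auto simp: smult_zero_left")
      then show "0[M] = ?f (%_. \<zero>)" by simp
    qed auto
  next
    fix x y assume "x : ?U" "y : ?U"
    then obtain c d where cd: "c : S \<rightarrow> carrier R" "x = ?f c" "d : S \<rightarrow> carrier R" "y = ?f d" by blast
    have "?f (%s. c s \<oplus> d s) = (\<Oplus>\<^bsub>M\<^esub>s\<in>S. c s .[M] s +[M] d s .[M] s)"
      using cd S(2) by (intro M.finsum_cong') (auto simp: smult_l_distr smult_closed Pi_def subset_iff)
    also have "... = x +[M] y" using cl cd by (simp add: M.finsum_addf)
    finally show "x +[M] y : ?U" using cd by (intro image_eqI[where x = "%s. c s \<oplus> d s"]) auto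
  next
    fix r x assume r: "r :. R" and "x : ?U"
    then obtain c where c: "c : S \<rightarrow> carrier R" "x = ?f c" by blast
    have "r .[M] x = (\<Oplus>\<^bsub>M\<^esub>s\<in>S. r .[M] (c s .[M] s))" using c r cl by (simp add: smult_finsum)
    also have "... = ?f (%s. r \<otimes> c s)"
      using c r S(2) by (intro M.finsum_cong') (auto simp: smult_assoc1 smult_closed Pi_def subset_iff)
    finally show "r .[M] x : ?U" using c r by (intro image_eqI[where x = "%s. r \<otimes> c s"]) auto
  qed
  moreover have "S \<subseteq> ?U"
  proof
    fix t assume t: "t : S"
    let ?c = "%s. if s = t then \<one> else \<zero>"
    have "?f ?c = (\<Oplus>\<^bsub>M\<^esub>s\<in>S. if t = s then s else 0[M])"
      using S(2) by (intro M.finsum_cong') (auto simp: smult_one smult_zero_left subset_iff)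
    also have "... = t" using M.finsum_singleton[OF t S(1), of "%s. s"] S(2) by auto
    finally show "t : ?U" by (intro image_eqI[where x = ?c]) auto
  qed
  ultimately have "carrier M \<subseteq> ?U" by (rule S(3))
  then show "fin_gen R M" unfolding fin_gen_def using S(1,2) by blast
qed

text \<open>Preimages of submodules are submodules, so the images of generators generate.\<close>

lemma fin_gen_image:
  assumes "left_module R M" "left_module R N" "fin_gen R M" "f : Hom R M N"
    "carrier N \<subseteq> f ` carrier M"
  shows "fin_gen R N"
proof -
  interpret M: left_module R M by fact
  interpret N: left_module R N by fact
  obtain S where S: "finite S" "S \<subseteq> carrier M" "ALL U. submod R M U --> S \<subseteq> U --> carrier M \<subseteq> U"
    using assms(3) fin_gen_iff[OF assms(1)] by blast
  have "carrier N \<subseteq> U" if U: "submod R N U" "f ` S \<subseteq> U" for U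
  proof -
    have "submod R M {x : carrier M. f x : U}"
      using U(1) assms(4) hom_zero[OF assms(4) M.M_group N.M_group]
      by (auto simp: submod_def hom_add hom_smult M.smult_closed)
    moreover have "S \<subseteq> {x : carrier M. f x : U}" using S(2) U(2) by auto
    ultimately have "carrier M \<subseteq> {x : carrier M. f x : U}" using S(3) by blast
    then show ?thesis using assms(5) by auto
  qed
  moreover have "f ` S \<subseteq> carrier N" using S(2) hom_closed[OF assms(4)] by auto
  ultimately show ?thesis unfolding fin_gen_iff[OF assms(2)] using S(1) by (intro exI[of _ "f ` S"]) auto
qed

section \<open>Finite-dimensional vector spaces\<close>

text \<open>Linearity is asked on the subset \<open>U\<close> only, so that \<open>f\<close> may be
  a coordinate function without meaning outside the subspace on which it was built.\<close>

definition lin :: "('k, 'z) ring_scheme => ('k, 'v) module => 'v set => ('k, 'w) module => ('v => 'w) => bool" where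
  "lin K V U W f \<longleftrightarrow> (ALL x:U. f x :. W) & (ALL x:U. ALL y:U. f (x +[V] y) = f x +[W] f y) &
     (ALL c:carrier K. ALL x:U. f (c .[V] x) = c .[W] f x)"

lemma linD:
  assumes "lin K V U W f"
  shows "x : U ==> f x :. W"
    "[|x : U; y : U|] ==> f (x +[V] y) = f x +[W] f y"
    "[|c :. K; x : U|] ==> f (c .[V] x) = c .[W] f x"
  using assms by (auto simp: lin_def)

text \<open>Coordinates modulo \<open>U\<close>: \<open>\<pi>\<close> projects \<open>U'\<close>
  onto \<open>U\<close>, and the expansion formula recovers what \<open>\<pi>\<close> loses. This
  formula takes the place of linear independence and dimension.\<close>

definition rel_dual_basis ::
    "('k, 'z) ring_scheme => ('k, 'v) module => 'v set => 'v set => ('v => 'v) => nat =>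
      (nat => 'v) => (nat => 'v => 'k) => bool" where
  "rel_dual_basis K V U U' \<pi> n b \<beta> \<longleftrightarrow> submod K V U' & U \<subseteq> U' & lin K V U' V \<pi> &
    (ALL x:U'. \<pi> x : U) & (ALL x:U. \<pi> x = x) &
    (ALL i<n. b i :. V & lin K V U' (regular K) (\<beta> i)) &
    (ALL x:U'. \<pi> x +[V] (\<Oplus>\<^bsub>V\<^esub>i\<in>{..<n}. \<beta> i x .[V] b i) = x)"

locale vspace = K?: field K + left_module K V for K (structure) and V :: "('k, 'v) module" (structure)
begin

text \<open>One step of a basis extension. An element of \<open>U + K z\<close> decomposes in only
  one way: a nonzero difference of two coefficients would be invertible and would put
  \<open>z\<close> into \<open>U\<close>. Hence both components depend linearly on the sum.\<close>

lemma vadjoin: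
  assumes U: "submod K V U" and z: "z :. V" "z \<notin> U"
  shows "EX U' uf cf. submod K V U' & U \<subseteq> U' & z : U' & lin K V U' V uf & lin K V U' (regular K) cf &
    (ALL x:U'. uf x : U & uf x +[V] cf x .[V] z = x) & (ALL x:U. uf x = x & cf x = \<zero>)"
proof -
  have UV: "x :. V" if "x : U" for x using U that by (auto simp: submod_def)
  have Uadd: "x +[V] y : U" if "x : U" "y : U" for x y using U that by (auto simp: submod_def)
  have Usm: "c .[V] y : U" if "c :. K" "y : U" for c y using U that by (auto simp: submod_def)
  have U0: "0[V] : U" using U by (auto simp: submod_def)
  note zs = smult_closed[OF _ z(1)]
  define U' where "U' = (%(u, c). u +[V] c .[V] z) ` (U \<times> carrier K)"
  have uniq: "u = u' & c = c'"
    if uc: "u : U" "u' : U" "c :. K" "c' :. K"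
      and eq: "u +[V] c .[V] z = u' +[V] c' .[V] z" for u u' c c'
  proof -
    let ?d = "c \<ominus> c'"
    have d: "?d :. K" using uc by simp
    have "?d .[V] z +[V] c' .[V] z = c .[V] z"
      using uc z by (simp add: smult_l_distr[symmetric] a_minus_def K.a_assoc K.l_neg)
    then have "(u +[V] ?d .[V] z) +[V] c' .[V] z = u' +[V] c' .[V] z"
      using eq uc d UV zs by (simp add: M.a_assoc)
    then have e: "u +[V] ?d .[V] z = u'" using uc d UV zs by simp
    have "?d = \<zero>"
    proof (rule ccontr)
      assume "?d ~= \<zero>"
      then have iv: "inv ?d :. K" "inv ?d \<otimes> ?d = \<one>"
        using d by (auto simp: K.field_Units)
      have "?d .[V] z = -[V] u +[V] (u +[V] ?d .[V] z)"
        using uc d UV zs by (simp add: M.a_assoc[symmetric] M.l_neg)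
      then have "?d .[V] z : U" unfolding e using Uadd submod_minus[OF U] uc by simp
      then have "inv ?d .[V] (?d .[V] z) : U" using Usm iv by simp
      then show False using iv d z by (simp add: smult_assoc1[symmetric] smult_one)
    qed
    moreover have "c = ?d \<oplus> c'" using uc by (simp add: a_minus_def K.a_assoc K.l_neg)
    ultimately show ?thesis using e uc UV z by (simp add: smult_zero_left)
  qed
  define pf where "pf = inv_into (U \<times> carrier K) (%(u, c). u +[V] c .[V] z)"
  have inj: "inj_on (%(u, c). u +[V] c .[V] z) (U \<times> carrier K)"
    using uniq by (auto simp: inj_on_def)
  have pf: "pf (u +[V] c .[V] z) = (u, c)" if "u : U" "c :. K" for u c
    unfolding pf_def using inv_into_f_f[OF inj, of "(u, c)"] that by simp
  have U'E: "EX u c. u : U & c :. K & x = u +[V] c .[V] z" if "x : U'" for x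
    using that by (auto simp: U'_def)
  have U'I: "u +[V] c .[V] z : U'" if "u : U" "c :. K" for u c
    using that unfolding U'_def by force
  have addf: "(u +[V] c .[V] z) +[V] (u' +[V] c' .[V] z) = (u +[V] u') +[V] (c \<oplus> c') .[V] z"
    if "u : U" "u' : U" "c :. K" "c' :. K" for u u' c c'
    using that z by (simp add: smult_l_distr UV zs M.a_ac)
  have smf: "r .[V] (u +[V] c .[V] z) = (r .[V] u) +[V] (r \<otimes> c) .[V] z"
    if "u : U" "r :. K" "c :. K" for u r c
    using that z by (simp add: smult_r_distr smult_assoc1 UV zs)
  have U0': "u = u +[V] \<zero> .[V] z" if "u : U" for u using that z by (simp add: smult_zero_left UV)
  have pfU: "pf u = (u, \<zero>)" if "u : U" for u using pf[OF that K.zero_closed] U0'[OF that] by simp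
  show ?thesis
  proof (intro exI[of _ U'] exI[of _ "fst \<circ> pf"] exI[of _ "snd \<circ> pf"] conjI)
    show "submod K V U'" unfolding submod_def
    proof (intro conjI ballI)
      show "U' \<subseteq> carrier V" using z by (auto simp: U'_def UV smult_closed)
      show "0[V] : U'" using U'I[OF U0 K.zero_closed] U0'[OF U0] by simp
    next
      fix x y assume "x : U'" "y : U'"
      then obtain u c u' c' where "u : U" "c :. K" "x = u +[V] c .[V] z"
        "u' : U" "c' :. K" "y = u' +[V] c' .[V] z" using U'E by meson
      then show "x +[V] y : U'" using U'I[of "u +[V] u'" "c \<oplus> c'"] by (simp add: addf Uadd)
    next
      fix r x assume r: "r :. K" and "x : U'"
      then obtain u c where "u : U" "c :. K" "x = u +[V] c .[V] z" using U'E by meson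
      then show "r .[V] x : U'" using U'I[of "r .[V] u" "r \<otimes> c"] r by (simp add: smf Usm)
    qed
    show "U \<subseteq> U'" using U'I[OF _ K.zero_closed] U0' by auto
    show "z : U'" using U'I[OF U0 K.one_closed] z by (simp add: smult_one)
    show "lin K V U' V (fst \<circ> pf)" unfolding lin_def
    proof (intro conjI ballI)
      fix x assume "x : U'" then show "(fst \<circ> pf) x :. V" using U'E[of x] by (auto simp: pf UV)
    next
      fix x y assume "x : U'" "y : U'"
      then obtain u c u' c' where "u : U" "c :. K" "x = u +[V] c .[V] z"
        "u' : U" "c' :. K" "y = u' +[V] c' .[V] z" using U'E by meson
      then show "(fst \<circ> pf) (x +[V] y) = (fst \<circ> pf) x +[V] (fst \<circ> pf) y" by (simp add: addf Uadd pf)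
    next
      fix r x assume r: "r :. K" and "x : U'"
      then obtain u c where "u : U" "c :. K" "x = u +[V] c .[V] z" using U'E by meson
      then show "(fst \<circ> pf) (r .[V] x) = r .[V] (fst \<circ> pf) x" using r by (simp add: smf Usm pf)
    qed
    show "lin K V U' (regular K) (snd \<circ> pf)" unfolding lin_def
    proof (intro conjI ballI)
      fix x assume "x : U'" then show "(snd \<circ> pf) x :. (regular K)" using U'E[of x] by (auto simp: pf)
    next
      fix x y assume "x : U'" "y : U'"
      then obtain u c u' c' where "u : U" "c :. K" "x = u +[V] c .[V] z"
        "u' : U" "c' :. K" "y = u' +[V] c' .[V] z" using U'E by meson
      then show "(snd \<circ> pf) (x +[V] y) = (snd \<circ> pf) x +[regular K] (snd \<circ> pf) y"
        by (simp add: addf Uadd pf)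
    next
      fix r x assume r: "r :. K" and "x : U'"
      then obtain u c where "u : U" "c :. K" "x = u +[V] c .[V] z" using U'E by meson
      then show "(snd \<circ> pf) (r .[V] x) = r .[regular K] (snd \<circ> pf) x" using r by (simp add: smf Usm pf)
    qed
    show "ALL x:U'. (fst \<circ> pf) x : U & (fst \<circ> pf) x +[V] (snd \<circ> pf) x .[V] z = x"
    proof
      fix x assume "x : U'"
      then obtain u c where "u : U" "c :. K" "x = u +[V] c .[V] z" using U'E by meson
      then show "(fst \<circ> pf) x : U & (fst \<circ> pf) x +[V] (snd \<circ> pf) x .[V] z = x"
        by (simp add: pf)
    qed
  qed (simp add: pfU)
qed

text \<open>Induction over \<open>S\<close>: a vector that is already present changes nothing, a new
  one is adjoined by \<open>vadjoin\<close>, and the old projection and coordinates are precomposed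
  with the component map \<open>uf\<close>.\<close>

lemma relative_dual_basis:
  assumes U: "submod K V U" and S: "finite S" "S \<subseteq> carrier V"
  shows "EX U' \<pi> n (b :: nat => 'v) \<beta>. S \<subseteq> U' & rel_dual_basis K V U U' \<pi> n b \<beta>"
  using S
proof (induction S rule: finite_induct)
  case empty
  have "lin K V U V (%x. x)" using U by (auto simp: lin_def submod_def)
  then have "rel_dual_basis K V U U (%x. x) 0 b \<beta>" for b \<beta>
    using U by (simp add: rel_dual_basis_def submod_def subset_iff)
  then show ?case by blast
next
  case (insert z S)
  then obtain U1 \<pi> n b \<beta> where SU1: "S \<subseteq> U1" and H: "rel_dual_basis K V U U1 \<pi> n b \<beta>" by blast
  note U1 = H[unfolded rel_dual_basis_def, THEN conjunct1]
    H[unfolded rel_dual_basis_def, THEN conjunct2, THEN conjunct1] SU1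
    H[unfolded rel_dual_basis_def, THEN conjunct2, THEN conjunct2, THEN conjunct1]
  have pi: "!!x. x : U1 ==> \<pi> x : U" "!!x. x : U ==> \<pi> x = x"
    using H by (simp_all add: rel_dual_basis_def)
  have b: "!!i. i < n ==> b i :. V" "!!i. i < n ==> lin K V U1 (regular K) (\<beta> i)"
    using H by (simp_all add: rel_dual_basis_def)
  have ex: "!!x. x : U1 ==> \<pi> x +[V] (\<Oplus>\<^bsub>V\<^esub>i\<in>{..<n}. \<beta> i x .[V] b i) = x"
    using H unfolding rel_dual_basis_def by metis
  show ?case
  proof (cases "z : U1")
    case True
    then show ?thesis using SU1 H by (metis insert_subset)
  next
    case False
    have zV: "z :. V" using insert by auto
    obtain U2 uf cf where adj: "submod K V U2 & U1 \<subseteq> U2 & z : U2 & lin K V U2 V uf & lin K V U2 (regular K) cf &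
      (ALL x:U2. uf x : U1 & uf x +[V] cf x .[V] z = x) & (ALL x:U1. uf x = x & cf x = \<zero>)"
      using vadjoin[OF U1(1) zV False] by blast
    then have U2: "submod K V U2" "U1 \<subseteq> U2" "z : U2"
      "lin K V U2 V uf" "lin K V U2 (regular K) cf" "!!x. x : U2 ==> uf x : U1"
      "!!x. x : U2 ==> uf x +[V] cf x .[V] z = x"
      "!!x. x : U1 ==> uf x = x" "!!x. x : U1 ==> cf x = \<zero>"
      by simp_all
    let ?b = "b(n := z)" and ?\<beta> = "%i. if i = n then cf else \<beta> i \<circ> uf"
    have l2: "lin K V U2 W (g \<circ> uf)" if "lin K V U1 W g" for g and W :: "('k, 'w) module"
      using that U2(4,6) unfolding lin_def by simp
    have "ALL i<Suc n. ?b i :. V & lin K V U2 (regular K) (?\<beta> i)"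
      using b zV U2(5) l2 by (auto simp: less_Suc_eq)
    moreover have "(\<pi> \<circ> uf) x +[V] (\<Oplus>\<^bsub>V\<^esub>i\<in>{..<Suc n}. ?\<beta> i x .[V] ?b i) = x" if x: "x : U2" for x
    proof -
      have cl: "\<beta> i (uf x) .[V] b i :. V" if "i < n" for i
        using linD(1)[OF b(2)[OF that] U2(6)[OF x]] b(1)[OF that] by (simp add: smult_closed)
      have czV: "cf x .[V] z :. V" using linD(1)[OF U2(5) x] zV by (simp add: smult_closed)
      have pV: "\<pi> (uf x) :. V" using pi(1)[OF U2(6)[OF x]] U by (auto simp: submod_def)
      have "(\<Oplus>\<^bsub>V\<^esub>i\<in>{..<Suc n}. ?\<beta> i x .[V] ?b i) =
          (\<Oplus>\<^bsub>V\<^esub>i\<in>{..<n}. ?\<beta> i x .[V] ?b i) +[V] ?\<beta> n x .[V] ?b n"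
        using cl czV by (intro M.finsum_lessThan_Suc) (auto simp: less_Suc_eq le_less)
      also have "(\<Oplus>\<^bsub>V\<^esub>i\<in>{..<n}. ?\<beta> i x .[V] ?b i) = (\<Oplus>\<^bsub>V\<^esub>i\<in>{..<n}. \<beta> i (uf x) .[V] b i)"
        using cl by (intro M.finsum_cong') auto
      finally have "(\<pi> \<circ> uf) x +[V] (\<Oplus>\<^bsub>V\<^esub>i\<in>{..<Suc n}. ?\<beta> i x .[V] ?b i) =
          (\<pi> (uf x) +[V] (\<Oplus>\<^bsub>V\<^esub>i\<in>{..<n}. \<beta> i (uf x) .[V] b i)) +[V] cf x .[V] z"
        using cl czV pV by (simp add: M.a_assoc M.finsum_closed Pi_def)
      also have "... = x" using ex[OF U2(6)[OF x]] U2(7)[OF x] by simp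
      finally show ?thesis by simp
    qed
    moreover have "ALL x:U2. (\<pi> \<circ> uf) x : U" "ALL x:U. (\<pi> \<circ> uf) x = x" "U \<subseteq> U2" "insert z S \<subseteq> U2"
      using U2(2,3,6,8) U1(2) SU1 pi by (auto simp: subset_iff)
    ultimately have "rel_dual_basis K V U U2 (\<pi> \<circ> uf) (Suc n) ?b ?\<beta>" "insert z S \<subseteq> U2"
      unfolding rel_dual_basis_def using U2(1) l2[OF U1(4)] by blast+
    then show ?thesis by blast
  qed
qed

lemma lin_hom:
  assumes "lin K V (carrier V) W f"
  shows "restrict f (carrier V) : Hom K V W"
  using assms by (intro hom_setI) (auto simp: lin_def smult_closed)

text \<open>\<open>\<nu>\<close> is composed with the projection of
  \<open>relative_dual_basis\<close>, taken for a generating set of \<open>V\<close>.\<close>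

lemma functional_extend:
  assumes fg: "fin_gen K V" and U: "submod K V U" and l: "lin K V U W \<nu>"
  shows "EX \<mu>:Hom K V W. ALL u:U. \<mu> u = \<nu> u"
proof -
  obtain S where S: "finite S" "S \<subseteq> carrier V" "ALL U. submod K V U --> S \<subseteq> U --> carrier V \<subseteq> U"
    using fg fin_gen_iff[OF left_module_axioms] by blast
  obtain U' \<pi> where p: "submod K V U'" "S \<subseteq> U'" "lin K V U' V \<pi>" "ALL x:U'. \<pi> x : U" "ALL x:U. \<pi> x = x"
    using relative_dual_basis[OF U S(1,2)] unfolding rel_dual_basis_def by metis
  have "U' = carrier V" using S(3) p(1,2) by (auto simp: submod_def)
  then have "lin K V (carrier V) W (\<nu> \<circ> \<pi>)" using p l by (simp add: lin_def)
  from lin_hom[OF this] show ?thesis using p(5) U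
    by (intro bexI[of _ "restrict (\<nu> \<circ> \<pi>) (carrier V)"]) (auto simp: submod_def)
qed

text \<open>The case \<open>U = {0}\<close> of \<open>relative_dual_basis\<close>, where the
  projection vanishes.\<close>

lemma dual_basis:
  assumes fg: "fin_gen K V"
  shows "EX n b \<beta>. (ALL i<n::nat. b i :. V & \<beta> i : Hom K V (regular K)) &
    (ALL x:carrier V. (\<Oplus>\<^bsub>V\<^esub>i\<in>{..<n}. \<beta> i x .[V] b i) = x)"
proof -
  obtain S where S: "finite S" "S \<subseteq> carrier V" "ALL U. submod K V U --> S \<subseteq> U --> carrier V \<subseteq> U"
    using fg fin_gen_iff[OF left_module_axioms] by blast
  have U0: "submod K V {0[V]}" by (auto simp: submod_def smult_zero_right)
  obtain U' \<pi> n and b :: "nat => 'v" and \<beta> where S': "S \<subseteq> U'" and H: "rel_dual_basis K V {0[V]} U' \<pi> n b \<beta>"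
    using relative_dual_basis[OF U0 S(1,2)] by blast
  have p: "submod K V U'" "S \<subseteq> U'" "ALL x:U'. \<pi> x : {0[V]}"
    "ALL i<n. b i :. V & lin K V U' (regular K) (\<beta> i)"
    "ALL x:U'. \<pi> x +[V] (\<Oplus>\<^bsub>V\<^esub>i\<in>{..<n}. \<beta> i x .[V] b i) = x"
    using H S' unfolding rel_dual_basis_def by blast+
  have U': "U' = carrier V" using S(3) p(1,2) by (auto simp: submod_def)
  show ?thesis
  proof (intro exI[of _ n] exI[of _ b] exI[of _ "%i. restrict (\<beta> i) (carrier V)"] conjI ballI)
    fix x assume x: "x :. V"
    have "(%i. \<beta> i x .[V] b i) : {..<n} \<rightarrow> carrier V"
      using p(4) x U' by (auto simp: lin_def intro!: smult_closed)
    then show "(\<Oplus>\<^bsub>V\<^esub>i\<in>{..<n}. restrict (\<beta> i) (carrier V) x .[V] b i) = x"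
      using p(3) p(5)[rule_format, of x] x U' by (simp add: M.finsum_closed)
  qed (use p(4) U' lin_hom in auto)
qed

lemma functional_separate:
  assumes "fin_gen K V" "x :. V" "!!\<mu>. \<mu> : Hom K V (regular K) ==> \<mu> x = \<zero>"
  shows "x = 0[V]"
proof -
  obtain n b \<beta> where H: "(ALL i<n::nat. b i :. V & \<beta> i : Hom K V (regular K)) &
    (ALL x:carrier V. (\<Oplus>\<^bsub>V\<^esub>i\<in>{..<n}. \<beta> i x .[V] b i) = x)"
    using dual_basis[OF assms(1)] by blast
  then have b: "!!i. i < n ==> b i :. V" "!!i. i < n ==> \<beta> i : Hom K V (regular K)"
    "!!x. x :. V ==> (\<Oplus>\<^bsub>V\<^esub>i\<in>{..<n}. \<beta> i x .[V] b i) = x"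
    by simp_all
  have "(\<Oplus>\<^bsub>V\<^esub>i\<in>{..<n}. \<beta> i x .[V] b i) = (\<Oplus>\<^bsub>V\<^esub>i\<in>{..<n}. 0[V])"
    by (intro M.finsum_cong') (auto simp: assms(3)[OF b(2)] b(1) smult_zero_left)
  then show ?thesis using b(3)[OF assms(2)] by simp
qed

text \<open>Finite dimension of Hom spaces and of duals comes from this criterion. By induction on
  \<open>L\<close>, the kernel of one functional inside \<open>U\<close> is finitely generated, and
  a single vector outside that kernel supplies the rest.\<close>

lemma fin_gen_if_separated:
  assumes L: "finite L" "L \<subseteq> Hom K V (regular K)"
    and sep: "!!x. [|x :. V; ALL \<mu>:L. \<mu> x = \<zero>|] ==> x = 0[V]"
  shows "fin_gen K V"
proof -
  have "EX S. finite S & S \<subseteq> U & (ALL U'. submod K V U' --> S \<subseteq> U' --> U \<subseteq> U')"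
    if "submod K V U" "ALL x:U. (ALL \<mu>:L. \<mu> x = \<zero>) --> x = 0[V]" for U
    using L that
  proof (induction L arbitrary: U rule: finite_induct)
    case empty
    then show ?case by (intro exI[of _ "{}"]) (auto simp: submod_def)
  next
    case (insert \<nu> L)
    have l: "\<nu> : Hom K V (regular K)" using insert.prems(1) by auto
    have l0: "\<nu> 0[V] = \<zero>" using hom_zero[OF l M.abelian_group_axioms] K.abelian_group_axioms by simp
    have UV: "x :. V" if "x : U" for x using insert.prems(2) that by (auto simp: submod_def)
    let ?U0 = "{x : U. \<nu> x = \<zero>}"
    have U0: "submod K V ?U0" using insert.prems(2) UV l0
      by (simp add: submod_def hom_add[OF l] hom_smult[OF l] subset_iff)
    have L': "L \<subseteq> Hom K V (regular K)" using insert.prems(1) by auto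
    have sep0: "ALL x:?U0. (ALL \<mu>:L. \<mu> x = \<zero>) --> x = 0[V]" using insert.prems(3) by simp
    obtain S where S: "finite S" "S \<subseteq> ?U0" "ALL U'. submod K V U' --> S \<subseteq> U' --> ?U0 \<subseteq> U'"
      using insert.IH[OF L' U0 sep0] by blast
    show ?case
    proof (cases "?U0 = U")
      case True then show ?thesis using S by auto
    next
      case False
      then obtain x where x: "x : U" "\<nu> x ~= \<zero>" by auto
      have lx: "\<nu> x :. K" using hom_closed[OF l UV[OF x(1)]] by simp
      then have iv: "inv (\<nu> x) :. K" "inv (\<nu> x) \<otimes> \<nu> x = \<one>" using x by (auto simp: K.field_Units)
      have "U \<subseteq> U'" if U': "submod K V U'" "insert x S \<subseteq> U'" for U'
      proof
        fix y assume y: "y : U"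
        \<comment> \<open>This multiple of \<open>x\<close> has the same value under
          \<open>\<nu>\<close> as \<open>y\<close>, so the difference falls into
          \<open>?U0\<close>.\<close>
        let ?c = "\<nu> y \<otimes> inv (\<nu> x)"
        have ly: "\<nu> y :. K" using hom_closed[OF l UV[OF y]] by simp
        then have c: "?c :. K" using iv by simp
        have cx: "?c .[V] x : U" using insert.prems(2) c x by (auto simp: submod_def)
        have m: "y -[V] ?c .[V] x : U" by (rule submod_diff[OF insert.prems(2) y cx])
        have "\<nu> (y -[V] ?c .[V] x) = \<nu> y \<ominus> ?c \<otimes> \<nu> x"
          using hom_diff[OF l M.abelian_group_axioms _ UV[OF y] UV[OF cx]] hom_smult[OF l c UV[OF x(1)]]
            K.abelian_group_axioms
          by (simp add: a_minus_def)
        also have "... = \<zero>" using iv ly lx by (simp add: K.m_assoc K.r_neg a_minus_def)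
        finally have "y -[V] ?c .[V] x : U'" using S(3) U' m by auto
        moreover have "?c .[V] x : U'" using U' c by (auto simp: submod_def)
        ultimately have "(y -[V] ?c .[V] x) +[V] ?c .[V] x : U'" using U' by (auto simp: submod_def)
        then show "y : U'" using UV[OF y] UV[OF cx] by (simp add: a_minus_def M.a_assoc M.l_neg)
      qed
      then show ?thesis using S x by (intro exI[of _ "insert x S"]) auto
    qed
  qed
  from this[of "carrier V"] show ?thesis unfolding fin_gen_iff[OF left_module_axioms]
    using sep by (auto simp: submod_def smult_closed)
qed

end

section \<open>Finite-dimensional modules over algebras\<close>

abbreviation rs :: "('k, 'r) module => ('r, 'm) module => ('k, 'm) module" where
  "rs R M \<equiv> with_smult (scal R M) M"

abbreviation functionals :: "'k ring => ('k, 'r) module => ('r, 'm) module => ('m => 'k) set" where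
  "functionals K R M \<equiv> hom_set K (rs R M) (regular K)"

lemma hom_set_regular [simp]: "Hom (regular K) M N = Hom K M N"
  by (simp add: hom_set_def)

lemma hom_set_opp [simp]: "Hom (opp A) M N = Hom A M N"
  by (simp add: hom_set_def)

lemma fd_algebraD:
  assumes "fd_algebra K R"
  shows "field K" "cring K" "ring K" "ring R" "module K R" "left_module K R" "fin_gen K R"
proof -
  have m: "module K R" by (rule fd_algebra.axioms(2)[OF assms])
  show "field K" by (rule fd_algebra.axioms(1)[OF assms])
  then show K: "cring K" "ring K" by (auto dest: field.axioms domain.axioms cring.axioms)
  show "ring R" by (rule fd_algebra.axioms(3)[OF assms])
  show "module K R" by (rule m)
  show "left_module K R" using K(2) module.axioms(2)[OF m]
    by (rule left_moduleI)
      (use module.smult_closed[OF m] module.smult_l_distr[OF m] module.smult_r_distr[OF m]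
        module.smult_assoc1[OF m] module.smult_one[OF m] in auto)
  show "fin_gen K R" by (rule fd_algebra.finite_dim[OF assms])
qed

lemma fd_algebraI:
  assumes "field K" "left_module K R" "ring R" "fin_gen K R"
    "!!c x y. [|c :. K; x :. R; y :. R|] ==>
        (c .[R] x) *[R] y = c .[R] (x *[R] y)"
    "!!c x y. [|c :. K; x :. R; y :. R|] ==>
        x *[R] (c .[R] y) = c .[R] (x *[R] y)"
  shows "fd_algebra K R"
proof -
  interpret R: left_module K R by fact
  have "cring K" using assms(1) by (auto dest: field.axioms domain.axioms)
  then have "module K R" using R.M_group
    by (intro module.intro module_axioms.intro)
      (auto simp: R.smult_closed R.smult_l_distr R.smult_r_distr R.smult_assoc1 R.smult_one)
  then show ?thesis using assms by (intro fd_algebra.intro fd_algebra_axioms.intro) auto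
qed

lemma fd_algebra_opp:
  assumes "fd_algebra K R"
  shows "fd_algebra K (opp R)"
proof -
  interpret R: ring R using fd_algebraD[OF assms] by simp
  interpret V: left_module K R using fd_algebraD[OF assms] by simp
  have 1: "left_module K (opp R)"
    by (rule left_moduleI)
      (auto simp: fd_algebraD(3)[OF assms] R.abelian_group_axioms V.smult_closed V.smult_l_distr V.smult_r_distr
        V.smult_assoc1 V.smult_one)
  have 2: "ring (opp R)"
    by (rule ringI) (auto simp: R.abelian_group_axioms R.m_assoc R.l_distr R.r_distr intro!: monoidI)
  have 3: "fin_gen K (opp R)" using fd_algebraD(7)[OF assms] by (simp add: fin_gen_def)
  show ?thesis
    by (rule fd_algebraI[OF fd_algebraD(1)[OF assms] 1 2 3]) (auto simp: fd_algebra.smult_mult_left[OF assms] fd_algebra.smult_mult_right[OF assms])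
qed

lemma fd_algebra_field:
  assumes "field K"
  shows "fd_algebra K (regular K)"
proof -
  interpret field K by fact
  have "left_module K (regular K)"
    by (rule left_moduleI) (auto simp: ring_axioms abelian_group_axioms l_distr r_distr m_assoc)
  moreover have "ring (regular K)"
    by (rule ringI) (auto simp: abelian_group_axioms l_distr r_distr m_assoc intro!: monoidI)
  moreover have "fin_gen K (regular K)"
    unfolding fin_gen_def
  proof (intro exI[of _ "{1[K]}"] conjI ballI)
    fix x assume "x :. (regular K)"
    then show "EX c:{1[K]} \<rightarrow> carrier K. x = (\<Oplus>\<^bsub>regular K\<^esub>s\<in>{1[K]}. c s .[regular K] s)"
      by (intro bexI[of _ "%_. x"]) (auto simp: finsum_insert)
  qed auto
  ultimately show ?thesis
    by (intro fd_algebraI assms) (auto simp: m_assoc m_lcomm)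
qed

lemma left_module_regular: "ring R ==> left_module R (regular R)"
proof -
  assume "ring R"
  then interpret ring R .
  show ?thesis
    by (rule left_moduleI) (auto simp: ring_axioms abelian_group_axioms l_distr r_distr m_assoc)
qed

lemma scal_regular:
  assumes "fd_algebra K R" "c :. K" "a :. R"
  shows "scal R (regular R) c a = c .[R] a"
proof -
  interpret R: ring R using fd_algebraD[OF assms(1)] by simp
  show ?thesis using assms by (simp add: scal_def fd_algebra.smult_mult_left[OF assms(1)])
qed

lemma scal_module:
  assumes "fd_algebra K R" "left_module R M"
  shows "left_module K (rs R M)"
    and "!!c x. [|c :. K; x :. M|] ==> scal R M c x :. M"
    and "!!a c x. [|a :. R; c :. K; x :. M|] ==>
      a .[M] scal R M c x = scal R M c (a .[M] x)"
    and "!!a c x. [|a :. R; c :. K; x :. M|] ==>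
      (c .[R] a) .[M] x = scal R M c (a .[M] x)"
proof -
  interpret R: ring R using fd_algebraD[OF assms(1)] by simp
  interpret V: left_module K R using fd_algebraD[OF assms(1)] by simp
  interpret M: left_module R M by fact
  have c1: "c .[R] 1[R] :. R" if "c :. K" for c using that by (simp add: V.smult_closed)
  show cl: "scal R M c x :. M" if "c :. K" "x :. M" for c x
    using that c1 by (simp add: scal_def M.smult_closed)
  show ca: "(c .[R] a) .[M] x = scal R M c (a .[M] x)"
    if "a :. R" "c :. K" "x :. M" for a c x
  proof -
    have "(c .[R] 1[R]) *[R] a = c .[R] a" using that by (simp add: fd_algebra.smult_mult_left[OF assms(1)])
    then show ?thesis using that c1 unfolding scal_def by (metis M.smult_assoc1)
  qed
  show "a .[M] scal R M c x = scal R M c (a .[M] x)"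
    if "a :. R" "c :. K" "x :. M" for a c x
  proof -
    have "a *[R] (c .[R] 1[R]) = c .[R] a" using that by (simp add: fd_algebra.smult_mult_right[OF assms(1)])
    then have "a .[M] scal R M c x = (c .[R] a) .[M] x"
      using that c1 unfolding scal_def by (metis M.smult_assoc1)
    then show ?thesis using ca that by simp
  qed
  show "left_module K (rs R M)"
  proof (rule left_moduleI)
    fix a b x assume "a :. K" "b :. K" "x :. (rs R M)"
    then show "(a *[K] b) .[rs R M] x = a .[rs R M] (b .[rs R M] x)"
      using ca[of "b .[R] 1[R]" a x] c1 by (simp add: V.smult_assoc1 scal_def)
  qed (use c1 cl in "auto simp: fd_algebraD(3)[OF assms(1)] M.M_group scal_def V.smult_l_distr
    M.smult_l_distr M.smult_r_distr V.smult_one M.smult_one")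
qed

lemma hom_scal:
  assumes "fd_algebra K R" "f : Hom R M N"
  shows "f : Hom K (rs R M) (rs R N)"
    and "[|c :. K; x :. M|] ==> f (scal R M c x) = scal R N c (f x)"
proof -
  interpret V: left_module K R using fd_algebraD[OF assms(1)] by simp
  interpret R: ring R using fd_algebraD[OF assms(1)] by simp
  have *: "f (scal R M c x) = scal R N c (f x)" if "c :. K" "x :. M" for c x
    using hom_smult[OF assms(2), of "c .[R] 1[R]" x] that by (simp add: scal_def V.smult_closed)
  then show "[|c :. K; x :. M|] ==> f (scal R M c x) = scal R N c (f x)" by simp
  show "f : Hom K (rs R M) (rs R N)"
    by (rule hom_setI) (use assms(2) * in "auto simp: hom_closed hom_add hom_ext")
qed

lemma vspace_rs: "[|fd_algebra K R; left_module R M|] ==> vspace K (rs R M)"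
  by (simp add: vspace_def scal_module fd_algebraD)

text \<open>Finite generation over \<open>K\<close> rather than over \<open>R\<close> is the
  property that passes to submodules, duals and Hom spaces by means of
  \<open>fin_gen_if_separated\<close>.\<close>

definition fdm :: "'k ring => ('k, 'r) module => ('r, 'm) module => bool" where
  "fdm K R M \<longleftrightarrow> left_module R M & fin_gen K (rs R M)"

lemma fdmD: assumes "fdm K R M" shows "left_module R M" "fin_gen K (rs R M)" "abelian_group M"
  using assms by (auto simp: fdm_def left_module_def)

text \<open>\<open>R\<close>-submodules are \<open>K\<close>-subspaces, so
  \<open>K\<close>-generators also generate over \<open>R\<close>. Conversely, the products of the
  \<open>K\<close>-generators of the algebra with the \<open>R\<close>-generators of the module
  span.\<close>

lemma fg_module_iff:
  assumes K: "fd_algebra K R"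
  shows "fg_module R M \<longleftrightarrow> fdm K R M"
proof -
  have "fin_gen R M \<longleftrightarrow> fin_gen K (rs R M)" if lm: "left_module R M"
  proof
    interpret M: left_module R M by fact
    note kM = scal_module[OF K lm]
    interpret R: ring R using fd_algebraD[OF K] by simp
    interpret V: left_module K R using fd_algebraD[OF K] by simp
    show "fin_gen R M" if "fin_gen K (rs R M)"
    proof -
      obtain S where S: "finite S" "S \<subseteq> carrier M" "ALL U. submod K (rs R M) U --> S \<subseteq> U --> carrier M \<subseteq> U"
        using \<open>fin_gen K (rs R M)\<close> unfolding fin_gen_iff[OF kM(1)] by auto
      have sub: "submod K (rs R M) U" if "submod R M U" for U
        using that V.smult_closed by (auto simp: submod_def scal_def)
      show ?thesis unfolding fin_gen_iff[OF lm]
        by (intro exI[of _ S] conjI allI impI S(1,2)) (rule S(3)[rule_format, OF sub])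
    qed
    show "fin_gen K (rs R M)" if fgM: "fin_gen R M"
    proof -
      obtain S where S: "finite S" "S \<subseteq> carrier M" "ALL U. submod R M U --> S \<subseteq> U --> carrier M \<subseteq> U"
        using fgM unfolding fin_gen_iff[OF lm] by auto
      obtain T where T: "finite T" "T \<subseteq> carrier R" "ALL U. submod K R U --> T \<subseteq> U --> carrier R \<subseteq> U"
        using fd_algebraD(7)[OF K] unfolding fin_gen_iff[OF fd_algebraD(6)[OF K]] by auto
      let ?W = "(%(t, s). t .[M] s) ` (T \<times> S)"
      have "carrier M \<subseteq> U" if U: "submod K (rs R M) U" "?W \<subseteq> U" for U
      proof -
        have U0: "0[M] : U" "!!x y. [|x : U; y : U|] ==> x +[M] y : U" "U \<subseteq> carrier M"
          "!!c x. [|c :. K; x : U|] ==> scal R M c x : U" using U(1) by (auto simp: submod_def)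
        have rs: "r .[M] s : U" if r: "r :. R" and s: "s : S" for r s
        proof -
          have sM: "s :. M" using s S(2) by auto
          have "submod K R {r : carrier R. r .[M] s : U}"
            using U0 sM by (simp add: submod_def subset_iff M.smult_zero_left M.smult_l_distr V.smult_closed kM(4))
          moreover have "T \<subseteq> {r : carrier R. r .[M] s : U}" using T(2) s U(2) by auto
          ultimately have "carrier R \<subseteq> {r : carrier R. r .[M] s : U}" using T(3) by blast
          then show ?thesis using r by auto
        qed
        \<comment> \<open>The largest \<open>R\<close>-submodule contained in the
          \<open>K\<close>-subspace \<open>U\<close>.\<close>
        let ?U = "{x : carrier M. ALL r:carrier R. r .[M] x : U}"
        have "submod R M ?U"
          using U0 by (simp add: submod_def subset_iff M.smult_zero_right M.smult_r_distr M.smult_closed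
              M.smult_assoc1[symmetric])
        moreover have "S \<subseteq> ?U" using S(2) rs by auto
        ultimately have "carrier M \<subseteq> ?U" using S(3) by blast
        then have "1[R] .[M] x : U" if "x :. M" for x using that M.R.one_closed by blast
        then show ?thesis by (auto simp: M.smult_one)
      qed
      moreover have "?W \<subseteq> carrier M" using S(2) T(2) by (auto intro!: M.smult_closed)
      ultimately show ?thesis unfolding fin_gen_iff[OF kM(1)] using S(1) T(1)
        by (intro exI[of _ ?W]) auto
    qed
  qed
  then show ?thesis by (auto simp: fg_module_def fdm_def)
qed

subsection \<open>Homomorphism spaces\<close>

lemma hom_space_simps [simp]:
  "carrier (hom_space A M N) = Hom A M N"
  "0[hom_space A M N] = (\<lambda>x\<in>carrier M. 0[N])"
  "f +[hom_space A M N] g = (\<lambda>x\<in>carrier M. f x +[N] g x)"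
  "c .[hom_space A M N] f = (\<lambda>x\<in>carrier M. scal A N c (f x))"
  by (simp_all add: hom_space_def)

text \<open>The hypotheses list closure and additivity facts instead of \<open>left_module\<close>,
  so that the lemma also serves for \<open>Hom\<close> over the corner algebra, where no module
  structure is set up.\<close>

lemma hom_space_group:
  assumes "abelian_group N"
    and M: "!!x y. [|x :. M; y :. M|] ==> x +[M] y :. M"
      "!!r x. [|r :. R; x :. M|] ==> r .[M] x :. M"
    and N: "!!r x. [|r :. R; x :. N|] ==> r .[N] x :. N"
      "!!r x y. [|r :. R; x :. N; y :. N|] ==>
        r .[N] (x +[N] y) = r .[N] x +[N] r .[N] y"
  shows "abelian_group (hom_space R M N)"
proof -
  interpret N: abelian_group N by fact
  have z: "r .[N] 0[N] = 0[N]" if "r :. R" for r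
    using N(2)[OF that N.zero_closed N.zero_closed] N(1)[OF that N.zero_closed] by simp
  have m: "r .[N] (-[N] x) = -[N] (r .[N] x)" if "r :. R" "x :. N" for r x
    using N(2)[OF that(1) N.a_inv_closed[OF that(2)] that(2)] z[OF that(1)] N(1) that
    by (simp add: N.l_neg N.minus_equality)
  have add: "(\<lambda>x\<in>carrier M. f x +[N] g x) : Hom R M N"
    if f: "f : Hom R M N" and g: "g : Hom R M N" for f g
    by (rule hom_setI)
      (simp_all add: M N hom_closed[OF f] hom_closed[OF g] hom_add[OF f] hom_add[OF g] hom_smult[OF f]
        hom_smult[OF g] N.a_ac)
  have zero: "(\<lambda>x\<in>carrier M. 0[N]) : Hom R M N"
    by (rule hom_setI) (simp_all add: M z)
  have neg: "(\<lambda>x\<in>carrier M. -[N] f x) : Hom R M N" if f: "f : Hom R M N" for f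
    by (rule hom_setI) (simp_all add: M hom_closed[OF f] hom_add[OF f] hom_smult[OF f] m N.minus_add)
  show ?thesis
  proof (rule abelian_groupI)
    fix f assume f: "f :. (hom_space R M N)"
    show "EX g:carrier (hom_space R M N). g +[hom_space R M N] f = 0[hom_space R M N]"
      using f neg[of f] by (intro bexI[of _ "\<lambda>x\<in>carrier M. -[N] f x"]) (auto simp: hom_closed N.l_neg)
    show "0[hom_space R M N] +[hom_space R M N] f = f"
      using f by (intro carrier_eqI[of _ M]) (auto simp: hom_closed hom_ext)
  next
    fix f g h assume "f :. (hom_space R M N)" "g :. (hom_space R M N)" "h :. (hom_space R M N)"
    then show "f +[hom_space R M N] g +[hom_space R M N] h = f +[hom_space R M N] (g +[hom_space R M N] h)"
      by (auto simp: hom_closed N.a_assoc intro!: restrict_ext)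
  next
    fix f g assume "f :. (hom_space R M N)" "g :. (hom_space R M N)"
    then show "f +[hom_space R M N] g = g +[hom_space R M N] f"
      by (auto simp: hom_closed N.a_comm intro!: restrict_ext)
  qed (use add zero in auto)
qed

lemma hom_space_module:
  assumes "fd_algebra K R" "left_module R M" "left_module R N"
  shows "left_module K (hom_space R M N)" "abelian_group (hom_space R M N)"
proof -
  interpret M: left_module R M by fact
  interpret N: left_module R N by fact
  note sN = scal_module[OF assms(1,3)]
  interpret NK: left_module K "rs R N" by (rule sN)
  note NKs = NK.smult_l_distr[simplified] NK.smult_r_distr[simplified] NK.smult_assoc1[simplified]
    NK.smult_one[simplified]
  show g: "abelian_group (hom_space R M N)"
    by (rule hom_space_group) (simp_all add: N.M_group M.smult_closed N.smult_closed N.smult_r_distr)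
  show "left_module K (hom_space R M N)"
  proof (rule left_moduleI)
    fix c f assume c: "c :. K" and "f :. (hom_space R M N)"
    then have f: "f : Hom R M N" by simp
    show "c .[hom_space R M N] f :. (hom_space R M N)"
      unfolding hom_space_simps
      by (rule hom_setI)
        (simp_all add: c sN hom_closed[OF f] hom_add[OF f] hom_smult[OF f] NKs M.smult_closed)
  next
    fix f assume "f :. (hom_space R M N)"
    then show "1[K] .[hom_space R M N] f = f"
      by (intro carrier_eqI[of _ M]) (auto simp: hom_closed hom_ext NKs)
  qed (use fd_algebraD(3)[OF assms(1)] g NKs sN in "auto simp: hom_closed intro!: restrict_ext")
qed

lemma hom_space_finsum:
  assumes "abelian_group (hom_space R M N)" "abelian_group N" "x :. M"
    "!!i. i : S ==> F i : Hom R M N"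
  shows "finsum (hom_space R M N) F S x = (\<Oplus>\<^bsub>N\<^esub>i\<in>S. F i x)"
proof -
  interpret H: abelian_group "hom_space R M N" by fact
  interpret N: abelian_group N by fact
  show ?thesis using assms(4)
  proof (induction S rule: infinite_finite_induct)
    case (insert i S)
    have F: "F i : Hom R M N" "F : S \<rightarrow> Hom R M N" using insert.prems by auto
    have Fx: "F i x :. N" "(%i. F i x) : S \<rightarrow> carrier N"
      using F assms(3) hom_closed by (auto simp: Pi_iff intro: hom_closed)
    have "finsum (hom_space R M N) F (insert i S) x = F i x +[N] finsum (hom_space R M N) F S x"
      using insert(1,2) F assms(3) by (simp add: H.finsum_insert)
    moreover have "(\<Oplus>\<^bsub>N\<^esub>i\<in>insert i S. F i x) = F i x +[N] (\<Oplus>\<^bsub>N\<^esub>i\<in>S. F i x)"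
      using insert(1,2) Fx by (simp add: N.finsum_insert)
    moreover have "finsum (hom_space R M N) F S x = (\<Oplus>\<^bsub>N\<^esub>i\<in>S. F i x)"
      by (rule insert.IH) (use insert.prems in simp)
    ultimately show ?case by simp
  qed (use assms(3) in "simp_all add: H.finsum_infinite N.finsum_infinite")
qed

lemma fdm_coordinates:
  assumes "fd_algebra K R" "fdm K R M"
  shows "EX n b \<beta>. (ALL i<n::nat. b i :. M & \<beta> i : functionals K R M) &
    (ALL x:carrier M. (\<Oplus>\<^bsub>M\<^esub>i\<in>{..<n}. scal R M (\<beta> i x) (b i)) = x)"
  using vspace.dual_basis[OF vspace_rs[OF assms(1)], of M] assms(2) by (simp add: fdm_def)

text \<open>The matrix entries \<open>\<alpha> j (f (b i))\<close> separate homomorphisms, because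
  \<open>f\<close> is determined by its values on the \<open>b i\<close>.\<close>

lemma fin_gen_hom_space:
  assumes K: "fd_algebra K R" and M: "fdm K R M" and N: "fdm K R N"
  shows "fin_gen K (hom_space R M N)"
proof -
  note lM = fdmD(1)[OF M] and lN = fdmD(1)[OF N]
  interpret M: left_module R M by (rule lM)
  interpret N: left_module R N by (rule lN)
  interpret H: vspace K "hom_space R M N"
    using hom_space_module[OF K lM lN] fd_algebraD(1)[OF K] by (simp add: vspace_def)
  interpret Nv: vspace K "rs R N" by (rule vspace_rs[OF K lN])
  interpret Mv: vspace K "rs R M" by (rule vspace_rs[OF K lM])
  obtain m b \<beta> where b: "!!i. i < m ==> b i :. M" "!!i. i < m ==> \<beta> i : functionals K R M"
      "!!x. x :. M ==> (\<Oplus>\<^bsub>M\<^esub>i\<in>{..<m::nat}. scal R M (\<beta> i x) (b i)) = x"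
    using fdm_coordinates[OF K M] by blast
  obtain n a \<alpha> where a: "!!i. i < n ==> a i :. N" "!!i. i < n ==> \<alpha> i : functionals K R N"
      "!!x. x :. N ==> (\<Oplus>\<^bsub>N\<^esub>i\<in>{..<n::nat}. scal R N (\<alpha> i x) (a i)) = x"
    using fdm_coordinates[OF K N] by blast
  let ?L = "(%(i, j). \<lambda>f\<in>Hom R M N. \<alpha> j (f (b i))) ` ({..<m} \<times> {..<n})"
  show ?thesis
  proof (rule H.fin_gen_if_separated[of ?L])
    show "finite ?L" by simp
    have "(\<lambda>f\<in>Hom R M N. \<alpha> j (f (b i))) : Hom K (hom_space R M N) (regular K)"
      if ij: "i < m" "j < n" for i j
    proof -
      have i: "b i :. M" and j: "\<alpha> j : functionals K R N" using a b ij by auto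
      show ?thesis
      proof (rule hom_setI)
        fix f g assume "f :. (hom_space R M N)" "g :. (hom_space R M N)"
        then show "(\<lambda>f\<in>Hom R M N. \<alpha> j (f (b i))) (f +[hom_space R M N] g) =
            (\<lambda>f\<in>Hom R M N. \<alpha> j (f (b i))) f +[regular K] (\<lambda>f\<in>Hom R M N. \<alpha> j (f (b i))) g"
          using H.M.a_closed[of f g] i hom_closed[of _ R M N "b i"] hom_add[OF j] by simp
      next
        fix c f assume "c :. K" "f :. (hom_space R M N)"
        then show "(\<lambda>f\<in>Hom R M N. \<alpha> j (f (b i))) (c .[hom_space R M N] f) =
            c .[regular K] (\<lambda>f\<in>Hom R M N. \<alpha> j (f (b i))) f"
          using H.smult_closed[of c f] i hom_closed[of _ R M N "b i"] hom_smult[OF j, of c] by simp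
      qed (use i hom_closed[of _ R M N "b i"] hom_closed[OF j] in auto)
    qed
    then show "?L \<subseteq> Hom K (hom_space R M N) (regular K)" by auto
  next
    fix f assume "f :. (hom_space R M N)" and z: "ALL \<mu>:?L. \<mu> f = 0[K]"
    then have f: "f : Hom R M N" by simp
    have z': "\<alpha> j (f (b i)) = 0[K]" if "i < m" "j < n" for i j
    proof -
      have "(\<lambda>f\<in>Hom R M N. \<alpha> j (f (b i))) : ?L" using that by auto
      from bspec[OF z this] show ?thesis using f by simp
    qed
    have fb: "f (b i) = 0[N]" if "i < m" for i
    proof -
      have fbi: "f (b i) :. N" using f b(1)[OF that] hom_closed by metis
      have "(\<Oplus>\<^bsub>N\<^esub>j\<in>{..<n}. scal R N (\<alpha> j (f (b i))) (a j)) = (\<Oplus>\<^bsub>N\<^esub>j\<in>{..<n}. 0[N])"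
        using a(1) that Nv.smult_zero_left by (intro N.M.finsum_cong') (auto simp: z')
      then show ?thesis using a(3)[OF fbi] by simp
    qed
    have "f x = 0[N]" if x: "x :. M" for x
    proof -
      have bx: "\<beta> i x :. K" if "i < m" for i using hom_closed[OF b(2)[OF that], of x] x by simp
      have "f x = f (\<Oplus>\<^bsub>M\<^esub>i\<in>{..<m}. scal R M (\<beta> i x) (b i))" using b(3)[OF x] by simp
      also have "... = (\<Oplus>\<^bsub>N\<^esub>i\<in>{..<m}. f (scal R M (\<beta> i x) (b i)))"
        using b(1) bx Mv.smult_closed by (intro hom_finsum[OF f M.M_group N.M_group]) auto
      also have "... = (\<Oplus>\<^bsub>N\<^esub>i\<in>{..<m}. 0[N])"
        using b(1) bx Nv.smult_zero_right by (intro N.M.finsum_cong') (auto simp: hom_scal[OF K f] fb)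
      finally show ?thesis by simp
    qed
    then show "f = 0[hom_space R M N]"
      using hom_ext[OF f] by (intro carrier_eqI[of _ M]) auto
  qed
qed

subsection \<open>Duality\<close>

lemma left_module_regular_iff [simp]: "left_module (regular K) V \<longleftrightarrow> left_module K V"
  if "ring K"
proof -
  interpret ring K by fact
  have r: "ring (regular K)"
    by (rule ringI) (auto simp: abelian_group_axioms l_distr r_distr m_assoc intro!: monoidI)
  show ?thesis using r that by (simp add: left_module_def left_module_axioms_def)
qed

lemma dual_simps [simp]:
  "carrier (dual K R X) = functionals K R X"
  "0[dual K R X] = (\<lambda>x\<in>carrier X. 0[K])"
  "f +[dual K R X] g = (\<lambda>x\<in>carrier X. f x +[K] g x)"
  "a .[dual K R X] f = (\<lambda>x\<in>carrier X. f (a .[X] x))"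
  by (simp_all add: dual_def)

lemma functionalD:
  assumes "f : functionals K R X"
  shows "x :. X ==> f x :. K"
    "[|x :. X; y :. X|] ==> f (x +[X] y) = f x +[K] f y"
    "[|c :. K; x :. X|] ==> f (scal R X c x) = c *[K] f x"
    "f : extensional (carrier X)"
  using hom_closed[OF assms, of x] hom_add[OF assms, of x y] hom_smult[OF assms, of c x] hom_ext[OF assms]
  by auto

lemma functionalI:
  assumes "f : extensional (carrier X)" "!!x. x :. X ==> f x :. K"
    "!!x y. [|x :. X; y :. X|] ==> f (x +[X] y) = f x +[K] f y"
    "!!c x. [|c :. K; x :. X|] ==> f (scal R X c x) = c *[K] f x"
  shows "f : functionals K R X"
  by (rule hom_setI) (use assms in auto)

lemma functional_finsum:
  assumes K: "field K" and X: "abelian_group X" and f: "f : functionals K R X" and g: "g : S \<rightarrow> carrier X"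
  shows "f (\<Oplus>\<^bsub>X\<^esub>i\<in>S. g i) = (\<Oplus>\<^bsub>K\<^esub>i\<in>S. f (g i))"
proof -
  interpret field K by fact
  show ?thesis using hom_finsum[OF f, of g S] X abelian_group_axioms g by simp
qed

lemma functional_zero:
  assumes K: "field K" and X: "abelian_group X" and f: "f : functionals K R X"
  shows "f 0[X] = 0[K]"
proof -
  interpret field K by fact
  show ?thesis using hom_zero[OF f] X abelian_group_axioms by simp
qed

lemma rs_opp: "rs (opp R) X = rs R X"
  by simp

lemma scal_module_opp:
  assumes "fd_algebra K R" "left_module (opp R) X"
  shows "left_module K (rs R X)" "vspace K (rs R X)"
    "!!c x. [|c :. K; x :. X|] ==> scal R X c x :. X"
    "!!a c x. [|a :. R; c :. K; x :. X|] ==>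
      a .[X] scal R X c x = scal R X c (a .[X] x)"
    "!!a c x. [|a :. R; c :. K; x :. X|] ==>
      (c .[R] a) .[X] x = scal R X c (a .[X] x)"
  using scal_module[OF fd_algebra_opp[OF assms(1)] assms(2)]
    vspace_rs[OF fd_algebra_opp[OF assms(1)] assms(2)] by simp_all

lemma dual_module:
  assumes K: "fd_algebra K R" and X: "left_module (opp R) X"
  shows "left_module R (dual K R X)"
proof -
  interpret X: left_module "opp R" X by fact
  note Xc = X.smult_closed[simplified] X.smult_l_distr[simplified] X.smult_r_distr[simplified]
    X.smult_assoc1[simplified] X.smult_one[simplified]
  note sX = scal_module_opp[OF K X]
  interpret fK: field K using fd_algebraD(1)[OF K] .
  have ag: "abelian_group (dual K R X)"
    unfolding dual_def using hom_space_module(2)[OF fd_algebra_field[OF fd_algebraD(1)[OF K]], of "rs R X" "regular K"]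
      sX(1) left_module_regular[OF fK.ring_axioms] fK.ring_axioms by simp
  note fD = functionalD
  show ?thesis
  proof (rule left_moduleI[OF fd_algebraD(4)[OF K] ag])
    fix a f assume a: "a :. R" and "f :. (dual K R X)"
    then have f: "f : functionals K R X" by simp
    show "a .[dual K R X] f :. (dual K R X)"
      unfolding dual_simps
      by (rule functionalI) (simp_all add: a Xc X.M.a_closed fD[OF f] sX)
  next
    fix f assume "f :. (dual K R X)"
    then show "1[R] .[dual K R X] f = f"
      by (intro carrier_eqI[of _ X]) (auto simp: Xc functionalD(4))
  qed (use Xc X.M.a_closed in "auto intro!: restrict_ext simp: functionalD")
qed

lemma scal_dual:
  assumes K: "fd_algebra K R" and X: "left_module (opp R) X"
    and "f : functionals K R X" "c :. K"
  shows "scal R (dual K R X) c f = (\<lambda>x\<in>carrier X. c *[K] f x)"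
  using functionalD(3)[OF assms(3,4)] unfolding scal_def[of R "dual K R X"]
  by (auto simp: scal_def intro!: restrict_ext)

text \<open>Evaluations at a coordinate system \<open>b i\<close> of \<open>X\<close> separate
  functionals.\<close>

lemma fdm_dual:
  assumes K: "fd_algebra K R" and X: "fdm K (opp R) X"
  shows "fdm K R (dual K R X)"
proof -
  note lX = fdmD(1)[OF X]
  interpret X: left_module "opp R" X by (rule lX)
  interpret fK: field K using fd_algebraD(1)[OF K] .
  obtain m b \<beta> where b: "!!i. i < m ==> b i :. X" "!!i. i < m ==> \<beta> i : functionals K R X"
      "!!x. x :. X ==> (\<Oplus>\<^bsub>X\<^esub>i\<in>{..<m::nat}. scal R X (\<beta> i x) (b i)) = x"
    using fdm_coordinates[OF fd_algebra_opp[OF K] X, unfolded scal_opp] by blast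
  note lD = dual_module[OF K lX]
  interpret D: left_module R "dual K R X" by (rule lD)
  interpret V: vspace K "rs R (dual K R X)" by (rule vspace_rs[OF K lD])
  let ?L = "(%i. \<lambda>f\<in>carrier (dual K R X). f (b i)) ` {..<m}"
  have "fin_gen K (rs R (dual K R X))"
  proof (rule V.fin_gen_if_separated[of ?L])
    have "(\<lambda>f\<in>carrier (dual K R X). f (b i)) : functionals K R (dual K R X)" if "i < m" for i
    proof (rule functionalI)
      fix f g assume "f :. (dual K R X)" "g :. (dual K R X)"
      then show "(\<lambda>f\<in>carrier (dual K R X). f (b i)) (f +[dual K R X] g) =
          (\<lambda>f\<in>carrier (dual K R X). f (b i)) f +[K] (\<lambda>f\<in>carrier (dual K R X). f (b i)) g"
        using D.M.a_closed[of f g] b(1)[OF that] by simp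
    next
      fix c f assume "c :. K" "f :. (dual K R X)"
      then show "(\<lambda>f\<in>carrier (dual K R X). f (b i)) (scal R (dual K R X) c f) =
          c *[K] (\<lambda>f\<in>carrier (dual K R X). f (b i)) f"
        using scal_module(2)[OF K lD, of c f] b(1)[OF that] scal_dual[OF K lX, of f c] by simp
    qed (use b(1)[OF that] functionalD(1) in auto)
    then show "?L \<subseteq> functionals K R (dual K R X)" by auto
  next
    fix f assume "f :. (rs R (dual K R X))" and z: "ALL \<mu>:?L. \<mu> f = 0[K]"
    then have f: "f : functionals K R X" by simp
    have fb: "f (b i) = 0[K]" if "i < m" for i
    proof -
      have "(\<lambda>f\<in>carrier (dual K R X). f (b i)) : ?L" using that by auto
      from bspec[OF z this] show ?thesis using f by simp
    qed
    have "f x = 0[K]" if x: "x :. X" for x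
    proof -
      have bx: "\<beta> i x :. K" if "i < m" for i using functionalD(1)[OF b(2)[OF that] x] .
      have sb: "scal R X (\<beta> i x) (b i) :. X" if "i < m" for i
        using scal_module_opp(3)[OF K lX bx[OF that] b(1)[OF that]] .
      have "f x = f (\<Oplus>\<^bsub>X\<^esub>i\<in>{..<m}. scal R X (\<beta> i x) (b i))" using b(3)[OF x] by simp
      also have "... = (\<Oplus>\<^bsub>K\<^esub>i\<in>{..<m}. f (scal R X (\<beta> i x) (b i)))"
        using sb by (intro functional_finsum[OF fd_algebraD(1)[OF K] X.M_group f]) auto
      also have "... = (\<Oplus>\<^bsub>K\<^esub>i\<in>{..<m}. 0[K])"
        by (intro fK.finsum_cong') (auto simp: functionalD(3)[OF f] bx b(1) fb)
      finally show ?thesis by simp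
    qed
    then show "f = 0[rs R (dual K R X)]"
      using functionalD(4)[OF f] by (intro carrier_eqI[of _ X]) auto
  qed simp
  then show ?thesis using lD by (simp add: fdm_def)
qed

lemma dual_eqI:
  assumes K: "fd_algebra K R" and X: "fdm K (opp R) X" and x: "x :. X" "y :. X"
    and eq: "!!f. f : functionals K R X ==> f x = f y"
  shows "x = y"
proof -
  note lX = fdmD(1)[OF X]
  interpret X: left_module "opp R" X by (rule lX)
  interpret fK: field K using fd_algebraD(1)[OF K] .
  interpret V: vspace K "rs R X" by (rule scal_module_opp(2)[OF K lX])
  have "x -[X] y = 0[rs R X]"
  proof (rule V.functional_separate)
    show "fin_gen K (rs R X)" using fdmD(2)[OF X] by simp
    fix f assume f: "f : functionals K R X"
    have "f (x -[rs R X] y) = f x -[regular K] f y"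
      using hom_diff[OF f] X.M_group fK.abelian_group_axioms x by simp
    then show "f (x -[X] y) = 0[K]" using eq[OF f] functionalD(1)[OF f x(2)]
      by (simp add: a_minus_def fK.r_neg)
  qed (use x in simp)
  then have "x -[X] y = 0[X]" by simp
  then have "(x -[X] y) +[X] y = y" using x by simp
  then show ?thesis using x by (simp add: a_minus_def X.M.a_assoc X.M.l_neg)
qed

text \<open>The vector with coordinates \<open>\<Phi> (\<beta> i)\<close> represents
  \<open>\<Phi>\<close>, because every functional \<open>f\<close> is the sum of the
  \<open>f (b i)\<close>-multiples of the \<open>\<beta> i\<close>.\<close>

lemma dual_reflexive:
  assumes K: "fd_algebra K R" and X: "fdm K (opp R) X"
    and P: "\<Phi> : functionals K R (dual K R X)"
  shows "EX y:carrier X. ALL f:functionals K R X. \<Phi> f = f y"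
proof -
  note lX = fdmD(1)[OF X]
  interpret X: left_module "opp R" X by (rule lX)
  interpret fK: field K using fd_algebraD(1)[OF K] .
  obtain m b \<beta> where b: "!!i. i < m ==> b i :. X" "!!i. i < m ==> \<beta> i : functionals K R X"
      "!!x. x :. X ==> (\<Oplus>\<^bsub>X\<^esub>i\<in>{..<m::nat}. scal R X (\<beta> i x) (b i)) = x"
    using fdm_coordinates[OF fd_algebra_opp[OF K] X, unfolded scal_opp] by blast
  note lD = dual_module[OF K lX]
  interpret D: left_module R "dual K R X" by (rule lD)
  have Pb: "\<Phi> (\<beta> i) :. K" if "i < m" for i
    using functionalD(1)[OF P, of "\<beta> i"] b(2)[OF that] by simp
  have sb: "scal R X (\<Phi> (\<beta> i)) (b i) :. X" if "i < m" for i
    using scal_module_opp(3)[OF K lX Pb[OF that] b(1)[OF that]] .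
  let ?y = "\<Oplus>\<^bsub>X\<^esub>i\<in>{..<m}. scal R X (\<Phi> (\<beta> i)) (b i)"
  have "\<Phi> f = f ?y" if f: "f : functionals K R X" for f
  proof -
    have fb: "f (b i) :. K" if "i < m" for i using functionalD(1)[OF f b(1)[OF that]] .
    let ?g = "%i. scal R (dual K R X) (f (b i)) (\<beta> i)"
    have g: "?g i :. (dual K R X)" if "i < m" for i
      using scal_module(2)[OF K lD fb[OF that], of "\<beta> i"] b(2)[OF that] by simp
    have gx: "?g i x = f (b i) *[K] \<beta> i x" if "i < m" "x :. X" for i x
      using scal_dual[OF K lX b(2) fb, of i i] that by simp
    have agH: "abelian_group (hom_space (regular K) (rs R X) (regular K))"
      using D.M_group by (simp add: dual_def)
    have "f x = finsum (dual K R X) ?g {..<m} x" if x: "x :. X" for x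
    proof -
      have bx: "\<beta> i x :. K" if "i < m" for i using functionalD(1)[OF b(2)[OF that] x] .
      have sbx: "scal R X (\<beta> i x) (b i) :. X" if "i < m" for i
        using scal_module_opp(3)[OF K lX bx[OF that] b(1)[OF that]] .
      have "f x = f (\<Oplus>\<^bsub>X\<^esub>i\<in>{..<m}. scal R X (\<beta> i x) (b i))" using b(3)[OF x] by simp
      also have "... = (\<Oplus>\<^bsub>K\<^esub>i\<in>{..<m}. f (scal R X (\<beta> i x) (b i)))"
        using sbx by (intro functional_finsum[OF fd_algebraD(1)[OF K] X.M_group f]) auto
      also have "... = (\<Oplus>\<^bsub>K\<^esub>i\<in>{..<m}. ?g i x)"
        by (intro fK.finsum_cong') (auto simp: functionalD(3)[OF f] bx b(1) gx x fK.m_comm fb)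
      also have "... = finsum (hom_space (regular K) (rs R X) (regular K)) ?g {..<m} x"
        using hom_space_finsum[OF agH, of x "{..<m}" ?g] fK.abelian_group_axioms x g by simp
      finally show ?thesis by (simp add: dual_def)
    qed
    moreover have "finsum (dual K R X) ?g {..<m} :. (dual K R X)"
      using g by (intro D.M.finsum_closed) auto
    ultimately have "f = finsum (dual K R X) ?g {..<m}"
      using functionalD(4)[OF f] by (intro carrier_eqI[of _ X]) (auto simp: functionalD(4))
    then have "\<Phi> f = (\<Oplus>\<^bsub>K\<^esub>i\<in>{..<m}. \<Phi> (?g i))"
      using functional_finsum[OF fd_algebraD(1)[OF K] D.M_group P, of ?g "{..<m}"] g by auto
    also have "... = (\<Oplus>\<^bsub>K\<^esub>i\<in>{..<m}. f (scal R X (\<Phi> (\<beta> i)) (b i)))"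
      using functionalD(3)[OF P fb, of _ "\<beta> _"] b(2)
      by (intro fK.finsum_cong') (auto simp: functionalD(3)[OF f Pb b(1)] Pb fb fK.m_comm)
    also have "... = f ?y"
      using functional_finsum[OF fd_algebraD(1)[OF K] X.M_group f, of "%i. scal R X (\<Phi> (\<beta> i)) (b i)" "{..<m}"] sb
      by auto
    finally show ?thesis .
  qed
  moreover have "?y :. X" using sb by (intro X.M.finsum_closed) auto
  ultimately show ?thesis by blast
qed

subsection \<open>Isomorphisms, images and submodules\<close>

text \<open>The inverse is kept explicitly, since later constructions conjugate by it.\<close>

definition isos :: "('r, 'z) ring_scheme => ('r, 'm) module => ('r, 'n) module => ('m => 'n) => ('n => 'm) => bool" where
  "isos R M N f g \<longleftrightarrow> f : Hom R M N & g : Hom R N M &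
     (ALL x:carrier M. g (f x) = x) & (ALL y:carrier N. f (g y) = y)"

lemma isosD:
  assumes "isos R M N f g"
  shows "f : Hom R M N" "g : Hom R N M" "x :. M ==> g (f x) = x" "y :. N ==> f (g y) = y"
    "x :. M ==> f x :. N" "y :. N ==> g y :. M"
  using assms by (auto simp: isos_def intro: hom_closed)

lemma isos_sym: "isos R M N f g ==> isos R N M g f"
  by (auto simp: isos_def)

lemma isos_mod_iso:
  assumes "isos R M N f g"
  shows "mod_iso R M N"
proof -
  note i = isosD[OF assms]
  have "bij_betw f (carrier M) (carrier N)"
    by (rule bij_betwI[where g = g]) (use i(3-6) in auto)
  then show ?thesis unfolding mod_iso_def using i(1) by blast
qed

text \<open>Nothing is assumed about \<open>N\<close>: its operations are the images of those of
  \<open>M\<close>, which gives the closure properties that the inverse needs.\<close>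

lemma isosI_bij:
  assumes M: "left_module R M" and f: "f : Hom R M N" "bij_betw f (carrier M) (carrier N)"
    shows "isos R M N f (restrict (inv_into (carrier M) f) (carrier N))"
proof -
  interpret M: left_module R M by fact
  let ?g = "inv_into (carrier M) f"
  have g: "?g y :. M" "f (?g y) = y" if "y :. N" for y
    using f(2) that by (auto simp: bij_betw_def inv_into_into f_inv_into_f)
  have gf: "?g (f x) = x" if "x :. M" for x
    using f(2) that by (auto simp: bij_betw_def)
  have cl: "x +[N] y :. N" if "x :. N" "y :. N" for x y
    using hom_closed[OF f(1), of "?g x +[M] ?g y"] hom_add[OF f(1)] g that by simp
  have cl2: "r .[N] y :. N" if "r :. R" "y :. N" for r y
    using hom_closed[OF f(1), of "r .[M] ?g y"] hom_smult[OF f(1)] g that by (simp add: M.smult_closed)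
  have "restrict ?g (carrier N) : Hom R N M"
  proof (rule hom_setI)
    fix x y assume xy: "x :. N" "y :. N"
    have "?g (x +[N] y) = ?g (f (?g x +[M] ?g y))" using hom_add[OF f(1)] g xy by simp
    then show "restrict ?g (carrier N) (x +[N] y) = restrict ?g (carrier N) x +[M] restrict ?g (carrier N) y"
      using gf g xy cl by simp
  next
    fix r y assume ry: "r :. R" "y :. N"
    have "?g (r .[N] y) = ?g (f (r .[M] ?g y))" using hom_smult[OF f(1)] g ry by simp
    then show "restrict ?g (carrier N) (r .[N] y) = r .[M] restrict ?g (carrier N) y"
      using gf g ry cl2 by (simp add: M.smult_closed)
  qed (use g in auto)
  then show ?thesis using f(1) g gf by (auto simp: isos_def hom_closed)
qed

lemma mod_iso_isos: "left_module R M ==> mod_iso R M N ==> EX f g. isos R M N f g"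
  unfolding mod_iso_def using isosI_bij by blast

lemma fdm_image:
  assumes K: "fd_algebra K R" and M: "fdm K R M" and N: "left_module R N"
    and f: "f : Hom R M N" "carrier N \<subseteq> f ` carrier M"
  shows "fdm K R N"
  unfolding fdm_def
proof (intro conjI N)
  show "fin_gen K (rs R N)"
    by (rule fin_gen_image[where M = "rs R M" and f = f])
      (use fdmD[OF M] scal_module(1)[OF K] N hom_scal(1)[OF K f(1)] f in auto)
qed

text \<open>Composing the \<open>f i\<close> with coordinate functionals of \<open>N\<close> gives a
  finite separating family on \<open>M\<close>. Submodules and direct sums are the intended
  uses.\<close>

lemma fdm_jointly_inj:
  assumes K: "fd_algebra K R" and M: "left_module R M" and N: "fdm K R N" and I: "finite I"
    and f: "!!i. i : I ==> f i : Hom R M N"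
    and inj: "!!x. [|x :. M; ALL i:I. f i x = 0[N]|] ==> x = 0[M]"
  shows "fdm K R M"
proof -
  interpret V: vspace K "rs R M" by (rule vspace_rs[OF K M])
  interpret N: left_module R N by (rule fdmD(1)[OF N])
  interpret Nv: left_module K "rs R N" by (rule scal_module(1)[OF K fdmD(1)[OF N]])
  obtain m b \<beta> where b: "!!i. i < m ==> b i :. N" "!!i. i < m ==> \<beta> i : functionals K R N"
      "!!x. x :. N ==> (\<Oplus>\<^bsub>N\<^esub>i\<in>{..<m::nat}. scal R N (\<beta> i x) (b i)) = x"
    using fdm_coordinates[OF K N] by blast
  let ?L = "(%(i, j). compose (carrier M) (\<beta> j) (f i)) ` (I \<times> {..<m})"
  have "fin_gen K (rs R M)"
  proof (rule V.fin_gen_if_separated[of ?L])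
    show "finite ?L" using I by simp
    have "compose (carrier M) (\<beta> j) (f i) : functionals K R M" if "i : I" "j < m" for i j
      using hom_compose[OF scal_module(1)[OF K M] hom_scal(1)[OF K f[OF that(1)]] b(2)[OF that(2)]] by simp
    then show "?L \<subseteq> functionals K R M" by auto
    fix x assume "x :. (rs R M)" and z: "ALL \<mu>:?L. \<mu> x = 0[K]"
    then have x: "x :. M" by simp
    have z': "\<beta> j (f i x) = 0[K]" if "i : I" "j < m" for i j
    proof -
      have "compose (carrier M) (\<beta> j) (f i) : ?L" using that by auto
      from bspec[OF z this] show ?thesis using x by (simp add: compose_eq)
    qed
    have "f i x = 0[N]" if i: "i : I" for i
    proof -
      have "(\<Oplus>\<^bsub>N\<^esub>j\<in>{..<m}. scal R N (\<beta> j (f i x)) (b j)) = (\<Oplus>\<^bsub>N\<^esub>j\<in>{..<m}. 0[N])"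
        using Nv.smult_zero_left b(1) by (intro N.M.finsum_cong') (auto simp: z' i)
      then show ?thesis using b(3)[OF hom_closed[OF f[OF i] x]] by simp
    qed
    then show "x = 0[rs R M]" using inj[OF x] by simp
  qed
  then show ?thesis using M by (simp add: fdm_def)
qed

lemma fdm_submod:
  assumes K: "fd_algebra K R" and M: "fdm K R M" and U: "submod R M U"
  shows "fdm K R (M\<lparr>carrier := U\<rparr>)"
proof -
  interpret M: left_module R M by (rule fdmD(1)[OF M])
  have "(\<lambda>x\<in>U. x) : Hom R (M\<lparr>carrier := U\<rparr>) M"
    using U by (intro hom_setI) (auto simp: submod_def)
  then show ?thesis
    by (intro fdm_jointly_inj[OF K M.left_module_submod[OF U] M, of "{()}" "%_. \<lambda>x\<in>U. x"]) auto
qed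

lemma fdm_iso:
  assumes "fd_algebra K R" "fdm K R M" "left_module R N" "isos R M N f g"
  shows "fdm K R N"
proof -
  note i = isosD[OF assms(4)]
  have "carrier N \<subseteq> f ` carrier M"
  proof
    fix y assume "y :. N"
    then show "y : f ` carrier M" using i(4,6) by (intro image_eqI[of _ _ "g y"]) auto
  qed
  then show ?thesis by (rule fdm_image[OF assms(1-3) i(1)])
qed

definition transport :: "('m => 'n) => ('r, 'm) module => ('r, 'n) module" where
  "transport f M = (let g = inv_into (carrier M) f in
    \<lparr>carrier = f ` carrier M, monoid.mult = undefined, one = undefined,
     ring.zero = f 0[M], ring.add = (%x y. f (g x +[M] g y)), smult = (%r x. f (r .[M] g x))\<rparr>)"

lemma transport:
  assumes M: "left_module R M" and inj: "inj_on f (carrier M)"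
  shows "left_module R (transport f M)"
    "isos R M (transport f M) (restrict f (carrier M)) (restrict (inv_into (carrier M) f) (f ` carrier M))"
proof -
  interpret M: left_module R M by fact
  let ?g = "inv_into (carrier M) f"
  have g: "?g (f x) = x" if "x :. M" for x using inj that by simp
  have neg: "EX y:carrier M. f (y +[M] x) = f 0[M]" if "x :. M" for x
    using that by (intro bexI[of _ "-[M] x"]) (auto simp: M.M.l_neg)
  have neg': "EX y:carrier M. f (x +[M] y) = f 0[M]" if "x :. M" for x
    using that by (intro bexI[of _ "-[M] x"]) (auto simp: M.M.r_neg)
  have comm: "f (x +[M] y) = f (y +[M] x)" if "x :. M" "y :. M" for x y
    using that by (simp add: M.M.a_comm)
  show "left_module R (transport f M)"
    by (intro left_moduleI abelian_groupI M.R.ring_axioms)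
      (auto simp: transport_def Let_def g M.smult_closed M.smult_l_distr M.smult_r_distr M.smult_assoc1
        M.smult_one M.M.a_assoc neg neg' comm)
  show "isos R M (transport f M) (restrict f (carrier M)) (restrict ?g (f ` carrier M))"
    unfolding isos_def
    by (auto simp: transport_def Let_def g M.smult_closed inj_on_eq_iff[OF inj] intro!: hom_setI)
qed

text \<open>Coordinates with respect to the \<open>b i\<close> embed \<open>M\<close> into the lists
  of length \<open>m\<close>. This connects arbitrary carriers with the definitions that quantify
  over list carriers only.\<close>

lemma list_copy:
  fixes K :: "'k ring" and M :: "('r, 'm) module"
  assumes K: "fd_algebra K R" and M: "fdm K R M"
  shows "EX (L :: ('r, 'k list) module) f g. isos R M L f g & fdm K R L"
proof -
  interpret M: left_module R M by (rule fdmD(1)[OF M])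
  obtain m b \<beta> where b: "!!i. i < m ==> b i :. M" "!!i. i < m ==> \<beta> i : functionals K R M"
      "!!x. x :. M ==> (\<Oplus>\<^bsub>M\<^esub>i\<in>{..<m::nat}. scal R M (\<beta> i x) (b i)) = x"
    using fdm_coordinates[OF K M] by blast
  let ?f = "%x. map (%i. \<beta> i x) [0..<m]"
  have "inj_on ?f (carrier M)"
  proof (rule inj_onI)
    fix x y assume x: "x :. M" "y :. M" and "?f x = ?f y"
    then have e: "\<beta> i x = \<beta> i y" if "i < m" for i using that by auto
    have "(\<Oplus>\<^bsub>M\<^esub>i\<in>{..<m}. scal R M (\<beta> i x) (b i)) = (\<Oplus>\<^bsub>M\<^esub>i\<in>{..<m}. scal R M (\<beta> i y) (b i))"
      by (intro M.M.finsum_cong')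
        (auto simp: e intro!: scal_module(2)[OF K fdmD(1)[OF M]] functionalD(1)[OF b(2)] b(1) x)
    then show "x = y" using b(3)[OF x(1)] b(3)[OF x(2)] by simp
  qed
  from transport[OF fdmD(1)[OF M] this] fdm_iso[OF K M] show ?thesis by blast
qed

subsection \<open>Direct sums and summands\<close>

lemma dsum_simps [simp]:
  "carrier (dsum n N) = (\<Pi>\<^sub>E i\<in>{..<n}. carrier (N i))"
  "0[dsum n N] = (\<lambda>i\<in>{..<n}. 0[N i])"
  "x +[dsum n N] y = (\<lambda>i\<in>{..<n}. x i +[N i] y i)"
  "r .[dsum n N] x = (\<lambda>i\<in>{..<n}. r .[N i] x i)"
  by (simp_all add: dsum_def)

lemma prod_module_simps [simp]:
  "carrier (prod_module M N) = carrier M \<times> carrier N"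
  "0[prod_module M N] = (0[M], 0[N])"
  "x +[prod_module M N] y = (fst x +[M] fst y, snd x +[N] snd y)"
  "r .[prod_module M N] x = (r .[M] fst x, r .[N] snd x)"
  by (simp_all add: prod_module_def)

lemma left_module_dsum:
  assumes R: "ring R" and N: "!!i. i < n ==> left_module R (N i)"
  shows "left_module R (dsum n N)"
proof -
  have ag: "abelian_group (N i)" if "i < n" for i using N[OF that] by (simp add: left_module_def)
  note c = abelian_groupE[OF ag] left_module.smult_closed[OF N] left_module.smult_l_distr[OF N]
    left_module.smult_r_distr[OF N] left_module.smult_assoc1[OF N] left_module.smult_one[OF N]
  show ?thesis
  proof (intro left_moduleI abelian_groupI R)
    fix x assume x: "x :. (dsum n N)"
    have "ALL i. EX y. i < n --> y :. (N i) & y +[N i] x i = 0[N i]"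
      using x c(6)[of _ "x _"] by (metis PiE_mem dsum_simps(1) lessThan_iff)
    then obtain y where "!!i. i < n ==> y i :. (N i) & y i +[N i] x i = 0[N i]" by metis
    then show "EX y:carrier (dsum n N). y +[dsum n N] x = 0[dsum n N]"
      by (intro bexI[of _ "restrict y {..<n}"] extensionalityI[of _ "{..<n}"]) auto
  next
    fix x y assume "x :. (dsum n N)" "y :. (dsum n N)"
    then show "x +[dsum n N] y = y +[dsum n N] x" by (intro extensionalityI[of _ "{..<n}"]) (auto simp: PiE_iff c(4))
  next
    fix x y z assume "x :. (dsum n N)" "y :. (dsum n N)" "z :. (dsum n N)"
    then show "x +[dsum n N] y +[dsum n N] z = x +[dsum n N] (y +[dsum n N] z)"
      by (intro extensionalityI[of _ "{..<n}"]) (auto simp: PiE_iff c(3))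
  next
    fix x assume "x :. (dsum n N)"
    then show "0[dsum n N] +[dsum n N] x = x" "1[R] .[dsum n N] x = x"
      by (intro extensionalityI[of _ "{..<n}"]; simp add: PiE_iff c(5) c(11))+
  next
    fix a b x assume "a :. R" "b :. R" "x :. (dsum n N)"
    then show "(a +[R] b) .[dsum n N] x = a .[dsum n N] x +[dsum n N] b .[dsum n N] x"
      "a *[R] b .[dsum n N] x = a .[dsum n N] (b .[dsum n N] x)"
      by (intro extensionalityI[of _ "{..<n}"]; simp add: PiE_iff c(8) c(10))+
  next
    fix a x y assume "a :. R" "x :. (dsum n N)" "y :. (dsum n N)"
    then show "a .[dsum n N] (x +[dsum n N] y) = a .[dsum n N] x +[dsum n N] a .[dsum n N] y"
      by (intro extensionalityI[of _ "{..<n}"]) (auto simp: PiE_iff c(9))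
  qed (simp_all add: PiE_iff c(1,2,7))
qed

definition dpr :: "nat => (nat => ('r, 'm) module) => nat => (nat => 'm) => 'm" where
  "dpr n N i = (\<lambda>x\<in>carrier (dsum n N). x i)"

definition dinc :: "nat => (nat => ('r, 'm) module) => nat => 'm => nat => 'm" where
  "dinc n N i = (\<lambda>y\<in>carrier (N i). \<lambda>j\<in>{..<n}. if j = i then y else 0[N j])"

lemma dpr_hom:
  assumes "ring R" "!!i. i < n ==> left_module R (N i)" "i < n"
  shows "dpr n N i : Hom R (dsum n N) (N i)"
proof -
  interpret D: left_module R "dsum n N" by (rule left_module_dsum) fact+
  show ?thesis unfolding dpr_def
  proof (rule hom_setI)
    fix x y assume "x :. (dsum n N)" "y :. (dsum n N)"
    then show "(\<lambda>x\<in>carrier (dsum n N). x i) (x +[dsum n N] y) =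
      (\<lambda>x\<in>carrier (dsum n N). x i) x +[N i] (\<lambda>x\<in>carrier (dsum n N). x i) y"
      using D.M.a_closed[of x y] assms(3) by simp
  next
    fix r x assume "r :. R" "x :. (dsum n N)"
    then show "(\<lambda>x\<in>carrier (dsum n N). x i) (r .[dsum n N] x) = r .[N i] (\<lambda>x\<in>carrier (dsum n N). x i) x"
      using D.smult_closed[of r x] assms(3) by simp
  qed (use assms(3) in auto)
qed

lemma dinc_hom:
  assumes "ring R" "!!i. i < n ==> left_module R (N i)" "i < n"
  shows "dinc n N i : Hom R (N i) (dsum n N)"
proof -
  interpret Ni: left_module R "N i" using assms by simp
  have ag: "abelian_group (N j)" if "j < n" for j using assms(2)[OF that] by (simp add: left_module_def)
  show ?thesis unfolding dinc_def
    by (rule hom_setI)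
      (auto simp: Ni.smult_closed abelian_groupE(2,5)[OF ag] left_module.smult_zero_right[OF assms(2)]
        intro!: restrict_ext)
qed

lemma dsum_expand:
  assumes R: "ring R" and N: "!!i. i < n ==> left_module R (N i)" and x: "x :. (dsum n N)"
  shows "(\<Oplus>\<^bsub>dsum n N\<^esub>i\<in>{..<n}. dinc n N i (x i)) = x"
proof -
  interpret D: left_module R "dsum n N" by (rule left_module_dsum[OF R N])
  have xi: "x i :. (N i)" if "i < n" for i using x that by auto
  have cl: "dinc n N i (x i) :. (dsum n N)" if "i < n" for i
    using dinc_hom[of R n N i] R N that xi hom_closed by metis
  have fcl: "(\<Oplus>\<^bsub>dsum n N\<^esub>i\<in>{..<n}. dinc n N i (x i)) :. (dsum n N)" (is "?s : _")
    using cl by (intro D.M.finsum_closed) auto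
  have "?s j = x j" if j: "j < n" for j
  proof -
    interpret Nj: left_module R "N j" by (rule N[OF j])
    have dpr_j: "dpr n N j : Hom R (dsum n N) (N j)" using dpr_hom[of R n N j] R N j by blast
    have "?s j = dpr n N j ?s" using fcl by (simp add: dpr_def)
    also have "... = (\<Oplus>\<^bsub>N j\<^esub>i\<in>{..<n}. dpr n N j (dinc n N i (x i)))"
      using cl by (intro hom_finsum[OF dpr_j D.M_group Nj.M_group]) auto
    also have "... = (\<Oplus>\<^bsub>N j\<^esub>i\<in>{..<n}. if j = i then x i else 0[N j])"
    proof (rule Nj.M.finsum_cong')
      fix i assume "i : {..<n}"
      then show "dpr n N j (dinc n N i (x i)) = (if j = i then x i else 0[N j])"
        using cl[of i] xi[of i] j by (simp add: dpr_def) (simp add: dinc_def)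
    qed (use xi j in auto)
    also have "... = x j"
    proof -
      have "(\<Oplus>\<^bsub>N j\<^esub>i\<in>{..<n}. if j = i then x i else 0[N j]) = (\<Oplus>\<^bsub>N j\<^esub>i\<in>{..<n}. if j = i then x j else 0[N j])"
        using xi j by (intro Nj.M.finsum_cong') auto
      also have "... = x j" using Nj.M.finsum_singleton[of j "{..<n}" "%_. x j"] xi j by simp
      finally show ?thesis .
    qed
    finally show ?thesis .
  qed
  then show ?thesis using fcl x by (intro extensionalityI[of _ "{..<n}"]) (auto simp: PiE_def)
qed

lemma hom_into_dsum:
  assumes "left_module R X" "!!l. l < n ==> a l : Hom R X (N l)"
  shows "(\<lambda>x\<in>carrier X. \<lambda>l\<in>{..<n}. a l x) : Hom R X (dsum n N)"
proof -
  interpret X: left_module R X by fact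
  show ?thesis
    by (rule hom_setI)
      (auto simp: X.smult_closed hom_closed[OF assms(2)] hom_add[OF assms(2)] hom_smult[OF assms(2)]
        intro!: restrict_ext)
qed

lemma hom_from_dsum:
  assumes R: "ring R" and N: "!!i. i < n ==> left_module R (N i)" and Y: "left_module R Y"
    and b: "!!l. l < n ==> b l : Hom R (N l) Y"
  shows "(\<lambda>x\<in>carrier (dsum n N). \<Oplus>\<^bsub>Y\<^esub>l\<in>{..<n}. b l (x l)) : Hom R (dsum n N) Y"
proof -
  interpret D: left_module R "dsum n N" by (rule left_module_dsum[OF R N])
  interpret Y: left_module R Y by fact
  have cl: "(%l. b l (x l)) : {..<n} \<rightarrow> carrier Y" if "x :. (dsum n N)" for x
    using that hom_closed[OF b] by auto
  show ?thesis
  proof (rule hom_setI)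
    fix x y assume xy: "x :. (dsum n N)" "y :. (dsum n N)"
    have "(\<Oplus>\<^bsub>Y\<^esub>l\<in>{..<n}. b l ((x +[dsum n N] y) l)) = (\<Oplus>\<^bsub>Y\<^esub>l\<in>{..<n}. b l (x l) +[Y] b l (y l))"
      using cl[OF xy(1)] cl[OF xy(2)] xy by (intro Y.M.finsum_cong') (auto simp: hom_add[OF b] Pi_iff PiE_iff)
    also have "... = (\<Oplus>\<^bsub>Y\<^esub>l\<in>{..<n}. b l (x l)) +[Y] (\<Oplus>\<^bsub>Y\<^esub>l\<in>{..<n}. b l (y l))"
      by (rule Y.M.finsum_addf[OF cl[OF xy(1)] cl[OF xy(2)]])
    finally show "(\<lambda>x\<in>carrier (dsum n N). \<Oplus>\<^bsub>Y\<^esub>l\<in>{..<n}. b l (x l)) (x +[dsum n N] y) =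
        (\<lambda>x\<in>carrier (dsum n N). \<Oplus>\<^bsub>Y\<^esub>l\<in>{..<n}. b l (x l)) x +[Y]
        (\<lambda>x\<in>carrier (dsum n N). \<Oplus>\<^bsub>Y\<^esub>l\<in>{..<n}. b l (x l)) y"
      using D.M.a_closed[OF xy] xy by simp
  next
    fix r x assume rx: "r :. R" "x :. (dsum n N)"
    have "(\<Oplus>\<^bsub>Y\<^esub>l\<in>{..<n}. b l ((r .[dsum n N] x) l)) = (\<Oplus>\<^bsub>Y\<^esub>l\<in>{..<n}. r .[Y] b l (x l))"
      using cl[OF rx(2)] rx by (intro Y.M.finsum_cong') (auto simp: hom_smult[OF b] Pi_iff PiE_iff Y.smult_closed)
    also have "... = r .[Y] (\<Oplus>\<^bsub>Y\<^esub>l\<in>{..<n}. b l (x l))"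
      using Y.smult_finsum[OF rx(1) cl[OF rx(2)]] by simp
    finally show "(\<lambda>x\<in>carrier (dsum n N). \<Oplus>\<^bsub>Y\<^esub>l\<in>{..<n}. b l (x l)) (r .[dsum n N] x) =
        r .[Y] (\<lambda>x\<in>carrier (dsum n N). \<Oplus>\<^bsub>Y\<^esub>l\<in>{..<n}. b l (x l)) x"
      using D.smult_closed[OF rx] rx by simp
  qed (use cl Y.M.finsum_closed in auto)
qed

lemma fdm_dsum:
  assumes K: "fd_algebra K R" and W: "fdm K R W"
  shows "fdm K R (dsum n (%_. W))"
proof (rule fdm_jointly_inj[OF K _ W, of _ "{..<n}" "dpr n (%_. W)"])
  note lW = fdmD(1)[OF W]
  show "left_module R (dsum n (%_. W))" by (rule left_module_dsum[OF fd_algebraD(4)[OF K] lW])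
  show "dpr n (%_. W) i : Hom R (dsum n (%_. W)) W" if "i : {..<n}" for i
    using dpr_hom[OF fd_algebraD(4)[OF K] lW, of i n] that by simp
  fix x assume x: "x :. (dsum n (%_. W))" and "ALL i:{..<n}. dpr n (%_. W) i x = 0[W]"
  then show "x = 0[dsum n (%_. W)]"
    by (intro extensionalityI[of _ "{..<n}"]) (auto simp: dpr_def PiE_def)
qed simp

lemma left_module_prod:
  assumes M: "left_module R M" and N: "left_module R N"
  shows "left_module R (prod_module M N)"
proof -
  interpret M: left_module R M by fact
  interpret N: left_module R N by fact
  show ?thesis
  proof (intro left_moduleI abelian_groupI M.R.ring_axioms)
    fix x assume "x :. (prod_module M N)"
    then show "EX y:carrier (prod_module M N). y +[prod_module M N] x = 0[prod_module M N]"
      by (intro bexI[of _ "(-[M] fst x, -[N] snd x)"]) (auto simp: M.M.l_neg N.M.l_neg)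
  qed (auto simp: M.M.a_assoc N.M.a_assoc M.smult_closed N.smult_closed M.smult_l_distr N.smult_l_distr
      M.smult_r_distr N.smult_r_distr M.smult_assoc1 N.smult_assoc1 M.smult_one N.smult_one
      intro: M.M.a_comm N.M.a_comm)
qed

text \<open>\<open>N\<close> enters only through the isomorphism, so its closure properties are read
  off from the direct sum.\<close>

lemma summandE:
  fixes A :: "('k, 'a) module"
  assumes s: "summand A M N" and M: "left_module A M"
  shows "EX \<alpha> \<beta>. \<alpha> : Hom A M N & \<beta> : Hom A N M & (ALL x:carrier M. \<beta> (\<alpha> x) = x)"
proof -
  obtain L :: "('a, 'k list) module" where L: "fg_module A L" and iso: "mod_iso A (prod_module M L) N"
    using s unfolding summand_def by blast
  have lL: "left_module A L" using L by (simp add: fg_module_def)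
  interpret M: left_module A M by fact
  interpret L: left_module A L by (rule lL)
  note lP = left_module_prod[OF M lL]
  obtain f g where fg: "isos A (prod_module M L) N f g" using mod_iso_isos[OF lP iso] by blast
  note i = isosD[OF fg]
  have 1: "(\<lambda>x\<in>carrier M. (x, 0[L])) : Hom A M (prod_module M L)"
    by (rule hom_setI) (auto simp: M.smult_closed L.smult_zero_right)
  have 2: "(\<lambda>x\<in>carrier (prod_module M L). fst x) : Hom A (prod_module M L) M"
    by (rule hom_setI) (auto simp: M.smult_closed L.smult_closed)
  have N: "x +[N] y :. N" "r .[N] x :. N"
    if "x :. N" "y :. N" "r :. A" for x y r
  proof -
    interpret P: left_module A "prod_module M L" by (rule lP)
    show "x +[N] y :. N"
      using hom_add[OF i(1) i(6)[OF that(1)] i(6)[OF that(2)]] i(4) that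
        i(5)[OF P.M.a_closed[OF i(6)[OF that(1)] i(6)[OF that(2)]]] by simp
    show "r .[N] x :. N"
      using hom_smult[OF i(1) that(3) i(6)[OF that(1)]] i(4) that
        i(5)[OF P.smult_closed[OF that(3) i(6)[OF that(1)]]] by simp
  qed
  have "(\<lambda>y\<in>carrier N. fst (g y)) : Hom A N M"
  proof (rule hom_setI)
    fix x y assume xy: "x :. N" "y :. N"
    show "(\<lambda>y\<in>carrier N. fst (g y)) (x +[N] y) = (\<lambda>y\<in>carrier N. fst (g y)) x +[M] (\<lambda>y\<in>carrier N. fst (g y)) y"
      using xy N(1)[OF xy M.R.zero_closed] hom_add[OF i(2) xy] by simp
  next
    fix r x assume rx: "r :. A" "x :. N"
    show "(\<lambda>y\<in>carrier N. fst (g y)) (r .[N] x) = r .[M] (\<lambda>y\<in>carrier N. fst (g y)) x"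
      using rx N(2)[OF rx(2) rx(2) rx(1)] hom_smult[OF i(2) rx] by simp
  qed (use i(6) in "auto simp: mem_Times_iff")
  moreover have "compose (carrier M) f (\<lambda>x\<in>carrier M. (x, 0[L])) : Hom A M N"
    by (rule hom_compose[OF M 1 i(1)])
  ultimately show ?thesis using i(3,5)
    by (intro exI[of _ "compose (carrier M) f (\<lambda>x\<in>carrier M. (x, 0[L]))"]
        exI[of _ "\<lambda>y\<in>carrier N. fst (g y)"]) (auto simp: compose_eq)
qed

text \<open>The complement is the kernel of \<open>\<beta>\<close>, moved to a list carrier because
  \<open>summand\<close> looks for it there.\<close>

lemma summandI:
  fixes A :: "('k, 'a) module"
  assumes K: "fd_algebra K A" and N: "fdm K A N" and M: "left_module A M"
    and \<alpha>: "\<alpha> : Hom A M N" and \<beta>: "\<beta> : Hom A N M" and \<beta>\<alpha>: "!!x. x :. M ==> \<beta> (\<alpha> x) = x"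
  shows "summand A M N"
proof -
  interpret M: left_module A M by fact
  interpret N: left_module A N by (rule fdmD(1)[OF N])
  note ag = M.M_group N.M_group
  let ?U = "{y : carrier N. \<beta> y = 0[M]}"
  have U: "submod A N ?U"
    using hom_zero[OF \<beta> ag(2,1)]
    by (simp add: submod_def subset_iff hom_add[OF \<beta>] hom_smult[OF \<beta>] M.smult_zero_right N.smult_closed)
  let ?L' = "N\<lparr>carrier := ?U\<rparr>"
  obtain L :: "('a, 'k list) module" and u v where uv: "isos A ?L' L u v" and L: "fdm K A L"
    using list_copy[OF K fdm_submod[OF K N U]] by blast
  interpret L: left_module A L by (rule fdmD(1)[OF L])
  note i = isosD[OF uv]
  have v: "v l :. N" "\<beta> (v l) = 0[M]" if "l :. L" for l using i(6)[OF that] by auto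
  have va: "v (x +[L] y) = v x +[N] v y" if "x :. L" "y :. L" for x y
    using hom_add[OF i(2) that] by simp
  have vs: "v (r .[L] x) = r .[N] v x" if "r :. A" "x :. L" for r x
    using hom_smult[OF i(2) that] by simp
  let ?f = "\<lambda>z\<in>carrier (prod_module M L). \<alpha> (fst z) +[N] v (snd z)"
  note h\<alpha> = hom_closed[OF \<alpha>] and h\<beta> = hom_closed[OF \<beta>]
  have f: "?f : Hom A (prod_module M L) N"
    by (rule hom_setI)
      (auto simp: h\<alpha> v va vs hom_add[OF \<alpha>] hom_smult[OF \<alpha>] N.M.a_ac N.smult_r_distr M.smult_closed L.smult_closed)
  have \<beta>f: "\<beta> (\<alpha> x +[N] v l) = x" if "x :. M" "l :. L" for x l
    using that by (simp add: hom_add[OF \<beta>] h\<alpha> v \<beta>\<alpha>)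
  have "bij_betw ?f (carrier (prod_module M L)) (carrier N)"
  proof (rule bij_betw_imageI)
    show "inj_on ?f (carrier (prod_module M L))"
    proof (rule inj_onI, clarsimp)
      fix x l x' l' assume z: "x :. M" "l :. L" "x' :. M" "l' :. L"
        and e: "\<alpha> x +[N] v l = \<alpha> x' +[N] v l'"
      then have x: "x = x'" using \<beta>f[of x l] \<beta>f[of x' l'] by simp
      then have "v l = v l'" using e z h\<alpha> v by simp
      then show "x = x' & l = l'" using x i(4) z by metis
    qed
    have "y : ?f ` carrier (prod_module M L)" if y: "y :. N" for y
    proof -
      have ay: "\<alpha> (\<beta> y) :. N" using y h\<alpha> h\<beta> by simp
      have yU: "y -[N] \<alpha> (\<beta> y) :. ?L'"
        using y ay h\<beta> by (simp add: hom_diff[OF \<beta> ag(2,1)] \<beta>\<alpha>) (simp add: a_minus_def M.M.r_neg)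
      have "y = \<alpha> (\<beta> y) +[N] v (u (y -[N] \<alpha> (\<beta> y)))"
        using i(3)[OF yU] y ay by (simp add: a_minus_def N.M.a_lcomm N.M.r_neg)
      then show ?thesis using i(5)[OF yU] h\<beta>[OF y]
        by (intro image_eqI[of _ _ "(\<beta> y, u (y -[N] \<alpha> (\<beta> y)))"]) auto
    qed
    then show "?f ` carrier (prod_module M L) = carrier N" using hom_closed[OF f] by auto
  qed
  then have "mod_iso A (prod_module M L) N" using f unfolding mod_iso_def by blast
  moreover have "fg_module A L" using L fg_module_iff[OF K] by blast
  ultimately show ?thesis unfolding summand_def by blast
qed

text \<open>
  \<open>fac R W X\<close>: the identity of \<open>X\<close> is a finite sum of maps that factor through \<open>W\<close>. For
  finite-dimensional modules this says \<open>X \<in> add W\<close>, without reference to a carrier type for the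
  complement.
\<close>

definition fac :: "('r, 'z) ring_scheme => ('r, 'w) module => ('r, 'x) module => bool" where
  "fac R W X \<longleftrightarrow> (EX (n :: nat) a b. (ALL l<n. a l : Hom R X W & b l : Hom R W X) &
     (ALL x:carrier X. (\<Oplus>\<^bsub>X\<^esub>l\<in>{..<n}. b l (a l x)) = x))"

lemma fac_of_in_add:
  assumes W: "left_module A W" and ia: "in_add A W X"
  shows "fac A W X" "left_module A X"
proof -
  show X: "left_module A X" using ia by (simp add: in_add_def fg_module_def)
  interpret X: left_module A X by (rule X)
  interpret W: left_module A W by fact
  obtain n where s: "summand A X (dsum n (%_. W))" using ia unfolding in_add_def by blast
  obtain \<alpha> \<beta> where ab: "\<alpha> : Hom A X (dsum n (%_. W))" "\<beta> : Hom A (dsum n (%_. W)) X"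
    "!!x. x :. X ==> \<beta> (\<alpha> x) = x" using summandE[OF s X] by blast
  let ?D = "dsum n (%_. W)"
  interpret D: left_module A ?D by (rule left_module_dsum[OF X.R.ring_axioms W])
  have pr: "dpr n (%_. W) l : Hom A ?D W" and inc: "dinc n (%_. W) l : Hom A W ?D" if "l < n" for l
    using dpr_hom[of A n "%_. W" l] dinc_hom[of A n "%_. W" l] X.R.ring_axioms W that by auto
  define a where "a l = compose (carrier X) (dpr n (%_. W) l) \<alpha>" for l
  define b where "b l = compose (carrier W) \<beta> (dinc n (%_. W) l)" for l
  have a: "a l : Hom A X W" if "l < n" for l unfolding a_def by (rule hom_compose[OF X ab(1) pr[OF that]])
  have b: "b l : Hom A W X" if "l < n" for l unfolding b_def by (rule hom_compose[OF W inc[OF that] ab(2)])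
  have "(\<Oplus>\<^bsub>X\<^esub>l\<in>{..<n}. b l (a l x)) = x" if x: "x :. X" for x
  proof -
    have ax: "\<alpha> x :. ?D" using hom_closed[OF ab(1) x] .
    have axl: "\<alpha> x l :. W" if "l < n" for l using ax that by auto
    have il: "dinc n (%_. W) l (\<alpha> x l) :. ?D" if "l < n" for l
      using hom_closed[OF inc[OF that] axl[OF that]] .
    have "(\<Oplus>\<^bsub>X\<^esub>l\<in>{..<n}. b l (a l x)) = (\<Oplus>\<^bsub>X\<^esub>l\<in>{..<n}. \<beta> (dinc n (%_. W) l (\<alpha> x l)))"
      using ax axl x hom_closed[OF ab(2)] il
      by (intro X.M.finsum_cong') (auto simp: a_def b_def compose_eq dpr_def)
    also have "... = \<beta> (\<Oplus>\<^bsub>?D\<^esub>l\<in>{..<n}. dinc n (%_. W) l (\<alpha> x l))"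
      using il by (intro hom_finsum[OF ab(2) D.M_group X.M_group, symmetric]) auto
    also have "... = x" using dsum_expand[OF X.R.ring_axioms W ax] ab(3)[OF x] by simp
    finally show ?thesis .
  qed
  then show "fac A W X" unfolding fac_def using a b by blast
qed

lemma in_add_of_fac:
  fixes A :: "('k, 'a) module"
  assumes K: "fd_algebra K A" and W: "fdm K A W" and X: "fdm K A X" and f: "fac A W X"
  shows "in_add A W X"
proof -
  note lW = fdmD(1)[OF W] and lX = fdmD(1)[OF X]
  obtain n a b where ab: "!!l. l < (n::nat) ==> a l : Hom A X W" "!!l. l < n ==> b l : Hom A W X"
    "!!x. x :. X ==> (\<Oplus>\<^bsub>X\<^esub>l\<in>{..<n}. b l (a l x)) = x"
    using f unfolding fac_def by blast
  interpret X: left_module A X by (rule lX)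
  have "summand A X (dsum n (%_. W))"
  proof (rule summandI[OF K fdm_dsum[OF K W] lX])
    show "(\<lambda>x\<in>carrier X. \<lambda>l\<in>{..<n}. a l x) : Hom A X (dsum n (%_. W))"
      by (rule hom_into_dsum[OF lX]) (use ab in auto)
    show "(\<lambda>x\<in>carrier (dsum n (%_. W)). \<Oplus>\<^bsub>X\<^esub>l\<in>{..<n}. b l (x l)) : Hom A (dsum n (%_. W)) X"
      by (rule hom_from_dsum[OF fd_algebraD(4)[OF K] lW lX]) (use ab in auto)
    fix x assume x: "x :. X"
    have ax: "a l x :. W" if "l < n" for l using hom_closed[OF ab(1)[OF that] x] .
    have "(\<Oplus>\<^bsub>X\<^esub>l\<in>{..<n}. b l ((\<lambda>l\<in>{..<n}. a l x) l)) = (\<Oplus>\<^bsub>X\<^esub>l\<in>{..<n}. b l (a l x))"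
      using hom_closed[OF ab(2) ax] by (intro X.M.finsum_cong') auto
    then show "(\<lambda>x\<in>carrier (dsum n (%_. W)). \<Oplus>\<^bsub>X\<^esub>l\<in>{..<n}. b l (x l)) ((\<lambda>x\<in>carrier X. \<lambda>l\<in>{..<n}. a l x) x) = x"
      using x ax ab(3) by simp
  qed
  then show ?thesis using fg_module_iff[OF K] X unfolding in_add_def by blast
qed

subsection \<open>Lifting properties for arbitrary carriers\<close>

lemma submod_image:
  assumes X: "left_module R X" and Y: "left_module R Y" and g: "g : Hom R X Y"
  shows "submod R Y (g ` carrier X)"
proof -
  interpret X: left_module R X by fact
  interpret Y: left_module R Y by fact
  show ?thesis unfolding submod_def
  proof (intro conjI ballI)
    show "g ` carrier X \<subseteq> carrier Y" using hom_closed[OF g] by auto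
    show "0[Y] : g ` carrier X"
      using hom_zero[OF g X.M_group Y.M_group] X.M.zero_closed by (metis imageI)
  next
    fix x y assume "x : g ` carrier X" "y : g ` carrier X"
    then obtain u v where "u :. X" "x = g u" "v :. X" "y = g v" by blast
    then show "x +[Y] y : g ` carrier X" using hom_add[OF g, of u v]
      by (intro image_eqI[of _ g "u +[X] v"]) auto
  next
    fix r x assume "r :. R" "x : g ` carrier X"
    then obtain u where "r :. R" "u :. X" "x = g u" by blast
    then show "r .[Y] x : g ` carrier X" using hom_smult[OF g, of r u] X.smult_closed
      by (intro image_eqI[of _ g "r .[X] u"]) auto
  qed
qed

lemma hom_restrict_range: "f : Hom R X Y ==> f ` carrier X \<subseteq> U ==> f : Hom R X (Y\<lparr>carrier := U\<rparr>)"
  by (auto simp: hom_set_def PiE_def)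

lemma projectiveD:
  fixes X Y :: "('a, 'k list) module" and A :: "('k, 'a) module"
  assumes "projective A P" "fg_module A X" "fg_module A Y" "g : Hom A X Y" "f : Hom A P Y"
    "g ` carrier X = carrier Y"
  shows "EX h:Hom A P X. ALL p:carrier P. g (h p) = f p"
  using assms(1)[unfolded projective_def, THEN conjunct2, rule_format, OF assms(2-6)] .

lemma injectiveD:
  fixes X Y :: "('a, 'k list) module" and A :: "('k, 'a) module"
  assumes "injective A I" "fg_module A X" "fg_module A Y" "g : Hom A X Y" "f : Hom A X I"
    "inj_on g (carrier X)"
  shows "EX h:Hom A Y I. ALL x:carrier X. h (g x) = f x"
  using assms(1)[unfolded injective_def, THEN conjunct2, rule_format, OF assms(2-6)] .

text \<open>Two gaps to the definition of \<open>projective\<close> are closed here: the carriers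
  are arbitrary, and instead of surjectivity of \<open>g\<close> an inclusion of images is asked,
  since \<open>Y\<close> can be shrunk to the image of \<open>g\<close>.\<close>

lemma projective_lift:
  fixes R :: "('k, 'r) module"
  assumes K: "fd_algebra K R" and Q: "projective R Q" and X: "fdm K R X" and Y: "fdm K R Y"
    and g: "g : Hom R X Y" and f: "f : Hom R Q Y" and im: "f ` carrier Q \<subseteq> g ` carrier X"
  shows "EX h:Hom R Q X. ALL p:carrier Q. g (h p) = f p"
proof -
  note lX = fdmD(1)[OF X] and lY = fdmD(1)[OF Y]
  have lQ: "left_module R Q" using Q by (simp add: projective_def fg_module_def)
  let ?Y0 = "Y\<lparr>carrier := g ` carrier X\<rparr>"
  have Y0: "fdm K R ?Y0" by (rule fdm_submod[OF K Y submod_image[OF lX lY g]])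
  obtain X' :: "('r, 'k list) module" and x1 x2 where X': "isos R X X' x1 x2" "fdm K R X'"
    using list_copy[OF K X] by blast
  obtain Y' :: "('r, 'k list) module" and y1 y2 where Y': "isos R ?Y0 Y' y1 y2" "fdm K R Y'"
    using list_copy[OF K Y0] by blast
  note x = isosD[OF X'(1)] and y = isosD[OF Y'(1)]
  have g0: "g : Hom R X ?Y0" and f0: "f : Hom R Q ?Y0"
    using hom_restrict_range g f im by blast+
  let ?g = "compose (carrier X') y1 (compose (carrier X') g x2)"
  let ?f = "compose (carrier Q) y1 f"
  have g': "?g : Hom R X' Y'"
    by (rule hom_compose[OF fdmD(1)[OF X'(2)] hom_compose[OF fdmD(1)[OF X'(2)] x(2) g0] y(1)])
  have f': "?f : Hom R Q Y'" by (rule hom_compose[OF lQ f0 y(1)])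
  have "?g ` carrier X' = carrier Y'"
  proof
    show "?g ` carrier X' \<subseteq> carrier Y'" using hom_closed[OF g'] by auto
    show "carrier Y' \<subseteq> ?g ` carrier X'"
    proof
      fix z assume z: "z :. Y'"
      then have "y2 z : g ` carrier X" using y(6)[of z] by simp
      then obtain w where w: "w :. X" "y2 z = g w" by auto
      then have "?g (x1 w) = z" using x(3,5) y(4)[OF z] by (simp add: compose_eq)
      then show "z : ?g ` carrier X'" using x(5)[OF w(1)] by (metis imageI)
    qed
  qed
  note surj = this
  have fg: "fg_module R X'" "fg_module R Y'" using X'(2) Y'(2) fg_module_iff[OF K] by blast+
  obtain h where h: "h : Hom R Q X'" "!!p. p :. Q ==> ?g (h p) = ?f p"
    using projectiveD[OF Q fg g' f' surj] by blast
  have "g (x2 (h p)) = f p" if p: "p :. Q" for p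
  proof -
    have hp: "h p :. X'" using hom_closed[OF h(1) p] .
    have "y1 (g (x2 (h p))) = y1 (f p)" using h(2)[OF p] p hp by (simp add: compose_eq)
    moreover have "g (x2 (h p)) :. ?Y0" "f p :. ?Y0"
      using hom_closed[OF g0 x(6)[OF hp]] hom_closed[OF f0 p] by auto
    ultimately show ?thesis using y(3) by metis
  qed
  then show ?thesis using hom_compose[OF lQ h(1) x(2)]
    by (intro bexI[of _ "compose (carrier Q) x2 h"]) (auto simp: compose_eq)
qed

text \<open>The kernel condition lets \<open>f\<close> descend to the image of \<open>g\<close>; the
  inclusion of that image into \<open>Y\<close> is the monomorphism along which injectivity is
  applied.\<close>

lemma injective_extend:
  fixes R :: "('k, 'r) module"
  assumes K: "fd_algebra K R" and I: "injective R I" and X: "left_module R X" and Y: "fdm K R Y"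
    and g: "g : Hom R X Y" and f: "f : Hom R X I"
    and ker: "!!x. [|x :. X; g x = 0[Y]|] ==> f x = 0[I]"
  shows "EX h:Hom R Y I. ALL x:carrier X. h (g x) = f x"
proof -
  note lY = fdmD(1)[OF Y]
  have lI: "left_module R I" using I by (simp add: injective_def fg_module_def)
  interpret X: left_module R X by fact
  interpret Y: left_module R Y by fact
  interpret I: left_module R I by fact
  note sub = submod_image[OF X lY g]
  let ?Y0 = "Y\<lparr>carrier := g ` carrier X\<rparr>"
  have Y0: "fdm K R ?Y0" by (rule fdm_submod[OF K Y sub])
  obtain X' :: "('r, 'k list) module" and x1 x2 where X': "isos R ?Y0 X' x1 x2" "fdm K R X'"
    using list_copy[OF K Y0] by blast
  obtain Y' :: "('r, 'k list) module" and y1 y2 where Y': "isos R Y Y' y1 y2" "fdm K R Y'"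
    using list_copy[OF K Y] by blast
  note x = isosD[OF X'(1)] and y = isosD[OF Y'(1)]
  have fg: "f x = f x'" if "x :. X" "x' :. X" "g x = g x'" for x x'
  proof -
    have "g (x -[X] x') = 0[Y]"
      using that hom_closed[OF g]
      by (simp add: hom_diff[OF g X.M_group Y.M_group]) (simp add: a_minus_def Y.M.r_neg)
    then have "f x -[I] f x' = 0[I]"
      using that ker[of "x -[X] x'"] by (simp add: hom_diff[OF f X.M_group I.M_group])
    then have "(f x -[I] f x') +[I] f x' = f x'" using hom_closed[OF f] that by simp
    then show ?thesis using hom_closed[OF f] that by (simp add: a_minus_def I.M.a_assoc I.M.l_neg)
  qed
  define s where "s = inv_into (carrier X) g"
  have s: "s z :. X" "g (s z) = z" if "z : g ` carrier X" for z
    using that by (auto simp: s_def inv_into_into f_inv_into_f)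
  have f0: "(\<lambda>z\<in>g ` carrier X. f (s z)) : Hom R ?Y0 I"
  proof (rule hom_setI)
    fix u v assume "u :. ?Y0" "v :. ?Y0"
    then have uv: "u : g ` carrier X" "v : g ` carrier X" by auto
    then have w: "u +[Y] v : g ` carrier X" using sub by (auto simp: submod_def)
    have "f (s (u +[Y] v)) = f (s u +[X] s v)"
      by (rule fg) (use s uv s[OF w] in "auto simp: hom_add[OF g]")
    then show "(\<lambda>z\<in>g ` carrier X. f (s z)) (u +[?Y0] v) =
        (\<lambda>z\<in>g ` carrier X. f (s z)) u +[I] (\<lambda>z\<in>g ` carrier X. f (s z)) v"
      using uv w s by (simp add: hom_add[OF f])
  next
    fix r u assume r: "r :. R" and "u :. ?Y0"
    then have u: "u : g ` carrier X" by auto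
    then have w: "r .[Y] u : g ` carrier X" using sub r by (auto simp: submod_def)
    have "f (s (r .[Y] u)) = f (r .[X] s u)"
      by (rule fg) (use s u s[OF w] r in "auto simp: hom_smult[OF g] X.smult_closed")
    then show "(\<lambda>z\<in>g ` carrier X. f (s z)) (r .[?Y0] u) = r .[I] (\<lambda>z\<in>g ` carrier X. f (s z)) u"
      using u w s r by (simp add: hom_smult[OF f])
  qed (use s hom_closed[OF f] in auto)
  let ?f = "compose (carrier X') (\<lambda>z\<in>g ` carrier X. f (s z)) x2"
  have incl: "(\<lambda>z\<in>g ` carrier X. z) : Hom R ?Y0 Y"
    by (rule hom_setI) (use sub in "auto simp: submod_def")
  let ?i = "compose (carrier X') (compose (carrier ?Y0) y1 (\<lambda>z\<in>g ` carrier X. z)) x2"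
  have f': "?f : Hom R X' I" by (rule hom_compose[OF fdmD(1)[OF X'(2)] x(2) f0])
  have i': "?i : Hom R X' Y'"
    by (rule hom_compose[OF fdmD(1)[OF X'(2)] x(2) hom_compose[OF fdmD(1)[OF Y0] incl y(1)]])
  have iX: "?i z = y1 (x2 z)" "x2 z :. Y" if "z :. X'" for z
    using x(6)[OF that] that sub by (auto simp: compose_eq submod_def)
  have "inj_on ?i (carrier X')"
  proof (rule inj_onI)
    fix u v assume uv: "u :. X'" "v :. X'" "?i u = ?i v"
    then have "x2 u = x2 v" using iX y(3) by metis
    then show "u = v" using x(4) uv by metis
  qed
  note inj = this
  have fgm: "fg_module R X'" "fg_module R Y'" using X'(2) Y'(2) fg_module_iff[OF K] by blast+
  obtain h where h: "h : Hom R Y' I" "!!z. z :. X' ==> h (?i z) = ?f z"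
    using injectiveD[OF I fgm i' f' inj] by blast
  have "h (y1 (g z)) = f z" if z: "z :. X" for z
  proof -
    have gz: "g z :. ?Y0" using z by auto
    have "h (?i (x1 (g z))) = ?f (x1 (g z))" by (rule h(2)[OF x(5)[OF gz]])
    moreover have "?i (x1 (g z)) = y1 (g z)" using iX(1)[OF x(5)[OF gz]] x(3)[OF gz] by simp
    moreover have "?f (x1 (g z)) = f (s (g z))" using x(5)[OF gz] x(3)[OF gz] z by (simp add: compose_eq)
    moreover have "f (s (g z)) = f z" using fg[of "s (g z)" z] s[of "g z"] z by auto
    ultimately show ?thesis by simp
  qed
  then show ?thesis using hom_compose[OF lY y(1) h(1)] hom_closed[OF g]
    by (intro bexI[of _ "compose (carrier Y) h y1"]) (auto simp: compose_eq)
qed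

section \<open>Basic algebras\<close>

definition jac :: "('a, 'z) ring_scheme => 'a set" where
  "jac R = {r : carrier R. ALL x:carrier R. 1[R] -[R] r *[R] x : Units R}"

context ring
begin

text \<open>The geometric series, built by recursion on the exponent, commutes with \<open>z\<close>
  and inverts \<open>\<one> \<ominus> z\<close>.\<close>

lemma nilpotent_unit:
  assumes z: "z :. R" "z [^] (n::nat) = \<zero>"
  shows "\<one> \<ominus> z : Units R"
proof -
  have "EX s:carrier R. s \<otimes> z = z \<otimes> s & (\<one> \<ominus> z) \<otimes> s = \<one> \<ominus> z [^] (m::nat)" for m
  proof (induction m)
    case 0
    then show ?case using z by (intro bexI[of _ \<zero>]) (auto simp: a_minus_def r_neg)
  next
    case (Suc m)
    then obtain s where s: "s :. R" "s \<otimes> z = z \<otimes> s" "(\<one> \<ominus> z) \<otimes> s = \<one> \<ominus> z [^] m" by blast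
    have "(\<one> \<ominus> z) \<otimes> (s \<oplus> z [^] m) = (\<one> \<ominus> z) \<otimes> s \<oplus> (\<one> \<ominus> z) \<otimes> z [^] m"
      using s(1) z(1) by (subst r_distr) auto
    also have "... = (\<one> \<ominus> z [^] m) \<oplus> (z [^] m \<ominus> z \<otimes> z [^] m)"
      unfolding s(3) using z(1) by (simp add: a_minus_def l_distr l_minus)
    also have "... = \<one> \<ominus> z \<otimes> z [^] m"
      using z(1) by (simp add: a_minus_def a_assoc r_neg1)
    also have "z \<otimes> z [^] m = z [^] Suc m" using z(1) nat_pow_Suc2[OF z(1)] by simp
    finally show ?case using s z(1) nat_pow_comm[of z m 1]
      by (intro bexI[of _ "s \<oplus> z [^] m"]) (simp_all add: l_distr r_distr)
  qed
  then obtain s where s: "s :. R" "s \<otimes> z = z \<otimes> s" "(\<one> \<ominus> z) \<otimes> s = \<one>"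
    using z(2) by (metis a_minus_def minus_zero one_closed r_zero)
  then have "s \<otimes> (\<one> \<ominus> z) = \<one>" using z(1)
    by (simp add: a_minus_def l_distr r_distr l_minus r_minus)
  then show ?thesis using s z(1) by (auto simp: Units_def)
qed

text \<open>If \<open>g\<close> inverts \<open>1 - ab\<close>, then \<open>1 + b g a\<close> inverts
  \<open>1 - ba\<close>. This makes the one-sided condition in \<open>jac\<close> stable under left
  multiplication.\<close>

lemma unit_swap:
  assumes ab: "a :. R" "b :. R" and u: "\<one> \<ominus> a \<otimes> b : Units R"
  shows "\<one> \<ominus> b \<otimes> a : Units R"
proof -
  obtain g where g: "g :. R" "g \<otimes> (\<one> \<ominus> a \<otimes> b) = \<one>" "(\<one> \<ominus> a \<otimes> b) \<otimes> g = \<one>"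
    using u by (auto simp: Units_def)
  have e1: "g = \<one> \<oplus> a \<otimes> (b \<otimes> g)" and e2: "g = \<one> \<oplus> g \<otimes> (a \<otimes> b)"
  proof -
    have "g = (g \<ominus> a \<otimes> (b \<otimes> g)) \<oplus> a \<otimes> (b \<otimes> g)" using ab g(1) by (simp add: a_minus_def a_assoc l_neg)
    also have "g \<ominus> a \<otimes> (b \<otimes> g) = \<one>" using g ab by (simp add: a_minus_def l_distr l_minus m_assoc)
    finally show "g = \<one> \<oplus> a \<otimes> (b \<otimes> g)" .
    have "g = (g \<ominus> g \<otimes> (a \<otimes> b)) \<oplus> g \<otimes> (a \<otimes> b)" using ab g(1) by (simp add: a_minus_def a_assoc l_neg)
    also have "g \<ominus> g \<otimes> (a \<otimes> b) = \<one>" using g ab by (simp add: a_minus_def r_distr r_minus)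
    finally show "g = \<one> \<oplus> g \<otimes> (a \<otimes> b)" .
  qed
  let ?h = "\<one> \<oplus> b \<otimes> (g \<otimes> a)"
  have f1: "b \<otimes> (g \<otimes> a) = b \<otimes> a \<oplus> (b \<otimes> a) \<otimes> (b \<otimes> (g \<otimes> a))"
  proof -
    have "b \<otimes> (g \<otimes> a) = b \<otimes> ((\<one> \<oplus> a \<otimes> (b \<otimes> g)) \<otimes> a)" using e1 by simp
    also have "... = b \<otimes> a \<oplus> (b \<otimes> a) \<otimes> (b \<otimes> (g \<otimes> a))" using ab g(1) by (simp add: l_distr r_distr m_assoc)
    finally show ?thesis .
  qed
  have f2: "b \<otimes> (g \<otimes> a) = b \<otimes> a \<oplus> (b \<otimes> (g \<otimes> a)) \<otimes> (b \<otimes> a)"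
  proof -
    have "b \<otimes> (g \<otimes> a) = b \<otimes> ((\<one> \<oplus> g \<otimes> (a \<otimes> b)) \<otimes> a)" using e2 by simp
    also have "... = b \<otimes> a \<oplus> (b \<otimes> (g \<otimes> a)) \<otimes> (b \<otimes> a)" using ab g(1) by (simp add: l_distr r_distr m_assoc)
    finally show ?thesis .
  qed
  have cl: "b \<otimes> (g \<otimes> a) :. R" "b \<otimes> a :. R" using ab g by auto
  have "(\<one> \<ominus> b \<otimes> a) \<otimes> ?h = \<one> \<oplus> (b \<otimes> (g \<otimes> a) \<ominus> (b \<otimes> a \<oplus> (b \<otimes> a) \<otimes> (b \<otimes> (g \<otimes> a))))"
    using cl by (simp add: a_minus_def l_distr r_distr l_minus minus_add a_ac)
  also have "... = \<one>" unfolding f1[symmetric] using cl by (simp add: a_minus_def r_neg)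
  finally have h1: "(\<one> \<ominus> b \<otimes> a) \<otimes> ?h = \<one>" .
  have "?h \<otimes> (\<one> \<ominus> b \<otimes> a) = \<one> \<oplus> (b \<otimes> (g \<otimes> a) \<ominus> (b \<otimes> a \<oplus> (b \<otimes> (g \<otimes> a)) \<otimes> (b \<otimes> a)))"
    using cl by (simp add: a_minus_def l_distr r_distr r_minus minus_add a_ac)
  also have "... = \<one>" unfolding f2[symmetric] using cl by (simp add: a_minus_def r_neg)
  finally have h2: "?h \<otimes> (\<one> \<ominus> b \<otimes> a) = \<one>" .
  show ?thesis using h1 h2 cl by (auto simp: Units_def)
qed

lemma jac_closed: "r : jac R ==> r :. R"
  by (simp add: jac_def)

lemma jac_rmult: "[|r : jac R; y :. R|] ==> r \<otimes> y : jac R"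
  by (simp add: jac_def m_assoc)

lemma jac_lmult:
  assumes "r : jac R" "y :. R"
  shows "y \<otimes> r : jac R"
proof -
  have r: "r :. R" using assms jac_closed by simp
  have "\<one> \<ominus> y \<otimes> r \<otimes> x : Units R" if x: "x :. R" for x
    using unit_swap[of "r \<otimes> x" y] assms r x by (simp add: jac_def m_assoc)
  then show ?thesis using assms r by (simp add: jac_def)
qed

lemma jac_zero: "\<zero> : jac R"
  by (auto simp: jac_def a_minus_def)

text \<open>The unit \<open>u = 1 - r x\<close> with inverse \<open>g\<close> is split off:
  \<open>1 - (r + s) x = (1 - s x g) u\<close>.\<close>

lemma jac_add:
  assumes r: "r : jac R" and s: "s : jac R"
  shows "r \<oplus> s : jac R"
proof -
  have c: "r :. R" "s :. R" using assms jac_closed by auto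
  have "\<one> \<ominus> (r \<oplus> s) \<otimes> x : Units R" if x: "x :. R" for x
  proof -
    let ?u = "\<one> \<ominus> r \<otimes> x"
    have u: "?u : Units R" using r x by (simp add: jac_def)
    then obtain g where g: "g :. R" "g \<otimes> ?u = \<one>" by (auto simp: Units_def)
    have "ALL y:carrier R. \<one> \<ominus> s \<otimes> y : Units R" using s by (simp add: jac_def)
    then have v: "\<one> \<ominus> s \<otimes> (x \<otimes> g) : Units R" using x g(1) by blast
    have uc: "?u :. R" using c x by simp
    have "(\<one> \<ominus> s \<otimes> (x \<otimes> g)) \<otimes> ?u = ?u \<ominus> s \<otimes> (x \<otimes> (g \<otimes> ?u))"
      unfolding a_minus_def[of R \<one> "s \<otimes> (x \<otimes> g)"] a_minus_def[of R ?u]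
      using c x g uc by (subst l_distr) (simp_all add: l_minus m_assoc)
    also have "... = \<one> \<ominus> (r \<oplus> s) \<otimes> x" unfolding g(2) using c x
      by (simp add: a_minus_def l_distr minus_add a_assoc)
    finally show ?thesis using Units_m_closed[OF v u] by simp
  qed
  then show ?thesis using c by (simp add: jac_def)
qed

lemma jac_neg: "r : jac R ==> \<ominus> r : jac R"
  using jac_rmult[of r "\<ominus> \<one>"] jac_closed[of r] by (simp add: r_minus)

lemma jac_finsum: "(!!i. i : S ==> f i : jac R) ==> finsum R f S : jac R"
  by (rule finsum_in_set) (auto simp: jac_zero jac_add jac_closed)

lemma jac_if_nil:
  assumes "r :. R" "!!x. x :. R ==> EX n::nat. (r \<otimes> x) [^] n = \<zero>"
  shows "r : jac R"
proof -
  have "\<one> \<ominus> r \<otimes> x : Units R" if x: "x :. R" for x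
  proof -
    obtain n where "(r \<otimes> x) [^] (n::nat) = \<zero>" using assms(2)[OF x] by blast
    then show ?thesis using nilpotent_unit[of "r \<otimes> x" n] assms(1) x by simp
  qed
  then show ?thesis using assms(1) by (simp add: jac_def)
qed

text \<open>Nilpotence is transferred out of the corner by
  \<open>(e z)^(N+1) = (e z e)^N (e z)\<close>.\<close>

lemma nil_corner:
  assumes e: "e :. R" "e \<otimes> e = e" and z: "z :. R" "(e \<otimes> z \<otimes> e) [^] (N::nat) = \<zero>"
  shows "(e \<otimes> z) [^] Suc N = \<zero>"
proof -
  have ee: "e \<otimes> (e \<otimes> x) = e \<otimes> x" if "x :. R" for x using e that by (simp add: m_assoc[symmetric])
  have "(e \<otimes> z) [^] Suc N = (e \<otimes> z \<otimes> e) [^] N \<otimes> (e \<otimes> z)" for N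
  proof (induction N)
    case (Suc N)
    have "(e \<otimes> z) [^] Suc (Suc N) = (e \<otimes> z) [^] Suc N \<otimes> (e \<otimes> z)" by simp
    also have "... = (e \<otimes> z \<otimes> e) [^] N \<otimes> (e \<otimes> z) \<otimes> (e \<otimes> z)" unfolding Suc ..
    also have "... = (e \<otimes> z \<otimes> e) [^] Suc N \<otimes> (e \<otimes> z)" using e z(1) by (simp add: m_assoc ee)
    finally show ?case .
  qed (use e z in simp)
  then show ?thesis using z e by simp
qed

end

section \<open>Fitting's lemma for finite-dimensional algebras\<close>

definition strongly_pi_regular :: "('a, 'z) ring_scheme => bool" where
  "strongly_pi_regular R \<longleftrightarrow> (ALL f:carrier R. EX (n::nat) h. h :. R & f *[R] h = h *[R] f &
     f [^]\<^bsub>R\<^esub> n = f [^]\<^bsub>R\<^esub> Suc n *[R] h)"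

text \<open>Finite dimension as a chain condition, by induction on the separating functionals. If
  \<open>\<nu>\<close> vanishes on some term, the chain of its kernels takes over; otherwise
  \<open>\<nu>\<close> is nonzero on every term, and a stable kernel forces the terms to be
  stable.\<close>

lemma (in vspace) descending_chain:
  assumes L: "finite L" "L \<subseteq> Hom K V (regular K)"
    and U: "!!n. submod K V (U n)" "!!n m. n <= m ==> U m \<subseteq> U n"
    and sep: "!!x. [|x : U 0; ALL \<mu>:L. \<mu> x = \<zero>|] ==> x = 0[V]"
  shows "EX n. ALL m>=n. U m = U (n::nat)"
  using assms
proof (induction L arbitrary: U rule: finite_induct)
  case empty
  have "U n = {0[V]}" for n
    using empty(4)[of _] empty(3)[of 0 n] empty(2)[of n] by (auto simp: submod_def)
  then show ?case by simp
next
  case (insert \<nu> L)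
  note U = insert.prems(2,3)
  have l: "\<nu> : Hom K V (regular K)" using insert.prems(1) by auto
  have l0: "\<nu> 0[V] = \<zero>" using hom_zero[OF l M.abelian_group_axioms] K.abelian_group_axioms by simp
  have UV: "x :. V" if "x : U n" for x n using U(1)[of n] that by (auto simp: submod_def)
  let ?W = "%n. {x : U n. \<nu> x = \<zero>}"
  have W: "submod K V (?W n)" for n using U(1)[of n] UV[of _ n] l0
    by (simp add: submod_def hom_add[OF l] hom_smult[OF l] subset_iff)
  have Wd: "?W m \<subseteq> ?W n" if "n <= m" for n m using U(2)[OF that] by auto
  have L': "L \<subseteq> Hom K V (regular K)" using insert.prems(1) by auto
  have sep': "x = 0[V]" if "x : ?W 0" "ALL \<mu>:L. \<mu> x = \<zero>" for x using insert.prems(4)[of x] that by simp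
  obtain n0 where n0: "ALL m>=n0. ?W m = ?W n0" using insert.IH[of ?W, OF L' W Wd sep'] by blast
  show ?case
  proof (cases "EX n1. ALL x:U n1. \<nu> x = \<zero>")
    case True
    then obtain n1 where n1: "ALL x:U n1. \<nu> x = \<zero>" by blast
    have "U m = ?W n0" if m: "m >= max n0 n1" for m
    proof -
      have "U m = ?W m" using n1 U(2)[of n1 m] m by auto
      also have "... = ?W n0" using n0[rule_format, of m] m by simp
      finally show ?thesis .
    qed
    then have "ALL m>=max n0 n1. U m = U (max n0 n1)" by simp
    then show ?thesis by blast
  next
    case False
    have "U n0 \<subseteq> U m" if m: "m >= n0" for m
    proof
      fix y assume y: "y : U n0"
      obtain x where x: "x : U m" "\<nu> x ~= \<zero>" using False by blast
      have lx: "\<nu> x :. K" using hom_closed[OF l UV[OF x(1)]] by simp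
      then have iv: "inv (\<nu> x) :. K" "inv (\<nu> x) \<otimes> \<nu> x = \<one>" using x by (auto simp: K.field_Units)
      let ?c = "\<nu> y \<otimes> inv (\<nu> x)"
      have ly: "\<nu> y :. K" using hom_closed[OF l UV[OF y]] by simp
      then have c: "?c :. K" using iv by simp
      have cx: "?c .[V] x : U m" using U(1)[of m] c x by (auto simp: submod_def)
      have mm: "y -[V] ?c .[V] x : U n0" using submod_diff[OF U(1)[of n0] y] cx U(2)[OF m] by auto
      have "\<nu> (y -[V] ?c .[V] x) = \<nu> y \<ominus> ?c \<otimes> \<nu> x"
        using hom_diff[OF l M.abelian_group_axioms _ UV[OF y] UV[OF cx]] hom_smult[OF l c UV[OF x(1)]]
          K.abelian_group_axioms by (simp add: a_minus_def)
      also have "... = \<zero>" using iv ly lx by (simp add: K.m_assoc K.r_neg a_minus_def)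
      finally have "y -[V] ?c .[V] x : ?W n0" using mm by simp
      then have "y -[V] ?c .[V] x : U m" using n0 m by blast
      then have "(y -[V] ?c .[V] x) +[V] ?c .[V] x : U m" using cx U(1)[of m] by (auto simp: submod_def)
      then show "y : U m" using UV[OF y] UV[OF cx] by (simp add: a_minus_def M.a_assoc M.l_neg)
    qed
    then show ?thesis using U(2) by blast
  qed
qed

text \<open>The chain consists of the spaces \<open>f^n Z\<close>, with \<open>Z\<close> the
  centralizer of \<open>f\<close>. Using \<open>Z\<close> instead of the whole algebra makes the
  resulting \<open>h\<close> commute with \<open>f\<close>.\<close>

lemma strongly_pi_regular_fd:
  assumes K: "fd_algebra K R"
  shows "strongly_pi_regular R"
  unfolding strongly_pi_regular_def
proof
  fix f assume f: "f :. R"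
  interpret R: ring R using fd_algebraD[OF K] by simp
  interpret V: vspace K R using fd_algebraD[OF K] by (simp add: vspace_def)
  let ?Z = "{x : carrier R. f *[R] x = x *[R] f}"
  let ?U = "%n::nat. (%x. f [^]\<^bsub>R\<^esub> n *[R] x) ` ?Z"
  have U: "submod K R (?U n)" for n
    unfolding submod_def
  proof (intro conjI ballI)
    show "?U n \<subseteq> carrier R" using f by auto
    show "0[R] : ?U n" using f by (intro image_eqI[of _ _ "0[R]"]) auto
  next
    fix x y assume "x : ?U n" "y : ?U n"
    then obtain u v where "u : ?Z" "x = f [^]\<^bsub>R\<^esub> n *[R] u" "v : ?Z" "y = f [^]\<^bsub>R\<^esub> n *[R] v" by blast
    then show "x +[R] y : ?U n" using f
      by (intro image_eqI[of _ _ "u +[R] v"]) (auto simp: R.r_distr R.l_distr)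
  next
    fix c x assume c: "c :. K" and "x : ?U n"
    then obtain u where "u : ?Z" "x = f [^]\<^bsub>R\<^esub> n *[R] u" by blast
    then show "c .[R] x : ?U n" using f c
      by (intro image_eqI[of _ _ "c .[R] u"])
        (auto simp: fd_algebra.smult_mult_left[OF K] fd_algebra.smult_mult_right[OF K] V.smult_closed)
  qed
  have step: "?U (Suc n) \<subseteq> ?U n" for n
  proof
    fix x assume "x : ?U (Suc n)"
    then obtain u where u: "u :. R" "f *[R] u = u *[R] f" and x: "x = f [^]\<^bsub>R\<^esub> Suc n *[R] u" by blast
    have "f *[R] (f *[R] u) = f *[R] (u *[R] f)" by (simp only: u(2))
    also have "... = (f *[R] u) *[R] f" by (rule R.m_assoc[symmetric]) (use f u in auto)
    finally have "f *[R] u : ?Z" using f u(1) by simp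
    moreover have "x = f [^]\<^bsub>R\<^esub> n *[R] (f *[R] u)" unfolding x using f u(1) by (simp add: R.m_assoc)
    ultimately show "x : ?U n" by blast
  qed
  have mono: "?U m \<subseteq> ?U n" if "n <= m" for n m by (rule lift_Suc_antimono_le[of ?U, OF step that])
  obtain m b \<beta> where H: "(ALL i<m::nat. b i :. R & \<beta> i : Hom K R (regular K)) &
    (ALL x:carrier R. (\<Oplus>\<^bsub>R\<^esub>i\<in>{..<m}. \<beta> i x .[R] b i) = x)"
    using V.dual_basis[OF fd_algebraD(7)[OF K]] by blast
  have "EX n. ALL m>=n. ?U m = ?U n"
  proof (rule V.descending_chain[of "\<beta> ` {..<m}" ?U])
    fix x assume x0: "x : ?U 0" and z: "ALL \<mu>:\<beta> ` {..<m}. \<mu> x = 0[K]"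
    then have x: "x :. R" using f by auto
    have "(\<Oplus>\<^bsub>R\<^esub>i\<in>{..<m}. \<beta> i x .[R] b i) = (\<Oplus>\<^bsub>R\<^esub>i\<in>{..<m}. 0[R])"
      using H z by (intro R.finsum_cong') (auto simp: V.smult_zero_left)
    then show "x = 0[R]" using H x by simp
  qed (use H U mono in auto)
  then obtain n where "?U (Suc n) = ?U n" by (meson le_SucI order_refl)
  moreover have "f [^]\<^bsub>R\<^esub> n : ?U n" using f by (intro image_eqI[of _ _ "1[R]"]) auto
  ultimately obtain h where h: "h : ?Z" "f [^]\<^bsub>R\<^esub> n = f [^]\<^bsub>R\<^esub> Suc n *[R] h" by blast
  then show "EX n h. h :. R & f *[R] h = h *[R] f & f [^]\<^bsub>R\<^esub> n = f [^]\<^bsub>R\<^esub> Suc n *[R] h" by blast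
qed

section \<open>Primitive idempotents and basic algebras\<close>

definition primitive_idem :: "('a, 'z) ring_scheme => 'a => bool" where
  "primitive_idem R e \<longleftrightarrow> e :. R & e ~= 0[R] & e *[R] e = e &
     (ALL p:carrier R. e *[R] p = p & p *[R] e = p & p *[R] p = p --> p = 0[R] \<or> p = e)"

text \<open>For a suitable \<open>N\<close>, \<open>x^N h^N\<close> is an idempotent below
  \<open>e\<close>, hence \<open>0\<close> or \<open>e\<close>. The first case makes
  \<open>x\<close> nilpotent, the second makes it invertible in \<open>e R e\<close>.\<close>

lemma (in ring) corner_nil_or_unit:
  assumes spr: "strongly_pi_regular R" and e: "primitive_idem R e"
    and x: "x :. R" "e \<otimes> x = x" "x \<otimes> e = x"
  shows "(EX n::nat. x [^] n = \<zero>) \<or> (EX g:carrier R. e \<otimes> g = g & g \<otimes> e = g & x \<otimes> g = e)"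
proof -
  have ee: "e :. R" "e \<otimes> e = e" using e by (auto simp: primitive_idem_def)
  obtain n h where h: "h :. R" "x \<otimes> h = h \<otimes> x" "x [^] (n::nat) = x [^] Suc n \<otimes> h"
    using spr x(1) unfolding strongly_pi_regular_def by blast
  \<comment> \<open>The exponent must be positive for \<open>e\<close> to fix the power on both
    sides, since the zeroth power is \<open>\<one>\<close>.\<close>
  let ?N = "Suc n"
  have hx: "h \<otimes> x [^] (m::nat) = x [^] m \<otimes> h" for m
  proof (induction m)
    case (Suc m)
    have "h \<otimes> x [^] Suc m = x [^] m \<otimes> (h \<otimes> x)" using Suc h(1) x(1) by (simp add: m_assoc[symmetric])
    also have "... = x [^] Suc m \<otimes> h" using h x(1) by (simp add: h(2)[symmetric] m_assoc)
    finally show ?case .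
  qed (use h in simp)
  have hxp: "h [^] (k::nat) \<otimes> x [^] (m::nat) = x [^] m \<otimes> h [^] k" for k m
  proof (induction k)
    case (Suc k)
    have "h [^] Suc k \<otimes> x [^] m = h [^] k \<otimes> (x [^] m \<otimes> h)" using h(1) x(1) by (simp add: m_assoc hx)
    also have "... = x [^] m \<otimes> h [^] Suc k" using Suc h(1) x(1) by (simp add: m_assoc[symmetric])
    finally show ?case .
  qed (use x in simp)
  \<comment> \<open>Iterating \<open>x^n = x^(n+1) h\<close> trades further powers of
    \<open>x\<close> for powers of \<open>h\<close>.\<close>
  have st: "x [^] ?N = x [^] (?N + k) \<otimes> h [^] (k::nat)" for k
  proof (induction k)
    case (Suc k)
    have "x [^] (?N + k) = x [^] (Suc k + n)" by (simp add: add.commute)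
    also have "... = x [^] Suc k \<otimes> x [^] n" by (rule nat_pow_mult[OF x(1), symmetric])
    also have "... = x [^] Suc k \<otimes> (x [^] Suc n \<otimes> h)" using h(3) by simp
    also have "... = x [^] (?N + Suc k) \<otimes> h"
    proof -
      have "x [^] Suc k \<otimes> x [^] Suc n = x [^] (?N + Suc k)" using x(1) by (subst nat_pow_mult) (auto simp: add.commute)
      then show ?thesis using x(1) h(1) by (simp add: m_assoc[symmetric] del: nat_pow_Suc)
    qed
    finally have a: "x [^] (?N + k) = x [^] (?N + Suc k) \<otimes> h" .
    have "x [^] ?N = x [^] (?N + Suc k) \<otimes> h \<otimes> h [^] k" unfolding a[symmetric] by (rule Suc)
    also have "... = x [^] (?N + Suc k) \<otimes> h [^] Suc k"
      using h(1) x(1) nat_pow_Suc2[OF h(1), of k] by (simp add: m_assoc del: nat_pow_Suc)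
    finally show ?case .
  qed (use x in simp)
  let ?y = "x [^] ?N" and ?k = "h [^] ?N"
  have yk: "?y :. R" "?k :. R" using x h by auto
  have kyc: "?k \<otimes> ?y = ?y \<otimes> ?k" by (rule hxp)
  have yy: "?y = ?y \<otimes> (?y \<otimes> ?k)"
  proof -
    have "?y = x [^] (?N + ?N) \<otimes> ?k" by (rule st)
    also have "x [^] (?N + ?N) = ?y \<otimes> ?y" using x(1) by (subst nat_pow_mult) auto
    finally show ?thesis using yk by (simp add: m_assoc del: nat_pow_Suc)
  qed
  let ?p = "?y \<otimes> ?k"
  have p: "?p :. R" using yk by simp
  have ey: "e \<otimes> ?y = ?y" using x ee nat_pow_Suc2[OF x(1), of n] by (simp add: m_assoc[symmetric] del: nat_pow_Suc)
  have ye: "?y \<otimes> e = ?y" using x ee by (simp add: m_assoc)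
  have "?p \<otimes> ?p = ?y \<otimes> (?k \<otimes> ?y) \<otimes> ?k" using yk by (simp add: m_assoc del: nat_pow_Suc)
  also have "... = (?y \<otimes> (?y \<otimes> ?k)) \<otimes> ?k" using yk kyc by simp
  also have "... = ?p" using yy by simp
  finally have pp: "?p \<otimes> ?p = ?p" .
  have ep: "e \<otimes> ?p = ?p" using yk ey ee by (simp add: m_assoc[symmetric] del: nat_pow_Suc)
  have "?p \<otimes> e = ?k \<otimes> (?y \<otimes> e)" using yk ee kyc[symmetric] by (simp add: m_assoc del: nat_pow_Suc)
  then have pe: "?p \<otimes> e = ?p" using ye kyc by simp
  from e p pp ep pe consider "?p = \<zero>" | "?p = e" by (auto simp: primitive_idem_def)
  then show ?thesis
  proof cases
    case 1
    then have "?y = \<zero>" using yy yk by simp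
    then show ?thesis by blast
  next
    case 2
    \<comment> \<open>As \<open>x^N h^N = e\<close>, the inverse of \<open>x\<close> is
      \<open>x^n h^N\<close>, trimmed by \<open>e\<close> on both sides to lie in the
      corner.\<close>
    let ?g = "e \<otimes> (x [^] n \<otimes> (?k \<otimes> e))"
    have c: "x [^] n :. R" using x by simp
    have "x \<otimes> ?g = (x \<otimes> x [^] n) \<otimes> (?k \<otimes> e)" using x ee c yk by (simp add: m_assoc[symmetric] del: nat_pow_Suc)
    also have "x \<otimes> x [^] n = ?y" using nat_pow_Suc2[OF x(1), of n] by simp
    also have "?y \<otimes> (?k \<otimes> e) = e" using 2 pe yk ee by (simp add: m_assoc[symmetric] del: nat_pow_Suc)
    finally have xg: "x \<otimes> ?g = e" .
    have "e \<otimes> ?g = ?g" using ee c yk by (simp add: m_assoc[symmetric] del: nat_pow_Suc)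
    moreover have "?g \<otimes> e = ?g" using ee c yk by (simp add: m_assoc del: nat_pow_Suc)
    ultimately show ?thesis using xg ee c yk by (intro disjI2 bexI[of _ ?g]) auto
  qed
qed

text \<open>The last clause says that the projectives \<open>R (e i)\<close> are pairwise
  non-isomorphic: \<open>x\<close> and \<open>y\<close> would be mutually inverse maps, given as
  elements of \<open>e i R e j\<close> and \<open>e j R e i\<close>.\<close>

definition basic_family :: "('a, 'z) ring_scheme => nat => (nat => 'a) => bool" where
  "basic_family R n e \<longleftrightarrow> (ALL i<n. primitive_idem R (e i)) &
     (ALL i<n. ALL j<n. i ~= j --> e i *[R] e j = 0[R]) & (\<Oplus>\<^bsub>R\<^esub>i\<in>{..<n}. e i) = 1[R] &
     (ALL i<n. ALL j<n. i ~= j --> \<not> (EX x:carrier R. EX y:carrier R.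
        e i *[R] x = x & x *[R] e j = x & e j *[R] y = y & y *[R] e i = y &
        x *[R] y = e i & y *[R] x = e j))"

text \<open>If some \<open>r x e i\<close> were not nilpotent, it would be invertible in its corner,
  and \<open>r\<close> would have a right inverse \<open>y\<close> in \<open>e j R e i\<close>. Then
  \<open>y r\<close> is a nonzero idempotent below \<open>e j\<close>, hence equal to
  \<open>e j\<close>, which contradicts non-isomorphism.\<close>

lemma (in ring) off_diagonal_jac:
  assumes spr: "strongly_pi_regular R" and fam: "basic_family R n e"
    and ij: "i < n" "j < n" "i ~= j" and r: "r :. R" "e i \<otimes> r = r" "r \<otimes> e j = r"
  shows "r : jac R"
proof (rule jac_if_nil[OF r(1)])
  fix x assume x: "x :. R"
  have pi: "primitive_idem R (e i)" and pj: "primitive_idem R (e j)" using fam ij by (auto simp: basic_family_def)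
  have ei: "e i :. R" "e i \<otimes> e i = e i" "e i ~= \<zero>" and ej: "e j :. R" "e j \<otimes> e j = e j"
    using pi pj by (auto simp: primitive_idem_def)
  have erx: "e i \<otimes> (r \<otimes> x) = r \<otimes> x" using r ei x by (simp add: m_assoc[symmetric])
  let ?a = "r \<otimes> x \<otimes> e i"
  have a: "?a :. R" "e i \<otimes> ?a = ?a" "?a \<otimes> e i = ?a"
    using r x ei erx by (simp_all add: m_assoc) (simp add: m_assoc[symmetric])
  show "EX n::nat. (r \<otimes> x) [^] n = \<zero>"
  proof (cases "EX n::nat. ?a [^] n = \<zero>")
    case True
    then obtain N where "?a [^] (N::nat) = \<zero>" by blast
    then have "(e i \<otimes> (r \<otimes> x) \<otimes> e i) [^] N = \<zero>" using erx by simp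
    from nil_corner[OF ei(1,2) _ this] have "(r \<otimes> x) [^] Suc N = \<zero>" using r x erx by simp
    then show ?thesis by blast
  next
    case False
    then obtain g where g: "g :. R" "e i \<otimes> g = g" "g \<otimes> e i = g" "?a \<otimes> g = e i"
      using corner_nil_or_unit[OF spr pi a] by blast
    let ?y = "e j \<otimes> (x \<otimes> g)"
    have y: "?y :. R" "e j \<otimes> ?y = ?y" "?y \<otimes> e i = ?y"
    proof -
      show "?y :. R" using ej x g by simp
      show "e j \<otimes> ?y = ?y" using ej x g(1) by (simp add: m_assoc[symmetric])
      show "?y \<otimes> e i = ?y" using ej x g ei by (simp add: m_assoc)
    qed
    have ry: "r \<otimes> ?y = e i"
    proof -
      have "r \<otimes> ?y = (r \<otimes> e j) \<otimes> (x \<otimes> g)" by (rule m_assoc[symmetric]) (use r ej x g in auto)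
      also have "... = r \<otimes> x \<otimes> (e i \<otimes> g)" using r x g by (simp add: m_assoc)
      also have "... = ?a \<otimes> g" using r x g ei by (simp add: m_assoc)
      finally show ?thesis using g by simp
    qed
    let ?p = "?y \<otimes> r"
    have p: "?p :. R" "e j \<otimes> ?p = ?p" "?p \<otimes> e j = ?p"
    proof -
      show "?p :. R" using y r by simp
      show "e j \<otimes> ?p = ?p" using y(1,2) r(1) ej by (metis m_assoc)
      show "?p \<otimes> e j = ?p" using y(1) r ej by (metis m_assoc)
    qed
    have "?p \<otimes> ?p = ?y \<otimes> ((r \<otimes> ?y) \<otimes> r)" using y(1) r(1) by (simp add: m_assoc)
    also have "... = ?p" unfolding ry using r by simp
    finally have pp: "?p \<otimes> ?p = ?p" .
    have "?p ~= \<zero>"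
    proof
      assume z: "?p = \<zero>"
      have "e i = (r \<otimes> ?y) \<otimes> (r \<otimes> ?y)" using ry ei by simp
      also have "... = r \<otimes> (?p \<otimes> ?y)" using y(1) r(1) by (simp add: m_assoc)
      also have "... = \<zero>" using z y(1) r(1) by simp
      finally show False using ei by simp
    qed
    then have "?p = e j" using pj p pp by (auto simp: primitive_idem_def)
    then show ?thesis using fam ij r y ry unfolding basic_family_def by blast
  qed
qed

text \<open>
  The exchange argument: in a basic algebra an idempotent \<open>\<epsilon>\<close> that lies in the trace ideal of \<open>W\<close>
  already factors through a single copy of \<open>W\<close>. The primitive idempotents that do not factor
  through \<open>W\<close> contribute to \<open>\<epsilon>\<close> only modulo the Jacobson radical, and so do the off-diagonal terms
  in the sum of the factorizations of the others.
\<close>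

lemma basic_idem_factor:
  assumes K: "fd_algebra K R" and fam: "basic_family R n e" and W: "left_module R W"
    and eps: "\<epsilon> *[R] \<epsilon> = \<epsilon>"
    and w: "!!l. l < m ==> w l :. W" and \<beta>: "!!l. l < m ==> \<beta> l : Hom R W (regular R)"
    and sum: "(\<Oplus>\<^bsub>R\<^esub>l\<in>{..<m::nat}. \<beta> l (w l)) = \<epsilon>"
  shows "EX w:carrier W. EX \<beta>:Hom R W (regular R). \<epsilon> *[R] \<beta> w *[R] \<epsilon> = \<epsilon>"
proof -
  interpret R: ring R using fd_algebraD(4)[OF K] .
  interpret W: left_module R W by fact
  note spr = strongly_pi_regular_fd[OF K]
  let ?H = "Hom R W (regular R)"
  note lreg = left_module_regular[OF R.ring_axioms]
  have hcl: "\<beta> x :. R" if "\<beta> : ?H" "x :. W" for \<beta> x using hom_closed[OF that] by simp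
  have hsm: "\<beta> (r .[W] x) = r *[R] \<beta> x" if "\<beta> : ?H" "r :. R" "x :. W" for \<beta> r x
    using hom_smult[OF that] by simp
  have rm: "(\<lambda>x\<in>carrier W. \<beta> x *[R] r) : ?H" if "\<beta> : ?H" "r :. R" for \<beta> r
    by (rule hom_setI)
      (simp_all add: that hcl[OF that(1)] hsm[OF that(1)] hom_add[OF that(1)] W.smult_closed R.l_distr R.m_assoc)
  have pe: "primitive_idem R (e i)" if "i < n" for i using fam that by (simp add: basic_family_def)
  have e: "e i :. R" "e i *[R] e i = e i" if "i < n" for i using pe[OF that] by (auto simp: primitive_idem_def)
  have eps_c: "\<epsilon> :. R" unfolding sum[symmetric] using hcl[OF \<beta> w] by (intro R.finsum_closed) auto
  define J where "J = {i. i < n & (EX x:carrier W. EX b:?H. e i *[R] b x *[R] e i = e i)}"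
  have Jn: "i < n" if "i : J" for i using that by (simp add: J_def)
  have finJ: "finite J" by (simp add: J_def)
  have "ALL i. EX x b. i : J --> x :. W & b : ?H & e i *[R] b x *[R] e i = e i"
    unfolding J_def by blast
  then obtain x b where xb: "!!i. i : J ==> x i :. W & b i : ?H & e i *[R] b i (x i) *[R] e i = e i"
    by metis
  then have x: "!!i. i : J ==> x i :. W" and b: "!!i. i : J ==> b i : ?H"
    and bx: "!!i. i : J ==> e i *[R] b i (x i) *[R] e i = e i" by auto
  \<comment> \<open>Cutting down by idempotents puts \<open>b' j (x' i)\<close> into
    \<open>e i R e j\<close>, where elements with distinct indices are radical.\<close>
  define x' where "x' i = e i .[W] x i" for i
  define b' where "b' i = (\<lambda>y\<in>carrier W. b i y *[R] e i)" for i
  have x': "x' i :. W" if "i : J" for i unfolding x'_def using x e Jn that by (simp add: W.smult_closed)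
  have b': "b' i : ?H" if "i : J" for i unfolding b'_def using rm b e Jn that by simp
  have bx': "b' j (x' i) = e i *[R] b j (x i) *[R] e j" if "i : J" "j : J" for i j
    using x'[OF that(1)] hsm[OF b[OF that(2)] e(1)[OF Jn[OF that(1)]] x[OF that(1)]] by (simp add: b'_def x'_def)
  have bxc: "b' j (x' i) :. R" if "i : J" "j : J" for i j using hcl[OF b'[OF that(2)] x'[OF that(1)]] .
  have agH: "abelian_group (hom_space R W (regular R))" by (rule hom_space_module(2)[OF K W lreg])
  interpret H: abelian_group "hom_space R W (regular R)" by (rule agH)
  let ?b = "finsum (hom_space R W (regular R)) b' J" and ?x = "\<Oplus>\<^bsub>W\<^esub>i\<in>J. x' i"
  have bH: "?b : ?H" using H.finsum_closed[of b' J] b' by auto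
  have xW: "?x :. W" using x' by (intro W.M.finsum_closed) auto
  have beval: "?b y = (\<Oplus>\<^bsub>R\<^esub>j\<in>J. b' j y)" if "y :. W" for y
    using hom_space_finsum[OF agH, of y J b'] R.abelian_group_axioms b' that by simp
  \<comment> \<open>The diagonal term is \<open>e j\<close> itself; all others are off-diagonal and
    hence in the radical.\<close>
  have "EX r. r : jac R & b' j ?x = e j +[R] r" if j: "j : J" for j
  proof -
    have "b' j ?x = (\<Oplus>\<^bsub>R\<^esub>i\<in>J. b' j (x' i))"
      using hom_finsum[OF b'[OF j] W.M_group, of x' J] R.abelian_group_axioms x' by auto
    also have "... = (\<Oplus>\<^bsub>R\<^esub>i\<in>insert j (J - {j}). b' j (x' i))" using j by (simp add: insert_absorb)
    also have "... = b' j (x' j) +[R] (\<Oplus>\<^bsub>R\<^esub>i\<in>J - {j}. b' j (x' i))"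
      using finJ bxc j by (intro R.finsum_insert) auto
    also have "b' j (x' j) = e j" using bx' bx j by simp
    finally have 1: "b' j ?x = e j +[R] (\<Oplus>\<^bsub>R\<^esub>i\<in>J - {j}. b' j (x' i))" .
    have "(\<Oplus>\<^bsub>R\<^esub>i\<in>J - {j}. b' j (x' i)) : jac R"
    proof (rule R.jac_finsum)
      fix i assume "i : J - {j}"
      then have i: "i : J" "i ~= j" by auto
      have c: "b j (x i) :. R" by (rule hcl[OF b[OF j] x[OF i(1)]])
      show "b' j (x' i) : jac R"
        by (rule R.off_diagonal_jac[OF spr fam Jn[OF i(1)] Jn[OF j] i(2)])
          (use c e[OF Jn[OF i(1)]] e[OF Jn[OF j]] in
            \<open>simp_all add: bx'[OF i(1) j] R.m_assoc\<close>, simp add: R.m_assoc[symmetric])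
    qed
    then show ?thesis using 1 by blast
  qed
  then obtain r where r: "!!j. j : J ==> r j : jac R" "!!j. j : J ==> b' j ?x = e j +[R] r j" by metis
  let ?eJ = "\<Oplus>\<^bsub>R\<^esub>j\<in>J. e j" and ?r = "\<Oplus>\<^bsub>R\<^esub>j\<in>J. r j"
  have eJ: "?eJ :. R" using e Jn by (intro R.finsum_closed) auto
  have rJ: "?r : jac R" using r(1) by (rule R.jac_finsum)
  note rc = R.jac_closed[OF rJ]
  have "?b ?x = (\<Oplus>\<^bsub>R\<^esub>j\<in>J. e j +[R] r j)"
    unfolding beval[OF xW] using r e Jn R.jac_closed by (intro R.finsum_cong') auto
  also have "... = ?eJ +[R] ?r" using r e Jn R.jac_closed by (intro R.finsum_addf) auto
  finally have bxJ: "?b ?x = ?eJ +[R] ?r" .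
  \<comment> \<open>For an index outside \<open>J\<close> no element \<open>e i (c y u) e i\<close>
    is invertible in the corner, since the inverse could be absorbed into the homomorphism. So all
    these elements are nilpotent.\<close>
  have out: "e i *[R] c y : jac R" if i: "i < n" "i \<notin> J" and c: "c : ?H" and y: "y :. W" for i c y
  proof (rule R.jac_if_nil)
    note ei = e[OF i(1)] and cy = hcl[OF c y]
    show "e i *[R] c y :. R" using ei cy by simp
    fix u assume u: "u :. R"
    let ?a = "e i *[R] (c y *[R] u) *[R] e i"
    have a: "?a :. R" "e i *[R] ?a = ?a" "?a *[R] e i = ?a"
      using ei cy u by (simp_all add: R.m_assoc) (simp add: R.m_assoc[symmetric])
    have nil: "EX N::nat. ?a [^]\<^bsub>R\<^esub> N = 0[R]"
    proof (rule ccontr)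
      assume "\<not> ?thesis"
      then obtain g where g: "g :. R" "e i *[R] g = g" "g *[R] e i = g" "?a *[R] g = e i"
        using R.corner_nil_or_unit[OF spr pe[OF i(1)] a] by blast
      let ?c = "\<lambda>y\<in>carrier W. c y *[R] (u *[R] g)"
      have "e i *[R] ?c y *[R] e i = ?a *[R] g"
        using ei cy u g y by (simp add: R.m_assoc)
      then have "e i *[R] ?c y *[R] e i = e i" using g by simp
      then have "i : J" unfolding J_def using i(1) y rm[OF c, of "u *[R] g"] u g by blast
      then show False using i by simp
    qed
    then obtain N where "?a [^]\<^bsub>R\<^esub> (N::nat) = 0[R]" by blast
    from R.nil_corner[OF ei _ this] have "(e i *[R] c y *[R] u) [^]\<^bsub>R\<^esub> Suc N = 0[R]"
      using cy u ei by (simp add: R.m_assoc)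
    then show "EX N::nat. (e i *[R] c y *[R] u) [^]\<^bsub>R\<^esub> N = 0[R]" by blast
  qed
  have out_eps: "e i *[R] \<epsilon> : jac R" if i: "i < n" "i \<notin> J" for i
  proof -
    interpret Rm: left_module R "regular R" by (rule lreg)
    have "e i *[R] \<epsilon> = (\<Oplus>\<^bsub>R\<^esub>l\<in>{..<m}. e i *[R] \<beta> l (w l))"
      unfolding sum[symmetric] using Rm.smult_finsum[of "e i" "%l. \<beta> l (w l)" "{..<m}"] e[OF i(1)] hcl[OF \<beta> w] by auto
    also have "... : jac R" using out[OF i \<beta> w] by (intro R.jac_finsum) auto
    finally show ?thesis .
  qed
  let ?s = "\<Oplus>\<^bsub>R\<^esub>i\<in>{..<n} - J. e i *[R] \<epsilon>"
  have sJ: "?s : jac R" using out_eps by (intro R.jac_finsum) auto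
  note sc = R.jac_closed[OF sJ]
  have "\<epsilon> = (\<Oplus>\<^bsub>R\<^esub>i\<in>{..<n}. e i) *[R] \<epsilon>" using fam eps_c by (simp add: basic_family_def)
  also have "(\<Oplus>\<^bsub>R\<^esub>i\<in>{..<n}. e i) = (\<Oplus>\<^bsub>R\<^esub>i\<in>J \<union> ({..<n} - J). e i)" using Jn by (intro arg_cong[where f = "finsum R e"]) auto
  also have "... = ?eJ +[R] (\<Oplus>\<^bsub>R\<^esub>i\<in>{..<n} - J. e i)"
    using finJ e Jn by (intro R.finsum_Un_disjoint) auto
  also have "... *[R] \<epsilon> = ?eJ *[R] \<epsilon> +[R] ?s"
  proof -
    interpret Rm: left_module R "regular R" by (rule lreg)
    have "(\<Oplus>\<^bsub>R\<^esub>i\<in>{..<n} - J. e i) :. R" using e by (intro R.finsum_closed) auto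
    moreover have "(\<Oplus>\<^bsub>R\<^esub>i\<in>{..<n} - J. e i) *[R] \<epsilon> = ?s"
      using Rm.finsum_smult[of \<epsilon> e "{..<n} - J"] eps_c e by auto
    ultimately show ?thesis using eJ eps_c by (simp add: R.l_distr)
  qed
  finally have eps1: "\<epsilon> = ?eJ *[R] \<epsilon> +[R] ?s" .
  let ?t = "?b ?x"
  have tc: "?t :. R" by (rule hcl[OF bH xW])
  let ?rr = "?s -[R] ?r *[R] \<epsilon>"
  have \<rho>0: "?rr : jac R" unfolding a_minus_def using sJ rJ eps_c by (intro R.jac_add R.jac_neg R.jac_rmult)
  have eps2: "\<epsilon> = ?t *[R] \<epsilon> +[R] ?rr"
  proof -
    let ?u = "?eJ *[R] \<epsilon>" and ?v = "?r *[R] \<epsilon>"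
    have uv: "?u :. R" "?v :. R" using eJ rc eps_c by auto
    have "?t *[R] \<epsilon> +[R] ?rr = (?u +[R] ?v) +[R] (?s -[R] ?v)"
      unfolding bxJ using eJ rc eps_c by (simp add: R.l_distr)
    also have "... = ?u +[R] ?s" using uv sc by (simp add: a_minus_def R.a_assoc R.a_lcomm[of ?v] R.r_neg)
    finally show ?thesis using eps1 by simp
  qed
  let ?\<rho> = "\<epsilon> *[R] ?rr"
  have \<rho>J: "?\<rho> : jac R" by (rule R.jac_lmult[OF \<rho>0 eps_c])
  note \<rho>0c = R.jac_closed[OF \<rho>0] and \<rho>c = R.jac_closed[OF \<rho>J]
  let ?tt = "\<epsilon> *[R] ?t *[R] \<epsilon>"
  have t0c: "?tt :. R" using eps_c tc by simp
  have "\<epsilon> = \<epsilon> *[R] (?t *[R] \<epsilon> +[R] ?rr)" by (simp only: eps2[symmetric] eps)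
  also have "... = ?tt +[R] ?\<rho>"
    using eps_c tc \<rho>0c R.r_distr[of "?t *[R] \<epsilon>" ?rr \<epsilon>] by (simp add: R.m_assoc)
  finally have eps3: "\<epsilon> = ?tt +[R] ?\<rho>" .
  have e\<rho>: "\<epsilon> *[R] ?\<rho> = ?\<rho>" using eps eps_c \<rho>0c by (simp add: R.m_assoc[symmetric])
  have unit: "1[R] -[R] ?\<rho> : Units R" using \<rho>J R.one_closed \<rho>c unfolding jac_def by (metis (no_types, lifting) R.r_one mem_Collect_eq)
  then obtain g where g: "g :. R" "(1[R] -[R] ?\<rho>) *[R] g = 1[R]" by (auto simp: Units_def)
  have t0: "?tt = \<epsilon> *[R] (1[R] -[R] ?\<rho>)"
  proof -
    have "\<epsilon> *[R] (1[R] -[R] ?\<rho>) = \<epsilon> -[R] ?\<rho>"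
    proof -
      have "\<epsilon> *[R] (1[R] -[R] u) = \<epsilon> -[R] u" if "u :. R" "\<epsilon> *[R] u = u" for u
        using that eps_c by (simp add: a_minus_def R.r_distr R.r_minus)
      from this[OF \<rho>c e\<rho>] show ?thesis .
    qed
    also have "\<epsilon> -[R] ?\<rho> = (?tt +[R] ?\<rho>) -[R] ?\<rho>" using eps3 by simp
    also have "... = ?tt" using t0c \<rho>c by (simp add: a_minus_def R.a_assoc R.r_neg)
    finally show ?thesis by simp
  qed
  have t0g: "?tt *[R] g = \<epsilon>" unfolding t0 using g eps_c \<rho>c by (simp add: R.m_assoc)
  \<comment> \<open>The homomorphism is corrected on the right: \<open>g\<close> inverts
    \<open>1 - \<rho>\<close>, and
    \<open>\<epsilon> t \<epsilon> = \<epsilon> (1 - \<rho>)\<close>.\<close>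
  let ?c = "\<lambda>y\<in>carrier W. ?b y *[R] (\<epsilon> *[R] g *[R] \<epsilon>)"
  have "\<epsilon> *[R] ?c ?x *[R] \<epsilon> = (?tt *[R] g) *[R] (\<epsilon> *[R] \<epsilon>)"
    using xW tc eps_c g by (simp add: R.m_assoc)
  also have "... = \<epsilon>" by (simp only: t0g eps)
  finally show ?thesis using xW rm[OF bH, of "\<epsilon> *[R] g *[R] \<epsilon>"] eps_c g by (intro bexI[of _ ?x] bexI[of _ ?c]) auto
qed

subsection \<open>Endomorphism algebras\<close>

lemma end_alg_simps [simp]:
  "carrier (end_alg A M) = Hom A M M" "0[end_alg A M] = (\<lambda>x\<in>carrier M. 0[M])"
  "1[end_alg A M] = (\<lambda>x\<in>carrier M. x)" "f *[end_alg A M] g = compose (carrier M) f g"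
  "f +[end_alg A M] g = (\<lambda>x\<in>carrier M. f x +[M] g x)"
  "c .[end_alg A M] f = (\<lambda>x\<in>carrier M. scal A M c (f x))"
  by (simp_all add: end_alg_def hom_space_def)

lemma finsum_end_alg [simp]: "finsum (end_alg A M) = finsum (hom_space A M M)"
  by (simp add: end_alg_def hom_space_def finsum_def finprod_def fun_eq_iff)

lemma fd_algebra_end_alg:
  assumes K: "fd_algebra K A" and M: "fdm K A M"
  shows "fd_algebra K (end_alg A M)"
proof -
  note lM = fdmD(1)[OF M]
  interpret M: left_module A M by (rule lM)
  interpret H: left_module K "hom_space A M M" by (rule hom_space_module(1)[OF K lM lM])
  have K': "ring K" using fd_algebraD(3)[OF K] .
  have "left_module K (end_alg A M)"
  proof (rule left_moduleI)
    show "abelian_group (end_alg A M)" by (rule abelian_group_cong[OF H.M_group]) auto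
  qed (use K' H.smult_closed H.smult_l_distr H.smult_r_distr H.smult_assoc1 H.smult_one in simp_all)
  moreover have "ring (end_alg A M)"
  proof (rule ringI)
    show "abelian_group (end_alg A M)" by (rule abelian_group_cong[OF H.M_group]) auto
    show "Group.monoid (end_alg A M)"
    proof (rule monoidI)
      fix f g h assume "f :. (end_alg A M)" "g :. (end_alg A M)" "h :. (end_alg A M)"
      then have fgh: "f : Hom A M M" "g : Hom A M M" "h : Hom A M M" by auto
      show "f *[end_alg A M] g *[end_alg A M] h = f *[end_alg A M] (g *[end_alg A M] h)"
        by (rule carrier_eqI[of _ M]) (simp_all add: compose_eq hom_closed[OF fgh(3)])
      show "1[end_alg A M] *[end_alg A M] f = f" "f *[end_alg A M] 1[end_alg A M] = f"
        by (rule carrier_eqI[of _ M]; simp add: compose_eq hom_closed[OF fgh(1)] hom_ext[OF fgh(1)])+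
    qed (use hom_compose[OF lM] hom_id[OF lM] in simp_all)
  qed (auto simp: compose_def hom_closed hom_add intro!: restrict_ext)
  moreover have "fin_gen K (end_alg A M)"
    using fin_gen_hom_space[OF K M M] by (simp add: fin_gen_def)
  ultimately show ?thesis
    using scal_module(2)[OF K lM]
    by (intro fd_algebraI fd_algebraD(1)[OF K])
      (auto simp: compose_def hom_closed hom_scal(2)[OF K] intro!: restrict_ext)
qed

text \<open>The idempotents are the projections onto the indecomposable summands \<open>N i\<close>.
  An idempotent below \<open>e k\<close> induces one on \<open>N k\<close>, whose image and kernel
  split \<open>N k\<close>; mutually inverse corner elements would make two summands
  isomorphic.\<close>

lemma basic_family_end_alg:
  fixes A :: "('k, 'a) module"
  assumes K: "fd_algebra K A" and M: "left_module A M" and b: "basic A M"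
  shows "EX n e. basic_family (end_alg A M) n e"
proof -
  interpret M: left_module A M by fact
  obtain n and N :: "nat => ('a, 'k list) module" where
    ind: "!!i. i < n ==> indecomposable A (N i)" and
    noniso: "!!i j. [|i < n; j < n; i ~= j|] ==> \<not> mod_iso A (N i) (N j)" and
    iso: "mod_iso A M (dsum n N)" using b unfolding basic_def by blast
  have fN: "fdm K A (N i)" if "i < n" for i
    using ind[OF that] fg_module_iff[OF K] unfolding indecomposable_def by blast
  note lN = fdmD(1)[OF fN] and agN = fdmD(3)[OF fN]
  obtain f g where fg: "isos A M (dsum n N) f g" using mod_iso_isos[OF M iso] by blast
  note i = isosD[OF fg]
  have R: "ring A" by (rule M.R.ring_axioms)
  interpret D: left_module A "dsum n N" by (rule left_module_dsum[OF R lN])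
  have dp: "dpr n N i : Hom A (dsum n N) (N i)" and di: "dinc n N i : Hom A (N i) (dsum n N)" if "i < n" for i
    using dpr_hom[of A n N i] dinc_hom[of A n N i] R lN that by blast+
  define \<alpha> where "\<alpha> i = compose (carrier M) (dpr n N i) f" for i
  define \<gamma> where "\<gamma> i = compose (carrier (N i)) g (dinc n N i)" for i
  have \<alpha>: "\<alpha> i : Hom A M (N i)" if "i < n" for i unfolding \<alpha>_def by (rule hom_compose[OF M i(1) dp[OF that]])
  have \<gamma>: "\<gamma> i : Hom A (N i) M" if "i < n" for i unfolding \<gamma>_def by (rule hom_compose[OF lN[OF that] di[OF that] i(2)])
  note \<alpha>c = hom_closed[OF \<alpha>] and \<gamma>c = hom_closed[OF \<gamma>]
  have \<alpha>\<gamma>: "\<alpha> j (\<gamma> i y) = (if j = i then y else 0[N j])" if "i < n" "j < n" "y :. (N i)" for i j y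
  proof -
    have c: "dinc n N i y :. (dsum n N)" using hom_closed[OF di[OF that(1)] that(3)] .
    have "\<alpha> j (\<gamma> i y) = dpr n N j (dinc n N i y)"
      using \<gamma>c[OF that(1,3)] that i(4)[OF c] by (simp add: \<alpha>_def compose_eq) (simp add: \<gamma>_def compose_eq i(4)[OF c])
    also have "... = (if j = i then y else 0[N j])" using c that by (simp add: dpr_def) (simp add: dinc_def)
    finally show ?thesis .
  qed
  have sum: "(\<Oplus>\<^bsub>M\<^esub>i\<in>{..<n}. \<gamma> i (\<alpha> i x)) = x" if x: "x :. M" for x
  proof -
    have fx: "f x :. (dsum n N)" using i(5)[OF x] .
    have fxi: "f x l :. (N l)" if "l < n" for l using fx that by auto
    have dc: "dinc n N l (f x l) :. (dsum n N)" if "l < n" for l using hom_closed[OF di[OF that] fxi[OF that]] .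
    have "(\<Oplus>\<^bsub>M\<^esub>l\<in>{..<n}. \<gamma> l (\<alpha> l x)) = (\<Oplus>\<^bsub>M\<^esub>l\<in>{..<n}. g (dinc n N l (f x l)))"
      using fx fxi x i(6)[OF dc] by (intro M.M.finsum_cong') (auto simp: \<alpha>_def \<gamma>_def compose_eq dpr_def)
    also have "... = g (\<Oplus>\<^bsub>dsum n N\<^esub>l\<in>{..<n}. dinc n N l (f x l))"
      using dc by (intro hom_finsum[OF i(2) D.M_group M.M_group, symmetric]) auto
    also have "... = x" using dsum_expand[OF R lN fx] i(3)[OF x] by simp
    finally show ?thesis .
  qed
  define e where "e i = compose (carrier M) (\<gamma> i) (\<alpha> i)" for i
  have eH: "e i : Hom A M M" if "i < n" for i unfolding e_def by (rule hom_compose[OF M \<alpha>[OF that] \<gamma>[OF that]])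
  have ex: "e i x = \<gamma> i (\<alpha> i x)" if "x :. M" for i x using that by (simp add: e_def compose_eq)
  have pw: "p (q x) = r x" if "compose (carrier M) p q = r" "x :. M" for p q r and x
    using that by (auto simp: compose_eq)
  have feq: "p = q" if "p : Hom A M M" "q : Hom A M M" "!!x. x :. M ==> p x = q x" for p q
    using that by (rule hom_eqI)
  have agH: "abelian_group (hom_space A M M)" by (rule hom_space_module(2)[OF K M M])
  have zH: "(\<lambda>x\<in>carrier M. 0[M]) : Hom A M M" using abelian_groupE(2)[OF agH] by simp
  have prim: "primitive_idem (end_alg A M) (e k)" if k: "k < n" for k
    unfolding primitive_idem_def end_alg_simps
  proof (intro conjI ballI impI)
    interpret N: left_module A "N k" by (rule lN[OF k])
    note \<alpha>k = \<alpha>c[OF k] and \<gamma>k = \<gamma>c[OF k]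
    show "e k : Hom A M M" by (rule eH[OF k])
    show "compose (carrier M) (e k) (e k) = e k"
      by (rule feq[OF hom_compose[OF M eH[OF k] eH[OF k]] eH[OF k]])
        (use \<alpha>k \<gamma>k \<alpha>\<gamma>[OF k k] in "simp add: compose_eq ex")
    show "e k ~= (\<lambda>x\<in>carrier M. 0[M])"
    proof
      assume z: "e k = (\<lambda>x\<in>carrier M. 0[M])"
      have "y = 0[N k]" if y: "y :. (N k)" for y
      proof -
        have "y = \<alpha> k (e k (\<gamma> k y))" using y \<gamma>k \<alpha>\<gamma>[OF k k] by (simp add: ex)
        also have "... = 0[N k]" using z \<gamma>k[OF y] hom_zero[OF \<alpha>[OF k] M.M_group agN[OF k]] by simp
        finally show ?thesis .
      qed
      then have "zero_module (N k)" unfolding zero_module_def using N.M.zero_closed by blast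
      then show False using ind[OF k] by (simp add: indecomposable_def)
    qed
    fix p assume p: "p : Hom A M M"
      and "compose (carrier M) (e k) p = p & compose (carrier M) p (e k) = p & compose (carrier M) p p = p"
    then have ep: "!!x. x :. M ==> e k (p x) = p x" and pe: "!!x. x :. M ==> p (e k x) = p x"
      and pp: "!!x. x :. M ==> p (p x) = p x" using pw by blast+
    note pc = hom_closed[OF p]
    define p' where "p' = compose (carrier (N k)) (compose (carrier M) (\<alpha> k) p) (\<gamma> k)"
    have p': "p' : Hom A (N k) (N k)" unfolding p'_def
      by (rule hom_compose[OF lN[OF k] \<gamma>[OF k] hom_compose[OF M p \<alpha>[OF k]]])
    have p'x: "p' y = \<alpha> k (p (\<gamma> k y))" if "y :. (N k)" for y
      using that \<gamma>k by (simp add: p'_def compose_eq)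
    note p'c = hom_closed[OF p']
    have p'p': "p' (p' y) = p' y" if y: "y :. (N k)" for y
    proof -
      have "p' (p' y) = \<alpha> k (p (e k (p (\<gamma> k y))))" using y p'c \<gamma>k pc by (simp add: p'x ex)
      also have "... = p' y" using y pc \<gamma>k by (simp add: pe pp p'x)
      finally show ?thesis .
    qed
    have pp'x: "p x = \<gamma> k (p' (\<alpha> k x))" if x: "x :. M" for x
    proof -
      have "\<gamma> k (p' (\<alpha> k x)) = e k (p (e k x))" using x \<alpha>k \<gamma>k pc by (simp add: p'x ex)
      also have "... = p x" using x pe ep by simp
      finally show ?thesis ..
    qed
    \<comment> \<open>Fixed points and kernel of the idempotent \<open>p'\<close> are complementary,
      so indecomposability of \<open>N k\<close> kills one of them.\<close>
    let ?U = "{y : carrier (N k). p' y = y}" and ?V = "{y : carrier (N k). p' y = 0[N k]}"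
    have p'0: "p' 0[N k] = 0[N k]" by (rule hom_zero[OF p' agN[OF k] agN[OF k]])
    have U: "submod A (N k) ?U" and V: "submod A (N k) ?V" using p'0
      by (simp_all add: submod_def subset_iff hom_add[OF p'] hom_smult[OF p'] N.smult_zero_right N.smult_closed)
    let ?L = "N k\<lparr>carrier := ?U\<rparr>" and ?L' = "N k\<lparr>carrier := ?V\<rparr>"
    have LL': "fg_module A ?L" "fg_module A ?L'"
      using fdm_submod[OF K fN[OF k] U] fdm_submod[OF K fN[OF k] V] fg_module_iff[OF K] by blast+
    let ?h = "\<lambda>y\<in>carrier (N k). (p' y, y -[N k] p' y)"
    have V1: "y -[N k] p' y : ?V" if y: "y :. (N k)" for y
      using y p'c by (simp add: hom_diff[OF p' agN[OF k] agN[OF k]] p'p') (simp add: a_minus_def N.M.r_neg)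
    have "?h : Hom A (N k) (prod_module ?L ?L')"
    proof (rule hom_setI)
      show "?h y :. (prod_module ?L ?L')" if "y :. (N k)" for y
        using V1[OF that] p'c[OF that] p'p'[OF that] that by simp
    qed (auto simp: p'c hom_add[OF p'] hom_smult[OF p'] N.smult_closed a_minus_def N.M.minus_add N.M.a_ac
        N.smult_r_distr N.smult_minus_right)
    moreover have "bij_betw ?h (carrier (N k)) (carrier (prod_module ?L ?L'))"
    proof (rule bij_betwI[where g = "%z. fst z +[N k] snd z"])
      show "?h : carrier (N k) \<rightarrow> carrier (prod_module ?L ?L')" using V1 p'c p'p' by auto
      show "(%z. fst z +[N k] snd z) : carrier (prod_module ?L ?L') \<rightarrow> carrier (N k)" by auto
      show "fst (?h y) +[N k] snd (?h y) = y" if "y :. (N k)" for y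
        using that p'c by (simp add: a_minus_def N.M.a_lcomm N.M.r_neg)
      show "?h (fst z +[N k] snd z) = z" if zc: "z :. (prod_module ?L ?L')" for z
      proof -
        obtain u v where z: "z = (u, v)" "u :. (N k)" "p' u = u" "v :. (N k)" "p' v = 0[N k]"
          using zc by (cases z) auto
        then have "p' (u +[N k] v) = u" by (simp add: hom_add[OF p'])
        then show ?thesis using z by (simp add: a_minus_def N.M.a_comm[of u v] N.M.a_assoc N.M.r_neg)
      qed
    qed
    ultimately have "mod_iso A (N k) (prod_module ?L ?L')" unfolding mod_iso_def by blast
    then have "zero_module ?L \<or> zero_module ?L'" using ind[OF k] LL' unfolding indecomposable_def by blast
    then show "p = (\<lambda>x\<in>carrier M. 0[M]) \<or> p = e k"
    proof
      assume z: "zero_module ?L"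
      have "p' y = 0[N k]" if "y :. (N k)" for y
      proof -
        have "p' y :. ?L" using p'p' p'c that by simp
        then show ?thesis using z unfolding zero_module_def by simp
      qed
      then have "p = (\<lambda>x\<in>carrier M. 0[M])"
        using \<alpha>k hom_zero[OF \<gamma>[OF k] agN[OF k] M.M_group]
        by (intro feq[OF p zH]) (simp add: pp'x)
      then show ?thesis ..
    next
      assume z: "zero_module ?L'"
      have "p' y = y" if y: "y :. (N k)" for y
      proof -
        have "y -[N k] p' y :. ?L'" using V1[OF y] by simp
        then have "y -[N k] p' y = 0[N k]" using z unfolding zero_module_def by simp
        then have "(y -[N k] p' y) +[N k] p' y = p' y" using y p'c by simp
        then show ?thesis using y p'c by (simp add: a_minus_def N.M.a_assoc N.M.l_neg)
      qed
      then have "p = e k" using \<alpha>k by (intro feq[OF p eH[OF k]]) (simp add: pp'x ex)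
      then show ?thesis ..
    qed
  qed
  have "basic_family (end_alg A M) n e"
    unfolding basic_family_def
  proof (intro conjI allI impI)
    show "primitive_idem (end_alg A M) (e k)" if "k < n" for k by (rule prim[OF that])
    show "e i *[end_alg A M] e j = 0[end_alg A M]" if ij: "i < n" "j < n" "i ~= j" for i j
      unfolding end_alg_simps
    proof (rule feq[OF hom_compose[OF M eH[OF ij(2)] eH[OF ij(1)]] zH])
      fix x assume x: "x :. M"
      then show "compose (carrier M) (e i) (e j) x = (\<lambda>x\<in>carrier M. 0[M]) x"
        using \<gamma>c[OF ij(2) \<alpha>c[OF ij(2) x]] \<alpha>\<gamma>[OF ij(2,1) \<alpha>c[OF ij(2) x]] ij(3)
          hom_zero[OF \<gamma>[OF ij(1)] agN[OF ij(1)] M.M_group]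
        by (simp add: compose_eq ex)
    qed
    show "finsum (end_alg A M) e {..<n} = 1[end_alg A M]"
      unfolding end_alg_simps finsum_end_alg
    proof (rule feq[OF _ hom_id[OF M]])
      interpret H: abelian_group "hom_space A M M" by (rule agH)
      show "finsum (hom_space A M M) e {..<n} : Hom A M M" using H.finsum_closed[of e "{..<n}"] eH by auto
      fix x assume x: "x :. M"
      have "finsum (hom_space A M M) e {..<n} x = (\<Oplus>\<^bsub>M\<^esub>i\<in>{..<n}. e i x)"
        using hom_space_finsum[OF agH M.M_group x, of "{..<n}" e] eH by simp
      also have "... = (\<lambda>x\<in>carrier M. x) x" using sum[OF x] x by (simp add: ex)
      finally show "finsum (hom_space A M M) e {..<n} x = (\<lambda>x\<in>carrier M. x) x" .
    qed
    show "\<not> (EX x:carrier (end_alg A M). EX y:carrier (end_alg A M).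
        e i *[end_alg A M] x = x & x *[end_alg A M] e j = x & e j *[end_alg A M] y = y &
        y *[end_alg A M] e i = y & x *[end_alg A M] y = e i & y *[end_alg A M] x = e j)"
      if ij: "i < n" "j < n" "i ~= j" for i j
    proof
      assume "EX x:carrier (end_alg A M). EX y:carrier (end_alg A M).
        e i *[end_alg A M] x = x & x *[end_alg A M] e j = x & e j *[end_alg A M] y = y &
        y *[end_alg A M] e i = y & x *[end_alg A M] y = e i & y *[end_alg A M] x = e j"
      then obtain x y where xy: "x : Hom A M M" "y : Hom A M M"
        "compose (carrier M) x (e j) = x" "compose (carrier M) y (e i) = y"
        "compose (carrier M) x y = e i" "compose (carrier M) y x = e j" by auto
      note xc = hom_closed[OF xy(1)] and yc = hom_closed[OF xy(2)]
      let ?u = "compose (carrier (N i)) (compose (carrier M) (\<alpha> j) y) (\<gamma> i)"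
      let ?v = "compose (carrier (N j)) (compose (carrier M) (\<alpha> i) x) (\<gamma> j)"
      have u: "?u : Hom A (N i) (N j)"
        by (rule hom_compose[OF lN[OF ij(1)] \<gamma>[OF ij(1)] hom_compose[OF M xy(2) \<alpha>[OF ij(2)]]])
      have v: "?v : Hom A (N j) (N i)"
        by (rule hom_compose[OF lN[OF ij(2)] \<gamma>[OF ij(2)] hom_compose[OF M xy(1) \<alpha>[OF ij(1)]]])
      have uv: "?v (?u z) = z" if z: "z :. (N i)" for z
      proof -
        have "?v (?u z) = \<alpha> i (x (e j (y (\<gamma> i z))))"
          using z \<gamma>c[OF ij(1) z] yc \<alpha>c[OF ij(2)] \<gamma>c[OF ij(2)] by (simp add: compose_eq ex)
        also have "... = \<alpha> i (e i (\<gamma> i z))" using \<gamma>c[OF ij(1) z] yc by (simp add: pw[OF xy(3)] pw[OF xy(5)])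
        also have "... = z" using z \<gamma>c[OF ij(1) z] \<alpha>\<gamma>[OF ij(1) ij(1)] by (simp add: ex)
        finally show ?thesis .
      qed
      have vu: "?u (?v z) = z" if z: "z :. (N j)" for z
      proof -
        have "?u (?v z) = \<alpha> j (y (e i (x (\<gamma> j z))))"
          using z \<gamma>c[OF ij(2) z] xc \<alpha>c[OF ij(1)] \<gamma>c[OF ij(1)] by (simp add: compose_eq ex)
        also have "... = \<alpha> j (e j (\<gamma> j z))" using \<gamma>c[OF ij(2) z] xc by (simp add: pw[OF xy(4)] pw[OF xy(6)])
        also have "... = z" using z \<gamma>c[OF ij(2) z] \<alpha>\<gamma>[OF ij(2) ij(2)] by (simp add: ex)
        finally show ?thesis .
      qed
      have "isos A (N i) (N j) ?u ?v" unfolding isos_def using u v uv vu by blast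
      then show False using isos_mod_iso noniso[OF ij] by blast
    qed
  qed
  then show ?thesis by blast
qed

lemma primitive_idem_opp: "primitive_idem (opp R) e \<longleftrightarrow> primitive_idem R e"
  unfolding primitive_idem_def by auto

text \<open>In the opposite ring the two mutually inverse corner elements exchange their
  roles.\<close>

lemma basic_family_opp:
  assumes "basic_family R n e"
  shows "basic_family (opp R) n e"
  unfolding basic_family_def primitive_idem_opp opp_simps finsum_with_smult
proof (intro conjI allI impI notI)
  fix i j assume ij: "i < n" "j < n" "i ~= j"
  show "e j *[R] e i = 0[R]" using assms ij by (simp add: basic_family_def)
  assume "EX x:carrier R. EX y:carrier R. x *[R] e i = x & e j *[R] x = x & y *[R] e j = y &
    e i *[R] y = y & y *[R] x = e i & x *[R] y = e j"
  then obtain x y where xy: "x :. R" "y :. R" "x *[R] e i = x" "e j *[R] x = x"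
    "y *[R] e j = y" "e i *[R] y = y" "y *[R] x = e i" "x *[R] y = e j" by (elim bexE conjE)
  have "\<not> (EX x:carrier R. EX y:carrier R. e i *[R] x = x & x *[R] e j = x & e j *[R] y = y &
    y *[R] e i = y & x *[R] y = e i & y *[R] x = e j)"
    using assms ij by (simp add: basic_family_def)
  then show False
  proof (rule notE)
    show "EX x:carrier R. EX y:carrier R. e i *[R] x = x & x *[R] e j = x & e j *[R] y = y &
      y *[R] e i = y & x *[R] y = e i & y *[R] x = e j"
      by (rule bexI[OF _ xy(2)], rule bexI[OF _ xy(1)], intro conjI) (fact xy)+
  qed
qed (use assms in "simp_all add: basic_family_def")

lemma basic_family_iso:
  assumes R: "ring R" and S: "ring S" and h: "h : ring_iso R S" and fam: "basic_family S n e"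
  shows "EX e'. basic_family R n e'"
proof -
  interpret R: ring R by fact
  interpret S: ring S by fact
  have hm: "h : ring_hom R S" and bij: "bij_betw h (carrier R) (carrier S)" using h by (auto simp: ring_iso_def)
  note hc = ring_hom_closed[OF hm] and hmul = ring_hom_mult[OF hm] and hadd = ring_hom_add[OF hm]
  have inj: "x = y" if "x :. R" "y :. R" "h x = h y" for x y
    using bij that by (auto simp: bij_betw_def inj_on_def)
  have h0: "h 0[R] = 0[S]" by (rule ring_hom_zero[OF hm R S])
  have h1: "h 1[R] = 1[S]" by (rule ring_hom_one[OF hm])
  define g where "g = inv_into (carrier R) h"
  have g: "g y :. R" "h (g y) = y" if "y :. S" for y
    using bij that by (auto simp: g_def bij_betw_def inv_into_into f_inv_into_f)
  have prS: "primitive_idem S (e i)" if "i < n" for i using fam that by (simp add: basic_family_def)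
  have ec: "e i :. S" if "i < n" for i using prS[OF that] by (simp add: primitive_idem_def)
  note ge = g[OF ec]
  have eqI: "x = y" if "h x = h y" "x :. R" "y :. R" for x y using inj that by blast
  have "basic_family R n (%i. g (e i))"
    unfolding basic_family_def
  proof (intro conjI allI impI)
    fix i assume i: "i < n"
    show "primitive_idem R (g (e i))"
      unfolding primitive_idem_def
    proof (intro conjI ballI impI)
      show "g (e i) :. R" by (rule ge[OF i])
      show "g (e i) ~= 0[R]" using prS[OF i] ge[OF i] h0 by (auto simp: primitive_idem_def)
      show "g (e i) *[R] g (e i) = g (e i)"
        by (rule eqI) (use prS[OF i] ge[OF i] in "auto simp: primitive_idem_def hmul")
      fix p assume p: "p :. R" and c: "g (e i) *[R] p = p & p *[R] g (e i) = p & p *[R] p = p"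
      have "e i *[S] h p = h p & h p *[S] e i = h p & h p *[S] h p = h p"
        using c hmul p ge[OF i] by metis
      then have "h p = 0[S] \<or> h p = e i" using prS[OF i] hc[OF p] unfolding primitive_idem_def by blast
      then show "p = 0[R] \<or> p = g (e i)" using eqI p ge[OF i] h0 R.zero_closed by metis
    qed
  next
    fix i j assume ij: "i < n" "j < n" "i ~= j"
    show "g (e i) *[R] g (e j) = 0[R]"
      by (rule eqI) (use fam ij ge h0 in "auto simp: basic_family_def hmul")
    show "\<not> (EX x:carrier R. EX y:carrier R. g (e i) *[R] x = x & x *[R] g (e j) = x &
        g (e j) *[R] y = y & y *[R] g (e i) = y & x *[R] y = g (e i) & y *[R] x = g (e j))"
    proof clarify
      fix x y assume xy: "x :. R" "y :. R" "g (e i) *[R] x = x" "x *[R] g (e j) = x"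
        "g (e j) *[R] y = y" "y *[R] g (e i) = y" "x *[R] y = g (e i)" "y *[R] x = g (e j)"
      have "e i *[S] h x = h x" "h x *[S] e j = h x" "e j *[S] h y = h y" "h y *[S] e i = h y"
        "h x *[S] h y = e i" "h y *[S] h x = e j"
        using hmul xy ge[OF ij(1)] ge[OF ij(2)] by metis+
      moreover have "\<not> (EX x:carrier S. EX y:carrier S. e i *[S] x = x & x *[S] e j = x & e j *[S] y = y &
        y *[S] e i = y & x *[S] y = e i & y *[S] x = e j)"
        using fam ij by (simp add: basic_family_def)
      ultimately show False using hc[OF xy(1)] hc[OF xy(2)] by blast
    qed
  next
    have hf: "h (\<Oplus>\<^bsub>R\<^esub>i\<in>S'. f i) = (\<Oplus>\<^bsub>S\<^esub>i\<in>S'. h (f i))" if "f : S' \<rightarrow> carrier R" for f and S' :: "nat set"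
      using that
    proof (induction S' rule: infinite_finite_induct)
      case (insert x F)
      then show ?case by (simp add: R.finsum_insert S.finsum_insert hadd hc Pi_iff)
    qed (simp_all add: R.finsum_infinite S.finsum_infinite h0)
    show "(\<Oplus>\<^bsub>R\<^esub>i\<in>{..<n}. g (e i)) = 1[R]"
    proof (rule eqI)
      have "h (\<Oplus>\<^bsub>R\<^esub>i\<in>{..<n}. g (e i)) = (\<Oplus>\<^bsub>S\<^esub>i\<in>{..<n}. h (g (e i)))" using ge by (intro hf) auto
      also have "... = (\<Oplus>\<^bsub>S\<^esub>i\<in>{..<n}. e i)" using ge ec by (intro S.finsum_cong') auto
      also have "... = h 1[R]" using fam h1 by (simp add: basic_family_def)
      finally show "h (\<Oplus>\<^bsub>R\<^esub>i\<in>{..<n}. g (e i)) = h 1[R]" .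
    qed (use ge in "auto intro!: R.finsum_closed")
  qed
  then show ?thesis by blast
qed

section \<open>Projective and injective modules\<close>

text \<open>The kernel condition makes the functional well defined on the image of \<open>g\<close>,
  and \<open>functional_extend\<close> takes it to all of \<open>N\<close>.\<close>

lemma functional_factor:
  assumes K: "fd_algebra K R" and M: "left_module R M" and N: "fdm K R N"
    and g: "g : Hom R M N" and l: "l : functionals K R M"
    and ker: "!!x. [|x :. M; g x = 0[N]|] ==> l x = 0[K]"
  shows "EX \<mu>:functionals K R N. ALL x:carrier M. \<mu> (g x) = l x"
proof -
  note lN = fdmD(1)[OF N]
  interpret M: left_module R M by fact
  interpret N: left_module R N by (rule lN)
  interpret fK: field K using fd_algebraD(1)[OF K] .
  interpret V: vspace K "rs R N" by (rule vspace_rs[OF K lN])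
  have gK: "g : Hom K (rs R M) (rs R N)" by (rule hom_scal(1)[OF K g])
  have sub: "submod K (rs R N) (g ` carrier M)"
    using submod_image[OF scal_module(1)[OF K M] scal_module(1)[OF K lN] gK] by simp
  have lg: "l x = l x'" if "x :. M" "x' :. M" "g x = g x'" for x x'
  proof -
    have "g (x -[M] x') = 0[N]"
      using that hom_closed[OF g]
      by (simp add: hom_diff[OF g M.M_group N.M_group]) (simp add: a_minus_def N.M.r_neg)
    then have z: "l (x -[M] x') = 0[K]" using that ker[of "x -[M] x'"] by simp
    have "l x = l ((x -[M] x') +[M] x')" using that by (simp add: a_minus_def M.M.a_assoc M.M.l_neg)
    also have "... = l x'" using that z functionalD(1,2)[OF l] by simp
    finally show ?thesis .
  qed
  define s where "s = inv_into (carrier M) g"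
  have s: "s z :. M" "g (s z) = z" if "z : g ` carrier M" for z
    using that by (auto simp: s_def inv_into_into f_inv_into_f)
  have sg: "l (s (g x)) = l x" if "x :. M" for x using lg[of "s (g x)" x] s[of "g x"] that by auto
  have "lin K (rs R N) (g ` carrier M) (regular K) (%z. l (s z))"
    unfolding lin_def
  proof (intro conjI ballI)
    fix u v assume "u : g ` carrier M" "v : g ` carrier M"
    then obtain x y where xy: "x :. M" "u = g x" "y :. M" "v = g y" by blast
    have "u +[N] v = g (x +[M] y)" using xy hom_add[OF g] by simp
    then show "l (s (u +[rs R N] v)) = l (s u) +[regular K] l (s v)"
      using xy sg functionalD(2)[OF l] by simp
  next
    fix c u assume c: "c :. K" and "u : g ` carrier M"
    then obtain x where x: "x :. M" "u = g x" by blast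
    have "scal R N c u = g (scal R M c x)" using x hom_scal(2)[OF K g c] by simp
    then show "l (s (c .[rs R N] u)) = c .[regular K] l (s u)"
      using x sg c functionalD(3)[OF l] scal_module(2)[OF K M] by simp
  qed (use s functionalD(1)[OF l] in auto)
  from V.functional_extend[OF fdmD(2)[OF N] sub this]
  obtain \<mu> where "\<mu> : functionals K R N" "ALL u:g ` carrier M. \<mu> u = l (s u)" by blast
  then show ?thesis using sg by (intro bexI[of _ \<mu>]) auto
qed

text \<open>The dual of a finitely generated projective right module is injective.\<close>

lemma dual_extend:
  assumes K: "fd_algebra K R" and X: "left_module (opp R) X"
    and x: "!!i. i < n ==> x i :. X" and t: "!!i. i < n ==> t i : Hom R X (regular (opp R))"
    and tx: "!!y. y :. X ==> (\<Oplus>\<^bsub>X\<^esub>i\<in>{..<n::nat}. t i y .[X] x i) = y"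
    and M: "left_module R M" and N: "fdm K R N"
    and g: "g : Hom R M N" and f: "f : Hom R M (dual K R X)"
    and ker: "!!m. [|m :. M; g m = 0[N]|] ==> f m = 0[dual K R X]"
  shows "EX h:Hom R N (dual K R X). ALL m:carrier M. h (g m) = f m"
proof -
  note lN = fdmD(1)[OF N]
  interpret M: left_module R M by fact
  interpret N: left_module R N by (rule lN)
  interpret X: left_module "opp R" X by fact
  interpret fK: field K using fd_algebraD(1)[OF K] .
  note Xc = X.smult_closed[simplified] X.smult_l_distr[simplified] X.smult_r_distr[simplified]
    X.smult_assoc1[simplified] X.smult_one[simplified]
  note sX = scal_module_opp[OF K X]
  have fc: "f m : functionals K R X" if "m :. M" for m
    using hom_closed[OF f that] by simp
  have fs: "f (r .[M] m) y = f m (r .[X] y)" if "r :. R" "m :. M" "y :. X" for r m y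
    using hom_smult[OF f that(1,2)] that by simp
  have lD: "left_module R (dual K R X)" by (rule dual_module[OF K X])
  have "EX \<mu>:functionals K R N. ALL m:carrier M. \<mu> (g m) = f m (x i)" if i: "i < n" for i
  proof -
    have 1: "(\<lambda>m\<in>carrier M. f m (x i)) : functionals K R M"
    proof (rule functionalI)
      fix m m' assume "m :. M" "m' :. M"
      then show "(\<lambda>m\<in>carrier M. f m (x i)) (m +[M] m') = (\<lambda>m\<in>carrier M. f m (x i)) m +[K] (\<lambda>m\<in>carrier M. f m (x i)) m'"
        using x[OF i] by (simp add: hom_add[OF f])
    next
      fix c m assume cm: "c :. K" "m :. M"
      then show "(\<lambda>m\<in>carrier M. f m (x i)) (scal R M c m) = c *[K] (\<lambda>m\<in>carrier M. f m (x i)) m"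
        using x[OF i] scal_module(2)[OF K M] hom_scal(2)[OF K f cm] scal_dual[OF K X fc[OF cm(2)] cm(1)] by simp
    qed (use functionalD(1)[OF fc x[OF i]] in auto)
    have "EX \<mu>:functionals K R N. ALL m:carrier M. \<mu> (g m) = (\<lambda>m\<in>carrier M. f m (x i)) m"
      by (rule functional_factor[OF K M N g 1]) (use ker x[OF i] in simp)
    then show ?thesis by auto
  qed
  then obtain \<mu> where \<mu>: "!!i. i < n ==> \<mu> i : functionals K R N"
    "!!i m. [|i < n; m :. M|] ==> \<mu> i (g m) = f m (x i)" by metis
  have tc: "t i y :. R" if "i < n" "y :. X" for i y
    using hom_closed[OF t[OF that(1)] that(2)] by simp
  have ta: "t i (y +[X] z) = t i y +[R] t i z" if "i < n" "y :. X" "z :. X" for i y z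
    using hom_add[OF t[OF that(1)] that(2,3)] by simp
  have ts: "t i (r .[X] y) = t i y *[R] r" if "i < n" "r :. R" "y :. X" for i r y
    using hom_smult[OF t[OF that(1)] that(2,3)] by simp
  have tsc: "t i (scal R X c y) .[N] z = scal R N c (t i y .[N] z)"
    if "i < n" "c :. K" "y :. X" "z :. N" for i c y z
  proof -
    interpret RK: left_module K R using fd_algebraD(6)[OF K] .
    have c1: "c .[R] 1[R] :. R" using that by (simp add: RK.smult_closed)
    have "t i (scal R X c y) .[N] z = t i y .[N] scal R N c z"
      using that c1 tc by (simp add: scal_def[of R X] scal_def[of R N] ts N.smult_assoc1)
    then show ?thesis using scal_module(3)[OF K lN tc[OF that(1,3)] that(2,4)] by simp
  qed
  \<comment> \<open>The dual basis formula: \<open>\<mu> i\<close> extends the functional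
    \<open>m |-> f m (x i)\<close>, and the expansion of \<open>y\<close> in the \<open>x i\<close>
    with coefficients \<open>t i y\<close> dictates the value at \<open>y\<close>.\<close>
  define h where "h = (\<lambda>z\<in>carrier N. \<lambda>y\<in>carrier X. \<Oplus>\<^bsub>K\<^esub>i\<in>{..<n}. \<mu> i (t i y .[N] z))"
  have \<mu>c: "\<mu> i z :. K" if "i < n" "z :. N" for i z using functionalD(1)[OF \<mu>(1)] that by simp
  have cl: "(%i. \<mu> i (t i y .[N] z)) : {..<n} \<rightarrow> carrier K" if "y :. X" "z :. N" for y z
    using that tc \<mu>c N.smult_closed by auto
  have hc: "h z : functionals K R X" if z: "z :. N" for z
  proof (rule functionalI)
    show "h z : extensional (carrier X)" using z by (simp add: h_def)
    show "h z y :. K" if "y :. X" for y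
      using z that fK.finsum_closed[OF cl[OF that z]] by (simp add: h_def)
    fix y y' assume yy: "y :. X" "y' :. X"
    have "(\<Oplus>\<^bsub>K\<^esub>i\<in>{..<n}. \<mu> i (t i (y +[X] y') .[N] z)) =
        (\<Oplus>\<^bsub>K\<^esub>i\<in>{..<n}. \<mu> i (t i y .[N] z) +[K] \<mu> i (t i y' .[N] z))"
      using yy z tc \<mu>c by (intro fK.finsum_cong') (auto simp: ta N.smult_l_distr N.smult_closed functionalD(2)[OF \<mu>(1)])
    also have "... = (\<Oplus>\<^bsub>K\<^esub>i\<in>{..<n}. \<mu> i (t i y .[N] z)) +[K] (\<Oplus>\<^bsub>K\<^esub>i\<in>{..<n}. \<mu> i (t i y' .[N] z))"
      by (rule fK.finsum_addf[OF cl[OF yy(1) z] cl[OF yy(2) z]])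
    finally show "h z (y +[X] y') = h z y +[K] h z y'" using yy z by (simp add: h_def)
  next
    fix c y assume cy: "c :. K" "y :. X"
    interpret KK: left_module K "regular K" by (rule left_module_regular[OF fK.ring_axioms])
    have "(\<Oplus>\<^bsub>K\<^esub>i\<in>{..<n}. \<mu> i (t i (scal R X c y) .[N] z)) = (\<Oplus>\<^bsub>K\<^esub>i\<in>{..<n}. c *[K] \<mu> i (t i y .[N] z))"
      using cy z tc \<mu>c by (intro fK.finsum_cong') (auto simp: tsc N.smult_closed functionalD(3)[OF \<mu>(1)])
    also have "... = c *[K] (\<Oplus>\<^bsub>K\<^esub>i\<in>{..<n}. \<mu> i (t i y .[N] z))"
      using KK.smult_finsum[of c "%i. \<mu> i (t i y .[N] z)" "{..<n}"] cl[OF cy(2) z] cy by simp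
    finally show "h z (scal R X c y) = c *[K] h z y" using cy z sX(3) by (simp add: h_def)
  qed
  have "h : Hom R N (dual K R X)"
  proof (rule hom_setI)
    show "h z :. (dual K R X)" if "z :. N" for z using hc[OF that] by simp
    show "h : extensional (carrier N)" by (simp add: h_def)
    fix z z' assume zz: "z :. N" "z' :. N"
    have "(\<Oplus>\<^bsub>K\<^esub>i\<in>{..<n}. \<mu> i (t i y .[N] (z +[N] z'))) =
        (\<Oplus>\<^bsub>K\<^esub>i\<in>{..<n}. \<mu> i (t i y .[N] z)) +[K] (\<Oplus>\<^bsub>K\<^esub>i\<in>{..<n}. \<mu> i (t i y .[N] z'))" if y: "y :. X" for y
    proof -
      have "(\<Oplus>\<^bsub>K\<^esub>i\<in>{..<n}. \<mu> i (t i y .[N] (z +[N] z'))) =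
          (\<Oplus>\<^bsub>K\<^esub>i\<in>{..<n}. \<mu> i (t i y .[N] z) +[K] \<mu> i (t i y .[N] z'))"
        using zz y tc \<mu>c by (intro fK.finsum_cong') (auto simp: N.smult_r_distr N.smult_closed functionalD(2)[OF \<mu>(1)])
      then show ?thesis using fK.finsum_addf[OF cl[OF y zz(1)] cl[OF y zz(2)]] by simp
    qed
    then show "h (z +[N] z') = h z +[dual K R X] h z'" using zz by (auto simp: h_def intro!: restrict_ext)
  next
    fix r z assume rz: "r :. R" "z :. N"
    have "(\<Oplus>\<^bsub>K\<^esub>i\<in>{..<n}. \<mu> i (t i y .[N] (r .[N] z))) = (\<Oplus>\<^bsub>K\<^esub>i\<in>{..<n}. \<mu> i (t i (r .[X] y) .[N] z))"
      if y: "y :. X" for y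
      using rz y tc \<mu>c Xc(1) by (intro fK.finsum_cong') (auto simp: ts N.smult_assoc1 N.smult_closed)
    then show "h (r .[N] z) = r .[dual K R X] h z"
      using rz N.smult_closed Xc(1) by (auto simp: h_def intro!: restrict_ext)
  qed
  moreover have "h (g m) = f m" if m: "m :. M" for m
  proof (rule carrier_eqI[of _ X])
    note gm = hom_closed[OF g m]
    show "h (g m) : extensional (carrier X)" "f m : extensional (carrier X)"
      using functionalD(4)[OF hc[OF gm]] functionalD(4)[OF fc[OF m]] by auto
    fix y assume y: "y :. X"
    have txc: "t i y .[X] x i :. X" if "i < n" for i using tc y x that Xc(1) by simp
    have "h (g m) y = (\<Oplus>\<^bsub>K\<^esub>i\<in>{..<n}. \<mu> i (t i y .[N] g m))" using gm y by (simp add: h_def)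
    also have "... = (\<Oplus>\<^bsub>K\<^esub>i\<in>{..<n}. f m (t i y .[X] x i))"
    proof (rule fK.finsum_cong')
      fix i assume "i : {..<n}"
      then have i: "i < n" by simp
      have "\<mu> i (t i y .[N] g m) = \<mu> i (g (t i y .[M] m))" using hom_smult[OF g tc[OF i y] m] by simp
      also have "... = f (t i y .[M] m) (x i)" using \<mu>(2)[OF i] M.smult_closed[OF tc[OF i y] m] by simp
      also have "... = f m (t i y .[X] x i)" using fs[OF tc[OF i y] m x[OF i]] .
      finally show "\<mu> i (t i y .[N] g m) = f m (t i y .[X] x i)" .
    qed (use functionalD(1)[OF fc[OF m]] txc in auto)
    also have "... = f m (\<Oplus>\<^bsub>X\<^esub>i\<in>{..<n}. t i y .[X] x i)"
      using txc by (intro functional_finsum[OF fd_algebraD(1)[OF K] X.M_group fc[OF m], symmetric]) auto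
    finally show "h (g m) y = f m y" using tx[OF y] by simp
  qed
  ultimately show ?thesis by blast
qed

section \<open>Retracts of the regular module, separating maps and single-copy retracts\<close>

lemma smult_hom:
  assumes "left_module R M" "x :. M"
  shows "(\<lambda>r\<in>carrier R. r .[M] x) : Hom R (regular R) M"
proof -
  interpret left_module R M by fact
  show ?thesis by (rule hom_setI) (use assms(2) in "simp_all add: smult_closed smult_l_distr smult_assoc1")
qed

text \<open>\<open>\<alpha>\<close> embeds \<open>Q\<close> into \<open>R\<close> as a summand
  generated by \<open>q\<close>, so a lift is determined by a preimage of
  \<open>f q\<close>.\<close>

lemma projective_of_retract:
  fixes R :: "('k, 'r) module"
  assumes K: "fd_algebra K R" and Q: "fdm K R Q" and \<alpha>: "\<alpha> : Hom R Q (regular R)"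
    and q: "q :. Q" and \<alpha>q: "!!p. p :. Q ==> \<alpha> p .[Q] q = p"
  shows "projective R Q"
proof -
  have "EX h:Hom R Q X. ALL p:carrier Q. g (h p) = f p"
    if X: "fg_module R X" and g: "g : Hom R X Y" and f: "f : Hom R Q Y"
      and surj: "g ` carrier X = carrier Y" for g f and X Y :: "('r, 'k list) module"
  proof -
    have lX: "left_module R X" using X by (simp add: fg_module_def)
    obtain x where x: "x :. X" "g x = f q" using hom_closed[OF f q] surj by (metis imageE)
    have \<alpha>c: "\<alpha> p :. R" if "p :. Q" for p using hom_closed[OF \<alpha> that] by simp
    have "compose (carrier Q) (\<lambda>r\<in>carrier R. r .[X] x) \<alpha> : Hom R Q X"
      by (rule hom_compose[OF fdmD(1)[OF Q] \<alpha> smult_hom[OF lX x(1)]])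
    moreover have "g (\<alpha> p .[X] x) = f p" if p: "p :. Q" for p
      using hom_smult[OF g \<alpha>c[OF p] x(1)] x(2) hom_smult[OF f \<alpha>c[OF p] q] \<alpha>q[OF p] by simp
    ultimately show ?thesis using \<alpha>c
      by (intro bexI[of _ "compose (carrier Q) (\<lambda>r\<in>carrier R. r .[X] x) \<alpha>"]) (auto simp: compose_eq)
  qed
  then show ?thesis unfolding projective_def using Q fg_module_iff[OF K] by blast
qed

lemma fdm_regular:
  assumes K: "fd_algebra K R"
  shows "fdm K R (regular R)"
proof -
  interpret R: ring R using fd_algebraD(4)[OF K] .
  have "fin_gen R (regular R)" unfolding fin_gen_def
  proof (intro exI[of _ "{1[R]}"] conjI ballI)
    fix y assume "y :. (regular R)"
    then show "EX c:{1[R]} \<rightarrow> carrier R. y = (\<Oplus>\<^bsub>regular R\<^esub>s\<in>{1[R]}. c s .[regular R] s)"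
      by (intro bexI[of _ "%_. y"]) (auto simp: R.finsum_insert)
  qed auto
  then show ?thesis
    using left_module_regular[OF R.ring_axioms] fg_module_iff[OF K, of "regular R"] unfolding fg_module_def by blast
qed

text \<open>An epimorphism from a free module, obtained from coordinates, splits and embeds
  \<open>P\<close> into it; some component is nonzero at \<open>x\<close>.\<close>

lemma projective_separated:
  fixes R :: "('k, 'r) module"
  assumes K: "fd_algebra K R" and P: "projective R P" and x: "x :. P" "x ~= 0[P]"
  shows "EX t:Hom R P (regular R). t x ~= 0[R]"
proof -
  have fP: "fdm K R P" using P fg_module_iff[OF K] unfolding projective_def by blast
  note lP = fdmD(1)[OF fP]
  interpret P: left_module R P by (rule lP)
  interpret RK: left_module K R using fd_algebraD(6)[OF K] .
  note lreg = left_module_regular[OF fd_algebraD(4)[OF K]]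
  note freg = fdm_regular[OF K]
  obtain m b \<beta> where b: "!!i. i < m ==> b i :. P" "!!i. i < m ==> \<beta> i : functionals K R P"
      "!!x. x :. P ==> (\<Oplus>\<^bsub>P\<^esub>i\<in>{..<m::nat}. scal R P (\<beta> i x) (b i)) = x"
    using fdm_coordinates[OF K fP] by blast
  let ?F = "dsum m (%_. regular R)"
  interpret F: left_module R ?F by (rule left_module_dsum[OF P.R.ring_axioms lreg])
  let ?g = "\<lambda>z\<in>carrier ?F. \<Oplus>\<^bsub>P\<^esub>l\<in>{..<m}. (\<lambda>r\<in>carrier R. r .[P] b l) (z l)"
  have g: "?g : Hom R ?F P"
    by (rule hom_from_dsum[OF P.R.ring_axioms lreg lP]) (rule smult_hom[OF lP b(1)])
  have "EX h:Hom R P ?F. ALL p:carrier P. ?g (h p) = (\<lambda>p\<in>carrier P. p) p"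
  proof (rule projective_lift[OF K P fdm_dsum[OF K freg] fP g hom_id[OF lP]])
    show "(\<lambda>p\<in>carrier P. p) ` carrier P \<subseteq> ?g ` carrier ?F"
    proof
      fix p assume "p : (\<lambda>p\<in>carrier P. p) ` carrier P"
      then have p: "p :. P" by auto
      have bp: "\<beta> l p .[R] 1[R] :. R" if "l < m" for l
        using functionalD(1)[OF b(2)[OF that] p] by (simp add: RK.smult_closed)
      let ?z = "\<lambda>l\<in>{..<m}. \<beta> l p .[R] 1[R]"
      have z: "?z :. ?F" using bp by auto
      have gz: "?g ?z = (\<Oplus>\<^bsub>P\<^esub>l\<in>{..<m}. scal R P (\<beta> l p) (b l))"
        using z bp b(1) P.smult_closed by simp (intro P.M.finsum_cong', auto simp: scal_def)
      show "p : ?g ` carrier ?F" using trans[OF gz b(3)[OF p]] imageI[OF z, of ?g] by (simp only:)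
    qed
  qed
  then obtain h where h: "h : Hom R P ?F" "!!p. p :. P ==> ?g (h p) = p" by auto
  have hx: "h x :. ?F" by (rule hom_closed[OF h(1) x(1)])
  have "h x ~= 0[?F]"
    using h(2)[OF x(1)] x(2) hom_zero[OF g F.M_group P.M_group] by metis
  then have "EX l<m. h x l ~= 0[R]"
  proof (rule contrapos_np)
    assume "\<not> (EX l<m. h x l ~= 0[R])"
    then show "h x = 0[?F]" using hx by (intro extensionalityI[of _ "{..<m}"]) (auto simp: PiE_def)
  qed
  then obtain l where l: "l < m" "h x l ~= 0[R]" by blast
  have pr: "dpr m (%_. regular R) l : Hom R ?F (regular R)"
    using dpr_hom[of R m "%_. regular R" l] P.R.ring_axioms lreg l by simp
  have "compose (carrier P) (dpr m (%_. regular R) l) h : Hom R P (regular R)"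
    by (rule hom_compose[OF lP h(1) pr])
  moreover have "compose (carrier P) (dpr m (%_. regular R) l) h x ~= 0[R]"
    using x hx l by (simp add: compose_eq dpr_def)
  ultimately show ?thesis by blast
qed

text \<open>A coordinate system of \<open>Hom(X,W)\<close> consists of finitely many maps that are
  jointly injective. The resulting embedding of \<open>X\<close> into a power of \<open>W\<close>
  splits because \<open>X\<close> is injective.\<close>

lemma fac_of_separated:
  fixes R :: "('k, 'r) module"
  assumes K: "fd_algebra K R" and I: "injective R X" and W: "fdm K R W"
    and sep: "!!x. [|x :. X; x ~= 0[X]|] ==> EX a:Hom R X W. a x ~= 0[W]"
  shows "fac R W X"
proof -
  have fX: "fdm K R X" using I fg_module_iff[OF K] unfolding injective_def by blast
  note lX = fdmD(1)[OF fX] and lW = fdmD(1)[OF W]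
  interpret X: left_module R X by (rule lX)
  interpret W: left_module R W by (rule lW)
  interpret Wv: left_module K "rs R W" by (rule scal_module(1)[OF K lW])
  note agH = hom_space_module(2)[OF K lX lW]
  interpret Hm: left_module K "hom_space R X W" by (rule hom_space_module(1)[OF K lX lW])
  interpret H: vspace K "hom_space R X W"
    using hom_space_module(1)[OF K lX lW] fd_algebraD(1)[OF K] by (simp add: vspace_def)
  obtain n a \<beta> where H: "(ALL i<n::nat. a i :. (hom_space R X W) & \<beta> i : Hom K (hom_space R X W) (regular K)) &
    (ALL x:carrier (hom_space R X W). (\<Oplus>\<^bsub>hom_space R X W\<^esub>i\<in>{..<n}. \<beta> i x .[hom_space R X W] a i) = x)"
    using H.dual_basis[OF fin_gen_hom_space[OF K fX W]] by blast
  have a: "a i : Hom R X W" if "i < n" for i using H that by simp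
  have az: "x = 0[X]" if x: "x :. X" and z: "!!i. i < n ==> a i x = 0[W]" for x
  proof (rule ccontr)
    assume "x ~= 0[X]"
    then obtain f where f: "f : Hom R X W" "f x ~= 0[W]" using sep[OF x] by blast
    have \<beta>f: "\<beta> i f :. K" if "i < n" for i
      using H that hom_closed[of "\<beta> i" K "hom_space R X W" "regular K" f] f(1) by simp
    have "f x = finsum (hom_space R X W) (%i. \<beta> i f .[hom_space R X W] a i) {..<n} x" using H f(1) by simp
    also have "... = (\<Oplus>\<^bsub>W\<^esub>i\<in>{..<n}. (\<beta> i f .[hom_space R X W] a i) x)"
      using Hm.smult_closed[of "\<beta> _ f" "a _"] \<beta>f a
      by (intro hom_space_finsum[OF agH W.M_group x]) auto
    also have "... = (\<Oplus>\<^bsub>W\<^esub>i\<in>{..<n}. 0[W])"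
      using x z \<beta>f Wv.smult_zero_right by (intro W.M.finsum_cong') auto
    finally show False using f(2) by simp
  qed
  let ?D = "dsum n (%_. W)"
  interpret D: left_module R ?D by (rule left_module_dsum[OF X.R.ring_axioms lW])
  let ?g = "\<lambda>x\<in>carrier X. \<lambda>l\<in>{..<n}. a l x"
  have g: "?g : Hom R X ?D" by (rule hom_into_dsum[OF lX]) (use a in simp)
  have "EX h:Hom R ?D X. ALL x:carrier X. h (?g x) = (\<lambda>x\<in>carrier X. x) x"
  proof (rule injective_extend[OF K I lX fdm_dsum[OF K W] g hom_id[OF lX]])
    fix x assume x: "x :. X" and z: "?g x = 0[?D]"
    have "a i x = 0[W]" if "i < n" for i
      using fun_cong[OF z, of i] x that by simp
    then show "(\<lambda>x\<in>carrier X. x) x = 0[X]" using az[OF x] x by simp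
  qed
  then obtain h where h: "h : Hom R ?D X" "!!x. x :. X ==> h (?g x) = x" by auto
  have inc: "dinc n (%_. W) l : Hom R W ?D" if "l < n" for l
    using dinc_hom[of R n "%_. W" l] X.R.ring_axioms lW that by auto
  define b where "b l = compose (carrier W) h (dinc n (%_. W) l)" for l
  have b: "b l : Hom R W X" if "l < n" for l unfolding b_def by (rule hom_compose[OF lW inc[OF that] h(1)])
  have "(\<Oplus>\<^bsub>X\<^esub>l\<in>{..<n}. b l (a l x)) = x" if x: "x :. X" for x
  proof -
    have gx: "?g x :. ?D" by (rule hom_closed[OF g x])
    have ax: "a l x :. W" if "l < n" for l by (rule hom_closed[OF a[OF that] x])
    have ic: "dinc n (%_. W) l (a l x) :. ?D" if "l < n" for l by (rule hom_closed[OF inc[OF that] ax[OF that]])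
    have "(\<Oplus>\<^bsub>X\<^esub>l\<in>{..<n}. b l (a l x)) = (\<Oplus>\<^bsub>X\<^esub>l\<in>{..<n}. h (dinc n (%_. W) l (a l x)))"
      using ax ic hom_closed[OF h(1)] by (intro X.M.finsum_cong') (auto simp: b_def compose_eq)
    also have "... = h (\<Oplus>\<^bsub>?D\<^esub>l\<in>{..<n}. dinc n (%_. W) l (a l x))"
      using ic by (intro hom_finsum[OF h(1) D.M_group X.M_group, symmetric]) auto
    also have "(\<Oplus>\<^bsub>?D\<^esub>l\<in>{..<n}. dinc n (%_. W) l (a l x)) = (\<Oplus>\<^bsub>?D\<^esub>l\<in>{..<n}. dinc n (%_. W) l (?g x l))"
      using ic x by (intro D.M.finsum_cong') auto
    also have "... = ?g x" by (rule dsum_expand[OF X.R.ring_axioms lW gx])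
    finally show ?thesis using h(2)[OF x] by simp
  qed
  then show ?thesis unfolding fac_def using a b by blast
qed

text \<open>A summand \<open>U\<close> of the regular module is generated by \<open>v 1\<close>, and
  its identity corresponds to the idempotent \<open>u (v 1)\<close>. A factorization through several
  copies of \<open>W\<close> puts this idempotent into the trace ideal, where
  \<open>basic_idem_factor\<close> leaves one copy.\<close>

lemma retract_of_fac:
  assumes K: "fd_algebra K R" and fam: "basic_family R n e" and U: "left_module R U" and W: "left_module R W"
    and u: "u : Hom R U (regular R)" and v: "v : Hom R (regular R) U"
    and vu: "!!x. x :. U ==> v (u x) = x" and f: "fac R W U"
  shows "EX \<alpha> \<beta>. \<alpha> : Hom R U W & \<beta> : Hom R W U & (ALL x:carrier U. \<beta> (\<alpha> x) = x)"
proof -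
  interpret U: left_module R U by fact
  interpret W: left_module R W by fact
  note lreg = left_module_regular[OF U.R.ring_axioms]
  have v1: "v r = r .[U] v 1[R]" if "r :. R" for r
    using hom_smult[OF v that, of "1[R]"] that by simp
  let ?p = "v 1[R]"
  have p: "?p :. U" using hom_closed[OF v, of "1[R]"] by simp
  have uc: "u x :. R" if "x :. U" for x using hom_closed[OF u that] by simp
  have us: "u (r .[U] x) = r *[R] u x" if "r :. R" "x :. U" for r x
    using hom_smult[OF u that] by simp
  let ?e = "u ?p"
  have e: "?e :. R" by (rule uc[OF p])
  have up: "u x .[U] ?p = x" if "x :. U" for x using v1[OF uc[OF that]] vu[OF that] by simp
  have ue: "u x *[R] ?e = u x" if "x :. U" for x using us[OF uc[OF that] p] up[OF that] by simp
  obtain m a b where ab: "!!l. l < (m::nat) ==> a l : Hom R U W" "!!l. l < m ==> b l : Hom R W U"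
    "!!x. x :. U ==> (\<Oplus>\<^bsub>U\<^esub>l\<in>{..<m}. b l (a l x)) = x"
    using f unfolding fac_def by blast
  have "EX w:carrier W. EX \<beta>:Hom R W (regular R). ?e *[R] \<beta> w *[R] ?e = ?e"
  proof (rule basic_idem_factor[OF K fam W, where m = m and w = "%l. a l ?p" and \<beta> = "%l. compose (carrier W) u (b l)"])
    show "?e *[R] ?e = ?e" by (rule ue[OF p])
    show "a l ?p :. W" if "l < m" for l by (rule hom_closed[OF ab(1)[OF that] p])
    show "compose (carrier W) u (b l) : Hom R W (regular R)" if "l < m" for l
      by (rule hom_compose[OF W ab(2)[OF that] u])
    have ap: "a l ?p :. W" "b l (a l ?p) :. U" if "l < m" for l
      using hom_closed[OF ab(1)[OF that] p] hom_closed[OF ab(2)[OF that]] by auto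
    have "(\<Oplus>\<^bsub>R\<^esub>l\<in>{..<m}. compose (carrier W) u (b l) (a l ?p)) = (\<Oplus>\<^bsub>R\<^esub>l\<in>{..<m}. u (b l (a l ?p)))"
      using ap uc by (intro U.R.finsum_cong') (auto simp: compose_eq)
    also have "... = u (\<Oplus>\<^bsub>U\<^esub>l\<in>{..<m}. b l (a l ?p))"
      using hom_finsum[OF u U.M_group, of "%l. b l (a l ?p)" "{..<m}"] U.R.abelian_group_axioms ap by auto
    finally show "(\<Oplus>\<^bsub>R\<^esub>l\<in>{..<m}. compose (carrier W) u (b l) (a l ?p)) = ?e" using ab(3)[OF p] by simp
  qed
  then obtain w \<beta> where w: "w :. W" and \<beta>: "\<beta> : Hom R W (regular R)"
    and ewe: "?e *[R] \<beta> w *[R] ?e = ?e" by blast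
  have bw: "\<beta> w :. R" using hom_closed[OF \<beta> w] by simp
  let ?\<alpha> = "compose (carrier U) (\<lambda>r\<in>carrier R. r .[W] w) u" and ?\<beta> = "compose (carrier W) v \<beta>"
  have "?\<alpha> : Hom R U W" by (rule hom_compose[OF U u smult_hom[OF W w]])
  moreover have "?\<beta> : Hom R W U" by (rule hom_compose[OF W \<beta> v])
  moreover have "?\<beta> (?\<alpha> x) = x" if x: "x :. U" for x
  proof -
    have "?\<beta> (?\<alpha> x) = v (u x *[R] \<beta> w)"
      using x uc[OF x] w hom_smult[OF \<beta> uc[OF x] w] by (simp add: compose_eq W.smult_closed)
    also have "... = (u x *[R] \<beta> w) .[U] ?p" by (rule v1) (use uc[OF x] bw in simp)
    also have "... = (u x *[R] \<beta> w) .[U] (?e .[U] ?p)" using up[OF p] by simp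
    also have "... = (u x *[R] ?e *[R] \<beta> w *[R] ?e) .[U] ?p"
      using uc[OF x] bw e p ue[OF x] by (simp add: U.smult_assoc1)
    also have "u x *[R] ?e *[R] \<beta> w *[R] ?e = u x *[R] (?e *[R] \<beta> w *[R] ?e)"
      using uc[OF x] bw e by (simp add: U.R.m_assoc)
    also have "... = u x" using ewe ue[OF x] by simp
    also have "u x .[U] ?p = x" by (rule up[OF x])
    finally show ?thesis .
  qed
  ultimately show ?thesis by blast
qed

section \<open>The dual of a generator-cogenerator\<close>

lemma dual_finsum:
  assumes K: "fd_algebra K R" and X: "left_module (opp R) X" and x: "x :. X"
    and F: "!!i. i : S ==> F i : functionals K R X"
  shows "finsum (dual K R X) F S x = (\<Oplus>\<^bsub>K\<^esub>i\<in>S. F i x)"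
proof -
  interpret fK: field K using fd_algebraD(1)[OF K] .
  have ag: "abelian_group (hom_space (regular K) (rs R X) (regular K))"
    using dual_module[OF K X] by (simp add: dual_def left_module_def)
  show ?thesis
    using hom_space_finsum[OF ag, of x S F] fK.abelian_group_axioms x F by (simp add: dual_def)
qed

text \<open>A fixed isomorphism \<open>\<psi>\<close> makes \<open>E\<close> a right
  \<open>G\<close>-module \<open>EG\<close>. Its dual \<open>DE\<close> is the concrete model of the
  maximal projective-injective summand.\<close>

locale gencogen =
  fixes K :: "'k ring" and A :: "('k, 'a) module" and E :: "('a, 'e) module"
    and G :: "('k, 'g) module" and \<psi> :: "'g => 'e => 'e"
  assumes KA: "fd_algebra K A" and fE: "fdm K A E"
    and gen: "fac A E (regular A)" and cogen: "fac A E (dual_regular K A)"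
    and KG: "fd_algebra K G" and \<psi>: "\<psi> : alg_iso K G (opp (end_alg A E))"
begin

abbreviation EG where "EG \<equiv> with_smult (%g x. \<psi> g x) E"
abbreviation DE where "DE \<equiv> dual K G EG"

lemma lE: "left_module A E" by (rule fdmD(1)[OF fE])

sublocale E: left_module A E by (rule lE)
sublocale G: left_module G "regular G" by (rule left_module_regular[OF fd_algebraD(4)[OF KG]])
sublocale GK: left_module K G by (rule fd_algebraD(6)[OF KG])
sublocale AK: left_module K A by (rule fd_algebraD(6)[OF KA])

lemma \<psi>_hom: "g :. G ==> \<psi> g : Hom A E E"
  and \<psi>_add: "[|g :. G; h :. G; x :. E|] ==> \<psi> (g +[G] h) x = \<psi> g x +[E] \<psi> h x"
  and \<psi>_mult: "[|g :. G; h :. G; x :. E|] ==> \<psi> (g *[G] h) x = \<psi> h (\<psi> g x)"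
  and \<psi>_one: "x :. E ==> \<psi> 1[G] x = x"
  and \<psi>_smult: "[|c :. K; g :. G; x :. E|] ==> \<psi> (c .[G] g) x = scal A E c (\<psi> g x)"
  and \<psi>_surj: "t : Hom A E E ==> EX g:carrier G. \<psi> g = t"
proof -
  have ri: "\<psi> : ring_hom G (opp (end_alg A E))" and bij: "bij_betw \<psi> (carrier G) (Hom A E E)"
    and sm: "!!c g. c :. K ==> g :. G ==> \<psi> (c .[G] g) = c .[opp (end_alg A E)] \<psi> g"
    using \<psi> by (auto simp: alg_iso_def ring_iso_def)
  show H: "g :. G ==> \<psi> g : Hom A E E" for g using ring_hom_closed[OF ri] by simp
  show "[|g :. G; h :. G; x :. E|] ==> \<psi> (g +[G] h) x = \<psi> g x +[E] \<psi> h x"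
    using ring_hom_add[OF ri, of g h] by simp
  show "[|g :. G; h :. G; x :. E|] ==> \<psi> (g *[G] h) x = \<psi> h (\<psi> g x)"
    using ring_hom_mult[OF ri, of g h] by (simp add: compose_eq)
  show "x :. E ==> \<psi> 1[G] x = x" using ring_hom_one[OF ri] by simp
  show "[|c :. K; g :. G; x :. E|] ==> \<psi> (c .[G] g) x = scal A E c (\<psi> g x)"
    using sm[of c g] by simp
  show "t : Hom A E E ==> EX g:carrier G. \<psi> g = t" by (metis (no_types) bij bij_betw_imp_surj_on imageE)
qed

lemma \<psi>_closed: "[|g :. G; x :. E|] ==> \<psi> g x :. E"
  by (rule hom_closed[OF \<psi>_hom])

lemma \<psi>_eqI:
  assumes "g :. G" "h :. G" "!!x. x :. E ==> \<psi> g x = \<psi> h x"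
  shows "g = h"
proof -
  have "\<psi> g = \<psi> h" by (rule hom_eqI[OF \<psi>_hom[OF assms(1)] \<psi>_hom[OF assms(2)] assms(3)])
  moreover have "inj_on \<psi> (carrier G)" using \<psi> by (auto simp: alg_iso_def ring_iso_def bij_betw_def)
  ultimately show ?thesis using assms by (auto simp: inj_on_def)
qed

definition \<chi> where "\<chi> t = (SOME g. g :. G & \<psi> g = t)"

lemma \<chi>: assumes "t : Hom A E E" shows "\<chi> t :. G" "\<psi> (\<chi> t) = t"
proof -
  have "EX g. g :. G & \<psi> g = t" using \<psi>_surj[OF assms] by blast
  from someI_ex[OF this] show "\<chi> t :. G" "\<psi> (\<chi> t) = t" by (simp_all add: \<chi>_def)
qed

lemma EG_module: "left_module (opp G) EG"
proof (rule left_moduleI)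
  show "ring (opp G)" by (rule fd_algebraD(4)[OF fd_algebra_opp[OF KG]])
qed (auto simp: E.M_group \<psi>_closed \<psi>_add hom_add[OF \<psi>_hom] \<psi>_mult \<psi>_one)

lemma scal_EG: "[|c :. K; x :. E|] ==> scal G EG c x = scal A E c x"
  using \<psi>_smult[of c "1[G]" x] \<psi>_one by (simp add: scal_def)

lemma functionals_EG: "functionals K G EG = functionals K A E"
  by (auto simp: hom_set_def scal_EG)

lemma fEG: "fdm K (opp G) EG"
  unfolding fdm_def
proof (intro conjI EG_module)
  have l1: "left_module K (rs A E)" by (rule scal_module(1)[OF KA lE])
  have l2: "left_module K (rs G EG)" by (rule scal_module_opp(1)[OF KG EG_module])
  have "(\<lambda>x\<in>carrier E. x) : Hom K (rs A E) (rs G EG)"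
    by (rule hom_setI) (auto simp: scal_EG scal_module(2)[OF KA lE])
  then have "fin_gen K (rs G EG)"
    by (rule fin_gen_image[OF l1 l2 fdmD(2)[OF fE]]) auto
  then show "fin_gen K (rs (opp G) EG)" by simp
qed

lemma fDE: "fdm K G DE" by (rule fdm_dual[OF KG fEG])
lemma lDE: "left_module G DE" by (rule fdmD(1)[OF fDE])

text \<open>As \<open>A\<close> lies in \<open>add E\<close>, \<open>E\<close> is a projective right
  \<open>G\<close>-module: its dual basis consists of the elements \<open>a i 1\<close> and of the
  maps that send \<open>x\<close> to the endomorphism \<open>y |-> b i y x\<close>, read in
  \<open>G\<close>. Hence \<open>dual_extend\<close> applies.\<close>

lemma DE_extend:
  assumes M: "left_module G M" and N: "fdm K G N" and g: "g : Hom G M N" and f: "f : Hom G M DE"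
    and ker: "!!m. [|m :. M; g m = 0[N]|] ==> f m = 0[DE]"
  shows "EX h:Hom G N DE. ALL m:carrier M. h (g m) = f m"
proof -
  obtain n a b where ab: "!!l. l < (n::nat) ==> a l : Hom A (regular A) E" "!!l. l < n ==> b l : Hom A E (regular A)"
    "!!x. x :. A ==> (\<Oplus>\<^bsub>A\<^esub>l\<in>{..<n}. b l (a l x)) = x"
    using gen[unfolded fac_def regular_simps finsum_with_smult] by blast
  have bc: "b l y :. A" if "l < n" "y :. E" for l y using hom_closed[OF ab(2)[OF that(1)] that(2)] by simp
  define u where "u l x = compose (carrier E) (\<lambda>r\<in>carrier A. r .[E] x) (b l)" for l x
  have u: "u l x : Hom A E E" if "l < n" "x :. E" for l x
    unfolding u_def by (rule hom_compose[OF lE ab(2)[OF that(1)] smult_hom[OF lE that(2)]])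
  have ux: "\<psi> (\<chi> (u l x)) y = b l y .[E] x" if "l < n" "x :. E" "y :. E" for l x y
    using \<chi>(2)[OF u[OF that(1,2)]] bc that by (simp add: u_def compose_eq)
  note uG = \<chi>(1)[OF u]
  let ?t = "%l. \<lambda>x\<in>carrier E. \<chi> (u l x)"
  have t: "?t l : Hom G EG (regular (opp G))" if l: "l < n" for l
  proof (rule hom_setI)
    fix x y assume xy: "x :. EG" "y :. EG"
    have "\<chi> (u l (x +[E] y)) = \<chi> (u l x) +[G] \<chi> (u l y)"
      by (rule \<psi>_eqI) (use xy l uG bc in \<open>auto simp: ux \<psi>_add E.smult_r_distr\<close>)
    then show "?t l (x +[EG] y) = ?t l x +[regular (opp G)] ?t l y" using xy by simp
  next
    fix r x assume rx: "r :. G" "x :. EG"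
    have "\<chi> (u l (\<psi> r x)) = \<chi> (u l x) *[G] r"
      by (rule \<psi>_eqI) (use rx l uG bc \<psi>_closed in \<open>auto simp: ux \<psi>_mult hom_smult[OF \<psi>_hom] E.smult_closed\<close>)
    then show "?t l (r .[EG] x) = r .[regular (opp G)] ?t l x" using rx \<psi>_closed by simp
  qed (use uG l in auto)
  show ?thesis
  proof (rule dual_extend[OF KG EG_module _ t _ M N g f ker])
    have a1: "a i 1[A] :. E" if "i < n" for i using hom_closed[OF ab(1)[OF that], of "1[A]"] by simp
    then show "a i 1[A] :. EG" if "i < n" for i using that by simp
    fix y assume "y :. EG"
    then have y: "y :. E" by simp
    have "(\<Oplus>\<^bsub>EG\<^esub>i\<in>{..<n}. ?t i y .[EG] a i 1[A]) = (\<Oplus>\<^bsub>E\<^esub>i\<in>{..<n}. b i (a i 1[A]) .[E] y)"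
      unfolding finsum_with_smult
      using y a1 bc by (intro E.M.finsum_cong') (auto simp: ux E.smult_closed)
    also have "... = (\<Oplus>\<^bsub>A\<^esub>i\<in>{..<n}. b i (a i 1[A])) .[E] y"
      using y a1 bc by (intro E.finsum_smult[symmetric]) auto
    also have "... = y" using ab(3)[OF E.R.one_closed] y by (simp add: E.smult_one)
    finally show "(\<Oplus>\<^bsub>EG\<^esub>i\<in>{..<n}. ?t i y .[EG] a i 1[A]) = y" .
  qed
qed

text \<open>As \<open>D A\<close> lies in \<open>add E\<close>, transposition puts \<open>1\<close>
  into the trace of the right \<open>A\<close>-module \<open>D E\<close> in \<open>A\<close>.
  Basicness of \<open>A\<close> reduces the sum to one pair with \<open>\<beta>1 w1 = 1\<close>, and
  dualizing again exhibits \<open>DE\<close> as a summand of \<open>G\<close> with generator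
  \<open>w1\<close>.\<close>

lemma DE_generator:
  assumes fam: "basic_family A n0 e0"
  shows "EX w:carrier DE. EX t:Hom G DE (regular G). ALL \<eta>:carrier DE. t \<eta> .[DE] w = \<eta>"
proof -
  let ?oA = "regular (opp A)" and ?DA = "dual K A (regular (opp A))" and ?DEA = "dual K (opp A) E"
  let ?FE = "functionals K A E" and ?FA = "Hom K (rs A (regular (opp A))) (regular K)"
  note KoA = fd_algebra_opp[OF KA]
  have foA: "fdm K (opp A) ?oA" by (rule fdm_regular[OF KoA])
  have fE': "fdm K (opp (opp A)) E" using fE by simp
  note loA = fdmD(1)[OF foA]
  have fDEA: "fdm K (opp A) ?DEA" by (rule fdm_dual[OF KoA fE'])
  note lDEA = fdmD(1)[OF fDEA]
  interpret DEA: left_module "opp A" ?DEA by (rule lDEA)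
  have fDA: "fdm K A ?DA" by (rule fdm_dual[OF KA foA])
  note lDA = fdmD(1)[OF fDA]
  interpret DA: left_module A ?DA by (rule lDA)
  obtain m a b where ab: "!!l. l < (m::nat) ==> a l : Hom A ?DA E" "!!l. l < m ==> b l : Hom A E ?DA"
    "!!x. x :. ?DA ==> (\<Oplus>\<^bsub>?DA\<^esub>l\<in>{..<m}. b l (a l x)) = x"
    using cogen unfolding fac_def dual_regular_def by blast
  have bF: "b l x : ?FA" if "l < m" "x :. E" for l x using hom_closed[OF ab(2)[OF that(1)] that(2)] by simp
  have aE: "a l \<eta> :. E" if "l < m" "\<eta> : ?FA" for l \<eta> using hom_closed[OF ab(1)[OF that(1)], of \<eta>] that by simp
  \<comment> \<open>The functional that corresponds to \<open>b l\<close> under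
    \<open>Hom(E, D A) = D E\<close>.\<close>
  define w where "w l = (\<lambda>x\<in>carrier E. b l x 1[A])" for l
  have w: "w l : ?FE" if l: "l < m" for l
    unfolding w_def
  proof (rule functionalI)
    fix x y assume "x :. E" "y :. E"
    then show "(\<lambda>x\<in>carrier E. b l x 1[A]) (x +[E] y) =
        (\<lambda>x\<in>carrier E. b l x 1[A]) x +[K] (\<lambda>x\<in>carrier E. b l x 1[A]) y"
      by (simp add: hom_add[OF ab(2)[OF l]])
  next
    fix c x assume cx: "c :. K" "x :. E"
    then show "(\<lambda>x\<in>carrier E. b l x 1[A]) (scal A E c x) = c *[K] (\<lambda>x\<in>carrier E. b l x 1[A]) x"
      using hom_scal(2)[OF KA ab(2)[OF l] cx] scal_dual[OF KA loA bF[OF l cx(2)] cx(1)] scal_module(2)[OF KA lE] by simp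
  qed (use functionalD(1)[OF bF[OF l]] in auto)
  \<comment> \<open>The transpose of \<open>a l : D A -> E\<close> takes values in the double dual
    of \<open>A\<close>, hence in \<open>A\<close>.\<close>
  have "EX x:carrier A. ALL \<eta>:?FA. \<eta> x = \<zeta> (a l \<eta>)" if l: "l < m" and z: "\<zeta> : ?FE" for l \<zeta>
  proof -
    have "compose (carrier ?DA) \<zeta> (a l) : Hom K (rs A ?DA) (regular K)"
      using hom_compose[OF scal_module(1)[OF KA lDA] hom_scal(1)[OF KA ab(1)[OF l]] z] by simp
    from dual_reflexive[OF KA foA this] show ?thesis by (auto simp: compose_eq)
  qed
  then obtain \<beta>0 where \<beta>0: "!!l \<zeta>. [|l < m; \<zeta> : ?FE|] ==> \<beta>0 l \<zeta> :. A"
    "!!l \<zeta> \<eta>. [|l < m; \<zeta> : ?FE; \<eta> : ?FA|] ==> \<eta> (\<beta>0 l \<zeta>) = \<zeta> (a l \<eta>)" by metis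
  define \<beta> where "\<beta> l = restrict (\<beta>0 l) ?FE" for l
  have eqA: "x = y" if "x :. A" "y :. A" "!!\<eta>. \<eta> : ?FA ==> \<eta> x = \<eta> y" for x y
    using dual_eqI[OF KA foA, of x y] that by simp
  have FAadd: "\<eta> (x +[A] y) = \<eta> x +[K] \<eta> y" if "\<eta> : ?FA" "x :. A" "y :. A" for \<eta> x y
    using functionalD(2)[OF that(1), of x y] that by simp
  have \<beta>: "\<beta> l : Hom (opp A) ?DEA ?oA" if l: "l < m" for l
  proof (rule hom_setI)
    fix \<zeta> \<zeta>' assume "\<zeta> :. ?DEA" "\<zeta>' :. ?DEA"
    then have z: "\<zeta> : ?FE" "\<zeta>' : ?FE" "\<zeta> +[?DEA] \<zeta>' : ?FE" using DEA.M.a_closed[of \<zeta> \<zeta>'] by auto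
    have "\<beta>0 l (\<zeta> +[?DEA] \<zeta>') = \<beta>0 l \<zeta> +[A] \<beta>0 l \<zeta>'"
    proof (rule eqA)
      fix \<eta> assume \<eta>: "\<eta> : ?FA"
      show "\<eta> (\<beta>0 l (\<zeta> +[?DEA] \<zeta>')) = \<eta> (\<beta>0 l \<zeta> +[A] \<beta>0 l \<zeta>')"
        using \<beta>0(2)[OF l z(3) \<eta>] \<beta>0[OF l z(1)] \<beta>0[OF l z(2)] \<eta> aE[OF l \<eta>] by (simp add: FAadd)
    qed (use \<beta>0(1)[OF l] z in auto)
    then show "\<beta> l (\<zeta> +[?DEA] \<zeta>') = \<beta> l \<zeta> +[?oA] \<beta> l \<zeta>'" using z by (simp add: \<beta>_def)
  next
    fix r \<zeta> assume "r :. (opp A)" "\<zeta> :. ?DEA"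
    then have r: "r :. A" and z: "\<zeta> : ?FE" "r .[?DEA] \<zeta> : ?FE" using DEA.smult_closed[of r \<zeta>] by auto
    have "\<beta>0 l (r .[?DEA] \<zeta>) = \<beta>0 l \<zeta> *[A] r"
    proof (rule eqA)
      fix \<eta> assume \<eta>: "\<eta> : ?FA"
      have r\<eta>: "r .[?DA] \<eta> : ?FA" using DA.smult_closed[OF r, of \<eta>] \<eta> by simp
      have "\<eta> (\<beta>0 l \<zeta> *[A] r) = (r .[?DA] \<eta>) (\<beta>0 l \<zeta>)" using \<beta>0(1)[OF l z(1)] by simp
      also have "... = \<zeta> (a l (r .[?DA] \<eta>))" by (rule \<beta>0(2)[OF l z(1) r\<eta>])
      also have "a l (r .[?DA] \<eta>) = r .[E] a l \<eta>" by (rule hom_smult[OF ab(1)[OF l] r]) (use \<eta> in simp)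
      also have "\<zeta> ... = \<eta> (\<beta>0 l (r .[?DEA] \<zeta>))" using \<beta>0(2)[OF l z(2) \<eta>] aE[OF l \<eta>] by simp
      finally show "\<eta> (\<beta>0 l (r .[?DEA] \<zeta>)) = \<eta> (\<beta>0 l \<zeta> *[A] r)" by simp
    qed (use \<beta>0(1)[OF l] z r in auto)
    then show "\<beta> l (r .[?DEA] \<zeta>) = r .[?oA] \<beta> l \<zeta>" using z by (simp add: \<beta>_def)
  qed (use \<beta>0(1)[OF l] in \<open>auto simp: \<beta>_def\<close>)
  have \<beta>wc: "\<beta> l (w l) :. A" if "l < m" for l using \<beta>0(1)[OF that w[OF that]] w[OF that] by (simp add: \<beta>_def)
  have sum: "(\<Oplus>\<^bsub>A\<^esub>l\<in>{..<m}. \<beta> l (w l)) = 1[A]"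
  proof (rule eqA)
    show "(\<Oplus>\<^bsub>A\<^esub>l\<in>{..<m}. \<beta> l (w l)) :. A" using \<beta>wc by (intro E.R.finsum_closed) auto
    fix \<eta> assume \<eta>: "\<eta> : ?FA"
    have "\<eta> (\<Oplus>\<^bsub>A\<^esub>l\<in>{..<m}. \<beta> l (w l)) = (\<Oplus>\<^bsub>K\<^esub>l\<in>{..<m}. \<eta> (\<beta> l (w l)))"
      using functional_finsum[OF fd_algebraD(1)[OF KA] _ \<eta>, of "%l. \<beta> l (w l)" "{..<m}"] \<beta>wc E.R.abelian_group_axioms by auto
    also have "... = (\<Oplus>\<^bsub>K\<^esub>l\<in>{..<m}. b l (a l \<eta>) 1[A])"
      using \<beta>0(2)[OF _ w \<eta>] w aE \<eta> functionalD(1)[OF bF, of _ _ "1[A]"]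
      by (intro GK.R.finsum_cong') (auto simp: \<beta>_def w_def[of _])
    also have "... = (\<Oplus>\<^bsub>?DA\<^esub>l\<in>{..<m}. b l (a l \<eta>)) 1[A]"
      using dual_finsum[OF KA loA, of "1[A]" "{..<m}" "%l. b l (a l \<eta>)"] bF aE \<eta> by simp
    also have "... = \<eta> 1[A]" using ab(3)[of \<eta>] \<eta> by simp
    finally show "\<eta> (\<Oplus>\<^bsub>A\<^esub>l\<in>{..<m}. \<beta> l (w l)) = \<eta> 1[A]" .
  qed simp
  have "EX w:carrier ?DEA. EX \<beta>:Hom (opp A) ?DEA ?oA. 1[A] *[opp A] \<beta> w *[opp A] 1[A] = 1[A]"
    by (rule basic_idem_factor[OF KoA basic_family_opp[OF fam] lDEA, where m = m and w = w and \<beta> = \<beta>])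
      (use w \<beta> sum in auto)
  then obtain w1 \<beta>1 where w1: "w1 : ?FE" and \<beta>1: "\<beta>1 : Hom (opp A) ?DEA ?oA"
    and "1[A] *[opp A] \<beta>1 w1 *[opp A] 1[A] = 1[A]" by auto
  moreover have \<beta>1c: "\<beta>1 \<zeta> :. A" if "\<zeta> : ?FE" for \<zeta> using hom_closed[OF \<beta>1, of \<zeta>] that by simp
  ultimately have \<beta>w1: "\<beta>1 w1 = 1[A]" using w1 by simp
  have \<beta>1a: "\<beta>1 (\<zeta> +[?DEA] \<zeta>') = \<beta>1 \<zeta> +[A] \<beta>1 \<zeta>'" if "\<zeta> : ?FE" "\<zeta>' : ?FE" for \<zeta> \<zeta>'
    using hom_add[OF \<beta>1, of \<zeta> \<zeta>'] that by simp
  have \<beta>1s: "\<beta>1 (r .[?DEA] \<zeta>) = \<beta>1 \<zeta> *[A] r" if "\<zeta> : ?FE" "r :. A" for \<zeta> r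
    using hom_smult[OF \<beta>1, of r \<zeta>] that by simp
  have \<beta>1c': "\<beta>1 (scal (opp A) ?DEA c \<zeta>) = c .[A] \<beta>1 \<zeta>" if "\<zeta> : ?FE" "c :. K" for \<zeta> c
    using hom_scal(2)[OF KoA \<beta>1 that(2), of \<zeta>] scal_regular[OF KoA that(2), of "\<beta>1 \<zeta>"] that \<beta>1c by simp
  \<comment> \<open>The endomorphism \<open>\<tau> \<eta>\<close> of \<open>E\<close> is prescribed
    through its transpose; composing it with \<open>w1\<close> gives back \<open>\<eta>\<close>,
    because \<open>\<beta>1 w1 = 1\<close>.\<close>
  have "EX y:carrier E. ALL \<zeta>:?FE. \<zeta> y = \<eta> (\<beta>1 \<zeta> .[E] x)" if \<eta>: "\<eta> : ?FE" and x: "x :. E" for \<eta> x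
  proof -
    let ?\<Phi> = "\<lambda>\<zeta>\<in>?FE. \<eta> (\<beta>1 \<zeta> .[E] x)"
    have cl: "\<beta>1 \<zeta> .[E] x :. E" if "\<zeta> : ?FE" for \<zeta> using E.smult_closed \<beta>1c that x by simp
    have "?\<Phi> : Hom K (rs (opp A) ?DEA) (regular K)"
    proof (rule functionalI)
      fix \<zeta> \<zeta>' assume "\<zeta> :. ?DEA" "\<zeta>' :. ?DEA"
      then have z: "\<zeta> : ?FE" "\<zeta>' : ?FE" "\<zeta> +[?DEA] \<zeta>' : ?FE" using DEA.M.a_closed[of \<zeta> \<zeta>'] by auto
      have "\<eta> (\<beta>1 (\<zeta> +[?DEA] \<zeta>') .[E] x) = \<eta> (\<beta>1 \<zeta> .[E] x) +[K] \<eta> (\<beta>1 \<zeta>' .[E] x)"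
        unfolding \<beta>1a[OF z(1,2)] using E.smult_l_distr[OF \<beta>1c[OF z(1)] \<beta>1c[OF z(2)] x]
          functionalD(2)[OF \<eta> cl[OF z(1)] cl[OF z(2)]] by simp
      then show "?\<Phi> (\<zeta> +[?DEA] \<zeta>') = ?\<Phi> \<zeta> +[K] ?\<Phi> \<zeta>'" using z by simp
    next
      fix c \<zeta> assume c: "c :. K" and "\<zeta> :. ?DEA"
      then have z: "\<zeta> : ?FE" "scal (opp A) ?DEA c \<zeta> : ?FE" using scal_module(2)[OF KoA lDEA, of c \<zeta>] by auto
      have "\<eta> (\<beta>1 (scal (opp A) ?DEA c \<zeta>) .[E] x) = c *[K] \<eta> (\<beta>1 \<zeta> .[E] x)"
        unfolding \<beta>1c'[OF z(1) c] scal_module(4)[OF KA lE \<beta>1c[OF z(1)] c x]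
        by (rule functionalD(3)[OF \<eta> c cl[OF z(1)]])
      then show "?\<Phi> (scal (opp A) ?DEA c \<zeta>) = c *[K] ?\<Phi> \<zeta>" using z by simp
    qed (use cl functionalD(1)[OF \<eta>] in auto)
    from dual_reflexive[OF KoA fE' this] show ?thesis by auto
  qed
  then obtain \<tau> where \<tau>: "!!\<eta> x. [|\<eta> : ?FE; x :. E|] ==> \<tau> \<eta> x :. E"
    "!!\<eta> x \<zeta>. [|\<eta> : ?FE; x :. E; \<zeta> : ?FE|] ==> \<zeta> (\<tau> \<eta> x) = \<eta> (\<beta>1 \<zeta> .[E] x)" by metis
  have eqE: "x = y" if "x :. E" "y :. E" "!!\<zeta>. \<zeta> : ?FE ==> \<zeta> x = \<zeta> y" for x y
    using dual_eqI[OF KoA fE', of x y] that by simp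
  have \<tau>H: "restrict (\<tau> \<eta>) (carrier E) : Hom A E E" if \<eta>: "\<eta> : ?FE" for \<eta>
  proof (rule hom_setI)
    fix x y assume xy: "x :. E" "y :. E"
    have "\<tau> \<eta> (x +[E] y) = \<tau> \<eta> x +[E] \<tau> \<eta> y"
    proof (rule eqE)
      fix \<zeta> assume z: "\<zeta> : ?FE"
      have "\<zeta> (\<tau> \<eta> (x +[E] y)) = \<eta> (\<beta>1 \<zeta> .[E] (x +[E] y))"
        by (rule \<tau>(2)[OF \<eta> _ z]) (use xy in simp)
      also have "... = \<eta> (\<beta>1 \<zeta> .[E] x) +[K] \<eta> (\<beta>1 \<zeta> .[E] y)"
        unfolding E.smult_r_distr[OF \<beta>1c[OF z] xy]
        by (rule functionalD(2)[OF \<eta>]) (use xy \<beta>1c[OF z] E.smult_closed in auto)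
      also have "... = \<zeta> (\<tau> \<eta> x +[E] \<tau> \<eta> y)"
        unfolding functionalD(2)[OF z \<tau>(1)[OF \<eta> xy(1)] \<tau>(1)[OF \<eta> xy(2)]]
          \<tau>(2)[OF \<eta> xy(1) z] \<tau>(2)[OF \<eta> xy(2) z] ..
      finally show "\<zeta> (\<tau> \<eta> (x +[E] y)) = \<zeta> (\<tau> \<eta> x +[E] \<tau> \<eta> y)" .
    qed (use xy \<tau>(1)[OF \<eta>] in auto)
    then show "restrict (\<tau> \<eta>) (carrier E) (x +[E] y) =
        restrict (\<tau> \<eta>) (carrier E) x +[E] restrict (\<tau> \<eta>) (carrier E) y" using xy by simp
  next
    fix r x assume rx: "r :. A" "x :. E"
    have "\<tau> \<eta> (r .[E] x) = r .[E] \<tau> \<eta> x"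
    proof (rule eqE)
      fix \<zeta> assume z: "\<zeta> : ?FE"
      have rz: "r .[?DEA] \<zeta> : ?FE" using DEA.smult_closed[of r \<zeta>] rx z by simp
      have "\<zeta> (r .[E] \<tau> \<eta> x) = (r .[?DEA] \<zeta>) (\<tau> \<eta> x)" using \<tau>(1)[OF \<eta> rx(2)] by simp
      also have "... = \<eta> (\<beta>1 (r .[?DEA] \<zeta>) .[E] x)" by (rule \<tau>(2)[OF \<eta> rx(2) rz])
      also have "... = \<eta> (\<beta>1 \<zeta> .[E] (r .[E] x))"
        unfolding \<beta>1s[OF z rx(1)] using E.smult_assoc1[OF \<beta>1c[OF z] rx] by simp
      also have "... = \<zeta> (\<tau> \<eta> (r .[E] x))" using \<tau>(2)[OF \<eta> _ z] E.smult_closed[OF rx] by simp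
      finally show "\<zeta> (\<tau> \<eta> (r .[E] x)) = \<zeta> (r .[E] \<tau> \<eta> x)" by simp
    qed (use rx \<tau>(1)[OF \<eta>] E.smult_closed in auto)
    then show "restrict (\<tau> \<eta>) (carrier E) (r .[E] x) = r .[E] restrict (\<tau> \<eta>) (carrier E) x"
      using rx E.smult_closed by simp
  qed (use \<tau>(1)[OF \<eta>] in auto)
  let ?t = "\<lambda>\<eta>\<in>?FE. \<chi> (restrict (\<tau> \<eta>) (carrier E))"
  note tG = \<chi>(1)[OF \<tau>H]
  have t\<psi>: "\<psi> (\<chi> (restrict (\<tau> \<eta>) (carrier E))) x = \<tau> \<eta> x" if "\<eta> : ?FE" "x :. E" for \<eta> x
    using \<chi>(2)[OF \<tau>H[OF that(1)]] that by simp
  interpret D: left_module G DE by (rule lDE)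
  have "?t : Hom G DE (regular G)"
  proof (rule hom_setI)
    fix \<eta> \<eta>' assume "\<eta> :. DE" "\<eta>' :. DE"
    then have \<eta>: "\<eta> : ?FE" "\<eta>' : ?FE" "\<eta> +[DE] \<eta>' : ?FE"
      using D.M.a_closed[of \<eta> \<eta>'] by (auto simp: functionals_EG)
    have "\<chi> (restrict (\<tau> (\<eta> +[DE] \<eta>')) (carrier E)) =
        \<chi> (restrict (\<tau> \<eta>) (carrier E)) +[G] \<chi> (restrict (\<tau> \<eta>') (carrier E))"
    proof (rule \<psi>_eqI)
      fix x assume x: "x :. E"
      have "\<tau> (\<eta> +[DE] \<eta>') x = \<tau> \<eta> x +[E] \<tau> \<eta>' x"
      proof (rule eqE)
        fix \<zeta> assume z: "\<zeta> : ?FE"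
        show "\<zeta> (\<tau> (\<eta> +[DE] \<eta>') x) = \<zeta> (\<tau> \<eta> x +[E] \<tau> \<eta>' x)"
          using \<tau>(2)[OF \<eta>(3) x z] \<tau>[OF \<eta>(1) x] \<tau>[OF \<eta>(2) x] z E.smult_closed[OF \<beta>1c[OF z] x]
          by (simp add: functionalD(2)[OF z])
      qed (use \<tau>(1) \<eta> x in auto)
      then show "\<psi> (\<chi> (restrict (\<tau> (\<eta> +[DE] \<eta>')) (carrier E))) x =
          \<psi> (\<chi> (restrict (\<tau> \<eta>) (carrier E)) +[G] \<chi> (restrict (\<tau> \<eta>') (carrier E))) x"
        using t\<psi>[OF \<eta>(3) x] t\<psi>[OF \<eta>(1) x] t\<psi>[OF \<eta>(2) x] \<psi>_add[OF tG[OF \<eta>(1)] tG[OF \<eta>(2)] x] by simp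
    qed (use tG \<eta> in auto)
    then show "?t (\<eta> +[DE] \<eta>') = ?t \<eta> +[regular G] ?t \<eta>'" using \<eta> by simp
  next
    fix g \<eta> assume g: "g :. G" and "\<eta> :. DE"
    then have \<eta>: "\<eta> : ?FE" "g .[DE] \<eta> : ?FE" using D.smult_closed[of g \<eta>] by (auto simp: functionals_EG)
    have "\<chi> (restrict (\<tau> (g .[DE] \<eta>)) (carrier E)) = g *[G] \<chi> (restrict (\<tau> \<eta>) (carrier E))"
    proof (rule \<psi>_eqI)
      fix x assume x: "x :. E"
      note gx = \<psi>_closed[OF g x]
      have "\<tau> (g .[DE] \<eta>) x = \<tau> \<eta> (\<psi> g x)"
      proof (rule eqE)
        fix \<zeta> assume z: "\<zeta> : ?FE"
        show "\<zeta> (\<tau> (g .[DE] \<eta>) x) = \<zeta> (\<tau> \<eta> (\<psi> g x))"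
          using \<tau>(2)[OF \<eta>(2) x z] \<tau>(2)[OF \<eta>(1) gx z] E.smult_closed[OF \<beta>1c[OF z] x]
            hom_smult[OF \<psi>_hom[OF g] \<beta>1c[OF z] x] by simp
      qed (use \<tau>(1) \<eta> x gx in auto)
      then show "\<psi> (\<chi> (restrict (\<tau> (g .[DE] \<eta>)) (carrier E))) x =
          \<psi> (g *[G] \<chi> (restrict (\<tau> \<eta>) (carrier E))) x"
        using t\<psi>[OF \<eta>(2) x] t\<psi>[OF \<eta>(1) gx] \<psi>_mult[OF g tG[OF \<eta>(1)] x] by simp
    qed (use tG[OF \<eta>(2)] G.R.m_closed[OF g tG[OF \<eta>(1)]] in auto)
    then show "?t (g .[DE] \<eta>) = g .[regular G] ?t \<eta>" using \<eta> by simp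
  qed (use tG in "auto simp: functionals_EG")
  moreover have "?t \<eta> .[DE] w1 = \<eta>" if "\<eta> :. DE" for \<eta>
  proof -
    have \<eta>: "\<eta> : ?FE" using that by (simp add: functionals_EG)
    show ?thesis
      using \<eta> functionalD(4)[OF \<eta>] t\<psi>[OF \<eta>] \<tau>(2)[OF \<eta> _ w1] \<beta>w1
      by (intro carrier_eqI[of _ E]) (auto simp: E.smult_one)
  qed
  moreover have "w1 :. DE" using w1 by (simp add: functionals_EG)
  ultimately show ?thesis by blast
qed

text \<open>\<open>X\<close> embeds into a free module and \<open>G\<close> acts faithfully on
  \<open>E\<close>, so a functional on \<open>E\<close> detects each nonzero element of
  \<open>X\<close>. Injectivity of \<open>X\<close> turns cogeneration by \<open>DE\<close> into a
  splitting.\<close>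

lemma fac_DE:
  assumes P: "projective G X" and I: "injective G X"
  shows "fac G DE X"
proof (rule fac_of_separated[OF KG I fDE])
  fix x assume x: "x :. X" "x ~= 0[X]"
  have lX: "left_module G X" using P by (simp add: projective_def fg_module_def)
  obtain t where t: "t : Hom G X (regular G)" "t x ~= 0[G]" using projective_separated[OF KG P x] by blast
  have tx: "t x :. G" using hom_closed[OF t(1) x(1)] by simp
  have "EX y:carrier E. \<psi> (t x) y ~= 0[E]"
  proof (rule ccontr)
    assume "\<not> ?thesis"
    moreover have "\<psi> 0[G] y = 0[E]" if y: "y :. E" for y
      using \<psi>_add[of "0[G]" "0[G]" y] y \<psi>_closed[of "0[G]" y] by simp
    ultimately have "t x = 0[G]" using tx by (intro \<psi>_eqI) auto
    then show False using t(2) by simp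
  qed
  then obtain y where y: "y :. E" "\<psi> (t x) y ~= 0[E]" by blast
  interpret V: vspace K "rs G EG" by (rule scal_module_opp(2)[OF KG EG_module])
  have "EX \<eta>:functionals K G EG. \<eta> (\<psi> (t x) y) ~= 0[K]"
    using V.functional_separate[of "\<psi> (t x) y"] fdmD(2)[OF fEG] \<psi>_closed[OF tx y(1)] y(2) by auto
  then obtain \<eta> where \<eta>: "\<eta> :. DE" "\<eta> (\<psi> (t x) y) ~= 0[K]" by auto
  have "compose (carrier X) (\<lambda>r\<in>carrier G. r .[DE] \<eta>) t : Hom G X DE"
    by (rule hom_compose[OF lX t(1) smult_hom[OF lDE \<eta>(1)]])
  moreover have "compose (carrier X) (\<lambda>r\<in>carrier G. r .[DE] \<eta>) t x ~= 0[DE]"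
  proof
    assume "compose (carrier X) (\<lambda>r\<in>carrier G. r .[DE] \<eta>) t x = 0[DE]"
    then have "(\<lambda>x'\<in>carrier E. \<eta> (\<psi> (t x) x')) = (\<lambda>x\<in>carrier E. 0[K])" using x(1) tx by (simp add: compose_eq)
    from fun_cong[OF this, of y] show False using \<eta>(2) y(1) by simp
  qed
  ultimately show "EX a:Hom G X DE. a x ~= 0[DE]" by blast
qed

text \<open>\<open>DE\<close> is itself a projective-injective summand of \<open>G\<close>, and by
  basicness of \<open>G\<close> the module \<open>P\<close> is a retract of one copy of it.
  Maximality of \<open>P\<close> is applied to a list copy \<open>Q\<close>, as it quantifies over
  such carriers.\<close>

lemma P_iso_DE:
  fixes P :: "('g, 'p) module"
  assumes famA: "basic_family A n0 e0" and famG: "basic_family G n1 e1" and P: "max_proj_inj_summand G P"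
  shows "EX \<kappa> \<kappa>'. isos G P DE \<kappa> \<kappa>'"
proof -
  have pP: "projective G P" and iP: "injective G P" and sP: "summand G P (regular G)"
    using P by (auto simp: max_proj_inj_summand_def proj_inj_summand_def)
  have lP: "left_module G P" using pP by (simp add: projective_def fg_module_def)
  obtain Q :: "('g, 'k list) module" and f g where Q: "isos G DE Q f g" and fQ: "fdm K G Q"
    using list_copy[OF KG fDE] by blast
  note i = isosD[OF Q] and lQ = fdmD(1)[OF fQ]
  interpret D: left_module G DE by (rule lDE)
  interpret Q: left_module G Q by (rule lQ)
  obtain w t where w: "w :. DE" and t: "t : Hom G DE (regular G)"
    and tw: "!!\<eta>. \<eta> :. DE ==> t \<eta> .[DE] w = \<eta>" using DE_generator[OF famA] by blast
  let ?t = "compose (carrier Q) t g"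
  have t': "?t : Hom G Q (regular G)" by (rule hom_compose[OF lQ i(2) t])
  have t'c: "?t p :. G" if "p :. Q" for p using hom_closed[OF t' that] by simp
  have tw': "?t p .[Q] f w = p" if p: "p :. Q" for p
  proof -
    have "?t p .[Q] f w = f (t (g p) .[DE] w)"
      using hom_smult[OF i(1) t'c[OF p] w] p by (simp add: compose_eq)
    then show ?thesis using tw[OF i(6)[OF p]] i(4)[OF p] by simp
  qed
  have projQ: "projective G Q" by (rule projective_of_retract[OF KG fQ t' i(5)[OF w] tw'])
  have sumQ: "summand G Q (regular G)"
    by (rule summandI[OF KG fdm_regular[OF KG] lQ t' smult_hom[OF lQ i(5)[OF w]]]) (use t'c tw' in simp)
  have "EX h:Hom G Y Q. ALL x:carrier X. h (u x) = v x"
    if X: "fg_module G X" and Y: "fg_module G Y" and u: "u : Hom G X Y" and v: "v : Hom G X Q"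
      and inj: "inj_on u (carrier X)" for u v and X Y :: "('g, 'k list) module"
  proof -
    have lX: "left_module G X" and fY: "fdm K G Y" using X Y fg_module_iff[OF KG] by (auto simp: fg_module_def)
    interpret X: left_module G X by (rule lX)
    have "EX h:Hom G Y DE. ALL m:carrier X. h (u m) = compose (carrier X) g v m"
    proof (rule DE_extend[OF lX fY u hom_compose[OF lX v i(2)]])
      fix m assume m: "m :. X" "u m = 0[Y]"
      have "u 0[X] = 0[Y]" by (rule hom_zero[OF u X.M_group fdmD(3)[OF fY]])
      then have "m = 0[X]" using inj m by (auto simp: inj_on_def)
      then show "compose (carrier X) g v m = 0[DE]"
        using hom_zero[OF hom_compose[OF lX v i(2)] X.M_group D.M_group] by simp
    qed
    then obtain h where h: "h : Hom G Y DE" "!!m. m :. X ==> h (u m) = g (v m)" by (auto simp: compose_eq)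
    show ?thesis using hom_compose[OF fdmD(1)[OF fY] h(1) i(1)] h(2) hom_closed[OF u] hom_closed[OF v] i(4)
      by (intro bexI[of _ "compose (carrier Y) f h"]) (auto simp: compose_eq)
  qed
  then have injQ: "injective G Q" unfolding injective_def using fQ fg_module_iff[OF KG] by blast
  obtain \<alpha> \<beta> where ab: "\<alpha> : Hom G P (regular G)" "\<beta> : Hom G (regular G) P"
    "!!x. x :. P ==> \<beta> (\<alpha> x) = x" using summandE[OF sP lP] by blast
  obtain \<gamma> \<delta> where cd: "\<gamma> : Hom G P DE" "\<delta> : Hom G DE P" "!!x. x :. P ==> \<delta> (\<gamma> x) = x"
    using retract_of_fac[OF KG famG lP lDE ab fac_DE[OF pP iP]] by blast
  have "summand G P Q"
    by (rule summandI[OF KG fQ lP hom_compose[OF lP cd(1) i(1)] hom_compose[OF lQ i(2) cd(2)]])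
      (use cd(3) hom_closed[OF cd(1)] i(3,5) in "simp add: compose_eq")
  then have "mod_iso G P Q" using P projQ injQ sumQ
    unfolding max_proj_inj_summand_def proj_inj_summand_def by blast
  then obtain a b where j: "isos G P Q a b" using mod_iso_isos[OF lP] by blast
  note j' = isosD[OF j]
  have "isos G P DE (compose (carrier P) g a) (compose (carrier DE) b f)"
    unfolding isos_def using hom_compose[OF lP j'(1) i(2)] hom_compose[OF lDE i(1) j'(2)] i j'
    by (auto simp: compose_eq)
  then show ?thesis by blast
qed

end

section \<open>Vanishing of Ext and exactness\<close>

lemma hom_sub:
  assumes M: "left_module R M" and N: "left_module R N" and f: "f : Hom R M N" and g: "g : Hom R M N"
  shows "(\<lambda>x\<in>carrier M. f x -[N] g x) : Hom R M N"
proof -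
  interpret M: left_module R M by fact
  interpret N: left_module R N by fact
  show ?thesis
    by (rule hom_setI)
      (simp_all add: hom_closed[OF f] hom_closed[OF g] hom_add[OF f] hom_add[OF g] hom_smult[OF f] hom_smult[OF g]
        M.smult_closed a_minus_def N.M.minus_add N.M.a_ac N.smult_r_distr N.smult_minus_right N.smult_closed)
qed

lemma hom_zero_map:
  assumes M: "left_module R M" and N: "left_module R N"
  shows "(\<lambda>x\<in>carrier M. 0[N]) : Hom R M N"
proof -
  interpret M: left_module R M by fact
  interpret N: left_module R N by fact
  show ?thesis by (rule hom_setI) (simp_all add: M.smult_closed N.smult_zero_right)
qed

lemma hom_sum:
  assumes M: "left_module R M" and N: "left_module R N" and f: "!!l. l < (n::nat) ==> f l : Hom R M N"
  shows "(\<lambda>x\<in>carrier M. \<Oplus>\<^bsub>N\<^esub>l\<in>{..<n}. f l x) : Hom R M N"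
proof -
  interpret M: left_module R M by fact
  interpret N: left_module R N by fact
  have c: "(%l. f l x) : {..<n} \<rightarrow> carrier N" if "x :. M" for x using hom_closed[OF f] that by auto
  show ?thesis
  proof (rule hom_setI)
    fix x y assume xy: "x :. M" "y :. M"
    have "(\<Oplus>\<^bsub>N\<^esub>l\<in>{..<n}. f l (x +[M] y)) = (\<Oplus>\<^bsub>N\<^esub>l\<in>{..<n}. f l x +[N] f l y)"
      using c[OF xy(1)] c[OF xy(2)] xy by (intro N.M.finsum_cong') (auto simp: hom_add[OF f] Pi_iff)
    also have "... = (\<Oplus>\<^bsub>N\<^esub>l\<in>{..<n}. f l x) +[N] (\<Oplus>\<^bsub>N\<^esub>l\<in>{..<n}. f l y)"
      by (rule N.M.finsum_addf[OF c[OF xy(1)] c[OF xy(2)]])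
    finally show "(\<lambda>x\<in>carrier M. \<Oplus>\<^bsub>N\<^esub>l\<in>{..<n}. f l x) (x +[M] y) =
      (\<lambda>x\<in>carrier M. \<Oplus>\<^bsub>N\<^esub>l\<in>{..<n}. f l x) x +[N] (\<lambda>x\<in>carrier M. \<Oplus>\<^bsub>N\<^esub>l\<in>{..<n}. f l x) y"
      using xy by simp
  next
    fix r x assume rx: "r :. R" "x :. M"
    have "(\<Oplus>\<^bsub>N\<^esub>l\<in>{..<n}. f l (r .[M] x)) = (\<Oplus>\<^bsub>N\<^esub>l\<in>{..<n}. r .[N] f l x)"
      using c[OF rx(2)] rx by (intro N.M.finsum_cong') (auto simp: hom_smult[OF f] Pi_iff N.smult_closed)
    also have "... = r .[N] (\<Oplus>\<^bsub>N\<^esub>l\<in>{..<n}. f l x)" using N.smult_finsum[OF rx(1) c[OF rx(2)]] by simp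
    finally show "(\<lambda>x\<in>carrier M. \<Oplus>\<^bsub>N\<^esub>l\<in>{..<n}. f l x) (r .[M] x) =
      r .[N] (\<lambda>x\<in>carrier M. \<Oplus>\<^bsub>N\<^esub>l\<in>{..<n}. f l x) x" using rx M.smult_closed by simp
  qed (use c N.M.finsum_closed in auto)
qed

lemma hom_descend:
  assumes M: "left_module R M" and N: "left_module R N" and L: "left_module R L"
    and g: "g : Hom R M N" and surj: "carrier N \<subseteq> g ` carrier M" and l: "l : Hom R M L"
    and ker: "!!x. [|x :. M; g x = 0[N]|] ==> l x = 0[L]"
  shows "EX h:Hom R N L. ALL x:carrier M. h (g x) = l x"
proof -
  interpret M: left_module R M by fact
  interpret N: left_module R N by fact
  interpret L: left_module R L by fact
  have lg: "l x = l x'" if "x :. M" "x' :. M" "g x = g x'" for x x'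
  proof -
    have "g (x -[M] x') = 0[N]"
      using that hom_closed[OF g]
      by (simp add: hom_diff[OF g M.M_group N.M_group]) (simp add: a_minus_def N.M.r_neg)
    then have z: "l (x -[M] x') = 0[L]" using that ker[of "x -[M] x'"] by simp
    have "l x = l ((x -[M] x') +[M] x')" using that by (simp add: a_minus_def M.M.a_assoc M.M.l_neg)
    also have "... = l (x -[M] x') +[L] l x'" by (rule hom_add[OF l]) (use that in auto)
    finally show ?thesis using that z hom_closed[OF l] by simp
  qed
  define s where "s = inv_into (carrier M) g"
  have s: "s z :. M" "g (s z) = z" if "z :. N" for z
    using that surj by (auto simp: s_def inv_into_into f_inv_into_f subset_iff)
  have sg: "l (s (g x)) = l x" if x: "x :. M" for x
    by (rule lg[OF s(1)[OF hom_closed[OF g x]] x s(2)[OF hom_closed[OF g x]]])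
  have "(\<lambda>z\<in>carrier N. l (s z)) : Hom R N L"
  proof (rule hom_setI)
    fix u v assume uv: "u :. N" "v :. N"
    have "l (s (u +[N] v)) = l (s u +[M] s v)"
      by (rule lg) (use s uv in "auto simp: hom_add[OF g]")
    then show "(\<lambda>z\<in>carrier N. l (s z)) (u +[N] v) = (\<lambda>z\<in>carrier N. l (s z)) u +[L] (\<lambda>z\<in>carrier N. l (s z)) v"
      using uv s by (simp add: hom_add[OF l])
  next
    fix r u assume ru: "r :. R" "u :. N"
    have "l (s (r .[N] u)) = l (r .[M] s u)"
      by (rule lg) (use s ru in "auto simp: hom_smult[OF g] M.smult_closed N.smult_closed")
    then show "(\<lambda>z\<in>carrier N. l (s z)) (r .[N] u) = r .[L] (\<lambda>z\<in>carrier N. l (s z)) u"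
      using ru s N.smult_closed by (simp add: hom_smult[OF l])
  qed (use s hom_closed[OF l] in auto)
  then show ?thesis using sg hom_closed[OF g] by (intro bexI[of _ "\<lambda>z\<in>carrier N. l (s z)"]) auto
qed

section \<open>Lifting along cotilting sequences and extending along injective resolutions\<close>

lemma proj_resolutionD:
  assumes "proj_resolution A P d M p"
  shows "projective A (P i)" "d i : Hom A (P (Suc i)) (P i)" "p : Hom A (P 0) M"
    "p ` carrier (P 0) = carrier M" "d 0 ` carrier (P (Suc 0)) = {x : carrier (P 0). p x = 0[M]}"
    "d (Suc i) ` carrier (P (Suc (Suc i))) = {x : carrier (P (Suc i)). d i x = 0[P i]}"
proof -
  have l: "left_seq A m P d M p" for m using assms by (simp add: proj_resolution_def)
  show "projective A (P i)" using assms by (simp add: proj_resolution_def)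
  show "d i : Hom A (P (Suc i)) (P i)" using l[of "Suc i"] by (simp add: left_seq_def)
  show "p : Hom A (P 0) M" using l[of 0] by (simp add: left_seq_def)
  show "p ` carrier (P 0) = carrier M" using l[of 0] by (simp add: left_seq_def exact_onto_def)
  show "d 0 ` carrier (P (Suc 0)) = {x : carrier (P 0). p x = 0[M]}"
    using l[of 1] by (simp add: left_seq_def exact_onto_def a_kernel_def')
  show "d (Suc i) ` carrier (P (Suc (Suc i))) = {x : carrier (P (Suc i)). d i x = 0[P i]}"
    using l[of "Suc (Suc i)"] by (simp add: left_seq_def exact_onto_def a_kernel_def')
qed

lemma inj_resolutionD:
  assumes "inj_resolution A N j I d"
  shows "injective A (I i)" "d i : Hom A (I i) (I (Suc i))" "j : Hom A N (I 0)" "inj_on j (carrier N)"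
    "j ` carrier N = {x : carrier (I 0). d 0 x = 0[I (Suc 0)]}"
    "d i ` carrier (I i) = {x : carrier (I (Suc i)). d (Suc i) x = 0[I (Suc (Suc i))]}"
proof -
  have l: "right_seq A m N j I d" for m using assms by (simp add: inj_resolution_def)
  show "injective A (I i)" using assms by (simp add: inj_resolution_def)
  show "d i : Hom A (I i) (I (Suc i))" using l[of "Suc i"] by (simp add: right_seq_def)
  show "j : Hom A N (I 0)" using l[of 0] by (simp add: right_seq_def)
  show "inj_on j (carrier N)" using l[of 0] by (simp add: right_seq_def exact_from_def)
  show "j ` carrier N = {x : carrier (I 0). d 0 x = 0[I (Suc 0)]}"
    using l[of 1] by (simp add: right_seq_def exact_from_def a_kernel_def')
  show "d i ` carrier (I i) = {x : carrier (I (Suc i)). d (Suc i) x = 0[I (Suc (Suc i))]}"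
    using l[of "Suc (Suc i)"] by (simp add: right_seq_def exact_from_def a_kernel_def')
qed

lemma projective_fdm: "fd_algebra K R ==> projective R P ==> fdm K R P"
  using fg_module_iff unfolding projective_def by blast

lemma injective_fdm: "fd_algebra K R ==> injective R P ==> fdm K R P"
  using fg_module_iff unfolding injective_def by blast

text \<open>The components of the identity of \<open>X\<close> through \<open>C\<close> turn a
  cocycle with values in \<open>X\<close> into cocycles with values in \<open>C\<close>, which are
  coboundaries. The resolution is a parameter, since \<open>ext_vanishes\<close> vouches for one
  resolution only.\<close>

lemma ext_vanishes_fac:
  fixes R :: "('k, 'r) module"
  assumes K: "fd_algebra K R" and C: "left_module R C" and X: "left_module R X" and fac: "fac R C X"
    and res: "proj_resolution R Q \<delta> M \<pi>"
    and cc: "cocycles R Q \<delta> C (Suc i) = coboundaries R Q \<delta> C (Suc i)"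
    and g: "g : Hom R (Q (Suc i)) X" and gd: "!!x. x :. (Q (Suc (Suc i))) ==> g (\<delta> (Suc i) x) = 0[X]"
  shows "EX h:Hom R (Q i) X. ALL x:carrier (Q (Suc i)). g x = h (\<delta> i x)"
proof -
  note r = proj_resolutionD[OF res]
  have lQ: "left_module R (Q i)" for i using r(1)[of i] by (simp add: projective_def fg_module_def)
  interpret X: left_module R X by (rule X)
  interpret C: left_module R C by (rule C)
  obtain n a b where ab: "!!l. l < (n::nat) ==> a l : Hom R X C" "!!l. l < n ==> b l : Hom R C X"
    "!!x. x :. X ==> (\<Oplus>\<^bsub>X\<^esub>l\<in>{..<n}. b l (a l x)) = x"
    using fac unfolding fac_def by blast
  have "EX h:Hom R (Q i) C. ALL x:carrier (Q (Suc i)). a l (g x) = h (\<delta> i x)" if l: "l < n" for l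
  proof -
    have "compose (carrier (Q (Suc i))) (a l) g : cocycles R Q \<delta> C (Suc i)"
      unfolding cocycles_def
      using hom_compose[OF lQ g ab(1)[OF l]] gd hom_closed[OF r(2)[of "Suc i"]]
        hom_zero[OF ab(1)[OF l] X.M_group C.M_group]
      by (simp add: compose_eq)
    then have "compose (carrier (Q (Suc i))) (a l) g : (%f. compose (carrier (Q (Suc i))) f (\<delta> i)) ` Hom R (Q i) C"
      unfolding cc by simp
    then obtain h where h: "h : Hom R (Q i) C"
      "compose (carrier (Q (Suc i))) (a l) g = compose (carrier (Q (Suc i))) h (\<delta> i)" by blast
    have "a l (g x) = h (\<delta> i x)" if "x :. (Q (Suc i))" for x
      using fun_cong[OF h(2), of x] that by (simp add: compose_eq)
    then show ?thesis using h(1) by blast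
  qed
  then obtain h where h: "!!l. l < n ==> h l : Hom R (Q i) C"
    "!!l x. [|l < n; x :. (Q (Suc i))|] ==> a l (g x) = h l (\<delta> i x)" by metis
  let ?h = "\<lambda>y\<in>carrier (Q i). \<Oplus>\<^bsub>X\<^esub>l\<in>{..<n}. compose (carrier (Q i)) (b l) (h l) y"
  have "?h : Hom R (Q i) X"
    by (rule hom_sum[OF lQ X]) (rule hom_compose[OF lQ h(1) ab(2)])
  moreover have "g x = ?h (\<delta> i x)" if x: "x :. (Q (Suc i))" for x
  proof -
    have dx: "\<delta> i x :. (Q i)" using hom_closed[OF r(2) x] .
    have gx: "g x :. X" using hom_closed[OF g x] .
    have bx: "b l (a l (g x)) :. X" if "l < n" for l
      using hom_closed[OF ab(2)[OF that] hom_closed[OF ab(1)[OF that] gx]] .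
    have "?h (\<delta> i x) = (\<Oplus>\<^bsub>X\<^esub>l\<in>{..<n}. b l (a l (g x)))"
      using dx h(2) x bx by simp (intro X.M.finsum_cong', auto simp: compose_eq)
    then show ?thesis using ab(3)[OF gx] by simp
  qed
  ultimately show ?thesis by blast
qed

text \<open>
  Dimension shifting without long exact sequences: only the resolution of \<open>C\<close> that witnesses
  \<open>Ext\<^sup>k\<^sup>-\<^sup>j(C,C) = 0\<close> is used.
\<close>

lemma cotilting_lift:
  fixes R :: "('k, 'r) module" and X :: "nat => ('r, 'k list) module"
  assumes K: "fd_algebra K R" and C: "fdm K R C" and jk: "j < k"
    and X: "!!i. i <= k ==> fdm K R (X i)" and inj: "!!i. i < k ==> injective R (X i)" and facX: "fac R C (X k)"
    and d: "!!i. i < k ==> d i : Hom R (X (Suc i)) (X i)"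
    and ex: "!!i. Suc i < k ==> d (Suc i) ` carrier (X (Suc (Suc i))) = {x : carrier (X (Suc i)). d i x = 0[X i]}"
    and dinj: "inj_on (d (k - 1)) (carrier (X k))"
    and ext: "!!i. i > 0 ==> ext_vanishes R i C C"
    and Y: "fdm K R Y" and q: "q : Hom R (X j) Y"
    and qker: "d j ` carrier (X (Suc j)) = {x : carrier (X j). q x = 0[Y]}"
    and f: "f : Hom R C Y" and fq: "f ` carrier C \<subseteq> q ` carrier (X j)"
  shows "EX g:Hom R C (X j). ALL x:carrier C. q (g x) = f x"
proof -
  note lX = fdmD(1)[OF X] and lC = fdmD(1)[OF C] and lY = fdmD(1)[OF Y]
  \<comment> \<open>From \<open>X j\<close> the walk to the end of the sequence has
    \<open>i0\<close> further steps, so the obstruction to lifting ends up in degree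
    \<open>Suc i0 = k - j\<close>.\<close>
  define i0 where "i0 = k - 1 - j"
  have i0: "j + i0 = k - 1" "Suc (j + i0) = k" using jk by (auto simp: i0_def)
  obtain Q \<delta> \<pi> where res: "proj_resolution R Q \<delta> C \<pi>"
    and cc: "cocycles R Q \<delta> C (Suc i0) = coboundaries R Q \<delta> C (Suc i0)"
    using ext[of "Suc i0"] unfolding ext_vanishes_def by blast
  note r = proj_resolutionD[OF res]
  have fQ: "fdm K R (Q i)" for i by (rule projective_fdm[OF K r(1)])
  note lQ = fdmD(1)[OF fQ] and agQ = fdmD(3)[OF fQ] and agX = fdmD(3)[OF X]
  have dd: "\<delta> i (\<delta> (Suc i) x) = 0[Q i]" if "x :. (Q (Suc (Suc i)))" for i x
    using r(6)[of i] that by auto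
  \<comment> \<open>Only the values on the image of \<open>\<delta> i\<close> are to be matched. The
    induction runs downwards in \<open>i\<close>: at \<open>i0\<close> it uses the vanishing
    \<open>Ext\<close>, before that the injectivity of \<open>X (Suc (j + i))\<close>.\<close>
  have "ALL g:Hom R (Q i) (X (j + i)).
      (ALL x:carrier (Q (Suc i)). g (\<delta> i x) : d (j + i) ` carrier (X (Suc (j + i)))) -->
      (EX h:Hom R (Q i) (X (Suc (j + i))). ALL x:carrier (Q (Suc i)). g (\<delta> i x) = d (j + i) (h (\<delta> i x)))"
    if "i <= i0" for i
    using that
  proof (induction "i0 - i" arbitrary: i)
    case 0
    then have i: "i = i0" by simp
    have kk: "Suc (j + i) = k" "j + i < k" "j + i = k - 1" using i i0 by auto
    show ?case
    proof (intro ballI impI)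
      fix g assume g: "g : Hom R (Q i) (X (j + i))"
        and gi: "ALL x:carrier (Q (Suc i)). g (\<delta> i x) : d (j + i) ` carrier (X (Suc (j + i)))"
      note dk = d[OF kk(2)]
      have gd: "compose (carrier (Q (Suc i))) g (\<delta> i) : Hom R (Q (Suc i)) (X (j + i))"
        by (rule hom_compose[OF lQ r(2) g])
      obtain g' where g': "g' : Hom R (Q (Suc i)) (X (Suc (j + i)))"
        "!!x. x :. (Q (Suc i)) ==> d (j + i) (g' x) = g (\<delta> i x)"
        using projective_lift[OF K r(1) X X dk gd] kk gi by (auto simp: compose_eq)
      \<comment> \<open>The last differential is injective, so \<open>g'\<close> is a
        cocycle.\<close>
      have "g' (\<delta> (Suc i) x) = 0[X (Suc (j + i))]" if x: "x :. (Q (Suc (Suc i)))" for x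
      proof -
        have dx: "\<delta> (Suc i) x :. (Q (Suc i))" by (rule hom_closed[OF r(2) x])
        have "d (j + i) (g' (\<delta> (Suc i) x)) = 0[X (j + i)]"
          unfolding g'(2)[OF dx] dd[OF x] by (rule hom_zero[OF g agQ agX]) (use kk in simp)
        moreover have "d (j + i) 0[X (Suc (j + i))] = 0[X (j + i)]" by (rule hom_zero[OF dk agX agX]) (use kk in auto)
        moreover have "0[X (Suc (j + i))] :. (X (Suc (j + i)))" using abelian_groupE(2)[OF agX[of k]] kk by simp
        ultimately show ?thesis
          using dinj hom_closed[OF g'(1) dx] kk by (auto simp: inj_on_def)
      qed
      note g'z = this
      have "fac R C (X (Suc (j + i)))" "left_module R (X (Suc (j + i)))" using facX lX[of k] kk by simp_all
      moreover have "cocycles R Q \<delta> C (Suc i) = coboundaries R Q \<delta> C (Suc i)" unfolding i by (rule cc)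
      ultimately have "EX h:Hom R (Q i) (X (Suc (j + i))). ALL x:carrier (Q (Suc i)). g' x = h (\<delta> i x)"
        using ext_vanishes_fac[OF K lC _ _ res _ g'(1) g'z] by blast
      then show "EX h:Hom R (Q i) (X (Suc (j + i))). ALL x:carrier (Q (Suc i)). g (\<delta> i x) = d (j + i) (h (\<delta> i x))"
        using g'(2) by metis
    qed
  next
    case (Suc m)
    then have i: "i < i0" and mi: "m = i0 - Suc i" "Suc i <= i0" by auto
    have kk: "Suc (j + i) < k" "j + i < k" "Suc (Suc (j + i)) <= k" using i i0 by auto
    note IH = Suc.hyps(1)[OF mi]
    show ?case
    proof (intro ballI impI)
      fix g assume g: "g : Hom R (Q i) (X (j + i))"
        and gi: "ALL x:carrier (Q (Suc i)). g (\<delta> i x) : d (j + i) ` carrier (X (Suc (j + i)))"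
      note dk = d[OF kk(2)] and dk' = d[OF kk(1)]
      note lX1 = lX[of "Suc (j + i)"] and lX2 = lX[of "Suc (Suc (j + i))"]
      have gd: "compose (carrier (Q (Suc i))) g (\<delta> i) : Hom R (Q (Suc i)) (X (j + i))"
        by (rule hom_compose[OF lQ r(2) g])
      obtain g' where g': "g' : Hom R (Q (Suc i)) (X (Suc (j + i)))"
        "!!x. x :. (Q (Suc i)) ==> d (j + i) (g' x) = g (\<delta> i x)"
        using projective_lift[OF K r(1) X X dk gd] kk gi by (auto simp: compose_eq)
      have "g' (\<delta> (Suc i) x) : d (Suc (j + i)) ` carrier (X (Suc (Suc (j + i))))" if x: "x :. (Q (Suc (Suc i)))" for x
      proof -
        have dx: "\<delta> (Suc i) x :. (Q (Suc i))" by (rule hom_closed[OF r(2) x])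
        have "d (j + i) (g' (\<delta> (Suc i) x)) = 0[X (j + i)]"
          unfolding g'(2)[OF dx] dd[OF x] by (rule hom_zero[OF g agQ agX]) (use kk in simp)
        then show ?thesis unfolding ex[OF kk(1)] using hom_closed[OF g'(1) dx] by simp
      qed
      then obtain h2 where h2: "h2 : Hom R (Q (Suc i)) (X (Suc (Suc (j + i))))"
        "!!x. x :. (Q (Suc (Suc i))) ==> g' (\<delta> (Suc i) x) = d (Suc (j + i)) (h2 (\<delta> (Suc i) x))"
        using IH g'(1) by auto
      let ?dh = "compose (carrier (Q (Suc i))) (d (Suc (j + i))) h2"
      have dh: "?dh : Hom R (Q (Suc i)) (X (Suc (j + i)))" by (rule hom_compose[OF lQ h2(1) dk'])
      \<comment> \<open>Subtracting \<open>d h2\<close> makes the map vanish on the kernel of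
        \<open>\<delta> i\<close>, so it extends to \<open>Q i\<close>.\<close>
      let ?u = "\<lambda>x\<in>carrier (Q (Suc i)). g' x -[X (Suc (j + i))] ?dh x"
      have u: "?u : Hom R (Q (Suc i)) (X (Suc (j + i)))" using hom_sub[OF lQ lX1 g'(1) dh] kk by simp
      have "EX h:Hom R (Q i) (X (Suc (j + i))). ALL x:carrier (Q (Suc i)). h (\<delta> i x) = ?u x"
      proof (rule injective_extend[OF K inj lQ fQ r(2) u])
        fix x assume x: "x :. (Q (Suc i))" "\<delta> i x = 0[Q i]"
        then have "x : \<delta> (Suc i) ` carrier (Q (Suc (Suc i)))" using r(6)[of i] by simp
        then obtain y where y: "y :. (Q (Suc (Suc i)))" "x = \<delta> (Suc i) y" by blast
        have "g' x = ?dh x" using h2(2)[OF y(1)] y(2) x(1) by (simp add: compose_eq)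
        moreover have "g' x :. (X (Suc (j + i)))" by (rule hom_closed[OF g'(1) x(1)])
        ultimately show "?u x = 0[X (Suc (j + i))]"
          using x(1) abelian_group.r_neg[OF agX[of "Suc (j + i)"], of "g' x"] kk by (simp add: a_minus_def)
      qed (use kk in auto)
      then obtain h where h: "h : Hom R (Q i) (X (Suc (j + i)))"
        "!!x. x :. (Q (Suc i)) ==> h (\<delta> i x) = ?u x" by blast
      have "g (\<delta> i x) = d (j + i) (h (\<delta> i x))" if x: "x :. (Q (Suc i))" for x
      proof -
        have c: "g' x :. (X (Suc (j + i)))" "?dh x :. (X (Suc (j + i)))"
          using hom_closed[OF g'(1) x] hom_closed[OF dh x] by auto
        have h2x: "h2 x :. (X (Suc (Suc (j + i))))" by (rule hom_closed[OF h2(1) x])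
        have ddx: "d (j + i) (?dh x) = 0[X (j + i)]" using ex[OF kk(1)] h2x x by (auto simp: compose_eq)
        have "d (j + i) (h (\<delta> i x)) = d (j + i) (g' x -[X (Suc (j + i))] ?dh x)" using h(2)[OF x] x by simp
        also have "... = d (j + i) (g' x) -[X (j + i)] 0[X (j + i)]"
          unfolding ddx[symmetric] by (rule hom_diff[OF dk agX agX c]) (use kk in auto)
        also have "... = d (j + i) (g' x)"
        proof -
          interpret Xi: abelian_group "X (j + i)" by (rule agX) (use kk in simp)
          show ?thesis using hom_closed[OF dk c(1)] by (simp add: a_minus_def)
        qed
        finally show ?thesis using g'(2)[OF x] by simp
      qed
      then show "EX h:Hom R (Q i) (X (Suc (j + i))). ALL x:carrier (Q (Suc i)). g (\<delta> i x) = d (j + i) (h (\<delta> i x))"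
        using h(1) by blast
    qed
  qed
  from this[of 0] have E0: "!!g. g : Hom R (Q 0) (X j) ==>
      (!!x. x :. (Q (Suc 0)) ==> g (\<delta> 0 x) : d j ` carrier (X (Suc j))) ==>
      (EX h:Hom R (Q 0) (X (Suc j)). ALL x:carrier (Q (Suc 0)). g (\<delta> 0 x) = d j (h (\<delta> 0 x)))" by simp
  have Xj: "fdm K R (X j)" and lXj: "left_module R (X j)" using X[of j] lX[of j] jk by auto
  interpret Xj: left_module R "X j" by (rule lXj)
  interpret Yi: left_module R Y by (rule lY)
  have f\<pi>: "compose (carrier (Q 0)) f \<pi> : Hom R (Q 0) Y" by (rule hom_compose[OF lQ r(3) f])
  have "f (\<pi> x) : q ` carrier (X j)" if "x :. (Q 0)" for x
    using fq hom_closed[OF r(3) that] by blast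
  then have "compose (carrier (Q 0)) f \<pi> ` carrier (Q 0) \<subseteq> q ` carrier (X j)" by (simp add: compose_eq image_subset_iff)
  from projective_lift[OF K r(1) Xj Y q f\<pi> this]
  obtain g where g: "g : Hom R (Q 0) (X j)" "!!x. x :. (Q 0) ==> q (g x) = f (\<pi> x)"
    by (auto simp: compose_eq)
  have "EX h:Hom R (Q 0) (X (Suc j)). ALL x:carrier (Q (Suc 0)). g (\<delta> 0 x) = d j (h (\<delta> 0 x))"
  proof (rule E0[OF g(1)])
    fix x assume x: "x :. (Q (Suc 0))"
    have dx: "\<delta> 0 x :. (Q 0)" by (rule hom_closed[OF r(2) x])
    have "\<pi> (\<delta> 0 x) = 0[C]" using r(5) x by auto
    then have "q (g (\<delta> 0 x)) = 0[Y]" using g(2)[OF dx] hom_zero[OF f fdmD(3)[OF C] fdmD(3)[OF Y]] by simp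
    then show "g (\<delta> 0 x) : d j ` carrier (X (Suc j))" unfolding qker using hom_closed[OF g(1) dx] by simp
  qed
  then obtain h where h: "h : Hom R (Q 0) (X (Suc j))"
    "!!x. x :. (Q (Suc 0)) ==> g (\<delta> 0 x) = d j (h (\<delta> 0 x))" by blast
  let ?dh = "compose (carrier (Q 0)) (d j) h"
  have dh: "?dh : Hom R (Q 0) (X j)" by (rule hom_compose[OF lQ h(1) d[OF jk]])
  \<comment> \<open>The corrected map kills the kernel of \<open>\<pi>\<close> and descends to
    \<open>C\<close>; \<open>q\<close> does not see the correction, because \<open>q\<close> kills
    the image of \<open>d j\<close>.\<close>
  let ?u = "\<lambda>x\<in>carrier (Q 0). g x -[X j] ?dh x"
  have u: "?u : Hom R (Q 0) (X j)" by (rule hom_sub[OF lQ lXj g(1) dh])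
  have "EX g2:Hom R C (X j). ALL x:carrier (Q 0). g2 (\<pi> x) = ?u x"
  proof (rule hom_descend[OF lQ lC lXj r(3) _ u])
    fix x assume x: "x :. (Q 0)" "\<pi> x = 0[C]"
    then have "x : \<delta> 0 ` carrier (Q (Suc 0))" using r(5) by simp
    then obtain y where y: "y :. (Q (Suc 0))" "x = \<delta> 0 y" by blast
    have "g x = ?dh x" using h(2)[OF y(1)] y(2) x(1) by (simp add: compose_eq)
    then show "?u x = 0[X j]" using x(1) hom_closed[OF g(1) x(1)] by (simp add: a_minus_def Xj.M.r_neg)
  qed (use r(4) in simp)
  then obtain g2 where g2: "g2 : Hom R C (X j)" "!!x. x :. (Q 0) ==> g2 (\<pi> x) = ?u x" by blast
  have "q (g2 x) = f x" if x: "x :. C" for x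
  proof -
    obtain y where y: "y :. (Q 0)" "x = \<pi> y" using r(4) x by blast
    have hy: "h y :. (X (Suc j))" by (rule hom_closed[OF h(1) y(1)])
    have qd: "q (?dh y) = 0[Y]" using qker hy y(1) by (auto simp: compose_eq)
    have "q (g2 x) = q (g y -[X j] ?dh y)" using g2(2)[OF y(1)] y by simp
    also have "... = q (g y) -[Y] 0[Y]"
      unfolding qd[symmetric]
      by (rule hom_diff[OF q Xj.M_group Yi.M_group hom_closed[OF g(1) y(1)] hom_closed[OF dh y(1)]])
    also have "... = f x" using g(2)[OF y(1)] y(2) hom_closed[OF f x] by (simp add: a_minus_def)
    finally show ?thesis .
  qed
  then show ?thesis using g2(1) by blast
qed

text \<open>The mirror image of \<open>cotilting_lift\<close>. The resolution of \<open>C\<close>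
  ends at \<open>J k\<close>, and the bound \<open>j + k \<le> d\<close> keeps all terms
  \<open>I (j + m)\<close> with \<open>m \<le> k\<close> projective. A map
  \<open>I (j + m) -> J m\<close> is corrected by downward induction on \<open>m\<close>, starting
  at \<open>m = k\<close>, where \<open>\<epsilon> k = 0\<close>.\<close>

lemma resolution_extend:
  fixes R :: "('k, 'r) module" and I J :: "nat => ('r, 'k list) module"
  assumes K: "fd_algebra K R" and C: "fdm K R C"
    and resJ: "inj_resolution R C \<iota> J \<epsilon>" and Jz: "zero_module (J (Suc k))"
    and I: "!!i. injective R (I i)" and pI: "!!i. i <= d ==> projective R (I i)"
    and D: "!!i. D i : Hom R (I i) (I (Suc i))"
    and DD: "!!i. D i ` carrier (I i) = {x : carrier (I (Suc i)). D (Suc i) x = 0[I (Suc (Suc i))]}"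
    and jk: "j + k <= d" and M: "left_module R M" and g0: "g0 : Hom R M (I j)"
    and gD: "g0 ` carrier M = {x : carrier (I j). D j x = 0[I (Suc j)]}"
    and f: "f : Hom R M C" and ker: "!!m. [|m :. M; g0 m = 0[I j]|] ==> f m = 0[C]"
  shows "EX h:Hom R (I j) C. ALL m:carrier M. h (g0 m) = f m"
proof -
  note r = inj_resolutionD[OF resJ]
  have fJ: "fdm K R (J i)" and fI: "fdm K R (I i)" for i by (rule injective_fdm[OF K r(1)], rule injective_fdm[OF K I])
  note lC = fdmD(1)[OF C] and lI = fdmD(1)[OF fI] and lJ = fdmD(1)[OF fJ]
  note agI = fdmD(3)[OF fI] and agJ = fdmD(3)[OF fJ]
  have ee: "\<epsilon> (Suc i) (\<epsilon> i x) = 0[J (Suc (Suc i))]" if "x :. (J i)" for i x using r(6)[of i] that by auto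
  have DDz: "D (Suc i) (D i x) = 0[I (Suc (Suc i))]" if "x :. (I i)" for i x using DD[of i] that by auto
  have minus0: "a -[J i] 0[J i] = a" if "a :. (J i)" for a i
  proof -
    interpret abelian_group "J i" by (rule agJ)
    show ?thesis using that by (simp add: a_minus_def)
  qed
  have "ALL g:Hom R (I (j + m)) (J m).
      (ALL y:carrier (I (j + m)). D (j + m) y = 0[I (Suc (j + m))] --> \<epsilon> m (g y) = 0[J (Suc m)]) -->
      (EX h:Hom R (I (Suc (j + m))) (J m). ALL y:carrier (I (j + m)). \<epsilon> m (g y) = \<epsilon> m (h (D (j + m) y)))"
    if "m <= k" for m
    using that
  proof (induction "k - m" arbitrary: m)
    case 0
    then have m: "m = k" by simp
    have z: "\<epsilon> m y = 0[J (Suc m)]" if "y :. (J m)" for y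
      using hom_closed[OF r(2) that] Jz m by (auto simp: zero_module_def)
    show ?case
    proof (intro ballI impI)
      fix g assume g: "g : Hom R (I (j + m)) (J m)"
      note h = hom_zero_map[OF lI[of "Suc (j + m)"] lJ[of m]]
      show "EX h:Hom R (I (Suc (j + m))) (J m). ALL y:carrier (I (j + m)). \<epsilon> m (g y) = \<epsilon> m (h (D (j + m) y))"
        by (rule bexI[OF _ h]) (use z hom_closed[OF g] hom_closed[OF h] hom_closed[OF D] in metis)
    qed
  next
    case (Suc l)
    then have mk: "m < k" and lm: "l = k - Suc m" "Suc m <= k" by auto
    note IH = Suc.hyps(1)[OF lm]
    let ?i = "j + m"
    show ?case
    proof (intro ballI impI)
      fix g assume g: "g : Hom R (I ?i) (J m)"
        and gz: "ALL y:carrier (I ?i). D ?i y = 0[I (Suc ?i)] --> \<epsilon> m (g y) = 0[J (Suc m)]"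
      have eg: "compose (carrier (I ?i)) (\<epsilon> m) g : Hom R (I ?i) (J (Suc m))" by (rule hom_compose[OF lI g r(2)])
      have "EX h:Hom R (I (Suc ?i)) (J (Suc m)). ALL x:carrier (I ?i). h (D ?i x) = compose (carrier (I ?i)) (\<epsilon> m) g x"
        by (rule injective_extend[OF K r(1) lI fI D eg]) (use gz in "simp add: compose_eq")
      then obtain g' where g': "g' : Hom R (I (Suc ?i)) (J (Suc m))"
        "!!x. x :. (I ?i) ==> g' (D ?i x) = \<epsilon> m (g x)" by (auto simp: compose_eq)
      have "\<epsilon> (Suc m) (g' y) = 0[J (Suc (Suc m))]"
        if y: "y :. (I (Suc ?i))" "D (Suc ?i) y = 0[I (Suc (Suc ?i))]" for y
      proof -
        have "y : D ?i ` carrier (I ?i)" unfolding DD using y by simp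
        then obtain x where x: "x :. (I ?i)" "y = D ?i x" by blast
        show ?thesis unfolding x(2) g'(2)[OF x(1)] by (rule ee[OF hom_closed[OF g x(1)]])
      qed
      then obtain h2 where h2: "h2 : Hom R (I (Suc (Suc ?i))) (J (Suc m))"
        "!!y. y :. (I (Suc ?i)) ==> \<epsilon> (Suc m) (g' y) = \<epsilon> (Suc m) (h2 (D (Suc ?i) y))"
        using IH g'(1) by auto
      let ?hD = "compose (carrier (I (Suc ?i))) h2 (D (Suc ?i))"
      have hD: "?hD : Hom R (I (Suc ?i)) (J (Suc m))" by (rule hom_compose[OF lI D h2(1)])
      \<comment> \<open>After the correction the values are killed by
        \<open>\<epsilon> (Suc m)\<close>, so projectivity of \<open>I (Suc ?i)\<close> lifts the
        map through \<open>\<epsilon> m\<close>.\<close>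
      let ?u = "\<lambda>x\<in>carrier (I (Suc ?i)). g' x -[J (Suc m)] ?hD x"
      have u: "?u : Hom R (I (Suc ?i)) (J (Suc m))" by (rule hom_sub[OF lI lJ g'(1) hD])
      have "EX h:Hom R (I (Suc ?i)) (J m). ALL p:carrier (I (Suc ?i)). \<epsilon> m (h p) = ?u p"
      proof (rule projective_lift[OF K pI fJ fJ r(2) u])
        show "Suc ?i <= d" using mk jk by simp
        show "?u ` carrier (I (Suc ?i)) \<subseteq> \<epsilon> m ` carrier (J m)"
        proof (rule image_subsetI)
          fix y assume y: "y :. (I (Suc ?i))"
          note c = hom_closed[OF g'(1) y] hom_closed[OF hD y]
          interpret J2: abelian_group "J (Suc (Suc m))" by (rule agJ)
          have "\<epsilon> (Suc m) (g' y -[J (Suc m)] ?hD y) = \<epsilon> (Suc m) (g' y) -[J (Suc (Suc m))] \<epsilon> (Suc m) (?hD y)"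
            by (rule hom_diff[OF r(2) agJ agJ c])
          also have "\<epsilon> (Suc m) (?hD y) = \<epsilon> (Suc m) (g' y)" using h2(2)[OF y] y by (simp add: compose_eq)
          also have "\<epsilon> (Suc m) (g' y) -[J (Suc (Suc m))] \<epsilon> (Suc m) (g' y) = 0[J (Suc (Suc m))]"
            using hom_closed[OF r(2) c(1)] by (simp add: a_minus_def J2.r_neg)
          finally have "\<epsilon> (Suc m) (?u y) = 0[J (Suc (Suc m))]" using y by simp
          then show "?u y : \<epsilon> m ` carrier (J m)" unfolding r(6) using hom_closed[OF u y] by simp
        qed
      qed
      then obtain h where h: "h : Hom R (I (Suc ?i)) (J m)"
        "!!p. p :. (I (Suc ?i)) ==> \<epsilon> m (h p) = ?u p" by blast
      have "\<epsilon> m (g y) = \<epsilon> m (h (D ?i y))" if y: "y :. (I ?i)" for y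
      proof -
        have Dy: "D ?i y :. (I (Suc ?i))" by (rule hom_closed[OF D y])
        have "?hD (D ?i y) = 0[J (Suc m)]"
          using Dy DDz[OF y] hom_zero[OF h2(1) agI agJ] by (simp add: compose_eq)
        then show ?thesis using h(2)[OF Dy] Dy g'(2)[OF y] minus0 hom_closed[OF g'(1) Dy] by simp
      qed
      then show "EX h:Hom R (I (Suc ?i)) (J m). ALL y:carrier (I ?i). \<epsilon> m (g y) = \<epsilon> m (h (D ?i y))"
        using h(1) by blast
    qed
  qed
  from this[of 0] have E0: "!!g. g : Hom R (I j) (J 0) ==>
      (!!y. y :. (I j) ==> D j y = 0[I (Suc j)] ==> \<epsilon> 0 (g y) = 0[J (Suc 0)]) ==>
      (EX h:Hom R (I (Suc j)) (J 0). ALL y:carrier (I j). \<epsilon> 0 (g y) = \<epsilon> 0 (h (D j y)))" by simp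
  have \<iota>f: "compose (carrier M) \<iota> f : Hom R M (J 0)" by (rule hom_compose[OF M f r(3)])
  have "EX h:Hom R (I j) (J 0). ALL x:carrier M. h (g0 x) = compose (carrier M) \<iota> f x"
    by (rule injective_extend[OF K r(1) M fI g0 \<iota>f])
      (use ker hom_zero[OF r(3) fdmD(3)[OF C] agJ] in "simp add: compose_eq")
  then obtain g where g: "g : Hom R (I j) (J 0)" "!!x. x :. M ==> g (g0 x) = \<iota> (f x)" by (auto simp: compose_eq)
  have "EX h:Hom R (I (Suc j)) (J 0). ALL y:carrier (I j). \<epsilon> 0 (g y) = \<epsilon> 0 (h (D j y))"
  proof (rule E0[OF g(1)])
    fix y assume y: "y :. (I j)" "D j y = 0[I (Suc j)]"
    then have "y : g0 ` carrier M" unfolding gD by simp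
    then obtain m where m: "m :. M" "y = g0 m" by blast
    have "\<iota> (f m) : {x : carrier (J 0). \<epsilon> 0 x = 0[J (Suc 0)]}"
      unfolding r(5)[symmetric] using hom_closed[OF f m(1)] by blast
    then show "\<epsilon> 0 (g y) = 0[J (Suc 0)]" using g(2)[OF m(1)] m(2) by simp
  qed
  then obtain h where h: "h : Hom R (I (Suc j)) (J 0)"
    "!!y. y :. (I j) ==> \<epsilon> 0 (g y) = \<epsilon> 0 (h (D j y))" by blast
  let ?hD = "compose (carrier (I j)) h (D j)"
  have hD: "?hD : Hom R (I j) (J 0)" by (rule hom_compose[OF lI D h(1)])
  let ?u = "\<lambda>x\<in>carrier (I j). g x -[J 0] ?hD x"
  have u: "?u : Hom R (I j) (J 0)" by (rule hom_sub[OF lI lJ g(1) hD])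
  have "EX h:Hom R (I j) C. ALL p:carrier (I j). \<iota> (h p) = ?u p"
  proof (rule projective_lift[OF K pI C fJ r(3) u])
    show "j <= d" using jk by simp
    show "?u ` carrier (I j) \<subseteq> \<iota> ` carrier C"
    proof (rule image_subsetI)
      fix y assume y: "y :. (I j)"
      note c = hom_closed[OF g(1) y] hom_closed[OF hD y]
      interpret J1: abelian_group "J (Suc 0)" by (rule agJ)
      have "\<epsilon> 0 (g y -[J 0] ?hD y) = \<epsilon> 0 (g y) -[J (Suc 0)] \<epsilon> 0 (?hD y)"
        by (rule hom_diff[OF r(2) agJ agJ c])
      also have "\<epsilon> 0 (?hD y) = \<epsilon> 0 (g y)" using h(2)[OF y] y by (simp add: compose_eq)
      also have "\<epsilon> 0 (g y) -[J (Suc 0)] \<epsilon> 0 (g y) = 0[J (Suc 0)]"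
        using hom_closed[OF r(2) c(1)] by (simp add: a_minus_def J1.r_neg)
      finally have "\<epsilon> 0 (?u y) = 0[J (Suc 0)]" using y by simp
      then show "?u y : \<iota> ` carrier C" unfolding r(5) using hom_closed[OF u y] by simp
    qed
  qed
  then obtain h2 where h2: "h2 : Hom R (I j) C" "!!p. p :. (I j) ==> \<iota> (h2 p) = ?u p" by blast
  have "h2 (g0 m) = f m" if m: "m :. M" for m
  proof -
    have gm: "g0 m :. (I j)" by (rule hom_closed[OF g0 m])
    have "D j (g0 m) = 0[I (Suc j)]" using gD m by auto
    then have "?hD (g0 m) = 0[J 0]" using gm hom_zero[OF h(1) agI agJ] by (simp add: compose_eq)
    then have "\<iota> (h2 (g0 m)) = \<iota> (f m)"
      using h2(2)[OF gm] gm g(2)[OF m] minus0 hom_closed[OF g(1) gm] by simp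
    then show ?thesis using r(4) hom_closed[OF h2(1) gm] hom_closed[OF f m] by (auto simp: inj_on_def)
  qed
  then show ?thesis using h2(1) by blast
qed

section \<open>Modules over the endomorphism algebra\<close>

subsection \<open>Functoriality of the dual\<close>

lemma dual_map:
  assumes K: "fd_algebra K R" and X: "left_module (opp R) X" and Y: "left_module (opp R) Y"
    and f: "f : Hom R X Y"
  shows "(\<lambda>\<eta>\<in>carrier (dual K R Y). \<lambda>x\<in>carrier X. \<eta> (f x)) : Hom R (dual K R Y) (dual K R X)"
proof -
  interpret X: left_module "opp R" X by fact
  interpret Y: left_module "opp R" Y by fact
  interpret DY: left_module R "dual K R Y" by (rule dual_module[OF K Y])
  note sX = scal_module_opp(3)[OF K X]
  have fs: "f (scal R X c x) = scal R Y c (f x)" if "c :. K" "x :. X" for c x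
    using hom_scal(2)[OF fd_algebra_opp[OF K], of f X Y c x] f that by simp
  note fc = hom_closed[OF f]
  show ?thesis
  proof (rule hom_setI)
    fix \<eta> assume "\<eta> :. (dual K R Y)"
    then have \<eta>: "\<eta> : functionals K R Y" by simp
    have "(\<lambda>x\<in>carrier X. \<eta> (f x)) : functionals K R X"
      by (rule functionalI)
        (simp_all add: fc functionalD(1-3)[OF \<eta>] hom_add[OF f] fs sX)
    then show "(\<lambda>\<eta>\<in>carrier (dual K R Y). \<lambda>x\<in>carrier X. \<eta> (f x)) \<eta> :. (dual K R X)" using \<eta> by simp
  next
    fix \<eta> \<eta>' assume h: "\<eta> :. (dual K R Y)" "\<eta>' :. (dual K R Y)"
    then show "(\<lambda>\<eta>\<in>carrier (dual K R Y). \<lambda>x\<in>carrier X. \<eta> (f x)) (\<eta> +[dual K R Y] \<eta>') =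
      (\<lambda>\<eta>\<in>carrier (dual K R Y). \<lambda>x\<in>carrier X. \<eta> (f x)) \<eta> +[dual K R X]
      (\<lambda>\<eta>\<in>carrier (dual K R Y). \<lambda>x\<in>carrier X. \<eta> (f x)) \<eta>'"
      using DY.M.a_closed[OF h] fc by (auto intro!: restrict_ext)
  next
    fix r \<eta> assume h: "r :. R" "\<eta> :. (dual K R Y)"
    then show "(\<lambda>\<eta>\<in>carrier (dual K R Y). \<lambda>x\<in>carrier X. \<eta> (f x)) (r .[dual K R Y] \<eta>) =
      r .[dual K R X] (\<lambda>\<eta>\<in>carrier (dual K R Y). \<lambda>x\<in>carrier X. \<eta> (f x)) \<eta>"
      using DY.smult_closed[OF h] fc X.smult_closed by (auto intro!: restrict_ext simp: hom_smult[OF f])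
  qed simp
qed

text \<open>Contravariance exchanges the two families of maps.\<close>

lemma fac_dual:
  assumes K: "fd_algebra K R" and W: "left_module (opp R) W" and X: "left_module (opp R) X" and f: "fac R W X"
  shows "fac R (dual K R W) (dual K R X)"
proof -
  interpret X: left_module "opp R" X by fact
  interpret fK: field K using fd_algebraD(1)[OF K] .
  obtain n a b where ab: "!!l. l < (n::nat) ==> a l : Hom R X W" "!!l. l < n ==> b l : Hom R W X"
    "!!x. x :. X ==> (\<Oplus>\<^bsub>X\<^esub>l\<in>{..<n}. b l (a l x)) = x"
    using f unfolding fac_def by blast
  let ?a = "%l. \<lambda>\<eta>\<in>carrier (dual K R X). \<lambda>x\<in>carrier W. \<eta> (b l x)"
  let ?b = "%l. \<lambda>\<eta>\<in>carrier (dual K R W). \<lambda>x\<in>carrier X. \<eta> (a l x)"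
  have a': "?a l : Hom R (dual K R X) (dual K R W)" and b': "?b l : Hom R (dual K R W) (dual K R X)"
    if "l < n" for l using dual_map[OF K W X ab(2)[OF that]] dual_map[OF K X W ab(1)[OF that]] by auto
  interpret DX: left_module R "dual K R X" by (rule dual_module[OF K X])
  have "(\<Oplus>\<^bsub>dual K R X\<^esub>l\<in>{..<n}. ?b l (?a l \<eta>)) = \<eta>" if h: "\<eta> :. (dual K R X)" for \<eta>
  proof (rule carrier_eqI[of _ X])
    have bac: "?b l (?a l \<eta>) :. (dual K R X)" if "l < n" for l
      by (rule hom_closed[OF b'[OF that] hom_closed[OF a'[OF that] h]])
    have \<eta>: "\<eta> : functionals K R X" using h by simp
    have "(\<Oplus>\<^bsub>dual K R X\<^esub>l\<in>{..<n}. ?b l (?a l \<eta>)) :. (dual K R X)"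
      using bac by (intro DX.M.finsum_closed) blast
    then show "(\<Oplus>\<^bsub>dual K R X\<^esub>l\<in>{..<n}. ?b l (?a l \<eta>)) : extensional (carrier X)" using functionalD(4) by simp
    show "\<eta> : extensional (carrier X)" by (rule functionalD(4)[OF \<eta>])
    fix x assume x: "x :. X"
    have ax: "a l x :. W" "b l (a l x) :. X" if "l < n" for l
      using hom_closed[OF ab(1)[OF that] x] hom_closed[OF ab(2)[OF that]] by auto
    have "(\<Oplus>\<^bsub>dual K R X\<^esub>l\<in>{..<n}. ?b l (?a l \<eta>)) x = (\<Oplus>\<^bsub>K\<^esub>l\<in>{..<n}. ?b l (?a l \<eta>) x)"
      by (rule dual_finsum[OF K X x]) (use bac in "simp only: dual_simps lessThan_iff")
    also have "... = (\<Oplus>\<^bsub>K\<^esub>l\<in>{..<n}. \<eta> (b l (a l x)))"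
      using ax x h hom_closed[OF a' h] functionalD(1)[OF \<eta>] by (intro fK.finsum_cong') auto
    also have "... = \<eta> (\<Oplus>\<^bsub>X\<^esub>l\<in>{..<n}. b l (a l x))"
      using ax by (intro functional_finsum[OF fd_algebraD(1)[OF K] X.M_group \<eta>, symmetric]) auto
    finally show "(\<Oplus>\<^bsub>dual K R X\<^esub>l\<in>{..<n}. ?b l (?a l \<eta>)) x = \<eta> x" using ab(3)[OF x] by simp
  qed
  then show ?thesis unfolding fac_def using a' b' by (intro exI[of _ n] exI[of _ ?a] exI[of _ ?b]) blast
qed

lemma dual_exact:
  assumes K: "fd_algebra K R" and X: "left_module (opp R) X" and Y: "fdm K (opp R) Y"
    and f: "f : Hom R X Y" and l: "l :. (dual K R X)"
    and z: "!!x. [|x :. X; f x = 0[Y]|] ==> l x = 0[K]"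
  shows "EX \<mu>:carrier (dual K R Y). (\<lambda>x\<in>carrier X. \<mu> (f x)) = l"
proof -
  have lf: "l : functionals K R X" using l by simp
  have "EX \<mu>:functionals K (opp R) Y. ALL x:carrier X. \<mu> (f x) = l x"
    by (rule functional_factor[OF fd_algebra_opp[OF K] X Y]) (use f lf z in auto)
  then obtain \<mu> where \<mu>: "\<mu> :. (dual K R Y)" "!!x. x :. X ==> \<mu> (f x) = l x" by auto
  have "(\<lambda>x\<in>carrier X. \<mu> (f x)) = l"
    using \<mu>(2) functionalD(4)[OF lf] by (intro carrier_eqI[of _ X]) auto
  then show ?thesis using \<mu>(1) by blast
qed

subsection \<open>The functors \<open>Hom(C,-)\<close> and \<open>Hom(-,C)\<close>\<close>

lemma Bk_simps [simp]:
  "carrier (Bk G C) = Hom G C C" "1[Bk G C] = (\<lambda>x\<in>carrier C. x)"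
  "f *[Bk G C] g = compose (carrier C) g f" "f +[Bk G C] g = (\<lambda>x\<in>carrier C. f x +[C] g x)"
  "c .[Bk G C] f = (\<lambda>x\<in>carrier C. scal G C c (f x))" "0[Bk G C] = (\<lambda>x\<in>carrier C. 0[C])"
  by (simp_all add: Bk_def)

lemma Pk_simps [simp]:
  "carrier (Pk G X C) = Hom G C X" "0[Pk G X C] = (\<lambda>x\<in>carrier C. 0[X])"
  "f +[Pk G X C] g = (\<lambda>x\<in>carrier C. f x +[X] g x)" "b .[Pk G X C] f = compose (carrier C) f b"
  by (simp_all add: Pk_def)

lemma finsum_Pk [simp]: "finsum (Pk G X C) = finsum (hom_space G C X)"
  by (simp add: Pk_def fun_eq_iff)

text \<open>\<open>Ik\<close> before dualization, kept for every \<open>X\<close> because the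
  coresolution of \<open>D C\<close> is the dual of a sequence of such modules.\<close>

definition Hk :: "('k, 'g) module => ('g, 'x) module => ('g, 'c) module => ('c => 'c, 'x => 'c) module" where
  "Hk G X C = with_smult (%b f. compose (carrier X) b f) (hom_space G X C)"

lemma Hk_simps [simp]:
  "carrier (Hk G X C) = Hom G X C" "0[Hk G X C] = (\<lambda>x\<in>carrier X. 0[C])"
  "f +[Hk G X C] g = (\<lambda>x\<in>carrier X. f x +[C] g x)" "b .[Hk G X C] f = compose (carrier X) b f"
  by (simp_all add: Hk_def)

lemma finsum_Hk [simp]: "finsum (Hk G X C) = finsum (hom_space G X C)"
  by (simp add: Hk_def fun_eq_iff)

lemma Ik_eq: "Ik K G X C = dual K (Bk G C) (Hk G X C)"
  by (simp add: Ik_def Hk_def)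

lemma eval_module_simps [simp]:
  "carrier (eval_module C) = carrier C" "0[eval_module C] = 0[C]"
  "x +[eval_module C] y = x +[C] y" "b .[eval_module C] x = b x"
  by (simp_all add: eval_module_def)

lemma fin_gen_rs_cong:
  assumes V: "left_module K V" "fin_gen K V" and W: "left_module K W"
    and eq: "carrier W = carrier V" "!!x y. x +[W] y = x +[V] y"
      "!!c x. [|c :. K; x :. V|] ==> c .[W] x = c .[V] x"
  shows "fin_gen K W"
proof -
  interpret V: left_module K V by fact
  have "(\<lambda>x\<in>carrier V. x) : Hom K V W"
    by (rule hom_setI) (auto simp: eq V.smult_closed)
  then show ?thesis by (rule fin_gen_image[OF V(1) W V(2)]) (auto simp: eq)
qed

locale cmod =
  fixes K :: "'k ring" and G :: "('k, 'g) module" and C :: "('g, 'c) module"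
  assumes KG: "fd_algebra K G" and fC: "fdm K G C"
begin

abbreviation B where "B \<equiv> Bk G C"

lemma lC: "left_module G C" by (rule fdmD(1)[OF fC])

sublocale C: left_module G C by (rule lC)

lemma KB: "fd_algebra K B" unfolding Bk_def by (rule fd_algebra_opp[OF fd_algebra_end_alg[OF KG fC]])

lemma Pk_module: "left_module B (Pk G X C)" if X: "left_module G X"
proof -
  interpret X: left_module G X by fact
  have ag: "abelian_group (Pk G X C)" unfolding Pk_def using hom_space_module(2)[OF KG lC X] by simp
  show ?thesis
  proof (rule left_moduleI[OF fd_algebraD(4)[OF KB] ag])
    fix b f assume "b :. B" "f :. (Pk G X C)"
    then show "b .[Pk G X C] f :. (Pk G X C)" using hom_compose[OF lC] by simp
  next
    fix a b f assume "a :. B" "b :. B" "f :. (Pk G X C)"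
    then have h: "a : Hom G C C" "b : Hom G C C" "f : Hom G C X" by auto
    note c = hom_closed[OF h(1)] hom_closed[OF h(2)] hom_closed[OF h(3)]
    show "(a +[B] b) .[Pk G X C] f = a .[Pk G X C] f +[Pk G X C] b .[Pk G X C] f"
      by (rule carrier_eqI[of _ C]) (simp_all add: compose_eq c hom_add[OF h(3)])
    show "(a *[B] b) .[Pk G X C] f = a .[Pk G X C] (b .[Pk G X C] f)"
      by (rule carrier_eqI[of _ C]) (simp_all add: compose_eq c)
  next
    fix a f g assume "a :. B" "f :. (Pk G X C)" "g :. (Pk G X C)"
    then have h: "a : Hom G C C" by auto
    show "a .[Pk G X C] (f +[Pk G X C] g) = a .[Pk G X C] f +[Pk G X C] a .[Pk G X C] g"
      by (rule carrier_eqI[of _ C]) (simp_all add: compose_eq hom_closed[OF h])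
  next
    fix f assume "f :. (Pk G X C)"
    then have h: "f : Hom G C X" by simp
    show "1[B] .[Pk G X C] f = f"
      by (rule carrier_eqI[of _ C]) (simp_all add: compose_eq hom_ext[OF h])
  qed
qed

lemma Hk_module: "left_module (opp B) (Hk G X C)" if X: "left_module G X"
proof -
  interpret X: left_module G X by fact
  have ag: "abelian_group (Hk G X C)" unfolding Hk_def using hom_space_module(2)[OF KG X lC] by simp
  show ?thesis
  proof (rule left_moduleI[OF fd_algebraD(4)[OF fd_algebra_opp[OF KB]] ag])
    fix b f assume "b :. (opp B)" "f :. (Hk G X C)"
    then show "b .[Hk G X C] f :. (Hk G X C)" using hom_compose[OF X] by simp
  next
    fix a b f assume "a :. (opp B)" "b :. (opp B)" "f :. (Hk G X C)"
    then have h: "a : Hom G C C" "b : Hom G C C" "f : Hom G X C" by auto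
    note c = hom_closed[OF h(1)] hom_closed[OF h(2)] hom_closed[OF h(3)]
    show "(a +[opp B] b) .[Hk G X C] f = a .[Hk G X C] f +[Hk G X C] b .[Hk G X C] f"
      by (rule carrier_eqI[of _ X]) (simp_all add: compose_eq c)
    show "(a *[opp B] b) .[Hk G X C] f = a .[Hk G X C] (b .[Hk G X C] f)"
      by (rule carrier_eqI[of _ X]) (simp_all add: compose_eq c)
  next
    fix a f g assume "a :. (opp B)" "f :. (Hk G X C)" "g :. (Hk G X C)"
    then have h: "a : Hom G C C" "f : Hom G X C" "g : Hom G X C" by auto
    show "a .[Hk G X C] (f +[Hk G X C] g) = a .[Hk G X C] f +[Hk G X C] a .[Hk G X C] g"
      by (rule carrier_eqI[of _ X])
        (simp_all add: compose_eq hom_add[OF h(1)] hom_closed[OF h(2)] hom_closed[OF h(3)])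
  next
    fix f assume "f :. (Hk G X C)"
    then have h: "f : Hom G X C" by simp
    show "1[opp B] .[Hk G X C] f = f"
      by (rule carrier_eqI[of _ X]) (simp_all add: compose_eq hom_ext[OF h] hom_closed[OF h])
  qed
qed

lemma scal_B: "c :. K ==> c .[B] 1[B] = (\<lambda>x\<in>carrier C. scal G C c x)"
  by (auto intro!: restrict_ext)

lemma scal_Pk:
  assumes "c :. K" "f : Hom G C X"
  shows "scal B (Pk G X C) c f = (\<lambda>x\<in>carrier C. scal G X c (f x))"
  unfolding scal_def[of B "Pk G X C"] scal_B[OF assms(1)]
  by (rule carrier_eqI[of _ C]) (simp_all add: compose_eq hom_scal(2)[OF KG assms(2,1)])

lemma scal_Hk:
  assumes "c :. K" "f : Hom G X C"
  shows "scal B (Hk G X C) c f = (\<lambda>x\<in>carrier X. scal G C c (f x))"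
  unfolding scal_def[of B "Hk G X C"] scal_B[OF assms(1)]
  by (rule carrier_eqI[of _ X]) (simp_all add: compose_eq hom_closed[OF assms(2)])

lemma fPk: "fdm K B (Pk G X C)" if X: "fdm K G X"
  unfolding fdm_def
proof (intro conjI Pk_module fdmD(1)[OF X])
  show "fin_gen K (rs B (Pk G X C))"
    by (rule fin_gen_rs_cong[OF hom_space_module(1)[OF KG lC fdmD(1)[OF X]] fin_gen_hom_space[OF KG fC X]
          scal_module(1)[OF KB Pk_module[OF fdmD(1)[OF X]]]]) (simp_all add: scal_Pk)
qed

lemma fHk: "fdm K (opp B) (Hk G X C)" if X: "fdm K G X"
  unfolding fdm_def
proof (intro conjI Hk_module fdmD(1)[OF X])
  show "fin_gen K (rs (opp B) (Hk G X C))"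
    by (rule fin_gen_rs_cong[OF hom_space_module(1)[OF KG fdmD(1)[OF X] lC] fin_gen_hom_space[OF KG X fC]
          scal_module(1)[OF fd_algebra_opp[OF KB] Hk_module[OF fdmD(1)[OF X]]]]) (simp_all add: scal_Hk)
qed

lemma eval_module_module: "left_module (opp B) (eval_module C)"
proof (rule left_moduleI[OF fd_algebraD(4)[OF fd_algebra_opp[OF KB]]])
  show "abelian_group (eval_module C)" unfolding eval_module_def using C.M_group by simp
qed (auto simp: hom_closed hom_add compose_eq)

lemma scal_eval: "[|c :. K; x :. C|] ==> scal B (eval_module C) c x = scal G C c x"
  unfolding scal_def[of B "eval_module C"] scal_B by simp

lemma functionals_C: "functionals K B (eval_module C) = functionals K G C"
  by (auto simp: hom_set_def scal_eval)

lemma f_eval: "fdm K (opp B) (eval_module C)"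
  unfolding fdm_def
proof (intro conjI eval_module_module)
  show "fin_gen K (rs (opp B) (eval_module C))"
    by (rule fin_gen_rs_cong[OF scal_module(1)[OF KG lC] fdmD(2)[OF fC]
          scal_module(1)[OF fd_algebra_opp[OF KB] eval_module_module]]) (simp_all add: scal_eval)
qed

lemma DCk_simps [simp]:
  "carrier (DCk K G C) = functionals K G C" "0[DCk K G C] = (\<lambda>x\<in>carrier C. 0[K])"
  "f +[DCk K G C] g = (\<lambda>x\<in>carrier C. f x +[K] g x)"
  "b .[DCk K G C] f = (\<lambda>x\<in>carrier C. f (b x))"
  by (simp_all add: DCk_def functionals_C)

lemma fDC: "fdm K B (DCk K G C)"
  unfolding DCk_def by (rule fdm_dual[OF KB f_eval])

lemma lDC: "left_module B (DCk K G C)" by (rule fdmD(1)[OF fDC])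

text \<open>\<open>Hom(C,d)\<close> and, below, \<open>Hom(d,C)\<close>. The modules are arguments
  because extensional functions need their domains.\<close>

definition pst :: "('g, 'x) module => ('x => 'y) => ('c => 'x) => 'c => 'y" where
  "pst X d = (\<lambda>f\<in>Hom G C X. compose (carrier C) d f)"

definition pre :: "('g, 'x) module => ('g, 'y) module => ('x => 'y) => ('y => 'c) => 'x => 'c" where
  "pre X Y d = (\<lambda>f\<in>Hom G Y C. compose (carrier X) f d)"

lemma pst_hom:
  assumes X: "left_module G X" and Y: "left_module G Y" and d: "d : Hom G X Y"
  shows "pst X d : Hom B (Pk G X C) (Pk G Y C)"
proof -
  interpret P: left_module B "Pk G X C" by (rule Pk_module[OF X])
  show ?thesis unfolding pst_def
  proof (rule hom_setI)
    fix f g assume h: "f :. (Pk G X C)" "g :. (Pk G X C)"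
    then have fg: "f : Hom G C X" "g : Hom G C X" by auto
    have "f +[Pk G X C] g : Hom G C X" using P.M.a_closed[OF h] by simp
    then show "(\<lambda>f\<in>Hom G C X. compose (carrier C) d f) (f +[Pk G X C] g) =
      (\<lambda>f\<in>Hom G C X. compose (carrier C) d f) f +[Pk G Y C] (\<lambda>f\<in>Hom G C X. compose (carrier C) d f) g"
      using fg by (intro carrier_eqI[of _ C])
        (simp_all add: compose_eq hom_add[OF d] hom_closed[OF fg(1)] hom_closed[OF fg(2)])
  next
    fix b f assume h: "b :. B" "f :. (Pk G X C)"
    then have bf: "b : Hom G C C" "f : Hom G C X" by auto
    have "b .[Pk G X C] f : Hom G C X" using P.smult_closed[OF h] by simp
    then show "(\<lambda>f\<in>Hom G C X. compose (carrier C) d f) (b .[Pk G X C] f) =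
      b .[Pk G Y C] (\<lambda>f\<in>Hom G C X. compose (carrier C) d f) f"
      using bf by (intro carrier_eqI[of _ C]) (simp_all add: compose_eq hom_closed[OF bf(1)])
  qed (use hom_compose[OF lC _ d] in auto)
qed

lemma pre_hom:
  assumes X: "left_module G X" and Y: "left_module G Y" and d: "d : Hom G X Y"
  shows "pre X Y d : Hom B (Hk G Y C) (Hk G X C)"
proof -
  interpret P: left_module "opp B" "Hk G Y C" by (rule Hk_module[OF Y])
  show ?thesis unfolding pre_def
  proof (rule hom_setI)
    fix f g assume h: "f :. (Hk G Y C)" "g :. (Hk G Y C)"
    then have fg: "f : Hom G Y C" "g : Hom G Y C" by auto
    have "f +[Hk G Y C] g : Hom G Y C" using P.M.a_closed[OF h] by simp
    then show "(\<lambda>f\<in>Hom G Y C. compose (carrier X) f d) (f +[Hk G Y C] g) =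
      (\<lambda>f\<in>Hom G Y C. compose (carrier X) f d) f +[Hk G X C] (\<lambda>f\<in>Hom G Y C. compose (carrier X) f d) g"
      using fg by (intro carrier_eqI[of _ X])
        (simp_all add: compose_eq hom_closed[OF d])
  next
    fix b f assume h: "b :. B" "f :. (Hk G Y C)"
    then have bf: "b : Hom G C C" "f : Hom G Y C" by auto
    have "b .[Hk G Y C] f : Hom G Y C" using P.smult_closed[of b f] h by simp
    then show "(\<lambda>f\<in>Hom G Y C. compose (carrier X) f d) (b .[Hk G Y C] f) =
      b .[Hk G X C] (\<lambda>f\<in>Hom G Y C. compose (carrier X) f d) f"
      using bf by (intro carrier_eqI[of _ X]) (simp_all add: compose_eq hom_closed[OF d])
  qed (use hom_compose[OF X d] in auto)
qed

lemma fac_Pk: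
  assumes W: "left_module G W" and X: "left_module G X" and f: "fac G W X"
  shows "fac B (Pk G W C) (Pk G X C)"
proof -
  interpret X: left_module G X by fact
  obtain n a b where ab: "!!l. l < (n::nat) ==> a l : Hom G X W" "!!l. l < n ==> b l : Hom G W X"
    "!!x. x :. X ==> (\<Oplus>\<^bsub>X\<^esub>l\<in>{..<n}. b l (a l x)) = x"
    using f unfolding fac_def by blast
  have a': "pst X (a l) : Hom B (Pk G X C) (Pk G W C)" and b': "pst W (b l) : Hom B (Pk G W C) (Pk G X C)"
    if "l < n" for l using pst_hom[OF X W ab(1)[OF that]] pst_hom[OF W X ab(2)[OF that]] by auto
  have ag: "abelian_group (hom_space G C X)" by (rule hom_space_module(2)[OF KG lC X])
  interpret H: abelian_group "hom_space G C X" by (rule ag)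
  have "(\<Oplus>\<^bsub>Pk G X C\<^esub>l\<in>{..<n}. pst W (b l) (pst X (a l) h)) = h" if "h :. (Pk G X C)" for h
  proof (rule hom_eqI)
    have h: "h : Hom G C X" using that by simp
    show "h : Hom G C X" by (rule h)
    have ba: "pst W (b l) (pst X (a l) h) : Hom G C X" if "l < n" for l
      using hom_closed[OF b'[OF that] hom_closed[OF a'[OF that]], of h] h by simp
    show "(\<Oplus>\<^bsub>Pk G X C\<^esub>l\<in>{..<n}. pst W (b l) (pst X (a l) h)) : Hom G C X"
      using H.finsum_closed[of "%l. pst W (b l) (pst X (a l) h)" "{..<n}"] ba by simp
    fix x assume x: "x :. C"
    have hx: "h x :. X" by (rule hom_closed[OF h x])
    have bx: "b l (a l (h x)) :. X" if "l < n" for l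
      by (rule hom_closed[OF ab(2)[OF that] hom_closed[OF ab(1)[OF that] hx]])
    have "(\<Oplus>\<^bsub>Pk G X C\<^esub>l\<in>{..<n}. pst W (b l) (pst X (a l) h)) x = (\<Oplus>\<^bsub>X\<^esub>l\<in>{..<n}. pst W (b l) (pst X (a l) h) x)"
      using hom_space_finsum[OF ag X.M_group x, of "{..<n}" "%l. pst W (b l) (pst X (a l) h)"] ba by simp
    also have "... = (\<Oplus>\<^bsub>X\<^esub>l\<in>{..<n}. b l (a l (h x)))"
      using x h bx hom_compose[OF lC h ab(1)] by (intro X.M.finsum_cong') (auto simp: pst_def compose_eq)
    finally show "(\<Oplus>\<^bsub>Pk G X C\<^esub>l\<in>{..<n}. pst W (b l) (pst X (a l) h)) x = h x" using ab(3)[OF hx] by simp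
  qed
  then show ?thesis unfolding fac_def using a' b'
    by (intro exI[of _ n] exI[of _ "%l. pst X (a l)"] exI[of _ "%l. pst W (b l)"]) blast
qed

lemma fac_Hk:
  assumes W: "left_module G W" and X: "left_module G X" and f: "fac G W X"
  shows "fac B (Hk G W C) (Hk G X C)"
proof -
  interpret X: left_module G X by fact
  obtain n a b where ab: "!!l. l < (n::nat) ==> a l : Hom G X W" "!!l. l < n ==> b l : Hom G W X"
    "!!x. x :. X ==> (\<Oplus>\<^bsub>X\<^esub>l\<in>{..<n}. b l (a l x)) = x"
    using f unfolding fac_def by blast
  have a': "pre W X (b l) : Hom B (Hk G X C) (Hk G W C)" and b': "pre X W (a l) : Hom B (Hk G W C) (Hk G X C)"
    if "l < n" for l using pre_hom[OF X W ab(1)[OF that]] pre_hom[OF W X ab(2)[OF that]] by auto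
  have ag: "abelian_group (hom_space G X C)" by (rule hom_space_module(2)[OF KG X lC])
  interpret H: abelian_group "hom_space G X C" by (rule ag)
  have "(\<Oplus>\<^bsub>Hk G X C\<^esub>l\<in>{..<n}. pre X W (a l) (pre W X (b l) h)) = h" if "h :. (Hk G X C)" for h
  proof (rule hom_eqI)
    have h: "h : Hom G X C" using that by simp
    show "h : Hom G X C" by (rule h)
    have ba: "pre X W (a l) (pre W X (b l) h) : Hom G X C" if "l < n" for l
      using hom_closed[OF b'[OF that] hom_closed[OF a'[OF that]], of h] h by simp
    show "(\<Oplus>\<^bsub>Hk G X C\<^esub>l\<in>{..<n}. pre X W (a l) (pre W X (b l) h)) : Hom G X C"
      using H.finsum_closed[of "%l. pre X W (a l) (pre W X (b l) h)" "{..<n}"] ba by simp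
    fix x assume x: "x :. X"
    have ax: "a l x :. W" "b l (a l x) :. X" if "l < n" for l
      using hom_closed[OF ab(1)[OF that] x] hom_closed[OF ab(2)[OF that]] by auto
    have "(\<Oplus>\<^bsub>Hk G X C\<^esub>l\<in>{..<n}. pre X W (a l) (pre W X (b l) h)) x = (\<Oplus>\<^bsub>C\<^esub>l\<in>{..<n}. pre X W (a l) (pre W X (b l) h) x)"
      using hom_space_finsum[OF ag C.M_group x, of "{..<n}" "%l. pre X W (a l) (pre W X (b l) h)"] ba by simp
    also have "... = (\<Oplus>\<^bsub>C\<^esub>l\<in>{..<n}. h (b l (a l x)))"
      using x h ax hom_closed[OF h] hom_compose[OF W ab(2) h] by (intro C.M.finsum_cong') (auto simp: pre_def compose_eq)
    also have "... = h (\<Oplus>\<^bsub>X\<^esub>l\<in>{..<n}. b l (a l x))"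
      using ax by (intro hom_finsum[OF h X.M_group C.M_group, symmetric]) auto
    finally show "(\<Oplus>\<^bsub>Hk G X C\<^esub>l\<in>{..<n}. pre X W (a l) (pre W X (b l) h)) x = h x" using ab(3)[OF x] by simp
  qed
  then show ?thesis unfolding fac_def using a' b'
    by (intro exI[of _ n] exI[of _ "%l. pre W X (b l)"] exI[of _ "%l. pre X W (a l)"]) blast
qed

end

section \<open>Membership in \<open>gen\<close> and \<open>cogen\<close>\<close>

lemma fac_iso:
  assumes W: "left_module R W" and X: "left_module R X" and Y: "left_module R Y" and f: "fac R W X"
    and i: "isos R X Y u v"
  shows "fac R W Y"
proof -
  interpret X: left_module R X by fact
  interpret Y: left_module R Y by fact
  obtain n a b where ab: "!!l. l < (n::nat) ==> a l : Hom R X W" "!!l. l < n ==> b l : Hom R W X"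
    "!!x. x :. X ==> (\<Oplus>\<^bsub>X\<^esub>l\<in>{..<n}. b l (a l x)) = x"
    using f unfolding fac_def by blast
  note ii = isosD[OF i]
  let ?a = "%l. compose (carrier Y) (a l) v" and ?b = "%l. compose (carrier W) u (b l)"
  have "(\<Oplus>\<^bsub>Y\<^esub>l\<in>{..<n}. ?b l (?a l y)) = y" if y: "y :. Y" for y
  proof -
    have c: "a l (v y) :. W" "b l (a l (v y)) :. X" if "l < n" for l
      using hom_closed[OF ab(1)[OF that] ii(6)[OF y]] hom_closed[OF ab(2)[OF that]] by auto
    have "(\<Oplus>\<^bsub>Y\<^esub>l\<in>{..<n}. ?b l (?a l y)) = (\<Oplus>\<^bsub>Y\<^esub>l\<in>{..<n}. u (b l (a l (v y))))"
      using c y ii(5) by (intro Y.M.finsum_cong') (auto simp: compose_eq)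
    also have "... = u (\<Oplus>\<^bsub>X\<^esub>l\<in>{..<n}. b l (a l (v y)))"
      using c by (intro hom_finsum[OF ii(1) X.M_group Y.M_group, symmetric]) auto
    finally show ?thesis using ab(3)[OF ii(6)[OF y]] ii(4)[OF y] by simp
  qed
  moreover have "?a l : Hom R Y W" "?b l : Hom R W Y" if "l < n" for l
    using hom_compose[OF Y ii(2) ab(1)[OF that]] hom_compose[OF W ab(2)[OF that] ii(1)] by auto
  ultimately show ?thesis unfolding fac_def by (intro exI[of _ n] exI[of _ ?a] exI[of _ ?b]) blast
qed

lemma list_copies:
  fixes K :: "'k ring" and Z :: "nat => ('r, 'z) module"
  assumes K: "fd_algebra K R" and Z: "!!i. i <= m ==> fdm K R (Z i)"
  shows "EX (Y :: nat => ('r, 'k list) module) u v. ALL i<=m. isos R (Z i) (Y i) (u i) (v i) & fdm K R (Y i)"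
proof -
  \<comment> \<open>Copy and maps are packed into one triple, so that a single choice over
    \<open>i\<close> produces all three families.\<close>
  have "ALL i. EX w :: ('r, 'k list) module \<times> ('z => 'k list) \<times> ('k list => 'z).
      i <= m --> isos R (Z i) (fst w) (fst (snd w)) (snd (snd w)) & fdm K R (fst w)"
  proof
    fix i
    show "EX w :: ('r, 'k list) module \<times> ('z => 'k list) \<times> ('k list => 'z).
      i <= m --> isos R (Z i) (fst w) (fst (snd w)) (snd (snd w)) & fdm K R (fst w)"
    proof (cases "i <= m")
      case True
      obtain L :: "('r, 'k list) module" and f g where "isos R (Z i) L f g" "fdm K R L"
        using list_copy[OF K Z[OF True]] by blast
      then show ?thesis by (intro exI[of _ "(L, f, g)"]) simp
    qed simp
  qed
  then obtain W :: "nat => ('r, 'k list) module \<times> ('z => 'k list) \<times> ('k list => 'z)"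
    where W: "!!i. i <= m --> isos R (Z i) (fst (W i)) (fst (snd (W i))) (snd (snd (W i))) & fdm K R (fst (W i))"
    by (rule choice[THEN exE]) blast
  show ?thesis
    by (intro exI[of _ "%i. fst (W i)"] exI[of _ "%i. fst (snd (W i))"] exI[of _ "%i. snd (snd (W i))"]) (use W in simp)
qed

lemma a_kernel_eq: "a_kernel M N f = {x : carrier M. f x = 0[N]}"
  by (simp add: a_kernel_def')

lemma image_exact_iso:
  assumes X: "isos R X X' a a'" and Y: "isos R Y Y' b b'" and Z: "isos R Z Z' c c'"
    and lY: "left_module R Y" and lZ: "left_module R Z" and lZ': "left_module R Z'"
    and d: "d : Hom R X Y" and e: "e : Hom R Y Z"
    and ex: "d ` carrier X = {y : carrier Y. e y = 0[Z]}"
  shows "(\<lambda>x\<in>carrier X'. b (d (a' x))) ` carrier X' = {y : carrier Y'. (\<lambda>y\<in>carrier Y'. c (e (b' y))) y = 0[Z']}"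
proof -
  note x = isosD[OF X] and y = isosD[OF Y] and z = isosD[OF Z]
  interpret Z: left_module R Z by fact
  interpret Z': left_module R Z' by fact
  have c0: "c 0[Z] = 0[Z']" by (rule hom_zero[OF z(1) Z.M_group Z'.M_group])
  have cz: "c w = 0[Z'] \<longleftrightarrow> w = 0[Z]" if "w :. Z" for w
    using z(3)[OF that] z(3)[OF Z.M.zero_closed] c0 by metis
  have ed: "e (d w) = 0[Z]" if "w :. X" for w using ex that by auto
  show ?thesis
  proof (intro equalityI subsetI)
    fix y' assume "y' : (\<lambda>x\<in>carrier X'. b (d (a' x))) ` carrier X'"
    then obtain x' where x': "x' :. X'" "y' = b (d (a' x'))" by auto
    have w: "d (a' x') :. Y" by (rule hom_closed[OF d x(6)[OF x'(1)]])
    show "y' : {y : carrier Y'. (\<lambda>y\<in>carrier Y'. c (e (b' y))) y = 0[Z']}"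
      using x' y(5)[OF w] y(3)[OF w] ed[OF x(6)[OF x'(1)]] c0 by simp
  next
    fix y' assume "y' : {y : carrier Y'. (\<lambda>y\<in>carrier Y'. c (e (b' y))) y = 0[Z']}"
    then have h: "y' :. Y'" "c (e (b' y')) = 0[Z']" by auto
    have "e (b' y') = 0[Z]" using h(2) cz[OF hom_closed[OF e y(6)[OF h(1)]]] by simp
    then have "b' y' : d ` carrier X" using ex y(6)[OF h(1)] by simp
    then obtain w where w: "w :. X" "b' y' = d w" by auto
    have "b (d (a' (a w))) = y'" using x(3)[OF w(1)] w(2)[symmetric] y(4)[OF h(1)] by simp
    then show "y' : (\<lambda>x\<in>carrier X'. b (d (a' x))) ` carrier X'"
      using x(5)[OF w(1)] by (intro image_eqI[of _ _ "a w"]) simp_all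
  qed
qed

lemma isos_refl: "left_module R M ==> isos R M M (\<lambda>x\<in>carrier M. x) (\<lambda>x\<in>carrier M. x)"
  by (simp add: isos_def hom_id)

lemma hom_conj_iso:
  assumes X: "isos R X X' a a'" and Y: "isos R Y Y' b b'" and l: "left_module R X'" and d: "d : Hom R X Y"
  shows "(\<lambda>x\<in>carrier X'. b (d (a' x))) : Hom R X' Y'"
proof -
  note x = isosD[OF X] and y = isosD[OF Y]
  interpret l: left_module R X' by fact
  show ?thesis
    by (rule hom_setI) (simp_all add: x y hom_closed[OF d] hom_add[OF d] hom_add[OF x(2)] hom_add[OF y(1)]
        hom_smult[OF d] hom_smult[OF x(2)] hom_smult[OF y(1)] l.smult_closed)
qed

text \<open>\<open>Hom(P,-)\<close> is exact for a projective \<open>P\<close>, so the Hom condition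
  of \<open>in_gen\<close> follows from exactness of the sequence. \<open>lift\<close> describes the
  image of \<open>Hom(P,g)\<close> through the image of \<open>g\<close>, which allows exactness to
  be read off pointwise.\<close>

lemma in_gen_of_lists:
  fixes K :: "'k ring" and R :: "('k, 'r) module" and Y :: "nat => ('r, 'k list) module"
  assumes K: "fd_algebra K R" and P: "projective R P" and M: "fdm K R M"
    and Y: "!!i. i <= m ==> fdm K R (Y i)" and d: "!!i. i < m ==> d i : Hom R (Y (Suc i)) (Y i)"
    and p: "p : Hom R (Y 0) M" and surj: "p ` carrier (Y 0) = carrier M"
    and ex0: "0 < m ==> d 0 ` carrier (Y (Suc 0)) = {x : carrier (Y 0). p x = 0[M]}"
    and ex: "!!i. Suc i < m ==> d (Suc i) ` carrier (Y (Suc (Suc i))) = {x : carrier (Y (Suc i)). d i x = 0[Y i]}"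
    and fac: "!!i. i <= m ==> fac R P (Y i)"
  shows "in_gen R (int m) P M"
proof -
  have fP: "fdm K R P" by (rule projective_fdm[OF K P])
  note lP = fdmD(1)[OF fP]
  have fg: "fg_module R (Y i)" if "i <= m" for i using fg_module_iff[OF K] Y[OF that] by blast
  have ls: "left_seq R m Y d M p"
    unfolding left_seq_def exact_onto_def a_kernel_eq
    using fg d p surj ex0 ex by auto
  have ia: "in_add R P (Y i)" if "i <= m" for i by (rule in_add_of_fac[OF K fP Y[OF that] fac[OF that]])
  have hz: "compose (carrier P) g f = (\<lambda>x\<in>carrier P. 0[T]) \<longleftrightarrow> (ALL x:carrier P. g (f x) = 0[T])" for T :: "('r, 't) module" and g :: "'s => 't" and f
    by (auto simp: compose_def fun_eq_iff)
  have lift: "(%f. compose (carrier P) g f) ` Hom R P S = {f : Hom R P T. ALL x:carrier P. f x : g ` carrier S}"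
    if S: "fdm K R S" and T: "fdm K R T" and g: "g : Hom R S T"
    for S :: "('r, 's) module" and T :: "('r, 't) module" and g
  proof (intro equalityI subsetI)
    fix h assume "h : (%f. compose (carrier P) g f) ` Hom R P S"
    then obtain f where f: "f : Hom R P S" "h = compose (carrier P) g f" by auto
    show "h : {f : Hom R P T. ALL x:carrier P. f x : g ` carrier S}"
      using hom_compose[OF lP f(1) g] f hom_closed[OF f(1)] by (auto simp: compose_eq)
  next
    fix h assume "h : {f : Hom R P T. ALL x:carrier P. f x : g ` carrier S}"
    then have h: "h : Hom R P T" "h ` carrier P \<subseteq> g ` carrier S" by auto
    obtain f where f: "f : Hom R P S" "ALL x:carrier P. g (f x) = h x"
      using projective_lift[OF K P S T g h] by blast
    have "compose (carrier P) g f = h"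
      by (rule carrier_eqI[of _ P]) (use f hom_ext[OF h(1)] in "simp_all add: compose_eq")
    then show "h : (%f. compose (carrier P) g f) ` Hom R P S" using f(1) by blast
  qed
  have "exact_onto m (%i. hom_space R P (Y i)) (%i f. compose (carrier P) (d i) f)
          (hom_space R P M) (%f. compose (carrier P) p f)"
    unfolding exact_onto_def a_kernel_eq
  proof (intro conjI allI impI)
    show "(%f. compose (carrier P) p f) ` carrier (hom_space R P (Y 0)) = carrier (hom_space R P M)"
      using lift[OF Y[of 0] M p] surj by (auto simp: hom_closed)
    show "(%f. compose (carrier P) (d 0) f) ` carrier (hom_space R P (Y 1)) =
      {x : carrier (hom_space R P (Y 0)). compose (carrier P) p x = 0[hom_space R P M]}" if "0 < m"
      using lift[OF Y[of "Suc 0"] Y[of 0] d[of 0]] that ex0 by (auto simp: hom_closed hz)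
    show "(%f. compose (carrier P) (d (Suc i)) f) ` carrier (hom_space R P (Y (Suc (Suc i)))) =
      {x : carrier (hom_space R P (Y (Suc i))). compose (carrier P) (d i) x = 0[hom_space R P (Y i)]}" if "Suc i < m" for i
      using lift[OF Y[of "Suc (Suc i)"] Y[of "Suc i"] d[of "Suc i"]] that ex[of i] by (auto simp: hom_closed hz)
  qed
  then show ?thesis unfolding in_gen_def using ls ia fg_module_iff[OF K] M by auto
qed

text \<open>The terms may have any carrier; list copies and conjugated differentials replace
  them.\<close>

lemma in_genI:
  fixes K :: "'k ring" and R :: "('k, 'r) module" and Z :: "nat => ('r, 'z) module"
  assumes K: "fd_algebra K R" and P: "projective R P" and M: "fdm K R M"
    and Z: "!!i. i <= m ==> fdm K R (Z i)" and d: "!!i. i < m ==> d i : Hom R (Z (Suc i)) (Z i)"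
    and p: "p : Hom R (Z 0) M" and surj: "p ` carrier (Z 0) = carrier M"
    and ex0: "0 < m ==> d 0 ` carrier (Z (Suc 0)) = {x : carrier (Z 0). p x = 0[M]}"
    and ex: "!!i. Suc i < m ==> d (Suc i) ` carrier (Z (Suc (Suc i))) = {x : carrier (Z (Suc i)). d i x = 0[Z i]}"
    and fac: "!!i. i <= m ==> fac R P (Z i)"
  shows "in_gen R (int m) P M"
proof -
  have lP: "left_module R P" by (rule fdmD(1)[OF projective_fdm[OF K P]])
  obtain Y :: "nat => ('r, 'k list) module" and u v
    where i: "!!i. i <= m ==> isos R (Z i) (Y i) (u i) (v i)" and Y: "!!i. i <= m ==> fdm K R (Y i)"
    using list_copies[of K R m Z, OF K] Z by blast
  note lY = fdmD(1)[OF Y] and lZ = fdmD(1)[OF Z]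
  have im: "isos R M M (\<lambda>x\<in>carrier M. x) (\<lambda>x\<in>carrier M. x)" by (rule isos_refl[OF fdmD(1)[OF M]])
  note lM = fdmD(1)[OF M]
  have p_eq: "(\<lambda>x\<in>carrier (Y 0). (\<lambda>x\<in>carrier M. x) (p (v 0 x))) = (\<lambda>x\<in>carrier (Y 0). p (v 0 x))"
    using hom_closed[OF p] isosD(6)[OF i[of 0]] by (intro restrict_ext) simp
  show ?thesis
  proof (rule in_gen_of_lists[OF K P M Y, where d = "%i. \<lambda>x\<in>carrier (Y (Suc i)). u i (d i (v (Suc i) x))"
        and p = "\<lambda>x\<in>carrier (Y 0). p (v 0 x)"])
    show "(\<lambda>x\<in>carrier (Y (Suc j)). u j (d j (v (Suc j) x))) : Hom R (Y (Suc j)) (Y j)" if "j < m" for j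
      using that by (intro hom_conj_iso[OF i[of "Suc j"] i[of j] lY d]) auto
    show "(\<lambda>x\<in>carrier (Y 0). p (v 0 x)) : Hom R (Y 0) M"
      using hom_conj_iso[OF i[of 0] im lY p] p_eq by simp
    show "(\<lambda>x\<in>carrier (Y 0). p (v 0 x)) ` carrier (Y 0) = carrier M"
    proof -
      have "v 0 ` carrier (Y 0) = carrier (Z 0)"
        using isosD(3,5,6)[OF i[of 0]] by (auto intro!: image_eqI[of _ "v 0" "u 0 _"])
      then show ?thesis using surj by (simp add: image_image[symmetric])
    qed
    show "(\<lambda>x\<in>carrier (Y (Suc 0)). u 0 (d 0 (v (Suc 0) x))) ` carrier (Y (Suc 0)) =
      {x : carrier (Y 0). (\<lambda>x\<in>carrier (Y 0). p (v 0 x)) x = 0[M]}" if "0 < m"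
      using image_exact_iso[OF i[of "Suc 0"] i[of 0] im lZ lM lM d[of 0] p ex0] that hom_closed[OF p isosD(6)[OF i[of 0]]] by (simp cong: conj_cong)
    show "(\<lambda>x\<in>carrier (Y (Suc (Suc j))). u (Suc j) (d (Suc j) (v (Suc (Suc j)) x))) ` carrier (Y (Suc (Suc j))) =
      {x : carrier (Y (Suc j)). (\<lambda>x\<in>carrier (Y (Suc j)). u j (d j (v (Suc j) x))) x = 0[Y j]}" if "Suc j < m" for j
      using that by (intro image_exact_iso[OF i i i lZ lZ lY d d ex]) auto
    show "fac R P (Y j)" if "j <= m" for j by (rule fac_iso[OF lP lZ lY fac i]) (use that in auto)
  qed
qed

text \<open>Injectivity of \<open>I\<close> makes \<open>Hom(-,I)\<close> exact; \<open>ext\<close>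
  decides by the kernel of \<open>g\<close> which maps extend along \<open>g\<close>.\<close>

lemma in_cogen_of_lists:
  fixes K :: "'k ring" and R :: "('k, 'r) module" and Y :: "nat => ('r, 'k list) module"
  assumes K: "fd_algebra K R" and I: "injective R I" and N: "fdm K R N"
    and Y: "!!i. i <= m ==> fdm K R (Y i)" and d: "!!i. i < m ==> d i : Hom R (Y i) (Y (Suc i))"
    and j: "j : Hom R N (Y 0)" and inj: "inj_on j (carrier N)"
    and ex0: "0 < m ==> j ` carrier N = {x : carrier (Y 0). d 0 x = 0[Y (Suc 0)]}"
    and ex: "!!i. Suc i < m ==> d i ` carrier (Y i) = {x : carrier (Y (Suc i)). d (Suc i) x = 0[Y (Suc (Suc i))]}"
    and fac: "!!i. i <= m ==> fac R I (Y i)"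
  shows "in_cogen R (int m) I N"
proof -
  have fI: "fdm K R I" by (rule injective_fdm[OF K I])
  have lN: "left_module R N" by (rule fdmD(1)[OF N])
  have fg: "fg_module R (Y i)" if "i <= m" for i using fg_module_iff[OF K] Y[OF that] by blast
  have rs: "right_seq R m N j Y d"
    unfolding right_seq_def exact_from_def a_kernel_eq
    using fg d j inj ex0 ex by auto
  have ia: "in_add R I (Y i)" if "i <= m" for i by (rule in_add_of_fac[OF K fI Y[OF that] fac[OF that]])
  have hz: "compose (carrier S) f g = (\<lambda>x\<in>carrier S. 0[I]) \<longleftrightarrow> (ALL y:g ` carrier S. f y = 0[I])"
    for S :: "('r, 't) module" and g :: "'t => 's" and f
    by (auto simp: compose_def fun_eq_iff)
  have ext: "(%f. compose (carrier S) f g) ` Hom R T I =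
      {f : Hom R S I. ALL x:carrier S. g x = 0[T] --> f x = 0[I]}"
    if S: "fdm K R S" and T: "fdm K R T" and g: "g : Hom R S T"
    for S :: "('r, 's) module" and T :: "('r, 't) module" and g
  proof (intro equalityI subsetI)
    note lS = fdmD(1)[OF S]
    fix h assume "h : (%f. compose (carrier S) f g) ` Hom R T I"
    then obtain f where f: "f : Hom R T I" "h = compose (carrier S) f g" by auto
    show "h : {f : Hom R S I. ALL x:carrier S. g x = 0[T] --> f x = 0[I]}"
      using hom_compose[OF lS g f(1)] f(2) hom_zero[OF f(1) fdmD(3)[OF T] fdmD(3)[OF fI]] by (auto simp: compose_eq)
  next
    note lS = fdmD(1)[OF S]
    fix h assume "h : {f : Hom R S I. ALL x:carrier S. g x = 0[T] --> f x = 0[I]}"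
    then have h: "h : Hom R S I" "!!x. [|x :. S; g x = 0[T]|] ==> h x = 0[I]" by auto
    obtain f where f: "f : Hom R T I" "ALL x:carrier S. f (g x) = h x"
      using injective_extend[OF K I lS T g h] by blast
    have "compose (carrier S) f g = h"
      by (rule carrier_eqI[of _ S]) (use f hom_ext[OF h(1)] in "simp_all add: compose_eq")
    then show "h : (%f. compose (carrier S) f g) ` Hom R T I" using f(1) by blast
  qed
  have j0: "x = 0[N]" if "x :. N" "j x = 0[Y 0]" for x
  proof -
    interpret N: left_module R N by fact
    show ?thesis using inj_onD[OF inj, of x "0[N]"] that hom_zero[OF j N.M_group fdmD(3)[OF Y]] by simp
  qed
  have "exact_onto m (%i. hom_space R (Y i) I) (%i f. compose (carrier (Y i)) f (d i))
          (hom_space R N I) (%f. compose (carrier N) f j)"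
    unfolding exact_onto_def a_kernel_eq
  proof (intro conjI allI impI)
    show "(%f. compose (carrier N) f j) ` carrier (hom_space R (Y 0) I) = carrier (hom_space R N I)"
    proof -
      have "f x = 0[I]" if "f : Hom R N I" "x :. N" "j x = 0[Y 0]" for f x
        using j0[OF that(2,3)] hom_zero[OF that(1) fdmD(3)[OF N] fdmD(3)[OF fI]] by simp
      then show ?thesis using ext[OF N Y[of 0] j] by auto
    qed
    show "(%f. compose (carrier (Y 0)) f (d 0)) ` carrier (hom_space R (Y 1) I) =
      {x : carrier (hom_space R (Y 0) I). compose (carrier N) x j = 0[hom_space R N I]}" if "0 < m"
      using ext[OF Y[of 0] Y[of "Suc 0"] d[of 0]] that by (simp add: hz ex0 del: image_iff ball_simps) auto
    show "(%f. compose (carrier (Y (Suc i))) f (d (Suc i))) ` carrier (hom_space R (Y (Suc (Suc i))) I) =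
      {x : carrier (hom_space R (Y (Suc i)) I). compose (carrier (Y i)) x (d i) = 0[hom_space R (Y i) I]}" if "Suc i < m" for i
      using ext[OF Y[of "Suc i"] Y[of "Suc (Suc i)"] d[of "Suc i"]] that by (simp add: hz ex del: image_iff ball_simps) auto
  qed
  then show ?thesis unfolding in_cogen_def using rs ia fg_module_iff[OF K] N by auto
qed

text \<open>As in \<open>in_genI\<close>, the sequence is moved to list carriers by
  conjugation.\<close>

lemma in_cogenI:
  fixes K :: "'k ring" and R :: "('k, 'r) module" and Z :: "nat => ('r, 'z) module"
  assumes K: "fd_algebra K R" and I: "injective R I" and N: "fdm K R N"
    and Z: "!!i. i <= m ==> fdm K R (Z i)" and d: "!!i. i < m ==> d i : Hom R (Z i) (Z (Suc i))"
    and j: "j : Hom R N (Z 0)" and inj: "inj_on j (carrier N)"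
    and ex0: "0 < m ==> j ` carrier N = {x : carrier (Z 0). d 0 x = 0[Z (Suc 0)]}"
    and ex: "!!i. Suc i < m ==> d i ` carrier (Z i) = {x : carrier (Z (Suc i)). d (Suc i) x = 0[Z (Suc (Suc i))]}"
    and fac: "!!i. i <= m ==> fac R I (Z i)"
  shows "in_cogen R (int m) I N"
proof -
  have lI: "left_module R I" by (rule fdmD(1)[OF injective_fdm[OF K I]])
  obtain Y :: "nat => ('r, 'k list) module" and u v
    where i: "!!i. i <= m ==> isos R (Z i) (Y i) (u i) (v i)" and Y: "!!i. i <= m ==> fdm K R (Y i)"
    using list_copies[of K R m Z, OF K] Z by blast
  note lY = fdmD(1)[OF Y] and lZ = fdmD(1)[OF Z]
  note lN = fdmD(1)[OF N]
  have iN: "isos R N N (\<lambda>x\<in>carrier N. x) (\<lambda>x\<in>carrier N. x)" by (rule isos_refl[OF lN])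
  have j_eq: "(\<lambda>x\<in>carrier N. u 0 (j ((\<lambda>x\<in>carrier N. x) x))) = (\<lambda>x\<in>carrier N. u 0 (j x))"
    by (intro restrict_ext) simp
  show ?thesis
  proof (rule in_cogen_of_lists[OF K I N Y, where d = "%i. \<lambda>x\<in>carrier (Y i). u (Suc i) (d i (v i x))"
        and j = "\<lambda>x\<in>carrier N. u 0 (j x)"])
    show "(\<lambda>x\<in>carrier (Y a). u (Suc a) (d a (v a x))) : Hom R (Y a) (Y (Suc a))" if "a < m" for a
      using that by (intro hom_conj_iso[OF i[of a] i[of "Suc a"] lY d]) auto
    show "(\<lambda>x\<in>carrier N. u 0 (j x)) : Hom R N (Y 0)"
      using hom_conj_iso[OF iN i[of 0] lN j] j_eq by simp
    show "inj_on (\<lambda>x\<in>carrier N. u 0 (j x)) (carrier N)"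
    proof (rule inj_onI)
      fix x y assume h: "x :. N" "y :. N" "(\<lambda>x\<in>carrier N. u 0 (j x)) x = (\<lambda>x\<in>carrier N. u 0 (j x)) y"
      then have "j x = j y" using isosD(3)[OF i[of 0]] hom_closed[OF j] by (metis le0 restrict_apply')
      then show "x = y" using inj_onD[OF inj] h by blast
    qed
    show "(\<lambda>x\<in>carrier N. u 0 (j x)) ` carrier N =
      {x : carrier (Y 0). (\<lambda>x\<in>carrier (Y 0). u (Suc 0) (d 0 (v 0 x))) x = 0[Y (Suc 0)]}" if "0 < m"
      using image_exact_iso[OF iN i[of 0] i[of "Suc 0"] lZ lZ lY j d[of 0] ex0] that j_eq by simp
    show "(\<lambda>x\<in>carrier (Y a). u (Suc a) (d a (v a x))) ` carrier (Y a) =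
      {x : carrier (Y (Suc a)). (\<lambda>x\<in>carrier (Y (Suc a)). u (Suc (Suc a)) (d (Suc a) (v (Suc a) x))) x = 0[Y (Suc (Suc a))]}"
      if "Suc a < m" for a
      using that by (intro image_exact_iso[OF i i i lZ lZ lY d d ex]) auto
    show "fac R I (Y a)" if "a <= m" for a by (rule fac_iso[OF lI lZ lY fac i]) (use that in auto)
  qed
qed

text \<open>Duality over a field is exact: a functional that kills the kernel of \<open>f\<close>
  factors through \<open>f\<close> by \<open>dual_exact\<close>.\<close>

lemma dual_exact_image:
  assumes K: "fd_algebra K R" and W: "left_module (opp R) W" and X: "left_module (opp R) X" and Y: "fdm K (opp R) Y"
    and g: "g : Hom R W X" and f: "f : Hom R X Y"
    and ex: "g ` carrier W = {x : carrier X. f x = 0[Y]}"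
  shows "(\<lambda>\<eta>\<in>carrier (dual K R Y). \<lambda>x\<in>carrier X. \<eta> (f x)) ` carrier (dual K R Y) =
    {l : carrier (dual K R X). (\<lambda>\<eta>\<in>carrier (dual K R X). \<lambda>w\<in>carrier W. \<eta> (g w)) l = 0[dual K R W]}"
proof (intro equalityI subsetI)
  note Fm = dual_map[OF K X fdmD(1)[OF Y] f]
  fix l assume "l : (\<lambda>\<eta>\<in>carrier (dual K R Y). \<lambda>x\<in>carrier X. \<eta> (f x)) ` carrier (dual K R Y)"
  then obtain \<eta> where \<eta>: "\<eta> :. (dual K R Y)" "l = (\<lambda>x\<in>carrier X. \<eta> (f x))" by auto
  have \<eta>f: "\<eta> : functionals K R Y" using \<eta>(1) by simp
  have l: "l :. (dual K R X)" using hom_closed[OF Fm \<eta>(1)] \<eta> by simp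
  have gw: "g w :. X" "f (g w) = 0[Y]" if "w :. W" for w using ex that by auto
  have "(\<lambda>w\<in>carrier W. l (g w)) = (\<lambda>w\<in>carrier W. 0[K])"
    by (rule restrict_ext)
      (simp add: \<eta>(2) gw functional_zero[OF fd_algebraD(1)[OF K] fdmD(3)[OF Y] \<eta>f])
  then show "l : {l : carrier (dual K R X). (\<lambda>\<eta>\<in>carrier (dual K R X). \<lambda>w\<in>carrier W. \<eta> (g w)) l = 0[dual K R W]}"
    using l by simp
next
  fix l assume "l : {l : carrier (dual K R X). (\<lambda>\<eta>\<in>carrier (dual K R X). \<lambda>w\<in>carrier W. \<eta> (g w)) l = 0[dual K R W]}"
  then have l: "l :. (dual K R X)" and lz: "(\<lambda>w\<in>carrier W. l (g w)) = (\<lambda>w\<in>carrier W. 0[K])" by auto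
  have lz': "l (g w) = 0[K]" if "w :. W" for w using fun_cong[OF lz, of w] that by simp
  have "l x = 0[K]" if "x :. X" "f x = 0[Y]" for x
  proof -
    have "x : g ` carrier W" using ex that by simp
    then show ?thesis using lz' by auto
  qed
  then obtain \<mu> where "\<mu> :. (dual K R Y)" "(\<lambda>x\<in>carrier X. \<mu> (f x)) = l"
    using dual_exact[OF K X Y f l] by blast
  then show "l : (\<lambda>\<eta>\<in>carrier (dual K R Y). \<lambda>x\<in>carrier X. \<eta> (f x)) ` carrier (dual K R Y)"
    by (intro image_eqI[of _ _ \<mu>]) simp_all
qed

lemma fac_injective:
  fixes R :: "('k, 'r) module"
  assumes K: "fd_algebra K R" and W: "injective R W" and X: "fdm K R X" and f: "fac R W X"
  shows "injective R X"
  unfolding injective_def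
proof (intro conjI allI impI ballI)
  show "fg_module R X" using fg_module_iff[OF K] X by blast
  interpret X: left_module R X by (rule fdmD(1)[OF X])
  obtain n a b where ab: "!!l. l < (n::nat) ==> a l : Hom R X W" "!!l. l < n ==> b l : Hom R W X"
    "!!x. x :. X ==> (\<Oplus>\<^bsub>X\<^esub>l\<in>{..<n}. b l (a l x)) = x"
    using f unfolding fac_def by blast
  fix S T :: "('r, 'k list) module" and g f
  assume h: "fg_module R S" "fg_module R T" "g : Hom R S T" "f : Hom R S X" "inj_on g (carrier S)"
  have lS: "left_module R S" and lT: "left_module R T" using h by (auto simp: fg_module_def)
  have "EX e:Hom R T W. ALL x:carrier S. e (g x) = a l (f x)" if "l < n" for l
    using injectiveD[OF W h(1-3) hom_compose[OF lS h(4) ab(1)[OF that]] h(5)] by (simp add: compose_eq)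
  then have "ALL l. EX e. l < n --> e : Hom R T W & (ALL x:carrier S. e (g x) = a l (f x))" by blast
  then obtain e where e: "!!l. l < n ==> e l : Hom R T W" "!!l x. [|l < n; x :. S|] ==> e l (g x) = a l (f x)"
    by (rule choice[THEN exE]) blast
  have be: "compose (carrier T) (b l) (e l) : Hom R T X" if "l < n" for l
    by (rule hom_compose[OF lT e(1)[OF that] ab(2)[OF that]])
  have sm: "(\<lambda>x\<in>carrier T. \<Oplus>\<^bsub>X\<^esub>l\<in>{..<n}. compose (carrier T) (b l) (e l) x) : Hom R T X"
    by (rule hom_sum[OF lT X.left_module_axioms be])
  show "EX h:Hom R T X. ALL x:carrier S. h (g x) = f x"
  proof (rule bexI[OF _ sm], intro ballI)
    fix x assume x: "x :. S"
    have gx: "g x :. T" and fx: "f x :. X" by (rule hom_closed[OF h(3) x], rule hom_closed[OF h(4) x])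
    have bc: "b l (a l (f x)) :. X" if "l < n" for l by (rule hom_closed[OF ab(2)[OF that] hom_closed[OF ab(1)[OF that] fx]])
    have "(\<Oplus>\<^bsub>X\<^esub>l\<in>{..<n}. compose (carrier T) (b l) (e l) (g x)) = (\<Oplus>\<^bsub>X\<^esub>l\<in>{..<n}. b l (a l (f x)))"
      using gx x bc e(2) by (intro X.M.finsum_cong') (auto simp: compose_eq)
    then show "(\<lambda>x\<in>carrier T. \<Oplus>\<^bsub>X\<^esub>l\<in>{..<n}. compose (carrier T) (b l) (e l) x) (g x) = f x"
      using gx ab(3)[OF fx] by simp
  qed
qed

text \<open>One half of the adjunction \<open>Hom(M, D R) = D M\<close>.\<close>

lemma dual_regular_hom:
  assumes K: "fd_algebra K R" and M: "left_module R M" and \<xi>: "\<xi> : functionals K R M"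
  shows "(\<lambda>x\<in>carrier M. \<lambda>r\<in>carrier R. \<xi> (r .[M] x)) : Hom R M (dual_regular K R)"
proof -
  interpret M: left_module R M by fact
  interpret RK: left_module K R by (rule fd_algebraD(6)[OF K])
  note \<xi>D = functionalD(1-3)[OF \<xi>]
  have sr: "scal R (regular (opp R)) c r = c .[R] r" if "c :. K" "r :. R" for c r
    using scal_regular[OF fd_algebra_opp[OF K], of c r] that by simp
  have fn: "(\<lambda>r\<in>carrier R. \<xi> (r .[M] x)) : Hom K (rs R (regular (opp R))) (regular K)" if x: "x :. M" for x
  proof (rule functionalI)
    fix c r assume "c :. K" "r :. (regular (opp R))"
    then show "(\<lambda>r\<in>carrier R. \<xi> (r .[M] x)) (scal R (regular (opp R)) c r) = c *[K] (\<lambda>r\<in>carrier R. \<xi> (r .[M] x)) r"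
      using x by (simp add: sr RK.smult_closed scal_module(4)[OF K M] M.smult_closed \<xi>D)
  qed (use x in \<open>simp_all add: M.smult_closed \<xi>D M.smult_l_distr\<close>)
  show ?thesis unfolding dual_regular_def
  proof (rule hom_setI)
    show "(\<lambda>x\<in>carrier M. \<lambda>r\<in>carrier R. \<xi> (r .[M] x)) x :. (dual K R (regular (opp R)))"
      if "x :. M" for x using fn[OF that] that by simp
  qed (auto intro!: restrict_ext simp: M.smult_closed M.smult_r_distr M.smult_assoc1 \<xi>D)
qed

text \<open>The other half: evaluation at \<open>1\<close> returns a functional, and the second
  claim recovers \<open>\<eta>\<close> from it.\<close>

lemma dual_regular_hom_one:
  assumes K: "fd_algebra K R" and M: "left_module R M" and \<eta>: "\<eta> : Hom R M (dual_regular K R)"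
  shows "(\<lambda>x\<in>carrier M. \<eta> x 1[R]) : functionals K R M"
    and "[|x :. M; r :. R|] ==> \<eta> x r = \<eta> (r .[M] x) 1[R]"
proof -
  interpret M: left_module R M by fact
  have lr: "left_module (opp R) (regular (opp R))" by (rule left_module_regular[OF fd_algebraD(4)[OF fd_algebra_opp[OF K]]])
  have \<eta>c: "\<eta> x : Hom K (rs R (regular (opp R))) (regular K)" if "x :. M" for x
    using hom_closed[OF \<eta> that] by (simp add: dual_regular_def)
  show "(\<lambda>x\<in>carrier M. \<eta> x 1[R]) : functionals K R M"
  proof (rule functionalI)
    fix c x assume h: "c :. K" "x :. M"
    show "(\<lambda>x\<in>carrier M. \<eta> x 1[R]) (scal R M c x) = c *[K] (\<lambda>x\<in>carrier M. \<eta> x 1[R]) x"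
      using h scal_module(2)[OF K M] hom_scal(2)[OF K \<eta> h] scal_dual[OF K lr \<eta>c[OF h(2)] h(1)]
      by (simp add: dual_regular_def)
  qed (use functionalD(1)[OF \<eta>c] in \<open>simp_all add: hom_add[OF \<eta>] dual_regular_def\<close>)
  show "\<eta> x r = \<eta> (r .[M] x) 1[R]" if "x :. M" "r :. R"
    using that hom_smult[OF \<eta> that(2,1)] by (simp add: dual_regular_def)
qed

section \<open>Projectivity of \<open>Pk\<close> and injectivity of \<open>Ik\<close>\<close>

lemma compose_zero_iff: "compose S g f = (\<lambda>x\<in>S. z) \<longleftrightarrow> (ALL x:S. g (f x) = z)"
  by (auto simp: compose_def fun_eq_iff)

context cmod
begin

text \<open>\<open>Hom(C,P)\<close> is a retract of \<open>Hom(C,C)\<close> through composition with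
  \<open>s\<close> and \<open>q\<close>, with generator \<open>q\<close>.\<close>

lemma Pk_projective:
  assumes P: "fdm K G P" and s: "s : Hom G P C" and q: "q : Hom G C P" and qs: "!!x. x :. P ==> q (s x) = x"
  shows "projective B (Pk G P C)"
proof (rule projective_of_retract[OF KB fPk[OF P]])
  interpret PM: left_module B "Pk G P C" by (rule Pk_module[OF fdmD(1)[OF P]])
  show "(\<lambda>u\<in>Hom G C P. compose (carrier C) s u) : Hom B (Pk G P C) (regular B)"
  proof (rule hom_setI)
    fix u v assume h: "u :. (Pk G P C)" "v :. (Pk G P C)"
    have "u +[Pk G P C] v : Hom G C P" using PM.M.a_closed[OF h] by simp
    then show "(\<lambda>u\<in>Hom G C P. compose (carrier C) s u) (u +[Pk G P C] v) =
      (\<lambda>u\<in>Hom G C P. compose (carrier C) s u) u +[regular B] (\<lambda>u\<in>Hom G C P. compose (carrier C) s u) v"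
      using h by (intro carrier_eqI[of _ C]) (simp_all add: compose_eq hom_add[OF s] hom_closed)
  next
    fix b u assume h: "b :. B" "u :. (Pk G P C)"
    have "b .[Pk G P C] u : Hom G C P" using PM.smult_closed[OF h] by simp
    then show "(\<lambda>u\<in>Hom G C P. compose (carrier C) s u) (b .[Pk G P C] u) =
      b .[regular B] (\<lambda>u\<in>Hom G C P. compose (carrier C) s u) u"
      using h by (intro carrier_eqI[of _ C]) (simp_all add: compose_eq hom_closed)
  qed (use hom_compose[OF lC _ s] in auto)
  show "q :. (Pk G P C)" using q by simp
  fix u assume u: "u :. (Pk G P C)"
  then have u': "u : Hom G C P" by simp
  show "(\<lambda>u\<in>Hom G C P. compose (carrier C) s u) u .[Pk G P C] q = u"
    by (rule carrier_eqI[of _ C]) (use u' in "simp_all add: compose_eq hom_ext[OF u'] hom_closed[OF u'] qs")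
qed

text \<open>\<open>Hom(P,C)\<close> is a projective right \<open>B\<close>-module whose dual basis
  has one member, formed by \<open>s\<close> and precomposition with \<open>q\<close>. So
  \<open>dual_extend\<close> applies with \<open>n = 1\<close>.\<close>

lemma Ik_injective:
  assumes P: "fdm K G P" and s: "s : Hom G P C" and q: "q : Hom G C P" and qs: "!!x. x :. P ==> q (s x) = x"
  shows "injective B (Ik K G P C)"
  unfolding injective_def Ik_eq
proof (intro conjI allI impI ballI)
  have lH: "left_module (opp B) (Hk G P C)" by (rule Hk_module[OF fdmD(1)[OF P]])
  interpret PM: left_module "opp B" "Hk G P C" by (rule lH)
  have fI: "fdm K B (dual K B (Hk G P C))" by (rule fdm_dual[OF KB fHk[OF P]])
  show "fg_module B (dual K B (Hk G P C))" using fg_module_iff[OF KB] fI by blast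
  have t: "(\<lambda>u\<in>Hom G P C. compose (carrier C) u q) : Hom B (Hk G P C) (regular (opp B))"
  proof (rule hom_setI)
    fix u v assume h: "u :. (Hk G P C)" "v :. (Hk G P C)"
    have "u +[Hk G P C] v : Hom G P C" using PM.M.a_closed[OF h] by simp
    then show "(\<lambda>u\<in>Hom G P C. compose (carrier C) u q) (u +[Hk G P C] v) =
      (\<lambda>u\<in>Hom G P C. compose (carrier C) u q) u +[regular (opp B)] (\<lambda>u\<in>Hom G P C. compose (carrier C) u q) v"
      using h by (intro carrier_eqI[of _ C]) (simp_all add: compose_eq hom_closed[OF q])
  next
    fix b u assume h: "b :. B" "u :. (Hk G P C)"
    have "b .[Hk G P C] u : Hom G P C" using PM.smult_closed[of b u] h by simp
    then show "(\<lambda>u\<in>Hom G P C. compose (carrier C) u q) (b .[Hk G P C] u) =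
      b .[regular (opp B)] (\<lambda>u\<in>Hom G P C. compose (carrier C) u q) u"
      using h by (intro carrier_eqI[of _ C]) (simp_all add: compose_eq hom_closed[OF q])
  qed (use hom_compose[OF lC q] in auto)
  have tx: "(\<Oplus>\<^bsub>Hk G P C\<^esub>i\<in>{..<1::nat}. (\<lambda>u\<in>Hom G P C. compose (carrier C) u q) y .[Hk G P C] s) = y"
    if "y :. (Hk G P C)" for y
  proof -
    have y: "y : Hom G P C" using that by simp
    have "(\<lambda>u\<in>Hom G P C. compose (carrier C) u q) y .[Hk G P C] s = y"
      by (rule carrier_eqI[of _ P]) (use y in "simp_all add: compose_eq hom_ext[OF y] hom_closed[OF s] qs")
    moreover have "(\<Oplus>\<^bsub>Hk G P C\<^esub>i\<in>{0::nat}. y) = y +[Hk G P C] (\<Oplus>\<^bsub>Hk G P C\<^esub>i\<in>({} :: nat set). y)"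
      by (rule PM.M.finsum_insert) (use that in simp_all)
    moreover have "... = y" by (simp only: PM.M.finsum_empty PM.M.r_zero[OF that])
    ultimately show ?thesis by (simp only: lessThan_Suc lessThan_0 One_nat_def)
  qed
  fix S T :: "('c => 'c, 'k list) module" and g f
  assume h: "fg_module B S" "fg_module B T" "g : Hom B S T" "f : Hom B S (dual K B (Hk G P C))" "inj_on g (carrier S)"
  have S: "fdm K B S" and T: "fdm K B T" using h fg_module_iff[OF KB] by blast+
  note lS = fdmD(1)[OF S]
  have ker: "f m = 0[dual K B (Hk G P C)]" if "m :. S" "g m = 0[T]" for m
  proof -
    interpret S: left_module B S by (rule lS)
    have "m = 0[S]" using inj_onD[OF h(5), of m "0[S]"] that hom_zero[OF h(3) fdmD(3)[OF S] fdmD(3)[OF T]] by simp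
    then show ?thesis using hom_zero[OF h(4) fdmD(3)[OF S] fdmD(3)[OF fI]] by simp
  qed
  show "EX e:Hom B T (dual K B (Hk G P C)). ALL x:carrier S. e (g x) = f x"
    by (rule dual_extend[OF KB lH, where n = 1 and x = "%_. s" and t = "%_. \<lambda>u\<in>Hom G P C. compose (carrier C) u q",
          OF _ t tx lS T h(3,4) ker]) (use s in simp_all)
qed

text \<open>\<open>Hom(C,p)\<close> followed by the identification \<open>Hom(C, D G) = D C\<close>,
  which is evaluation at \<open>1\<close>.\<close>

definition pstar :: "('g, 'x) module => ('x => 'g => 'k) => ('c => 'x) => 'c => 'k" where
  "pstar X p = (\<lambda>f\<in>Hom G C X. \<lambda>c\<in>carrier C. p (f c) 1[G])"

lemma pstar_hom:
  assumes X: "left_module G X" and p: "p : Hom G X (dual_regular K G)"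
  shows "pstar X p : Hom B (Pk G X C) (DCk K G C)"
proof -
  interpret PM: left_module B "Pk G X C" by (rule Pk_module[OF X])
  note pe = hom_add[OF p, unfolded dual_regular_def, simplified]
  interpret GR: ring G by (rule fd_algebraD(4)[OF KG])
  show ?thesis unfolding pstar_def
  proof (rule hom_setI)
    fix f assume h: "f :. (Pk G X C)"
    have "compose (carrier C) p f : Hom G C (dual_regular K G)" using hom_compose[OF lC _ p, of f] h by simp
    note dual_regular_hom_one(1)[OF KG lC this]
    moreover have "(\<lambda>x\<in>carrier C. compose (carrier C) p f x 1[G]) = (\<lambda>x\<in>carrier C. p (f x) 1[G])"
      by (rule restrict_ext) (simp add: compose_eq)
    ultimately show "(\<lambda>f\<in>Hom G C X. \<lambda>c\<in>carrier C. p (f c) 1[G]) f :. (DCk K G C)" using h by simp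
  next
    fix f g assume h: "f :. (Pk G X C)" "g :. (Pk G X C)"
    have "f +[Pk G X C] g : Hom G C X" using PM.M.a_closed[OF h] by simp
    then show "(\<lambda>f\<in>Hom G C X. \<lambda>c\<in>carrier C. p (f c) 1[G]) (f +[Pk G X C] g) =
      (\<lambda>f\<in>Hom G C X. \<lambda>c\<in>carrier C. p (f c) 1[G]) f +[DCk K G C] (\<lambda>f\<in>Hom G C X. \<lambda>c\<in>carrier C. p (f c) 1[G]) g"
      using h by (intro carrier_eqI[of _ C]) (simp_all add: pe hom_closed)
  next
    fix b f assume h: "b :. B" "f :. (Pk G X C)"
    have "b .[Pk G X C] f : Hom G C X" using PM.smult_closed[OF h] by simp
    then show "(\<lambda>f\<in>Hom G C X. \<lambda>c\<in>carrier C. p (f c) 1[G]) (b .[Pk G X C] f) =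
      b .[DCk K G C] (\<lambda>f\<in>Hom G C X. \<lambda>c\<in>carrier C. p (f c) 1[G]) f"
      using h by (intro carrier_eqI[of _ C]) (simp_all add: compose_eq hom_closed)
  qed simp
qed

end

section \<open>The sequence in \<open>add\<close> of \<open>Pk\<close> that resolves
  \<open>D C\<close>\<close>

locale special_cmod = cmod K G C
  for K :: "'k ring" and G :: "('k, 'g) module" and C :: "('g, 'c) module" +
  fixes P :: "('g, 'p) module" and s :: "'p => 'c" and q :: "'c => 'p"
    and k :: nat and X :: "nat => ('g, 'k list) module" and d :: "nat => 'k list => 'k list"
    and p :: "'k list => 'g => 'k"
  assumes fP: "fdm K G P" and P_inj: "injective G P"
    and s: "s : Hom G P C" and q: "q : Hom G C P" and qs: "!!x. x :. P ==> q (s x) = x"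
    and seq: "cotilting_seq K G k X d p" and facX: "fac G C (X k)" and facP: "!!j. j < k ==> fac G P (X j)"
    and ext: "!!i. i > 0 ==> ext_vanishes G i C C"
begin

lemma lP: "left_module G P" by (rule fdmD(1)[OF fP])

abbreviation DG where "DG \<equiv> dual_regular K G"

lemma fDG: "fdm K G DG" unfolding dual_regular_def by (rule fdm_dual[OF KG fdm_regular[OF fd_algebra_opp[OF KG]]])

lemma fX: "i <= k ==> fdm K G (X i)"
  using seq fg_module_iff[OF KG] unfolding cotilting_seq_def left_seq_def by blast

lemma X_inj: "i < k ==> injective G (X i)"
  by (rule fac_injective[OF KG P_inj fX facP]) simp_all

lemma d_hom: "i < k ==> d i : Hom G (X (Suc i)) (X i)"
  and p_hom: "p : Hom G (X 0) DG"
  and p_surj: "p ` carrier (X 0) = carrier DG"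
  and p_exact: "0 < k ==> d 0 ` carrier (X (Suc 0)) = {x : carrier (X 0). p x = 0[DG]}"
  and d_exact: "Suc i < k ==> d (Suc i) ` carrier (X (Suc (Suc i))) = {x : carrier (X (Suc i)). d i x = 0[X i]}"
  using seq unfolding cotilting_seq_def left_seq_def exact_onto_def a_kernel_eq by auto

lemma d_inj: "0 < k ==> inj_on (d (k - 1)) (carrier (X k))"
  using seq by (cases k) (simp_all add: cotilting_seq_def)

lemma lift_along:
  assumes "j < k" "fdm K G Y" "r : Hom G (X j) Y"
    "d j ` carrier (X (Suc j)) = {x : carrier (X j). r x = 0[Y]}"
    "f : Hom G C Y" "f ` carrier C \<subseteq> r ` carrier (X j)"
  shows "EX g:Hom G C (X j). ALL x:carrier C. r (g x) = f x"
  using cotilting_lift[OF KG fC assms(1) fX X_inj facX d_hom d_exact d_inj ext assms(2-6)] assms(1) by simp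

text \<open>Under the adjunction \<open>\<xi>\<close> becomes a map \<open>C -> D G\<close>, which
  is lifted through \<open>p\<close>.\<close>

lemma functional_lift:
  assumes k: "0 < k" and \<xi>: "\<xi> : functionals K G C"
  shows "EX f:Hom G C (X 0). pstar (X 0) p f = \<xi>"
proof -
  interpret GR: ring G by (rule fd_algebraD(4)[OF KG])
  let ?h = "\<lambda>x\<in>carrier C. \<lambda>r\<in>carrier G. \<xi> (r .[C] x)"
  have h: "?h : Hom G C DG" by (rule dual_regular_hom[OF KG lC \<xi>])
  have "?h ` carrier C \<subseteq> p ` carrier (X 0)" unfolding p_surj using hom_closed[OF h] by blast
  then obtain f where f: "f : Hom G C (X 0)" "!!x. x :. C ==> p (f x) = ?h x"
    using lift_along[OF k fDG p_hom p_exact[OF k] h] by blast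
  have "pstar (X 0) p f = \<xi>"
    by (rule carrier_eqI[of _ C])
      (use f in \<open>simp_all add: pstar_def functionalD(4)[OF \<xi>] C.smult_one\<close>)
  then show ?thesis using f(1) by blast
qed

lemma pstar_kernel:
  assumes f: "f : Hom G C (X 0)"
  shows "pstar (X 0) p f = 0[DCk K G C] \<longleftrightarrow> (ALL x:carrier C. p (f x) = 0[DG])"
proof
  interpret GR: ring G by (rule fd_algebraD(4)[OF KG])
  have cp: "compose (carrier C) p f : Hom G C DG" by (rule hom_compose[OF lC f p_hom])
  { assume z: "pstar (X 0) p f = 0[DCk K G C]"
    have z': "p (f x) 1[G] = 0[K]" if "x :. C" for x
      using fun_cong[OF z, of x] that f by (simp add: pstar_def)
    show "ALL x:carrier C. p (f x) = 0[DG]"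
    proof
      fix x assume x: "x :. C"
      have "p (f x) :. DG" by (rule hom_closed[OF p_hom hom_closed[OF f x]])
      then have e: "p (f x) : extensional (carrier G)"
        using functionalD(4)[of "p (f x)" K G "regular (opp G)"] by (simp add: dual_regular_def)
      show "p (f x) = 0[DG]"
      proof (rule carrier_eqI[of _ G])
        fix r assume r: "r :. G"
        show "p (f x) r = 0[DG] r"
          using dual_regular_hom_one(2)[OF KG lC cp x r] z'[OF C.smult_closed[OF r x]] x r
          by (simp add: compose_eq C.smult_closed dual_regular_def)
      qed (use e in "simp_all add: dual_regular_def")
    qed }
  assume "ALL x:carrier C. p (f x) = 0[DG]"
  then show "pstar (X 0) p f = 0[DCk K G C]"
    using f by (auto simp: pstar_def dual_regular_def intro!: restrict_ext)
qed

text \<open>A map killed by \<open>r\<close> lands in the image of \<open>d j\<close> and is lifted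
  through \<open>d j\<close> by \<open>lift_along\<close> at the index \<open>Suc j\<close>. This
  explains the bound \<open>Suc j < k\<close>, which suffices for the terms up to
  \<open>X (k - 1)\<close>.\<close>

lemma pst_image:
  assumes k: "j < k" and Y: "fdm K G Y" and r: "r : Hom G (X j) Y" and i: "Suc j < k"
    and ex: "d j ` carrier (X (Suc j)) = {x : carrier (X j). r x = 0[Y]}"
  shows "pst (X (Suc j)) (d j) ` Hom G C (X (Suc j)) = {f : Hom G C (X j). ALL x:carrier C. r (f x) = 0[Y]}"
proof (intro equalityI subsetI)
  fix f assume "f : pst (X (Suc j)) (d j) ` Hom G C (X (Suc j))"
  then obtain g where g: "g : Hom G C (X (Suc j))" "f = compose (carrier C) (d j) g" by (auto simp: pst_def)
  have "r (d j y) = 0[Y]" if "y :. (X (Suc j))" for y using ex that by auto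
  then show "f : {f : Hom G C (X j). ALL x:carrier C. r (f x) = 0[Y]}"
    using hom_compose[OF lC g(1) d_hom[OF k]] hom_closed[OF g(1)] g(2) by (simp add: compose_eq)
next
  fix f assume "f : {f : Hom G C (X j). ALL x:carrier C. r (f x) = 0[Y]}"
  then have f: "f : Hom G C (X j)" "!!x. x :. C ==> r (f x) = 0[Y]" by auto
  have im: "f ` carrier C \<subseteq> d j ` carrier (X (Suc j))" unfolding ex using f hom_closed[OF f(1)] by auto
  obtain g where g: "g : Hom G C (X (Suc j))" "!!x. x :. C ==> d j (g x) = f x"
    using lift_along[OF i fX d_hom[OF k] d_exact[OF i] f(1) im] k by auto
  have "pst (X (Suc j)) (d j) g = f"
    by (rule carrier_eqI[of _ C]) (use g hom_ext[OF f(1)] in "simp_all add: pst_def compose_eq")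
  then show "f : pst (X (Suc j)) (d j) ` Hom G C (X (Suc j))" using g(1) by blast
qed

text \<open>The last term \<open>X k\<close> is known to lie in \<open>add C\<close> only, so the
  resolution is cut off after \<open>X (k - 1)\<close>. For \<open>k = 0\<close> the index is
  \<open>-1\<close>, and finite generation is all that is asked.\<close>

lemma DC_in_gen: "in_gen B (int k - 1) (Pk G P C) (DCk K G C)"
proof (cases "k = 0")
  case True
  have "fg_module B (DCk K G C)" using fg_module_iff[OF KB] fDC by blast
  then show ?thesis unfolding in_gen_def using True by simp
next
  case False
  then have k: "0 < k" by simp
  note lX = fdmD(1)[OF fX]
  have "in_gen B (int (k - 1)) (Pk G P C) (DCk K G C)"
  proof (rule in_genI[OF KB Pk_projective[OF fP s q qs] fDC, where Z = "%i. Pk G (X i) C"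
        and d = "%i. pst (X (Suc i)) (d i)" and p = "pstar (X 0) p"])
    show "fdm K B (Pk G (X i) C)" if "i <= k - 1" for i by (rule fPk[OF fX]) (use that in simp)
    show "pst (X (Suc i)) (d i) : Hom B (Pk G (X (Suc i)) C) (Pk G (X i) C)" if "i < k - 1" for i
      by (rule pst_hom[OF lX lX d_hom]) (use that in simp_all)
    show ph: "pstar (X 0) p : Hom B (Pk G (X 0) C) (DCk K G C)" by (rule pstar_hom[OF lX p_hom]) simp
    show "pstar (X 0) p ` carrier (Pk G (X 0) C) = carrier (DCk K G C)"
    proof (intro equalityI subsetI)
      fix \<xi> assume "\<xi> :. (DCk K G C)"
      then show "\<xi> : pstar (X 0) p ` carrier (Pk G (X 0) C)" using functional_lift[OF k, of \<xi>] by auto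
    qed (use hom_closed[OF ph] in auto)
    show "pst (X (Suc 0)) (d 0) ` carrier (Pk G (X (Suc 0)) C) =
      {x : carrier (Pk G (X 0) C). pstar (X 0) p x = 0[DCk K G C]}" if "0 < k - 1"
      using pst_image[OF k fDG p_hom _ p_exact[OF k]] that pstar_kernel by auto
    show "pst (X (Suc (Suc i))) (d (Suc i)) ` carrier (Pk G (X (Suc (Suc i))) C) =
      {x : carrier (Pk G (X (Suc i)) C). pst (X (Suc i)) (d i) x = 0[Pk G (X i) C]}" if "Suc i < k - 1" for i
    proof -
      have i: "Suc i < k" "Suc (Suc i) < k" "i < k" "i <= k" using that by auto
      show ?thesis
        using pst_image[OF i(1) fX[OF i(4)] d_hom[OF i(3)] i(2) d_exact[OF i(1)]] by (auto simp: pst_def compose_zero_iff)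
    qed
    show "fac B (Pk G P C) (Pk G (X i) C)" if "i <= k - 1" for i
      by (rule fac_Pk[OF lP lX facP]) (use that k in simp_all)
  qed
  then show ?thesis using k by (simp add: of_nat_diff)
qed

end

section \<open>The sequence in \<open>add\<close> of \<open>Ik\<close> that coresolves
  \<open>D C\<close>\<close>

locale cogen_cmod = cmod K G C
  for K :: "'k ring" and G :: "('k, 'g) module" and C :: "('g, 'c) module" +
  fixes P :: "('g, 'p) module" and s :: "'p => 'c" and q :: "'c => 'p"
    and k n :: nat and J I :: "nat => ('g, 'k list) module" and \<epsilon> D :: "nat => 'k list => 'k list"
    and \<iota> :: "'c => 'k list" and jj :: "'g => 'k list"
  assumes fP: "fdm K G P" and s: "s : Hom G P C" and q: "q : Hom G C P" and qs: "!!x. x :. P ==> q (s x) = x"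
    and resJ: "inj_resolution G C \<iota> J \<epsilon>" and Jz: "zero_module (J (Suc k))"
    and resI: "inj_resolution G (regular G) jj I D" and I_proj: "!!i. i <= n ==> projective G (I i)"
    and facI: "!!i. i <= n ==> fac G P (I i)" and kn: "k <= n"
begin

lemma lP: "left_module G P" by (rule fdmD(1)[OF fP])

lemmas rI = inj_resolutionD[OF resI]

lemma fI: "fdm K G (I i)" by (rule injective_fdm[OF KG rI(1)])
lemma lI: "left_module G (I i)" by (rule fdmD(1)[OF fI])

lemma extend_along:
  assumes "j + k <= n" "left_module G M" "g0 : Hom G M (I j)"
    "g0 ` carrier M = {x : carrier (I j). D j x = 0[I (Suc j)]}" "f : Hom G M C"
    "!!m. [|m :. M; g0 m = 0[I j]|] ==> f m = 0[C]"
  shows "EX h:Hom G (I j) C. ALL m:carrier M. h (g0 m) = f m"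
  by (rule resolution_extend[OF KG fC resJ Jz rI(1) I_proj rI(2) rI(6) assms])

text \<open>\<open>Hom(jj, C)\<close> followed by the identification
  \<open>Hom(G,C) = C\<close>.\<close>

definition ev1 :: "('k list => 'c) => 'c" where
  "ev1 = (\<lambda>u\<in>Hom G (I 0) C. u (jj 1[G]))"

lemma jj_closed: "jj 1[G] :. (I 0)"
  using hom_closed[OF rI(3)] ring.ring_simprules(6)[OF fd_algebraD(4)[OF KG]] by simp

lemma ev1_hom: "ev1 : Hom B (Hk G (I 0) C) (eval_module C)"
proof -
  interpret PM: left_module "opp B" "Hk G (I 0) C" by (rule Hk_module[OF lI])
  show ?thesis unfolding ev1_def
  proof (rule hom_setI)
    fix u v assume h: "u :. (Hk G (I 0) C)" "v :. (Hk G (I 0) C)"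
    have "u +[Hk G (I 0) C] v : Hom G (I 0) C" using PM.M.a_closed[OF h] by simp
    then show "(\<lambda>u\<in>Hom G (I 0) C. u (jj 1[G])) (u +[Hk G (I 0) C] v) =
      (\<lambda>u\<in>Hom G (I 0) C. u (jj 1[G])) u +[eval_module C] (\<lambda>u\<in>Hom G (I 0) C. u (jj 1[G])) v"
      using h jj_closed by simp
  next
    fix b u assume h: "b :. B" "u :. (Hk G (I 0) C)"
    have "b .[Hk G (I 0) C] u : Hom G (I 0) C" using PM.smult_closed[of b u] h by simp
    then show "(\<lambda>u\<in>Hom G (I 0) C. u (jj 1[G])) (b .[Hk G (I 0) C] u) =
      b .[eval_module C] (\<lambda>u\<in>Hom G (I 0) C. u (jj 1[G])) u"
      using h jj_closed by (simp add: compose_eq)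
  qed (use jj_closed in "auto simp: hom_closed")
qed

lemma jj_eq: "g :. G ==> jj g = g .[I 0] jj 1[G]"
  using hom_smult[OF rI(3), of g "1[G]"] ring.ring_simprules(6)[OF fd_algebraD(4)[OF KG]]
    monoid.r_one[OF ring.is_monoid[OF fd_algebraD(4)[OF KG]]] by simp

text \<open>The map \<open>r |-> r c\<close> extends along the embedding \<open>jj\<close> of
  \<open>G\<close> into \<open>I 0\<close>. This is \<open>extend_along\<close> at
  \<open>j = 0\<close>, whose bound there is \<open>k \<le> n\<close>.\<close>

lemma ev1_surj:
  assumes c: "c :. C"
  shows "EX u:Hom G (I 0) C. ev1 u = c"
proof -
  interpret GR: ring G by (rule fd_algebraD(4)[OF KG])
  have lG: "left_module G (regular G)" by (rule left_module_regular[OF fd_algebraD(4)[OF KG]])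
  have f: "(\<lambda>r\<in>carrier G. r .[C] c) : Hom G (regular G) C" by (rule smult_hom[OF lC c])
  have ker: "(\<lambda>r\<in>carrier G. r .[C] c) m = 0[C]" if "m :. (regular G)" "jj m = 0[I 0]" for m
  proof -
    have "jj 0[regular G] = 0[I 0]" by (rule hom_zero[OF rI(3)]) (use lG fdmD(3)[OF fI] ring.axioms(1)[OF fd_algebraD(4)[OF KG]] in simp_all)
    then have "m = 0[G]" using inj_onD[OF rI(4), of m "0[G]"] that by simp
    then show ?thesis using c by (simp add: C.smult_zero_left)
  qed
  have k0: "0 + k <= n" using kn by simp
  obtain u where u: "u : Hom G (I 0) C" "!!m. m :. (regular G) ==> u (jj m) = (\<lambda>r\<in>carrier G. r .[C] c) m"
    using extend_along[OF k0 lG rI(3) rI(5) f ker] by blast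
  have "ev1 u = c" using u(1) u(2)[of "1[G]"] c by (simp add: ev1_def C.smult_one)
  then show ?thesis using u(1) by blast
qed

lemma ev1_zero_iff:
  assumes u: "u : Hom G (I 0) C"
  shows "ev1 u = 0[C] \<longleftrightarrow> (ALL g:carrier G. u (jj g) = 0[C])"
proof
  interpret GR: ring G by (rule fd_algebraD(4)[OF KG])
  assume "ev1 u = 0[C]"
  then have "u (jj 1[G]) = 0[C]" using u by (simp add: ev1_def)
  then have "u (g .[I 0] jj 1[G]) = 0[C]" if "g :. G" for g
    using hom_smult[OF u that jj_closed] that by (simp add: C.smult_zero_right)
  then show "ALL g:carrier G. u (jj g) = 0[C]" using jj_eq by metis
next
  interpret GR: ring G by (rule fd_algebraD(4)[OF KG])
  assume "ALL g:carrier G. u (jj g) = 0[C]"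
  then show "ev1 u = 0[C]" using u by (simp add: ev1_def)
qed

text \<open>A map on \<open>I j\<close> that kills the kernel of \<open>D j\<close> extends along
  \<open>D j\<close>, by \<open>extend_along\<close> at the index \<open>Suc j\<close>. The bound
  leaves enough projective terms for the length \<open>k\<close> of the resolution of
  \<open>C\<close>.\<close>

lemma pre_image:
  assumes j: "Suc j + k <= n"
  shows "pre (I j) (I (Suc j)) (D j) ` Hom G (I (Suc j)) C =
    {u : Hom G (I j) C. ALL x:carrier (I j). D j x = 0[I (Suc j)] --> u x = 0[C]}"
proof (intro equalityI subsetI)
  fix u assume "u : pre (I j) (I (Suc j)) (D j) ` Hom G (I (Suc j)) C"
  then obtain v where v: "v : Hom G (I (Suc j)) C" "u = compose (carrier (I j)) v (D j)" by (auto simp: pre_def)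
  have "v 0[I (Suc j)] = 0[C]" by (rule hom_zero[OF v(1) fdmD(3)[OF fI] fdmD(3)[OF fC]])
  then show "u : {u : Hom G (I j) C. ALL x:carrier (I j). D j x = 0[I (Suc j)] --> u x = 0[C]}"
    using hom_compose[OF lI rI(2) v(1)] v(2) by (auto simp: compose_eq)
next
  fix u assume "u : {u : Hom G (I j) C. ALL x:carrier (I j). D j x = 0[I (Suc j)] --> u x = 0[C]}"
  then have u: "u : Hom G (I j) C" "!!x. [|x :. (I j); D j x = 0[I (Suc j)]|] ==> u x = 0[C]" by auto
  obtain v where v: "v : Hom G (I (Suc j)) C" "!!m. m :. (I j) ==> v (D j m) = u m"
    using extend_along[OF j lI rI(2) rI(6) u] by blast
  have "pre (I j) (I (Suc j)) (D j) v = u"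
    by (rule carrier_eqI[of _ "(I j)"]) (use v hom_ext[OF u(1)] in "simp_all add: pre_def compose_eq")
  then show "u : pre (I j) (I (Suc j)) (D j) ` Hom G (I (Suc j)) C" using v(1) by blast
qed

text \<open>By \<open>ev1_surj\<close> and \<open>pre_image\<close>, the sequence
  \<open>Hom(I (n - k), C) -> ... -> Hom(I 0, C) -> C -> 0\<close> is exact except at its left end.
  Its dual is the required coresolution.\<close>

lemma DC_in_cogen: "in_cogen B (int n - int k) (Ik K G P C) (DCk K G C)"
proof -
  note lH = Hk_module[OF lI] and fH = fHk[OF fI]
  let ?Z = "%i. dual K B (Hk G (I i) C)"
  let ?d = "%i. \<lambda>\<eta>\<in>carrier (?Z i). \<lambda>x\<in>carrier (Hk G (I (Suc i)) C). \<eta> (pre (I i) (I (Suc i)) (D i) x)"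
  let ?j = "\<lambda>\<eta>\<in>carrier (DCk K G C). \<lambda>x\<in>carrier (Hk G (I 0) C). \<eta> (ev1 x)"
  have ph: "pre (I i) (I (Suc i)) (D i) : Hom B (Hk G (I (Suc i)) C) (Hk G (I i) C)" for i
    by (rule pre_hom[OF lI lI rI(2)])
  have jh: "?j : Hom B (DCk K G C) (?Z 0)"
    using dual_map[OF KB lH eval_module_module ev1_hom] unfolding DCk_def .
  have "in_cogen B (int (n - k)) (Ik K G P C) (DCk K G C)"
  proof (rule in_cogenI[OF KB Ik_injective[OF fP s q qs] fDC, where Z = ?Z and d = ?d and j = ?j])
    show "fdm K B (?Z i)" for i by (rule fdm_dual[OF KB fH])
    show "?d i : Hom B (?Z i) (?Z (Suc i))" for i by (rule dual_map[OF KB lH lH ph])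
    show "?j : Hom B (DCk K G C) (?Z 0)" by (rule jh)
    show "inj_on ?j (carrier (DCk K G C))"
    proof (rule inj_onI)
      fix \<xi> \<eta> assume h: "\<xi> :. (DCk K G C)" "\<eta> :. (DCk K G C)" "?j \<xi> = ?j \<eta>"
      have eq: "\<xi> (ev1 u) = \<eta> (ev1 u)" if "u : Hom G (I 0) C" for u
        using fun_cong[OF h(3), of u] h(1,2) that by simp
      show "\<xi> = \<eta>"
      proof (rule hom_eqI)
        show "\<xi> : functionals K G C" "\<eta> : functionals K G C" using h by simp_all
        fix c assume "c :. (rs G C)"
        then obtain u where "u : Hom G (I 0) C" "ev1 u = c" using ev1_surj[of c] by auto
        then show "\<xi> c = \<eta> c" using eq[of u] by simp
      qed
    qed
    show "?j ` carrier (DCk K G C) = {x : carrier (?Z 0). ?d 0 x = 0[?Z (Suc 0)]}" if "0 < n - k"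
      unfolding DCk_def
    proof (rule dual_exact_image[OF KB lH lH f_eval ph ev1_hom])
      have jk: "Suc 0 + k <= n" using that by simp
      show "pre (I 0) (I (Suc 0)) (D 0) ` carrier (Hk G (I (Suc 0)) C) =
        {x : carrier (Hk G (I 0) C). ev1 x = 0[eval_module C]}"
      proof -
        have *: "(ALL x:carrier (I 0). D 0 x = 0[I (Suc 0)] --> u x = 0[C]) \<longleftrightarrow> ev1 u = 0[C]" if "u : Hom G (I 0) C" for u
        proof -
          have "(ALL x:carrier (I 0). D 0 x = 0[I (Suc 0)] --> u x = 0[C]) \<longleftrightarrow> (ALL x:jj ` carrier (regular G). u x = 0[C])"
            unfolding rI(5) by blast
          then show ?thesis using ev1_zero_iff[OF that] by simp
        qed
        show ?thesis using pre_image[OF jk] * by auto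
      qed
    qed
    show "?d i ` carrier (?Z i) = {x : carrier (?Z (Suc i)). ?d (Suc i) x = 0[?Z (Suc (Suc i))]}" if "Suc i < n - k" for i
    proof (rule dual_exact_image[OF KB lH lH fH ph ph])
      have jk: "Suc (Suc i) + k <= n" using that by simp
      show "pre (I (Suc i)) (I (Suc (Suc i))) (D (Suc i)) ` carrier (Hk G (I (Suc (Suc i))) C) =
        {x : carrier (Hk G (I (Suc i)) C). pre (I i) (I (Suc i)) (D i) x = 0[Hk G (I i) C]}"
      proof -
        have *: "(ALL x:carrier (I (Suc i)). D (Suc i) x = 0[I (Suc (Suc i))] --> u x = 0[C]) \<longleftrightarrow>
            pre (I i) (I (Suc i)) (D i) u = (\<lambda>x\<in>carrier (I i). 0[C])" if "u : Hom G (I (Suc i)) C" for u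
        proof -
          have "(ALL x:carrier (I (Suc i)). D (Suc i) x = 0[I (Suc (Suc i))] --> u x = 0[C]) \<longleftrightarrow>
              (ALL x:D i ` carrier (I i). u x = 0[C])"
            unfolding rI(6) by blast
          then show ?thesis using that by (simp add: pre_def compose_zero_iff)
        qed
        show ?thesis using pre_image[OF jk] * by auto
      qed
    qed
    show "fac B (Ik K G P C) (?Z i)" if "i <= n - k" for i
      unfolding Ik_eq by (rule fac_dual[OF KB Hk_module[OF lP] lH fac_Hk[OF lP lI facI]]) (use that in simp)
  qed
  then show ?thesis using kn by (simp add: of_nat_diff)
qed

end

section \<open>Maps out of a tensor product\<close>

text \<open>The additive extension inside \<open>tensor_lift\<close>, as a function on formal sums
  before passing to cosets.\<close>

definition frag_sum :: "('r, 'n) module => ('z => 'n) => ('z \<Rightarrow>\<^sub>0 int) => 'n" where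
  "frag_sum N h u = (\<Oplus>\<^bsub>N\<^esub>z\<in>Poly_Mapping.keys u. [Poly_Mapping.lookup u z] \<cdot>\<^bsub>N\<^esub> h z)"

text \<open>Cancellation may shrink the support of a formal sum, so values are compared over a
  common finite index set.\<close>

lemma frag_sum_superset:
  fixes N :: "('r, 'n) module"
  assumes N: "abelian_group N" and h: "h : S \<rightarrow> carrier N" and T: "finite T" "T \<subseteq> S"
    and u: "Poly_Mapping.keys u \<subseteq> T"
  shows "frag_sum N h u = (\<Oplus>\<^bsub>N\<^esub>z\<in>T. [Poly_Mapping.lookup u z] \<cdot>\<^bsub>N\<^esub> h z)"
proof -
  interpret N: abelian_group N by fact
  show ?thesis unfolding frag_sum_def
  proof (rule N.add.finprod_mono_neutral_cong_left[OF T(1) u])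
    fix z assume "z : T - Poly_Mapping.keys u"
    then show "[Poly_Mapping.lookup u z] \<cdot>\<^bsub>N\<^esub> h z = 0[N]"
      by (simp add: in_keys_iff add_pow_def int_pow_def)
  qed (use h T in auto)
qed

lemma frag_sum_closed:
  fixes N :: "('r, 'n) module"
  assumes N: "abelian_group N" and h: "h : S \<rightarrow> carrier N" and u: "Poly_Mapping.keys u \<subseteq> S"
  shows "frag_sum N h u :. N"
proof -
  interpret N: abelian_group N by fact
  show ?thesis unfolding frag_sum_def by (intro N.finsum_closed) (use h u in auto)
qed

text \<open>Differences come before sums, because both the tensor relations and
  \<open>frag_induction\<close> are built from differences.\<close>

lemma frag_sum_diff:
  fixes N :: "('r, 'n) module" and h :: "'b => 'n"
  assumes N: "abelian_group N" and h: "h : S \<rightarrow> carrier N"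
    and u: "Poly_Mapping.keys u \<subseteq> S" and v: "Poly_Mapping.keys v \<subseteq> S"
  shows "frag_sum N h (u - v) = frag_sum N h u -[N] frag_sum N h v"
proof -
  interpret N: abelian_group N by fact
  define T where "T = Poly_Mapping.keys u \<union> Poly_Mapping.keys v"
  have T: "finite T" "T \<subseteq> S" "Poly_Mapping.keys u \<subseteq> T" "Poly_Mapping.keys v \<subseteq> T" "Poly_Mapping.keys (u - v) \<subseteq> T"
    using u v keys_diff[of u v] by (auto simp: T_def)
  note ss = frag_sum_superset[OF N h T(1,2)]
  have hT: "h z :. N" if "z : T" for z using T h that by (auto simp: Pi_iff)
  have c: "(%z. [Poly_Mapping.lookup w z] \<cdot>\<^bsub>N\<^esub> h z) : T \<rightarrow> carrier N" for w :: "'b \<Rightarrow>\<^sub>0 int" using hT by auto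
  let ?s = "%w :: 'b \<Rightarrow>\<^sub>0 int. \<Oplus>\<^bsub>N\<^esub>z\<in>T. [Poly_Mapping.lookup w z] \<cdot>\<^bsub>N\<^esub> h z"
  have "?s (u - v) +[N] ?s v = (\<Oplus>\<^bsub>N\<^esub>z\<in>T. [Poly_Mapping.lookup (u - v) z] \<cdot>\<^bsub>N\<^esub> h z +[N] [Poly_Mapping.lookup v z] \<cdot>\<^bsub>N\<^esub> h z)"
    by (rule N.finsum_addf[symmetric, OF c c])
  also have "... = ?s u"
    using c hT by (intro N.finsum_cong') (auto simp: lookup_minus N.add.int_pow_mult[symmetric])
  finally have "?s u = ?s (u - v) +[N] ?s v" by simp
  moreover have "?s w :. N" for w :: "'b \<Rightarrow>\<^sub>0 int" by (rule N.finsum_closed[OF c])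
  ultimately show ?thesis
    unfolding ss[OF T(3)] ss[OF T(4)] ss[OF T(5)] by (simp add: a_minus_def N.a_assoc N.r_neg)
qed

lemma frag_sum_zero: "abelian_group N ==> frag_sum N h 0 = 0[N]" for N :: "('r, 'n) module"
  using abelian_monoid.finsum_empty[OF abelian_group.axioms(1)] by (simp add: frag_sum_def)

lemma frag_sum_of:
  fixes N :: "('r, 'n) module"
  assumes N: "abelian_group N" and h: "h z :. N"
  shows "frag_sum N h (frag_of z) = h z"
proof -
  interpret N: abelian_group N by fact
  have "frag_sum N h (frag_of z) = (\<Oplus>\<^bsub>N\<^esub>z\<in>insert z {}. [Poly_Mapping.lookup (frag_of z) z] \<cdot>\<^bsub>N\<^esub> h z)"
    unfolding frag_sum_def by (rule N.finsum_cong') (use h in "simp_all add: keys_frag_of")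
  also have "... = h z" using h N.finsum_insert[of "{}" z] by simp
  finally show ?thesis .
qed

lemma frag_sum_add:
  fixes N :: "('r, 'n) module"
  assumes N: "abelian_group N" and h: "h : S \<rightarrow> carrier N"
    and u: "Poly_Mapping.keys u \<subseteq> S" and v: "Poly_Mapping.keys v \<subseteq> S"
  shows "frag_sum N h (u + v) = frag_sum N h u +[N] frag_sum N h v"
proof -
  interpret N: abelian_group N by fact
  have k: "Poly_Mapping.keys (u + v) \<subseteq> S" using u v Poly_Mapping.keys_add[of u v] by auto
  note c = frag_sum_closed[OF N h]
  have "frag_sum N h u = frag_sum N h (u + v) -[N] frag_sum N h v"
    using frag_sum_diff[OF N h k v] by simp
  then show ?thesis using c[OF k] c[OF v] by (simp add: a_minus_def N.a_assoc N.l_neg)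
qed

text \<open>The additive extension kills the relations, so it is constant on cosets, and its image
  can be computed on formal sums. The hypotheses are closure and balancedness only, so that no
  module structure over the corner algebra has to be set up.\<close>

lemma tensor_lift_image:
  fixes N :: "('r, 'n) module" and R :: "('k, 'a) module"
  assumes N: "abelian_group N" and h: "h : carrier X \<times> carrier M \<rightarrow> carrier N"
    and closed: "!!x y. [|x :. X; y :. X|] ==> x +[X] y :. X"
      "!!m n. [|m :. M; n :. M|] ==> m +[M] n :. M"
      "!!r x. [|r :. R; x :. X|] ==> r .[X] x :. X"
      "!!r m. [|r :. R; m :. M|] ==> r .[M] m :. M"
    and add1: "!!x y m. [|x :. X; y :. X; m :. M|] ==> h (x +[X] y, m) = h (x, m) +[N] h (y, m)"
    and add2: "!!x m n. [|x :. X; m :. M; n :. M|] ==> h (x, m +[M] n) = h (x, m) +[N] h (x, n)"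
    and bal: "!!r x m. [|r :. R; x :. X; m :. M|] ==> h (r .[X] x, m) = h (x, r .[M] m)"
  shows "tensor_lift N h ` carrier (tensor R l X M) =
    frag_sum N h ` {u. Poly_Mapping.keys u \<subseteq> carrier X \<times> carrier M}"
proof -
  interpret N: abelian_group N by fact
  let ?S = "carrier X \<times> carrier M" let ?F = "free_Abelian_group ?S"
  have F: "carrier ?F = {u. Poly_Mapping.keys u \<subseteq> ?S}" by (simp add: free_Abelian_group_def)
  have kf: "Poly_Mapping.keys (frag_of z) \<subseteq> ?S" if "z : ?S" for z using that by (simp add: keys_frag_of)
  have kd: "Poly_Mapping.keys (u - v) \<subseteq> ?S" if "Poly_Mapping.keys u \<subseteq> ?S" "Poly_Mapping.keys v \<subseteq> ?S"
    for u v :: "_ \<Rightarrow>\<^sub>0 int" using keys_diff[of u v] that by auto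
  have cancel: "a +[N] b -[N] a -[N] b = 0[N]" if "a :. N" "b :. N" for a b
    using that by (simp add: a_minus_def N.a_comm[of a b] N.a_assoc N.r_neg N.r_neg2)
  have hS: "h z :. N" if "z : ?S" for z using h that by blast
  note L = frag_sum_diff[OF N h] and Lf = frag_sum_of[of N h, OF N hS]
  have rel: "Poly_Mapping.keys t \<subseteq> ?S & frag_sum N h t = 0[N]" if "t : tensor_rels R X M" for t
    using that unfolding tensor_rels_def
  proof (elim UnE)
    assume "t : {frag_of (x +[X] y, m) - frag_of (x, m) - frag_of (y, m) | x y m.
        x :. X & y :. X & m :. M}"
    then obtain x y m where t: "t = frag_of (x +[X] y, m) - frag_of (x, m) - frag_of (y, m)"
      and z: "x :. X" "y :. X" "m :. M" by blast
    have S: "(x +[X] y, m) : ?S" "(x, m) : ?S" "(y, m) : ?S" using z closed by auto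
    note k = kf[OF S(1)] kf[OF S(2)] kf[OF S(3)]
    have "frag_sum N h t = h (x +[X] y, m) -[N] h (x, m) -[N] h (y, m)"
      unfolding t L[OF kd[OF k(1,2)] k(3)] L[OF k(1,2)] Lf[OF S(1)] Lf[OF S(2)] Lf[OF S(3)] by simp
    also have "... = 0[N]" unfolding add1[OF z] using hS[OF S(2)] hS[OF S(3)]
      by (rule cancel)
    finally show ?thesis unfolding t using kd[OF kd[OF k(1,2)] k(3)] by simp
  next
    assume "t : {frag_of (x, m +[M] n) - frag_of (x, m) - frag_of (x, n) | x m n.
        x :. X & m :. M & n :. M}"
    then obtain x m n where t: "t = frag_of (x, m +[M] n) - frag_of (x, m) - frag_of (x, n)"
      and z: "x :. X" "m :. M" "n :. M" by blast
    have S: "(x, m +[M] n) : ?S" "(x, m) : ?S" "(x, n) : ?S" using z closed by auto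
    note k = kf[OF S(1)] kf[OF S(2)] kf[OF S(3)]
    have "frag_sum N h t = h (x, m +[M] n) -[N] h (x, m) -[N] h (x, n)"
      unfolding t L[OF kd[OF k(1,2)] k(3)] L[OF k(1,2)] Lf[OF S(1)] Lf[OF S(2)] Lf[OF S(3)] by simp
    also have "... = 0[N]" unfolding add2[OF z] using hS[OF S(2)] hS[OF S(3)]
      by (rule cancel)
    finally show ?thesis unfolding t using kd[OF kd[OF k(1,2)] k(3)] by simp
  next
    assume "t : {frag_of (r .[X] x, m) - frag_of (x, r .[M] m) | r x m.
        r :. R & x :. X & m :. M}"
    then obtain r x m where t: "t = frag_of (r .[X] x, m) - frag_of (x, r .[M] m)"
      and z: "r :. R" "x :. X" "m :. M" by blast
    have S: "(r .[X] x, m) : ?S" "(x, r .[M] m) : ?S" using z closed by auto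
    note k = kf[OF S(1)] kf[OF S(2)]
    show ?thesis unfolding t L[OF k] Lf[OF S(1)] Lf[OF S(2)] bal[OF z] using kd[OF k] hS[OF S(2)] by (simp add: a_minus_def N.r_neg)
  qed
  have null: "Poly_Mapping.keys t \<subseteq> ?S & frag_sum N h t = 0[N]" if "t : tensor_null R X M" for t
    using that unfolding tensor_null_def
  proof (induction rule: generate.induct)
    case one
    show ?case by (simp add: frag_sum_zero[OF N])
  next
    case (incl t)
    then show ?case by (rule rel)
  next
    case (inv t)
    have t: "Poly_Mapping.keys t \<subseteq> ?S" "frag_sum N h t = 0[N]" using rel[OF inv] by auto
    have "frag_sum N h (0 - t) = 0[N]" using L[of 0 t] t by (simp add: a_minus_def N.r_neg frag_sum_zero[OF N])
    moreover have "inv\<^bsub>?F\<^esub> t = 0 - t" using inv_free_Abelian_group[OF t(1)] by simp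
    ultimately show ?case using t by (simp add: keys_minus)
  next
    case (eng t1 t2)
    then show ?case using frag_sum_add[OF N h, of t1 t2] Poly_Mapping.keys_add[of t1 t2] by auto
  qed
  have lift: "tensor_lift N h (tensor_null R X M #>\<^bsub>?F\<^esub> u) = frag_sum N h u" if u: "Poly_Mapping.keys u \<subseteq> ?S" for u
  proof -
    have "frag_sum N h (t + u) = frag_sum N h u" if "t : tensor_null R X M" for t
      using frag_sum_add[OF N h _ u, of t] null[OF that] frag_sum_closed[OF N h u] by simp
    moreover have "0 : tensor_null R X M" unfolding tensor_null_def using generate.one[of ?F] by simp
    moreover have rc: "tensor_null R X M #>\<^bsub>?F\<^esub> u = (%t. t + u) ` tensor_null R X M" by (auto simp: r_coset_def)
    ultimately have "frag_sum N h ` (tensor_null R X M #>\<^bsub>?F\<^esub> u) = {frag_sum N h u}"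
      unfolding rc image_image by (auto simp: image_constant_conv cong: image_cong)
    moreover have "tensor_lift N h U = the_elem (frag_sum N h ` U)" for U by (simp add: tensor_lift_def frag_sum_def[abs_def])
    ultimately show ?thesis by simp
  qed
  have "carrier (tensor R l X M) = (%u. tensor_null R X M #>\<^bsub>?F\<^esub> u) ` {u. Poly_Mapping.keys u \<subseteq> ?S}"
    by (simp add: tensor_def Let_def carrier_FactGroup F)
  then show ?thesis using lift by (simp add: image_image)
qed

lemma frag_sum_mem:
  fixes N :: "('r, 'n) module"
  assumes N: "abelian_group N" and h: "h : S \<rightarrow> carrier N" and u: "Poly_Mapping.keys u \<subseteq> S"
    and V: "0[N] : V" "!!x y. [|x : V; y : V|] ==> x -[N] y : V" "!!z. z : S ==> h z : V"
  shows "frag_sum N h u : V"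
proof -
  have "Poly_Mapping.keys u \<subseteq> S & frag_sum N h u : V"
    using u
  proof (induction u rule: frag_induction)
    case zero
    then show ?case using V(1) by (simp add: frag_sum_zero[OF N])
  next
    case (one x)
    then have "h x :. N" using h by blast
    from frag_sum_of[of N h x, OF N this] show ?case using one V(3) by (simp add: keys_frag_of)
  next
    case (diff a b)
    then show ?case using frag_sum_diff[OF N h, of a b] V(2) keys_diff[of a b] by auto
  qed
  then show ?thesis by simp
qed

section \<open>The intermediate extension of \<open>E\<close>\<close>

text \<open>\<open>trace_P\<close> makes the image of \<open>zeta\<close> large enough, and
  \<open>trace_C\<close> makes a functional on \<open>C\<close> determined by its restrictions along
  maps from \<open>P\<close>. \<open>\<theta>\<close> is the explicit identification of
  \<open>E\<close> with \<open>D P\<close>.\<close>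

locale ck_data = cmod K G C
  for K :: "'k ring" and G :: "('k, 'g) module" and C :: "('g, 'c) module" +
  fixes P :: "('g, 'p) module" and s :: "'p => 'c" and q :: "'c => 'p"
    and A :: "('k, 'a) module" and E :: "('a, 'e) module" and \<phi> :: "'a => 'p => 'p"
    and \<theta> :: "'e => 'p => 'k" and \<theta>' :: "('p => 'k) => 'e"
  assumes fP: "fdm K G P" and s: "s : Hom G P C" and q: "q : Hom G C P" and qs: "!!x. x :. P ==> q (s x) = x"
    and lE: "left_module A E" and \<phi>: "\<phi> : alg_iso K A (opp (end_alg G P))"
    and \<theta>: "isos A E (with_smult (%a x. \<phi> a .[DCk K G P] x) (DCk K G P)) \<theta> \<theta>'"
    and trace_P: "!!\<xi>. \<xi> : functionals K G C ==> EX (n :: nat) \<eta> f.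
      (ALL l<n. f l : Hom G C P & \<eta> l : functionals K G P) &
      (ALL c:carrier C. \<xi> c = (\<Oplus>\<^bsub>K\<^esub>l\<in>{..<n}. \<eta> l (f l c)))"
    and trace_C: "!!c. c :. C ==> EX (n :: nat) u x.
      (ALL l<n. u l : Hom G P C & x l :. P) & c = (\<Oplus>\<^bsub>C\<^esub>l\<in>{..<n}. u l (x l))"
begin

sublocale Pm: cmod K G P by (rule cmod.intro[OF KG fP])
sublocale E: left_module A E by (rule lE)

lemma lP: "left_module G P" by (rule fdmD(1)[OF fP])

abbreviation ee where "ee \<equiv> idem C s q"
abbreviation EE where "EE \<equiv> as_corner_module A P s q \<phi> E"

lemma s_closed: "x :. P ==> s x :. C" by (rule hom_closed[OF s])
lemma q_closed: "c :. C ==> q c :. P" by (rule hom_closed[OF q])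

lemma ee_hom: "ee : Hom G C C" unfolding idem_def by (rule hom_compose[OF lC q s])

lemma ee_eq: "c :. C ==> ee c = s (q c)" by (simp add: idem_def compose_eq)

text \<open>Multiplication in \<open>B\<close> is reversed composition, so the elements of
  \<open>e B\<close> are the maps invariant under precomposition with \<open>s\<close> after
  \<open>q\<close>; for \<open>B e\<close> below it is postcomposition.\<close>

lemma eB_carrier: "carrier (eB B ee) = {y : Hom G C C. ALL c:carrier C. y (s (q c)) = y c}"
proof (intro equalityI subsetI)
  fix y assume "y :. (eB B ee)"
  then obtain b where b: "b : Hom G C C" "y = compose (carrier C) b ee" by (auto simp: eB_def)
  then show "y : {y : Hom G C C. ALL c:carrier C. y (s (q c)) = y c}"
    using hom_compose[OF lC ee_hom b(1)] by (simp add: compose_eq ee_eq s_closed q_closed qs)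
next
  fix y assume "y : {y : Hom G C C. ALL c:carrier C. y (s (q c)) = y c}"
  then have y: "y : Hom G C C" "!!c. c :. C ==> y (s (q c)) = y c" by auto
  have "compose (carrier C) y ee = y"
    by (rule carrier_eqI[of _ C]) (simp_all add: compose_eq ee_eq y(2) hom_ext[OF y(1)])
  then show "y :. (eB B ee)" using y(1) by (auto simp: eB_def intro!: exI[of _ y])
qed

lemma Be_carrier: "carrier (Be B ee) = {x : Hom G C C. ALL c:carrier C. s (q (x c)) = x c}"
proof (intro equalityI subsetI)
  fix y assume "y :. (Be B ee)"
  then obtain b where b: "b : Hom G C C" "y = compose (carrier C) ee b" by (auto simp: Be_def)
  then show "y : {x : Hom G C C. ALL c:carrier C. s (q (x c)) = x c}"
    using hom_compose[OF lC b(1) ee_hom] by (simp add: compose_eq ee_eq s_closed q_closed qs hom_closed[OF b(1)])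
next
  fix y assume "y : {x : Hom G C C. ALL c:carrier C. s (q (x c)) = x c}"
  then have y: "y : Hom G C C" "!!c. c :. C ==> s (q (y c)) = y c" by auto
  have "compose (carrier C) ee y = y"
    by (rule carrier_eqI[of _ C]) (simp_all add: compose_eq ee_eq y(2) hom_ext[OF y(1)] hom_closed[OF y(1)])
  then show "y :. (Be B ee)" using y(1) by (auto simp: Be_def intro!: exI[of _ y])
qed

lemma cornerD:
  assumes "r :. (corner B ee)"
  shows "r : Hom G C C" "c :. C ==> r (s (q c)) = r c" "c :. C ==> s (q (r c)) = r c"
proof -
  obtain b where b: "b : Hom G C C" "r = compose (carrier C) ee (compose (carrier C) b ee)"
    using assms by (auto simp: corner_def)
  show "r : Hom G C C" unfolding b(2)
    by (rule hom_compose[OF lC hom_compose[OF lC ee_hom b(1)] ee_hom])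
  show "c :. C ==> r (s (q c)) = r c" "c :. C ==> s (q (r c)) = r c"
    by (simp_all add: b(2) compose_eq ee_eq s_closed q_closed qs hom_closed[OF b(1)])
qed

lemma eB_simps [simp]: "x +[eB B ee] y = (\<lambda>c\<in>carrier C. x c +[C] y c)" "r .[eB B ee] y = compose (carrier C) y r"
  "x +[Be B ee] y = (\<lambda>c\<in>carrier C. x c +[C] y c)" "r .[Be B ee] y = compose (carrier C) r y"
  by (simp_all add: eB_def Be_def)

definition \<Phi> where "\<Phi> r = inv_into (carrier A) \<phi> (\<lambda>y\<in>carrier P. q (r (s y)))"

lemma EE_simps [simp]: "carrier EE = carrier E" "x +[EE] y = x +[E] y" "0[EE] = 0[E]" "r .[EE] x = \<Phi> r .[E] x"
  by (simp_all add: as_corner_module_def \<Phi>_def)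

lemma \<Phi>:
  assumes r: "r : Hom G C C"
  shows "\<Phi> r :. A" "p :. P ==> \<phi> (\<Phi> r) p = q (r (s p))"
proof -
  have h: "(\<lambda>y\<in>carrier P. q (r (s y))) : Hom G P P"
    by (rule hom_setI)
      (simp_all add: Pm.C.smult_closed s_closed q_closed hom_closed[OF r] hom_add[OF s] hom_add[OF r] hom_add[OF q]
        hom_smult[OF s] hom_smult[OF r] hom_smult[OF q])
  have im: "\<phi> ` carrier A = Hom G P P" using \<phi> by (simp add: alg_iso_def ring_iso_def bij_betw_def)
  show "\<Phi> r :. A" unfolding \<Phi>_def by (rule inv_into_into) (simp only: im h)
  have "\<phi> (\<Phi> r) = (\<lambda>y\<in>carrier P. q (r (s y)))" unfolding \<Phi>_def by (rule f_inv_into_f) (simp only: im h)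
  then show "p :. P ==> \<phi> (\<Phi> r) p = q (r (s p))" by simp
qed

abbreviation DP where "DP \<equiv> functionals K G P"

lemma \<theta>D: "m :. E ==> \<theta> m : DP" "\<eta> : DP ==> \<theta>' \<eta> :. E"
  "m :. E ==> \<theta>' (\<theta> m) = m" "\<eta> : DP ==> \<theta> (\<theta>' \<eta>) = \<eta>"
  "[|m :. E; n :. E|] ==> \<theta> (m +[E] n) = (\<lambda>p\<in>carrier P. \<theta> m p +[K] \<theta> n p)"
  "[|\<eta> : DP; \<mu> : DP|] ==> \<theta>' (\<lambda>p\<in>carrier P. \<eta> p +[K] \<mu> p) = \<theta>' \<eta> +[E] \<theta>' \<mu>"
  "[|a :. A; m :. E|] ==> \<theta> (a .[E] m) = (\<lambda>p\<in>carrier P. \<theta> m (\<phi> a p))"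
  "[|a :. A; \<eta> : DP|] ==> \<theta>' (\<lambda>p\<in>carrier P. \<eta> (\<phi> a p)) = a .[E] \<theta>' \<eta>"
proof -
  note i = isosD[OF \<theta>]
  show "m :. E ==> \<theta> m : DP" "\<eta> : DP ==> \<theta>' \<eta> :. E"
    "m :. E ==> \<theta>' (\<theta> m) = m" "\<eta> : DP ==> \<theta> (\<theta>' \<eta>) = \<eta>"
    using i(3-6) by simp_all
  show "[|m :. E; n :. E|] ==> \<theta> (m +[E] n) = (\<lambda>p\<in>carrier P. \<theta> m p +[K] \<theta> n p)"
    "[|a :. A; m :. E|] ==> \<theta> (a .[E] m) = (\<lambda>p\<in>carrier P. \<theta> m (\<phi> a p))"
    using hom_add[OF i(1)] hom_smult[OF i(1)] by simp_all
  show "[|\<eta> : DP; \<mu> : DP|] ==> \<theta>' (\<lambda>p\<in>carrier P. \<eta> p +[K] \<mu> p) = \<theta>' \<eta> +[E] \<theta>' \<mu>"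
    "[|a :. A; \<eta> : DP|] ==> \<theta>' (\<lambda>p\<in>carrier P. \<eta> (\<phi> a p)) = a .[E] \<theta>' \<eta>"
    using hom_add[OF i(2), of \<eta> \<mu>] hom_smult[OF i(2), of a \<eta>] by simp_all
qed

definition res :: "('c => 'k) => ('c => 'c) => 'p => 'k" where
  "res \<xi> y = (\<lambda>p\<in>carrier P. \<xi> (y (s p)))"

lemma s_scal: "[|c :. K; p :. P|] ==> s (scal G P c p) = scal G C c (s p)" by (rule hom_scal(2)[OF KG s])
lemma scal_P: "[|c :. K; p :. P|] ==> scal G P c p :. P" by (rule scal_module(2)[OF KG lP])

lemma res: "[|\<xi> : functionals K G C; y : Hom G C C|] ==> res \<xi> y : DP"
  unfolding res_def
  by (rule functionalI)
    (simp_all add: s_closed hom_closed hom_add[OF s] hom_add[of y] s_scal scal_P hom_scal(2)[OF KG, of y C C] functionalD(1-3))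

text \<open>The canonical map from \<open>D C\<close> to \<open>Hom(e B, e D C)\<close>, with
  \<open>e D C\<close> identified with \<open>D P\<close> by restriction along \<open>s\<close>, and
  with \<open>E\<close> by \<open>\<theta>'\<close>.\<close>

definition \<Psi> :: "('c => 'k) => ('c => 'c) => 'e" where
  "\<Psi> = (\<lambda>\<xi>\<in>functionals K G C. \<lambda>y\<in>carrier (eB B ee). \<theta>' (res \<xi> y))"

lemma corner_smult_EE: "[|r : Hom G C C; \<eta> : DP|] ==> \<Phi> r .[E] \<theta>' \<eta> = \<theta>' (\<lambda>p\<in>carrier P. \<eta> (q (r (s p))))"
  using \<theta>D(8)[OF \<Phi>(1), of r \<eta>] \<Phi>(2) by (simp cong: restrict_cong)

lemma arr_simps [simp]: "carrier (arr B ee EE) = Hom (corner B ee) (eB B ee) EE"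
  "0[arr B ee EE] = (\<lambda>y\<in>carrier (eB B ee). 0[E])"
  "f +[arr B ee EE] g = (\<lambda>y\<in>carrier (eB B ee). f y +[E] g y)"
  "b .[arr B ee EE] f = (\<lambda>y\<in>carrier (eB B ee). f (compose (carrier C) b y))"
  by (simp_all add: arr_def)

lemma eB_closed: "[|x :. (eB B ee); y :. (eB B ee)|] ==> (\<lambda>c\<in>carrier C. x c +[C] y c) :. (eB B ee)"
  "[|r :. (corner B ee); y :. (eB B ee)|] ==> compose (carrier C) y r :. (eB B ee)"
  "[|b : Hom G C C; y :. (eB B ee)|] ==> compose (carrier C) b y :. (eB B ee)"
proof -
  show "[|x :. (eB B ee); y :. (eB B ee)|] ==> (\<lambda>c\<in>carrier C. x c +[C] y c) :. (eB B ee)"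
    using abelian_monoid.a_closed[OF abelian_group.axioms(1)[OF hom_space_module(2)[OF KG lC lC]], of x y]
    by (simp add: eB_carrier s_closed q_closed)
  show "[|r :. (corner B ee); y :. (eB B ee)|] ==> compose (carrier C) y r :. (eB B ee)"
    using hom_compose[OF lC cornerD(1)[of r], of y C] cornerD(2)[of r] by (simp add: eB_carrier s_closed q_closed compose_eq)
  show "[|b : Hom G C C; y :. (eB B ee)|] ==> compose (carrier C) b y :. (eB B ee)"
    using hom_compose[OF lC, of y C b] by (simp add: eB_carrier s_closed q_closed compose_eq)
qed

lemma arr_group: "abelian_group (arr B ee EE)"
proof -
  have "abelian_group (hom_space (corner B ee) (eB B ee) EE)"
  proof (rule hom_space_group)
    show "abelian_group EE" unfolding as_corner_module_def using E.M_group by simp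
  qed (simp_all add: eB_closed E.smult_closed E.smult_r_distr \<Phi> cornerD(1))
  then show ?thesis by (simp add: arr_def)
qed

lemma \<Psi>_hom: "\<Psi> : Hom B (DCk K G C) (arr B ee EE)"
  unfolding \<Psi>_def
proof (rule hom_setI)
  interpret DC: left_module B "DCk K G C" by (rule lDC)
  fix \<xi> assume "\<xi> :. (DCk K G C)"
  then have \<xi>: "\<xi> : functionals K G C" by simp
  have y: "y : Hom G C C" if "y :. (eB B ee)" for y using that by (simp add: eB_carrier)
  have "(\<lambda>y\<in>carrier (eB B ee). \<theta>' (res \<xi> y)) : Hom (corner B ee) (eB B ee) EE"
  proof (rule hom_setI)
    fix x z assume h: "x :. (eB B ee)" "z :. (eB B ee)"
    have "res \<xi> (\<lambda>c\<in>carrier C. x c +[C] z c) = (\<lambda>p\<in>carrier P. res \<xi> x p +[K] res \<xi> z p)"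
      unfolding res_def using y[OF h(1)] y[OF h(2)]
      by (intro restrict_ext) (simp add: s_closed hom_closed functionalD(2)[OF \<xi>])
    then show "(\<lambda>y\<in>carrier (eB B ee). \<theta>' (res \<xi> y)) (x +[eB B ee] z) =
      (\<lambda>y\<in>carrier (eB B ee). \<theta>' (res \<xi> y)) x +[EE] (\<lambda>y\<in>carrier (eB B ee). \<theta>' (res \<xi> y)) z"
      using h eB_closed(1)[OF h] \<theta>D(6)[OF res[OF \<xi> y] res[OF \<xi> y]] by simp
  next
    fix r x assume h: "r :. (corner B ee)" "x :. (eB B ee)"
    note r = cornerD[OF h(1)]
    have "res \<xi> (compose (carrier C) x r) = (\<lambda>p\<in>carrier P. res \<xi> x (q (r (s p))))"
      unfolding res_def by (intro restrict_ext) (simp add: compose_eq s_closed q_closed hom_closed[OF r(1)] r(3))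
    then show "(\<lambda>y\<in>carrier (eB B ee). \<theta>' (res \<xi> y)) (r .[eB B ee] x) =
      r .[EE] (\<lambda>y\<in>carrier (eB B ee). \<theta>' (res \<xi> y)) x"
      using h eB_closed(2)[OF h] corner_smult_EE[OF r(1) res[OF \<xi> y]] by simp
  qed (use \<theta>D(2)[OF res[OF \<xi> y]] in simp_all)
  then show "(\<lambda>\<xi>\<in>functionals K G C. \<lambda>y\<in>carrier (eB B ee). \<theta>' (res \<xi> y)) \<xi> :. (arr B ee EE)"
    using \<xi> by simp
next
  interpret DC: left_module B "DCk K G C" by (rule lDC)
  have y: "y : Hom G C C" if "y :. (eB B ee)" for y using that by (simp add: eB_carrier)
  fix \<xi> \<eta> assume h: "\<xi> :. (DCk K G C)" "\<eta> :. (DCk K G C)"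
  have "res (\<xi> +[DCk K G C] \<eta>) z = (\<lambda>p\<in>carrier P. res \<xi> z p +[K] res \<eta> z p)" if "z :. (eB B ee)" for z
    unfolding res_def by (intro restrict_ext) (simp add: s_closed hom_closed[OF y[OF that]])
  moreover have "\<theta>' (\<lambda>p\<in>carrier P. res \<xi> z p +[K] res \<eta> z p) = \<theta>' (res \<xi> z) +[E] \<theta>' (res \<eta> z)" if "z :. (eB B ee)" for z
    by (rule \<theta>D(6)) (use res[OF _ y[OF that]] h in simp_all)
  ultimately show "(\<lambda>\<xi>\<in>functionals K G C. \<lambda>y\<in>carrier (eB B ee). \<theta>' (res \<xi> y)) (\<xi> +[DCk K G C] \<eta>) =
    (\<lambda>\<xi>\<in>functionals K G C. \<lambda>y\<in>carrier (eB B ee). \<theta>' (res \<xi> y)) \<xi> +[arr B ee EE]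
    (\<lambda>\<xi>\<in>functionals K G C. \<lambda>y\<in>carrier (eB B ee). \<theta>' (res \<xi> y)) \<eta>"
    using h DC.M.a_closed[OF h] by (auto intro!: restrict_ext)
next
  interpret DC: left_module B "DCk K G C" by (rule lDC)
  have y: "y : Hom G C C" if "y :. (eB B ee)" for y using that by (simp add: eB_carrier)
  fix b \<xi> assume h: "b :. B" "\<xi> :. (DCk K G C)"
  have "res (b .[DCk K G C] \<xi>) z = res \<xi> (compose (carrier C) b z)" if "z :. (eB B ee)" for z
    unfolding res_def by (intro restrict_ext) (simp add: s_closed compose_eq hom_closed[OF y[OF that]])
  then show "(\<lambda>\<xi>\<in>functionals K G C. \<lambda>y\<in>carrier (eB B ee). \<theta>' (res \<xi> y)) (b .[DCk K G C] \<xi>) =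
    b .[arr B ee EE] (\<lambda>\<xi>\<in>functionals K G C. \<lambda>y\<in>carrier (eB B ee). \<theta>' (res \<xi> y)) \<xi>"
    using h DC.smult_closed[OF h] eB_closed(3) by (auto intro!: restrict_ext)
qed simp

text \<open>For \<open>u : P -> C\<close> the map \<open>u\<close> after \<open>q\<close> lies in
  \<open>e B\<close>. So functionals with the same image agree on all \<open>u x\<close>, and by
  \<open>trace_C\<close> these span \<open>C\<close>.\<close>

lemma \<Psi>_inj: "inj_on \<Psi> (carrier (DCk K G C))"
proof (rule inj_onI)
  fix \<xi> \<eta> assume h: "\<xi> :. (DCk K G C)" "\<eta> :. (DCk K G C)" "\<Psi> \<xi> = \<Psi> \<eta>"
  have f: "\<xi> : functionals K G C" "\<eta> : functionals K G C" using h by simp_all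
  have eq: "\<xi> (u x) = \<eta> (u x)" if u: "u : Hom G P C" and x: "x :. P" for u x
  proof -
    have y: "compose (carrier C) u q : Hom G C C" by (rule hom_compose[OF lC q u])
    have ye: "compose (carrier C) u q :. (eB B ee)" using y by (simp add: eB_carrier compose_eq s_closed q_closed qs)
    have "\<theta>' (res \<xi> (compose (carrier C) u q)) = \<theta>' (res \<eta> (compose (carrier C) u q))"
      using fun_cong[OF h(3), of "compose (carrier C) u q"] ye f by (simp add: \<Psi>_def)
    then have "\<theta> (\<theta>' (res \<xi> (compose (carrier C) u q))) = \<theta> (\<theta>' (res \<eta> (compose (carrier C) u q)))" by simp
    then have r: "res \<xi> (compose (carrier C) u q) = res \<eta> (compose (carrier C) u q)"
      unfolding \<theta>D(4)[OF res[OF f(1) y]] \<theta>D(4)[OF res[OF f(2) y]] .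
    show ?thesis using fun_cong[OF r, of x] x by (simp add: res_def compose_eq s_closed qs)
  qed
  show "\<xi> = \<eta>"
  proof (rule hom_eqI[OF f])
    interpret fK: field K by (rule fd_algebraD(1)[OF KG])
    fix c assume "c :. (rs G C)"
    then obtain n u x where ux: "!!l. l < (n::nat) ==> u l : Hom G P C & x l :. P" "c = (\<Oplus>\<^bsub>C\<^esub>l\<in>{..<n}. u l (x l))"
      using trace_C[of c] by auto
    have uc: "(%l. u l (x l)) : {..<n} \<rightarrow> carrier C" using ux(1) hom_closed by fastforce
    note fs = functional_finsum[OF fd_algebraD(1)[OF KG] C.M_group _ uc]
    have "(\<Oplus>\<^bsub>K\<^esub>l\<in>{..<n}. \<xi> (u l (x l))) = (\<Oplus>\<^bsub>K\<^esub>l\<in>{..<n}. \<eta> (u l (x l)))"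
      using uc eq ux(1) functionalD(1)[OF f(2)] by (intro fK.finsum_cong') (auto simp: Pi_iff)
    then show "\<xi> c = \<eta> c" using fs[OF f(1)] fs[OF f(2)] ux(2) by simp
  qed
qed

text \<open>The functional whose image under \<open>\<Psi>\<close> is the value of the canonical map
  on the tensor of \<open>x\<close> and \<open>m\<close>; this is the content of
  \<open>bil_eq\<close>.\<close>

definition \<zeta> :: "('c => 'c) => 'e => 'c => 'k" where
  "\<zeta> x m = (\<lambda>c\<in>carrier C. \<theta> m (q (x c)))"

lemma \<zeta>_closed: "[|x : Hom G C C; m :. E|] ==> \<zeta> x m : functionals K G C"
  unfolding \<zeta>_def
  by (rule functionalI)
    (simp_all add: q_closed hom_closed hom_add[OF q] hom_add[of x] hom_scal(2)[OF KG q] scal_module(2)[OF KG lC]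
      hom_scal(2)[OF KG, of x C C] functionalD(1-3)[OF \<theta>D(1)])

abbreviation bil where "bil \<equiv> %(x, m). \<lambda>y\<in>carrier (eB B ee). (y *[B] x) .[EE] m"

lemma bil_eq:
  assumes x: "x : Hom G C C" and m: "m :. E"
  shows "bil (x, m) = \<Psi> (\<zeta> x m)"
proof -
  have "\<Phi> (compose (carrier C) x y) .[E] m = \<theta>' (res (\<zeta> x m) y)" if "y :. (eB B ee)" for y
  proof -
    have y: "y : Hom G C C" using that by (simp add: eB_carrier)
    have "\<Phi> (compose (carrier C) x y) .[E] \<theta>' (\<theta> m) = \<theta>' (\<lambda>p\<in>carrier P. \<theta> m (q (compose (carrier C) x y (s p))))"
      by (rule corner_smult_EE[OF hom_compose[OF lC y x] \<theta>D(1)[OF m]])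
    also have "(\<lambda>p\<in>carrier P. \<theta> m (q (compose (carrier C) x y (s p)))) = res (\<zeta> x m) y"
      unfolding res_def \<zeta>_def by (intro restrict_ext) (simp add: compose_eq s_closed hom_closed[OF y])
    finally show ?thesis using \<theta>D(3)[OF m] by simp
  qed
  then show ?thesis using \<zeta>_closed[OF x m] by (simp add: \<Psi>_def cong: restrict_cong)
qed

text \<open>By \<open>bil_eq\<close>, elementary tensors are sent into the image of
  \<open>\<Psi>\<close>, which gives one inclusion. For the other, \<open>trace_P\<close> decomposes
  a functional on \<open>C\<close> into terms that factor through \<open>P\<close>, and each of them
  comes from an elementary tensor.\<close>

lemma image_zeta: "zeta B ee EE ` carrier (ell B ee EE) = \<Psi> ` carrier (DCk K G C)"
proof -
  interpret DC: left_module B "DCk K G C" by (rule lDC)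
  interpret N: abelian_group "arr B ee EE" by (rule arr_group)
  interpret fK: field K by (rule fd_algebraD(1)[OF KG])
  note agD = DC.M_group
  let ?S = "carrier (Be B ee) \<times> carrier EE"
  have xB: "x : Hom G C C" "c :. C ==> s (q (x c)) = x c" if "x :. (Be B ee)" for x c
    using that by (auto simp: Be_carrier)
  have bz: "bil (x, m) = \<Psi> (\<zeta> x m)" "\<zeta> x m :. (DCk K G C)" if "x :. (Be B ee)" "m :. E" for x m
    using bil_eq[OF xB(1)[OF that(1)] that(2)] \<zeta>_closed[OF xB(1)[OF that(1)] that(2)] by simp_all
  have hN: "bil : ?S \<rightarrow> carrier (arr B ee EE)"
  proof
    fix z assume "z : ?S"
    then obtain x m where z: "z = (x, m)" "x :. (Be B ee)" "m :. E" by auto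
    show "bil z :. (arr B ee EE)" unfolding z(1) bz(1)[OF z(2,3)] by (rule hom_closed[OF \<Psi>_hom bz(2)[OF z(2,3)]])
  qed
  have cl1: "x +[Be B ee] y :. (Be B ee)" if "x :. (Be B ee)" "y :. (Be B ee)" for x y
    using abelian_monoid.a_closed[OF abelian_group.axioms(1)[OF hom_space_module(2)[OF KG lC lC]], of x y] that
      hom_closed[OF xB(1)[OF that(1)]] hom_closed[OF xB(1)[OF that(2)]]
    by (simp add: Be_carrier s_closed q_closed hom_add[OF s] hom_add[OF q])
  have cl3: "r .[Be B ee] x :. (Be B ee)" if "r :. (corner B ee)" "x :. (Be B ee)" for r x
    using hom_compose[OF lC xB(1)[OF that(2)] cornerD(1)[OF that(1)]] cornerD(3)[OF that(1)] hom_closed[OF xB(1)[OF that(2)]]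
    by (simp add: Be_carrier compose_eq)
  have cl4: "r .[EE] m :. EE" if "r :. (corner B ee)" "m :. EE" for r m
    using that \<Phi>(1)[OF cornerD(1)] by (simp add: E.smult_closed)
  have add1: "bil (x +[Be B ee] y, m) = bil (x, m) +[arr B ee EE] bil (y, m)"
    if h: "x :. (Be B ee)" "y :. (Be B ee)" "m :. EE" for x y m
  proof -
    have m: "m :. E" using h by simp
    have "\<zeta> (x +[Be B ee] y) m = \<zeta> x m +[DCk K G C] \<zeta> y m"
      unfolding \<zeta>_def DCk_simps eB_simps using xB(1)[OF h(1)] xB(1)[OF h(2)]
      by (intro restrict_ext) (simp add: hom_closed hom_add[OF q] q_closed functionalD(2)[OF \<theta>D(1)[OF m]])
    then show ?thesis
      unfolding bz(1)[OF h(1) m] bz(1)[OF h(2) m] bz(1)[OF cl1[OF h(1,2)] m]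
      using hom_add[OF \<Psi>_hom bz(2)[OF h(1) m] bz(2)[OF h(2) m]] by simp
  qed
  have add2: "bil (x, m +[EE] n) = bil (x, m) +[arr B ee EE] bil (x, n)"
    if h: "x :. (Be B ee)" "m :. EE" "n :. EE" for x m n
  proof -
    have m: "m :. E" "n :. E" using h by simp_all
    have mn: "m +[EE] n :. E" using m by simp
    have "\<zeta> x (m +[EE] n) = \<zeta> x m +[DCk K G C] \<zeta> x n"
      unfolding \<zeta>_def DCk_simps using xB(1)[OF h(1)] m
      by (intro restrict_ext) (simp add: hom_closed q_closed \<theta>D(5))
    then show ?thesis
      unfolding bz(1)[OF h(1) m(1)] bz(1)[OF h(1) m(2)] bz(1)[OF h(1) mn]
      using hom_add[OF \<Psi>_hom bz(2)[OF h(1) m(1)] bz(2)[OF h(1) m(2)]] by simp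
  qed
  have bal: "bil (r .[Be B ee] x, m) = bil (x, r .[EE] m)"
    if h: "r :. (corner B ee)" "x :. (Be B ee)" "m :. EE" for r x m
  proof -
    have m: "m :. E" using h by simp
    have rm: "r .[EE] m :. E" using cl4[OF h(1,3)] by simp
    note r = cornerD[OF h(1)]
    have "\<zeta> (r .[Be B ee] x) m = \<zeta> x (r .[EE] m)"
      unfolding \<zeta>_def eB_simps EE_simps using \<Phi>[OF r(1)]
      by (intro restrict_ext) (simp add: compose_eq hom_closed[OF xB(1)[OF h(2)]] q_closed \<theta>D(7)[OF _ m] xB(2)[OF h(2)])
    then show ?thesis unfolding bz(1)[OF cl3[OF h(1,2)] m] bz(1)[OF h(2) rm] by simp
  qed
  have zi: "zeta B ee EE ` carrier (ell B ee EE) = frag_sum (arr B ee EE) bil ` {u. Poly_Mapping.keys u \<subseteq> ?S}"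
    unfolding zeta_def ell_def
    by (rule tensor_lift_image[OF arr_group hN cl1 _ cl3 cl4 add1 add2 bal]) simp_all
  let ?V = "\<Psi> ` carrier (DCk K G C)" and ?U = "frag_sum (arr B ee EE) bil ` {u. Poly_Mapping.keys u \<subseteq> ?S}"
  have V: "frag_sum (arr B ee EE) bil u : ?V" if "Poly_Mapping.keys u \<subseteq> ?S" for u
  proof (rule frag_sum_mem[OF arr_group hN that])
    show "0[arr B ee EE] : ?V"
      using hom_zero[OF \<Psi>_hom agD arr_group] imageI[OF DC.M.zero_closed, of \<Psi>] by (simp only:)
    fix x y assume "x : ?V" "y : ?V"
    then obtain \<xi> \<eta> where h: "\<xi> :. (DCk K G C)" "x = \<Psi> \<xi>" "\<eta> :. (DCk K G C)" "y = \<Psi> \<eta>" by blast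
    show "x -[arr B ee EE] y : ?V"
      unfolding h(2,4) hom_diff[OF \<Psi>_hom agD arr_group h(1,3), symmetric]
      by (rule imageI) (rule DC.M.minus_closed[OF h(1,3)])
  next
    fix z assume "z : ?S"
    then obtain x m where z: "z = (x, m)" "x :. (Be B ee)" "m :. E" by auto
    show "bil z : ?V" unfolding z(1) bz(1)[OF z(2,3)] by (rule imageI[OF bz(2)[OF z(2,3)]])
  qed
  have U0: "0[arr B ee EE] : ?U" by (rule image_eqI[of _ _ 0]) (simp_all only: frag_sum_zero[OF arr_group] keys_zero mem_Collect_eq empty_subsetI)
  have Uadd: "x +[arr B ee EE] y : ?U" if "x : ?U" "y : ?U" for x y
  proof -
    obtain u where u: "x = frag_sum (arr B ee EE) bil u" "u : {u. Poly_Mapping.keys u \<subseteq> ?S}" using \<open>x : ?U\<close> by (rule imageE)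
    obtain v where v: "y = frag_sum (arr B ee EE) bil v" "v : {u. Poly_Mapping.keys u \<subseteq> ?S}" using \<open>y : ?U\<close> by (rule imageE)
    note h = CollectD[OF u(2)] u(1) CollectD[OF v(2)] v(1)
    have "Poly_Mapping.keys (u + v) \<subseteq> ?S" by (rule order_trans[OF Poly_Mapping.keys_add Un_least[OF h(1,3)]])
    then show ?thesis unfolding h(2,4) frag_sum_add[OF arr_group hN h(1,3), symmetric] by (intro imageI CollectI)
  qed
  have Uc: "?U \<subseteq> carrier (arr B ee EE)" by (intro image_subsetI frag_sum_closed[OF arr_group hN]) (erule CollectD)
  have Ub: "\<Psi> (\<lambda>c\<in>carrier C. \<eta> (f c)) : ?U" and Db: "(\<lambda>c\<in>carrier C. \<eta> (f c)) :. (DCk K G C)"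
    if f: "f : Hom G C P" and \<eta>: "\<eta> : DP" for f \<eta>
  proof -
    \<comment> \<open>Since \<open>q\<close> undoes \<open>s\<close>, the tensor of this element
      with \<open>\<theta>' \<eta>\<close> yields the functional \<open>\<eta>\<close> after
      \<open>f\<close>.\<close>
    let ?x = "compose (carrier C) s f"
    have x: "?x :. (Be B ee)" using hom_compose[OF lC f s] by (simp add: Be_carrier compose_eq hom_closed[OF f] qs)
    have m: "\<theta>' \<eta> :. E" by (rule \<theta>D(2)[OF \<eta>])
    have eq: "\<zeta> ?x (\<theta>' \<eta>) = (\<lambda>c\<in>carrier C. \<eta> (f c))"
      unfolding \<zeta>_def by (intro restrict_ext) (simp add: compose_eq hom_closed[OF f] qs \<theta>D(4)[OF \<eta>])
    have S: "(?x, \<theta>' \<eta>) : ?S" using x m by simp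
    have "bil (?x, \<theta>' \<eta>) :. (arr B ee EE)" using hN S by blast
    then have "frag_sum (arr B ee EE) bil (frag_of (?x, \<theta>' \<eta>)) = \<Psi> (\<lambda>c\<in>carrier C. \<eta> (f c))"
      using frag_sum_of[OF arr_group, of bil "(?x, \<theta>' \<eta>)"] bz(1)[OF x m] eq by simp
    moreover have "Poly_Mapping.keys (frag_of (?x, \<theta>' \<eta>)) \<subseteq> ?S" using S by (simp add: keys_frag_of)
    ultimately show "\<Psi> (\<lambda>c\<in>carrier C. \<eta> (f c)) : ?U" by (intro image_eqI[of _ _ "frag_of (?x, \<theta>' \<eta>)"] CollectI) (rule sym)
    show "(\<lambda>c\<in>carrier C. \<eta> (f c)) :. (DCk K G C)" using bz(2)[OF x m] eq by simp
  qed
  have "\<Psi> \<xi> : ?U" if \<xi>: "\<xi> :. (DCk K G C)" for \<xi>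
  proof -
    obtain n \<eta> f where h: "!!l. l < (n::nat) ==> f l : Hom G C P" "!!l. l < n ==> \<eta> l : DP"
      "!!c. c :. C ==> \<xi> c = (\<Oplus>\<^bsub>K\<^esub>l\<in>{..<n}. \<eta> l (f l c))"
      using trace_P[OF \<xi>[unfolded DCk_simps]] by blast
    let ?g = "%l. \<lambda>c\<in>carrier C. \<eta> l (f l c)"
    have g: "?g l :. (DCk K G C)" if "l < n" for l by (rule Db[OF h(1)[OF that] h(2)[OF that]])
    have "(\<Oplus>\<^bsub>DCk K G C\<^esub>l\<in>{..<n}. ?g l) = \<xi>"
    proof (rule hom_eqI)
      show "(\<Oplus>\<^bsub>DCk K G C\<^esub>l\<in>{..<n}. ?g l) : functionals K G C"
        using DC.M.finsum_closed[of ?g "{..<n}"] g by simp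
      show "\<xi> : functionals K G C" using \<xi> by simp
      fix c assume "c :. (rs G C)"
      then have c: "c :. C" by simp
      have "(\<Oplus>\<^bsub>DCk K G C\<^esub>l\<in>{..<n}. ?g l) c = (\<Oplus>\<^bsub>K\<^esub>l\<in>{..<n}. ?g l c)"
        unfolding DCk_def by (rule dual_finsum[OF KB eval_module_module]) (use c g in "simp_all add: functionals_C")
      also have "... = \<xi> c" using c h(3)[OF c] by simp
      finally show "(\<Oplus>\<^bsub>DCk K G C\<^esub>l\<in>{..<n}. ?g l) c = \<xi> c" .
    qed
    moreover have "?g : {..<n} \<rightarrow> carrier (DCk K G C)" by (rule Pi_I) (simp only: lessThan_iff g)
    ultimately have "\<Psi> \<xi> = (\<Oplus>\<^bsub>arr B ee EE\<^esub>l\<in>{..<n}. \<Psi> (?g l))"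
      using hom_finsum[OF \<Psi>_hom agD arr_group, of ?g "{..<n}"] by (simp only:)
    moreover have "... : ?U"
      by (rule N.finsum_in_set[OF U0 Uadd Uc]) (use Ub h in simp_all)
    ultimately show ?thesis by simp
  qed
  then show ?thesis unfolding zi by (intro equalityI image_subsetI V) (simp_all only: mem_Collect_eq)
qed

theorem DC_iso_ck: "mod_iso B (DCk K G C) (ck A G P C s q \<phi> E)"
  unfolding mod_iso_def
proof (rule bexI[of _ \<Psi>])
  have car: "carrier (ck A G P C s q \<phi> E) = \<Psi> ` carrier (DCk K G C)"
    by (simp add: ck_def intermediate_ext_def image_zeta)
  have ck: "ck A G P C s q \<phi> E = (arr B ee EE)\<lparr>carrier := \<Psi> ` carrier (DCk K G C)\<rparr>"
    by (simp add: ck_def intermediate_ext_def image_zeta)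
  show "\<Psi> : Hom B (DCk K G C) (ck A G P C s q \<phi> E)"
    unfolding ck by (rule hom_restrict_range[OF \<Psi>_hom]) simp
  show "bij_betw \<Psi> (carrier (DCk K G C)) (carrier (ck A G P C s q \<phi> E))"
    unfolding car by (rule inj_on_imp_bij_betw[OF \<Psi>_inj])
qed

end

section \<open>Identification of \<open>A\<close> with the corner algebra\<close>

context gencogen
begin

text \<open>\<open>A\<close> is a summand of a power of \<open>E\<close>, so an element of
  \<open>A\<close> is determined by its action on \<open>E\<close>.\<close>

lemma E_faithful:
  assumes a: "a :. A" and b: "b :. A" and eq: "!!x. x :. E ==> a .[E] x = b .[E] x"
  shows "a = b"
proof -
  obtain n \<alpha> \<beta> where ab: "!!l. l < (n::nat) ==> \<alpha> l : Hom A (regular A) E" "!!l. l < n ==> \<beta> l : Hom A E (regular A)"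
    "!!x. x :. (regular A) ==> (\<Oplus>\<^bsub>regular A\<^esub>l\<in>{..<n}. \<beta> l (\<alpha> l x)) = x"
    using gen unfolding fac_def by blast
  have \<alpha>: "\<alpha> l y = y .[E] \<alpha> l 1[A]" if "l < n" "y :. A" for l y
    using hom_smult[OF ab(1)[OF that(1)], of y "1[A]"] that E.R.r_one by simp
  have \<alpha>1: "\<alpha> l 1[A] :. E" if "l < n" for l using hom_closed[OF ab(1)[OF that]] E.R.one_closed by simp
  have "\<alpha> l a = \<alpha> l b" if "l < n" for l using \<alpha>[OF that a] \<alpha>[OF that b] eq[OF \<alpha>1[OF that]] by simp
  moreover have "\<beta> l (\<alpha> l b) :. A" if "l < n" for l
    using hom_closed[OF ab(2)[OF that] hom_closed[OF ab(1)[OF that]], of b] b by simp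
  ultimately have "(\<Oplus>\<^bsub>A\<^esub>l\<in>{..<n}. \<beta> l (\<alpha> l a)) = (\<Oplus>\<^bsub>A\<^esub>l\<in>{..<n}. \<beta> l (\<alpha> l b))"
    by (intro E.R.finsum_cong') auto
  then show ?thesis using ab(3)[of a] ab(3)[of b] a b by simp
qed

text \<open>The maps \<open>y |-> \<beta> l y x\<close> are endomorphisms of \<open>E\<close>, hence
  commute with \<open>T\<close>. Writing \<open>1\<close> as the sum of the
  \<open>\<beta> l (e l)\<close> and moving \<open>T\<close> inside exhibits \<open>a\<close> as the
  sum of the \<open>\<beta> l (T (e l))\<close>.\<close>

lemma double_centralizer:
  assumes T: "T : Hom G EG EG"
  shows "EX a:carrier A. ALL x:carrier E. T x = a .[E] x"
proof -
  obtain n \<alpha> \<beta> where ab: "!!l. l < (n::nat) ==> \<alpha> l : Hom A (regular A) E" "!!l. l < n ==> \<beta> l : Hom A E (regular A)"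
    "!!x. x :. (regular A) ==> (\<Oplus>\<^bsub>regular A\<^esub>l\<in>{..<n}. \<beta> l (\<alpha> l x)) = x"
    using gen unfolding fac_def by blast
  let ?e = "%l. \<alpha> l 1[A]"
  have e: "?e l :. E" if "l < n" for l using hom_closed[OF ab(1)[OF that]] E.R.one_closed by simp
  have \<beta>: "\<beta> l z :. A" if "l < n" "z :. E" for l z using hom_closed[OF ab(2)[OF that(1)] that(2)] by simp
  have Tc: "T x :. E" if "x :. E" for x using hom_closed[OF T, of x] that by simp
  have Tcomm: "T (t x) = t (T x)" if t: "t : Hom A E E" and x: "x :. E" for t x
  proof -
    obtain g where "g :. G" "\<psi> g = t" using \<psi>_surj[OF t] by blast
    then show ?thesis using hom_smult[OF T, of g x] x by simp
  qed
  let ?a = "\<Oplus>\<^bsub>A\<^esub>l\<in>{..<n}. \<beta> l (T (?e l))"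
  have cA: "(%l. \<beta> l (T (?e l))) : {..<n} \<rightarrow> carrier A" "(%l. \<beta> l (?e l)) : {..<n} \<rightarrow> carrier A"
    by (auto intro!: \<beta> Tc e)
  have "T x = ?a .[E] x" if x: "x :. E" for x
  proof -
    have bx: "\<beta> l (?e l) .[E] x :. E" if "l < n" for l by (rule E.smult_closed[OF \<beta>[OF that e[OF that]] x])
    have Tb: "T (\<beta> l (?e l) .[E] x) = \<beta> l (T (?e l)) .[E] x" if l: "l < n" for l
    proof -
      have "compose (carrier E) (\<lambda>r\<in>carrier A. r .[E] x) (\<beta> l) : Hom A E E"
        by (rule hom_compose[OF lE ab(2)[OF l] smult_hom[OF lE x]])
      from Tcomm[OF this e[OF l]] show ?thesis
        using \<beta>[OF l] e[OF l] Tc[OF e[OF l]] by (simp add: compose_eq)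
    qed
    have "x = (\<Oplus>\<^bsub>A\<^esub>l\<in>{..<n}. \<beta> l (?e l)) .[E] x" using ab(3)[of "1[A]"] x by (simp add: E.smult_one)
    also have "... = (\<Oplus>\<^bsub>EG\<^esub>l\<in>{..<n}. \<beta> l (?e l) .[E] x)" using E.finsum_smult[OF x cA(2)] by simp
    finally have "T x = T (\<Oplus>\<^bsub>EG\<^esub>l\<in>{..<n}. \<beta> l (?e l) .[E] x)" by (rule arg_cong)
    also have "... = (\<Oplus>\<^bsub>EG\<^esub>l\<in>{..<n}. T (\<beta> l (?e l) .[E] x))"
      using bx fdmD(3)[OF fEG] by (intro hom_finsum[OF T]) auto
    also have "... = (\<Oplus>\<^bsub>E\<^esub>l\<in>{..<n}. \<beta> l (T (?e l)) .[E] x)"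
      unfolding finsum_with_smult using Tb \<beta> Tc e x E.smult_closed by (intro E.M.finsum_cong') auto
    also have "... = ?a .[E] x" by (rule E.finsum_smult[OF x cA(1), symmetric])
    finally show ?thesis .
  qed
  moreover have "?a :. A" by (rule E.R.finsum_closed[OF cA(1)])
  ultimately show ?thesis by blast
qed

text \<open>The right action of \<open>A\<close> on \<open>DE\<close> by transposition.\<close>

definition ra :: "'a => ('e => 'k) => 'e => 'k" where
  "ra a \<eta> = (\<lambda>x\<in>carrier E. \<eta> (a .[E] x))"

lemma DE_functional: "\<eta> : carrier DE \<longleftrightarrow> \<eta> : functionals K A E" by (simp add: functionals_EG)

lemma ra_closed:
  assumes a: "a :. A" and \<eta>: "\<eta> :. DE"
  shows "ra a \<eta> :. DE"
proof -
  have \<eta>': "\<eta> : functionals K A E" using \<eta> DE_functional by blast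
  show ?thesis unfolding DE_functional ra_def
    by (rule functionalI) (simp_all add: functionalD(1-3)[OF \<eta>'] E.smult_closed[OF a] E.smult_r_distr[OF a]
        scal_module(2)[OF KA lE] scal_module(3)[OF KA lE a])
qed

lemma ra_hom: "a :. A ==> (\<lambda>\<eta>\<in>carrier DE. ra a \<eta>) : Hom G DE DE"
proof (rule hom_setI)
  interpret DE: left_module G DE by (rule lDE)
  assume a: "a :. A"
  { fix \<eta> assume "\<eta> :. DE"
    then show "(\<lambda>\<eta>\<in>carrier DE. ra a \<eta>) \<eta> :. DE" using ra_closed[OF a] by (simp only: restrict_apply') }
  { fix \<eta> \<mu> assume h: "\<eta> :. DE" "\<mu> :. DE"
    have "ra a (\<eta> +[DE] \<mu>) = ra a \<eta> +[DE] ra a \<mu>"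
      unfolding ra_def by (auto intro!: restrict_ext simp: E.smult_closed[OF a])
    then show "(\<lambda>\<eta>\<in>carrier DE. ra a \<eta>) (\<eta> +[DE] \<mu>) = (\<lambda>\<eta>\<in>carrier DE. ra a \<eta>) \<eta> +[DE] (\<lambda>\<eta>\<in>carrier DE. ra a \<eta>) \<mu>"
      using h DE.M.a_closed[OF h] by (simp only: restrict_apply') }
  fix g \<eta> assume h: "g :. G" "\<eta> :. DE"
  have "ra a (g .[DE] \<eta>) = g .[DE] ra a \<eta>"
    unfolding ra_def by (auto intro!: restrict_ext simp: E.smult_closed[OF a] \<psi>_closed[OF h(1)] hom_smult[OF \<psi>_hom[OF h(1)] a])
  then show "(\<lambda>\<eta>\<in>carrier DE. ra a \<eta>) (g .[DE] \<eta>) = g .[DE] (\<lambda>\<eta>\<in>carrier DE. ra a \<eta>) \<eta>"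
    using h DE.smult_closed[OF h] by (simp only: restrict_apply')
qed simp

lemma E_eqI:
  assumes "x :. E" "y :. E" "!!\<eta>. \<eta> :. DE ==> \<eta> x = \<eta> y"
  shows "x = y"
  by (rule dual_eqI[OF KG fEG]) (use assms in simp_all)

text \<open>By reflexivity \<open>t\<close> is the transpose of a map \<open>S\<close> on
  \<open>E\<close>. This map is linear over \<open>G\<close>, so \<open>double_centralizer\<close>
  supplies \<open>a\<close>.\<close>

lemma end_DE:
  assumes t: "t : Hom G DE DE"
  shows "EX a:carrier A. ALL \<eta>:carrier DE. t \<eta> = ra a \<eta>"
proof -
  have tc: "t \<eta> : functionals K G EG" if "\<eta> : functionals K G EG" for \<eta>
    using hom_closed[OF t, of \<eta>] that by simp
  interpret DE: left_module G DE by (rule lDE)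
  have "EX y:carrier EG. ALL \<eta>:functionals K G EG. (\<lambda>\<eta>\<in>carrier DE. t \<eta> x) \<eta> = \<eta> y" if x: "x :. EG" for x
  proof (rule dual_reflexive[OF KG fEG], rule functionalI)
    fix \<eta> assume "\<eta> :. DE"
    then show "(\<lambda>\<eta>\<in>carrier DE. t \<eta> x) \<eta> :. K" using functionalD(1)[OF tc x] by simp
  next
    fix \<eta> \<mu> assume h: "\<eta> :. DE" "\<mu> :. DE"
    have "t (\<eta> +[DE] \<mu>) x = t \<eta> x +[K] t \<mu> x" using fun_cong[OF hom_add[OF t h], of x] x by simp
    then show "(\<lambda>\<eta>\<in>carrier DE. t \<eta> x) (\<eta> +[DE] \<mu>) = (\<lambda>\<eta>\<in>carrier DE. t \<eta> x) \<eta> +[K] (\<lambda>\<eta>\<in>carrier DE. t \<eta> x) \<mu>"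
      using h DE.M.a_closed[OF h] by (simp only: restrict_apply')
  next
    fix c \<eta> assume h: "c :. K" "\<eta> :. DE"
    have "t \<eta> : functionals K G EG" using tc h(2) by simp
    then have "t (scal G DE c \<eta>) x = c *[K] t \<eta> x"
      using hom_scal(2)[OF KG t h] scal_dual[OF KG EG_module _ h(1)] x by simp
    then show "(\<lambda>\<eta>\<in>carrier DE. t \<eta> x) (scal G DE c \<eta>) = c *[K] (\<lambda>\<eta>\<in>carrier DE. t \<eta> x) \<eta>"
      using h scal_module(2)[OF KG lDE h] by (simp only: restrict_apply')
  qed (rule restrict_extensional)
  then have "ALL x. EX y. x :. EG --> y :. EG & (ALL \<eta>:carrier DE. t \<eta> x = \<eta> y)" by fastforce
  then obtain S where S: "!!x. x :. EG --> S x :. EG & (ALL \<eta>:carrier DE. t \<eta> x = \<eta> (S x))"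
    by (rule choice[THEN exE]) blast
  have Sc: "S x :. E" if "x :. E" for x using S[of x] that by simp
  have St: "\<eta> (S x) = t \<eta> x" if "x :. E" "\<eta> :. DE" for x \<eta> using S[of x] that by simp
  have fD: "\<eta> (x +[E] y) = \<eta> x +[K] \<eta> y" if "\<eta> :. DE" "x :. E" "y :. E" for \<eta> x y
    using functionalD(2)[of \<eta> K G EG x y] that by simp
  have "(\<lambda>x\<in>carrier EG. S x) : Hom G EG EG"
  proof (rule hom_setI)
    fix x y assume "x :. EG" "y :. EG"
    then have h: "x :. E" "y :. E" by simp_all
    have "S (x +[E] y) = S x +[E] S y"
      by (rule E_eqI) (use h Sc in "simp_all only: St fD E.M.a_closed hom_closed[OF t]")
    then show "(\<lambda>x\<in>carrier EG. S x) (x +[EG] y) = (\<lambda>x\<in>carrier EG. S x) x +[EG] (\<lambda>x\<in>carrier EG. S x) y" using h by simp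
  next
    fix g x assume g: "g :. G" and "x :. EG"
    then have x: "x :. E" by simp
    have "S (\<psi> g x) = \<psi> g (S x)"
    proof (rule E_eqI)
      show "S (\<psi> g x) :. E" "\<psi> g (S x) :. E" using Sc[OF \<psi>_closed[OF g x]] \<psi>_closed[OF g Sc[OF x]] .
      fix \<eta> assume \<eta>: "\<eta> :. DE"
      have "\<eta> (S (\<psi> g x)) = t \<eta> (\<psi> g x)" by (rule St[OF \<psi>_closed[OF g x] \<eta>])
      also have "... = (g .[DE] t \<eta>) x" using x by simp
      also have "... = t (g .[DE] \<eta>) x" by (simp only: hom_smult[OF t g \<eta>])
      also have "... = (g .[DE] \<eta>) (S x)" by (rule St[OF x DE.smult_closed[OF g \<eta>], symmetric])
      also have "... = \<eta> (\<psi> g (S x))" using Sc[OF x] by simp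
      finally show "\<eta> (S (\<psi> g x)) = \<eta> (\<psi> g (S x))" .
    qed
    then show "(\<lambda>x\<in>carrier EG. S x) (g .[EG] x) = g .[EG] (\<lambda>x\<in>carrier EG. S x) x" using x Sc \<psi>_closed[OF g x] by simp
  qed (use Sc in simp_all)
  from double_centralizer[OF this] obtain a where a: "a :. A"
    and a0: "ALL x:carrier E. (\<lambda>x\<in>carrier EG. S x) x = a .[E] x" by blast
  have aS: "S x = a .[E] x" if "x :. E" for x using bspec[OF a0 that] that by simp
  have "t \<eta> = ra a \<eta>" if \<eta>: "\<eta> :. DE" for \<eta>
  proof (rule carrier_eqI[of _ E])
    show "t \<eta> : extensional (carrier E)" using functionalD(4)[OF tc, of \<eta>] \<eta> by simp
    fix x assume x: "x :. E"
    show "t \<eta> x = ra a \<eta> x" using St[OF x \<eta>] aS[OF x] x by (simp add: ra_def)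
  qed (simp add: ra_def)
  then show ?thesis using a by blast
qed

text \<open>\<open>\<phi>\<close> is the right action on \<open>DE\<close> conjugated by
  \<open>\<kappa>\<close>; transposition reverses products, whence the opposite algebra. It is
  injective because \<open>E\<close> is faithful and onto by \<open>end_DE\<close>.
  \<open>\<theta>\<close> is the map of \<open>E\<close> into its double dual, read through
  \<open>\<kappa>\<close>.\<close>

lemma ex_identification:
  fixes P :: "('g, 'p) module" and C :: "('g, 'c) module"
  assumes P: "fdm K G P" and \<kappa>: "isos G P DE \<kappa> \<kappa>'"
    and s: "s : Hom G P C" and q: "q : Hom G C P" and qs: "!!x. x :. P ==> q (s x) = x"
  shows "EX \<phi>. identification K A E G P C s q \<phi>"
proof -
  interpret P: cmod K G P by (rule cmod.intro[OF KG P])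
  interpret DE: left_module G DE by (rule lDE)
  note i = isosD[OF \<kappa>]
  define \<phi> where "\<phi> a = (\<lambda>p\<in>carrier P. \<kappa>' (ra a (\<kappa> p)))" for a
  have \<phi>\<kappa>: "\<kappa> (\<phi> a p) = ra a (\<kappa> p)" if "a :. A" "p :. P" for a p
    using that i(4)[OF ra_closed[OF that(1) i(5)[OF that(2)]]] by (simp add: \<phi>_def)
  have \<kappa>_inj: "x = y" if "\<kappa> x = \<kappa> y" "x :. P" "y :. P" for x y
    using arg_cong[OF that(1), of \<kappa>'] unfolding i(3)[OF that(2)] i(3)[OF that(3)] .
  have \<phi>h: "\<phi> a : Hom G P P" if a: "a :. A" for a
  proof -
    have "compose (carrier P) (compose (carrier DE) \<kappa>' (\<lambda>\<eta>\<in>carrier DE. ra a \<eta>)) \<kappa> : Hom G P P"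
      by (rule hom_compose[OF P.lC i(1) hom_compose[OF lDE ra_hom[OF a] i(2)]])
    moreover have "compose (carrier P) (compose (carrier DE) \<kappa>' (\<lambda>\<eta>\<in>carrier DE. ra a \<eta>)) \<kappa> = \<phi> a"
      unfolding \<phi>_def by (rule carrier_eqI[of _ P]) (use i(5) in "simp_all add: compose_eq")
    ultimately show ?thesis by simp
  qed
  have \<phi>c: "\<phi> a p :. P" if "a :. A" "p :. P" for a p by (rule hom_closed[OF \<phi>h[OF that(1)] that(2)])
  have \<kappa>E: "\<kappa> p : functionals K G EG" if "p :. P" for p using i(5)[OF that] by simp
  note \<kappa>D = functionalD[OF \<kappa>E, simplified]
  have \<phi>_eqI: "\<phi> a p = p'" if "a :. A" "p :. P" "p' :. P" "!!x. x :. E ==> \<kappa> p (a .[E] x) = \<kappa> p' x" for a p p'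
  proof (rule \<kappa>_inj[OF _ \<phi>c[OF that(1,2)] that(3)])
    show "\<kappa> (\<phi> a p) = \<kappa> p'" unfolding \<phi>\<kappa>[OF that(1,2)] ra_def
      by (rule carrier_eqI[of _ E]) (use that \<kappa>D(4)[OF that(3)] in simp_all)
  qed
  have \<kappa>\<phi>: "\<kappa> (\<phi> a p) x = \<kappa> p (a .[E] x)" if "a :. A" "p :. P" "x :. E" for a p x
    using that by (simp add: \<phi>\<kappa> ra_def)
  have \<kappa>add: "\<kappa> (p +[P] p') x = \<kappa> p x +[K] \<kappa> p' x" if "p :. P" "p' :. P" "x :. E" for p p' x
    using hom_add[OF i(1) that(1,2)] that(3) by simp
  have \<kappa>scal: "\<kappa> (scal G P c p) x = c *[K] \<kappa> p x" if "c :. K" "p :. P" "x :. E" for c p x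
    using hom_scal(2)[OF KG i(1) that(1,2)] scal_dual[OF KG EG_module \<kappa>E[OF that(2)] that(1)] that(3) by simp
  have "\<phi> : ring_hom A (opp (end_alg G P))"
  proof (rule ring_hom_memI)
    fix a assume "a :. A"
    then show "\<phi> a :. (opp (end_alg G P))" using \<phi>h by simp
  next
    fix a b assume ab: "a :. A" "b :. A"
    show "\<phi> (a *[A] b) = \<phi> a *[opp (end_alg G P)] \<phi> b"
    proof (rule carrier_eqI[of _ P])
      fix p assume p: "p :. P"
      have "\<phi> (a *[A] b) p = \<phi> b (\<phi> a p)"
        by (rule \<phi>_eqI) (use ab p in \<open>simp_all add: \<phi>c \<kappa>\<phi> E.smult_closed E.smult_assoc1\<close>)
      then show "\<phi> (a *[A] b) p = (\<phi> a *[opp (end_alg G P)] \<phi> b) p" using p by (simp add: compose_eq)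
    qed (simp_all add: \<phi>_def)
    show "\<phi> (a +[A] b) = \<phi> a +[opp (end_alg G P)] \<phi> b"
    proof (rule carrier_eqI[of _ P])
      fix p assume p: "p :. P"
      have "\<phi> (a +[A] b) p = \<phi> a p +[P] \<phi> b p"
        by (rule \<phi>_eqI) (use ab p in \<open>simp_all add: \<phi>c \<kappa>\<phi> \<kappa>add E.smult_closed E.smult_l_distr \<kappa>D(2)\<close>)
      then show "\<phi> (a +[A] b) p = (\<phi> a +[opp (end_alg G P)] \<phi> b) p" using p by simp
    qed (simp_all add: \<phi>_def)
  next
    show "\<phi> 1[A] = 1[opp (end_alg G P)]"
    proof (rule carrier_eqI[of _ P])
      fix p assume p: "p :. P"
      have "\<phi> 1[A] p = p" by (rule \<phi>_eqI) (use p in "simp_all add: E.smult_one")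
      then show "\<phi> 1[A] p = 1[opp (end_alg G P)] p" using p by simp
    qed (simp_all add: \<phi>_def)
  qed
  moreover have "bij_betw \<phi> (carrier A) (carrier (opp (end_alg G P)))"
  proof (rule bij_betw_imageI)
    show "inj_on \<phi> (carrier A)"
    proof (rule inj_onI)
      fix a b assume h: "a :. A" "b :. A" "\<phi> a = \<phi> b"
      show "a = b"
      proof (rule E_faithful[OF h(1,2)])
        fix x assume x: "x :. E"
        show "a .[E] x = b .[E] x"
        proof (rule E_eqI[OF E.smult_closed[OF h(1) x] E.smult_closed[OF h(2) x]])
          fix \<eta> assume \<eta>: "\<eta> :. DE"
          show "\<eta> (a .[E] x) = \<eta> (b .[E] x)"
            using \<kappa>\<phi>[OF h(1) i(6)[OF \<eta>] x] \<kappa>\<phi>[OF h(2) i(6)[OF \<eta>] x] h(3) i(4)[OF \<eta>] by simp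
        qed
      qed
    qed
    show "\<phi> ` carrier A = carrier (opp (end_alg G P))"
    proof (intro equalityI subsetI)
      fix t assume "t :. (opp (end_alg G P))"
      then have t: "t : Hom G P P" by simp
      have "compose (carrier DE) (compose (carrier P) \<kappa> t) \<kappa>' : Hom G DE DE"
        by (rule hom_compose[OF lDE i(2) hom_compose[OF P.lC t i(1)]])
      then obtain a where a: "a :. A"
        "!!\<eta>. \<eta> :. DE ==> compose (carrier DE) (compose (carrier P) \<kappa> t) \<kappa>' \<eta> = ra a \<eta>" using end_DE by blast
      have "\<phi> a = t"
      proof (rule carrier_eqI[of _ P])
        fix p assume p: "p :. P"
        have "ra a (\<kappa> p) = \<kappa> (t p)" using a(2)[OF i(5)[OF p]] i(5)[OF p] i(3)[OF p] p by (simp add: compose_eq)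
        then show "\<phi> a p = t p" using p i(3)[OF hom_closed[OF t p]] by (simp add: \<phi>_def)
      qed (simp_all add: \<phi>_def hom_ext[OF t])
      then show "t : \<phi> ` carrier A" using a(1) by blast
    qed (use \<phi>h in auto)
  qed
  moreover have "\<phi> (c .[A] a) = c .[opp (end_alg G P)] \<phi> a" if h: "c :. K" "a :. A" for c a
  proof (rule carrier_eqI[of _ P])
    fix p assume p: "p :. P"
    have ca: "c .[A] a :. A" by (rule AK.smult_closed[OF h])
    have "\<phi> (c .[A] a) p = scal G P c (\<phi> a p)"
    proof (rule \<phi>_eqI[OF ca p scal_module(2)[OF KG P.lC h(1) \<phi>c[OF h(2) p]]])
      fix x assume x: "x :. E"
      have "\<kappa> p ((c .[A] a) .[E] x) = \<kappa> p (scal A E c (a .[E] x))" using scal_module(4)[OF KA lE h(2,1) x] by simp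
      also have "... = c *[K] \<kappa> p (a .[E] x)"
        using functionalD(3)[of "\<kappa> p" K A E c "a .[E] x"] i(5)[OF p, unfolded DE_functional] h(1) E.smult_closed[OF h(2) x] by simp
      finally show "\<kappa> p ((c .[A] a) .[E] x) = \<kappa> (scal G P c (\<phi> a p)) x"
        using \<kappa>scal[OF h(1) \<phi>c[OF h(2) p] x] \<kappa>\<phi>[OF h(2) p x] by simp
    qed
    then show "\<phi> (c .[A] a) p = (c .[opp (end_alg G P)] \<phi> a) p" using p by simp
  qed (simp_all add: \<phi>_def)
  ultimately have \<phi>: "\<phi> : alg_iso K A (opp (end_alg G P))" by (simp add: alg_iso_def ring_iso_def)
  let ?X = "with_smult (%a x. \<phi> a .[DCk K G P] x) (DCk K G P)"
  define \<theta> where "\<theta> = (\<lambda>x\<in>carrier E. \<lambda>p\<in>carrier P. \<kappa> p x)"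
  have \<theta>c: "\<theta> x : functionals K G P" if "x :. E" for x
    unfolding \<theta>_def using that
    by (simp, intro functionalI) (simp_all add: \<kappa>D(1) \<kappa>add \<kappa>scal scal_module(2)[OF KG P.lC])
  have \<theta>h: "\<theta> : Hom A E ?X"
  proof (rule hom_setI)
    fix x y assume h: "x :. E" "y :. E"
    then show "\<theta> (x +[E] y) = \<theta> x +[?X] \<theta> y"
      by (auto simp: \<theta>_def \<kappa>D(2) intro!: restrict_ext)
  next
    fix a x assume h: "a :. A" "x :. E"
    then show "\<theta> (a .[E] x) = a .[?X] \<theta> x"
      by (auto simp: \<theta>_def \<kappa>\<phi> \<phi>c E.smult_closed intro!: restrict_ext)
  qed (use \<theta>c in \<open>simp_all add: \<theta>_def\<close>)
  have "bij_betw \<theta> (carrier E) (carrier ?X)"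
  proof (rule bij_betw_imageI)
    show "inj_on \<theta> (carrier E)"
    proof (rule inj_onI)
      fix x y assume h: "x :. E" "y :. E" "\<theta> x = \<theta> y"
      show "x = y"
      proof (rule E_eqI[OF h(1,2)])
        fix \<eta> assume \<eta>: "\<eta> :. DE"
        show "\<eta> x = \<eta> y" using fun_cong[OF h(3), of "\<kappa>' \<eta>"] h(1,2) i(6)[OF \<eta>] i(4)[OF \<eta>] by (simp add: \<theta>_def)
      qed
    qed
    show "\<theta> ` carrier E = carrier ?X"
    proof (intro equalityI subsetI)
      fix \<mu> assume "\<mu> :. ?X"
      then have \<mu>: "\<mu> : functionals K G P" by simp
      note \<kappa>'c = i(6)
      have "(\<lambda>\<eta>\<in>carrier DE. \<mu> (\<kappa>' \<eta>)) : functionals K G DE"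
      proof (rule functionalI)
        fix \<eta> assume "\<eta> :. DE"
        then show "(\<lambda>\<eta>\<in>carrier DE. \<mu> (\<kappa>' \<eta>)) \<eta> :. K"
          using functionalD(1)[OF \<mu> \<kappa>'c] by (simp only: restrict_apply')
      next
        fix \<eta> \<eta>' assume h: "\<eta> :. DE" "\<eta>' :. DE"
        show "(\<lambda>\<eta>\<in>carrier DE. \<mu> (\<kappa>' \<eta>)) (\<eta> +[DE] \<eta>') = (\<lambda>\<eta>\<in>carrier DE. \<mu> (\<kappa>' \<eta>)) \<eta> +[K] (\<lambda>\<eta>\<in>carrier DE. \<mu> (\<kappa>' \<eta>)) \<eta>'"
          using h DE.M.a_closed[OF h] hom_add[OF i(2) h] functionalD(2)[OF \<mu> \<kappa>'c[OF h(1)] \<kappa>'c[OF h(2)]] by (simp only: restrict_apply')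
      next
        fix c \<eta> assume h: "c :. K" "\<eta> :. DE"
        show "(\<lambda>\<eta>\<in>carrier DE. \<mu> (\<kappa>' \<eta>)) (scal G DE c \<eta>) = c *[K] (\<lambda>\<eta>\<in>carrier DE. \<mu> (\<kappa>' \<eta>)) \<eta>"
          using h scal_module(2)[OF KG lDE h] hom_scal(2)[OF KG i(2) h] functionalD(3)[OF \<mu> h(1) \<kappa>'c[OF h(2)]] by (simp only: restrict_apply')
      qed (rule restrict_extensional)
      then obtain y where y: "y :. EG" "ALL \<eta>:functionals K G EG. (\<lambda>\<eta>\<in>carrier DE. \<mu> (\<kappa>' \<eta>)) \<eta> = \<eta> y"
        using dual_reflexive[OF KG fEG] by blast
      have "\<theta> y = \<mu>"
      proof (rule carrier_eqI[of _ P])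
        fix p assume p: "p :. P"
        have "(\<lambda>\<eta>\<in>carrier DE. \<mu> (\<kappa>' \<eta>)) (\<kappa> p) = \<kappa> p y" using y(2) \<kappa>E[OF p] by blast
        then have "\<mu> (\<kappa>' (\<kappa> p)) = \<kappa> p y" using i(5)[OF p] by (simp only: restrict_apply')
        then show "\<theta> y p = \<mu> p" using p y(1) i(3)[OF p] by (simp add: \<theta>_def)
      qed (use y(1) functionalD(4)[OF \<mu>] in \<open>simp_all add: \<theta>_def\<close>)
      then show "\<mu> : \<theta> ` carrier E" using y(1) by auto
    qed (use \<theta>c in auto)
  qed
  then have iso: "mod_iso A E ?X" unfolding mod_iso_def using \<theta>h by blast
  have "identification K A E G P C s q \<phi>"
    unfolding identification_def Let_def by (intro conjI ballI s q qs \<phi> iso[unfolded DCk_def Bk_def])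
  then show ?thesis by blast
qed

end

section \<open>Trace decompositions and assembly of the result\<close>

lemma fac_iso_source:
  assumes X: "left_module R X" and W': "left_module R W'" and f: "fac R W X" and i: "isos R W W' u v"
  shows "fac R W' X"
proof -
  interpret X: left_module R X by fact
  obtain n a b where ab: "!!l. l < (n::nat) ==> a l : Hom R X W" "!!l. l < n ==> b l : Hom R W X"
    "!!x. x :. X ==> (\<Oplus>\<^bsub>X\<^esub>l\<in>{..<n}. b l (a l x)) = x"
    using f unfolding fac_def by blast
  note ii = isosD[OF i]
  let ?a = "%l. compose (carrier X) u (a l)" and ?b = "%l. compose (carrier W') (b l) v"
  have "(\<Oplus>\<^bsub>X\<^esub>l\<in>{..<n}. ?b l (?a l x)) = x" if x: "x :. X" for x
  proof -
    have c: "a l x :. W" "b l (a l x) :. X" if "l < n" for l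
      using hom_closed[OF ab(1)[OF that] x] hom_closed[OF ab(2)[OF that]] by auto
    have "(\<Oplus>\<^bsub>X\<^esub>l\<in>{..<n}. ?b l (?a l x)) = (\<Oplus>\<^bsub>X\<^esub>l\<in>{..<n}. b l (a l x))"
      using c x ii(3,5) by (intro X.M.finsum_cong') (auto simp: compose_eq)
    then show ?thesis using ab(3)[OF x] by simp
  qed
  moreover have "?a l : Hom R X W'" "?b l : Hom R W' X" if "l < n" for l
    using hom_compose[OF X ab(1)[OF that] ii(1)] hom_compose[OF W' ii(2) ab(2)[OF that]] by auto
  ultimately show ?thesis unfolding fac_def by (intro exI[of _ n] exI[of _ ?a] exI[of _ ?b]) blast
qed

text \<open>\<open>\<xi>\<close> is lifted to \<open>X 0\<close>, whose identity is a sum of maps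
  through \<open>P\<close>; \<open>k > 0\<close> guarantees that \<open>X 0\<close> is among the
  terms in \<open>add P\<close>.\<close>

lemma (in special_cmod) functional_decomposition:
  assumes k: "0 < k" and \<xi>: "\<xi> : functionals K G C"
  shows "EX (n :: nat) \<eta> f. (ALL l<n. f l : Hom G C P & \<eta> l : functionals K G P) &
    (ALL c:carrier C. \<xi> c = (\<Oplus>\<^bsub>K\<^esub>l\<in>{..<n}. \<eta> l (f l c)))"
proof -
  have lX: "left_module G (X 0)" by (rule fdmD(1)[OF fX]) simp
  interpret X: left_module G "X 0" by (rule lX)
  interpret fK: field K by (rule fd_algebraD(1)[OF KG])
  obtain f where f: "f : Hom G C (X 0)" "pstar (X 0) p f = \<xi>" using functional_lift[OF k \<xi>] by blast
  obtain n a b where ab: "!!l. l < (n::nat) ==> a l : Hom G (X 0) P" "!!l. l < n ==> b l : Hom G P (X 0)"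
    "!!x. x :. (X 0) ==> (\<Oplus>\<^bsub>X 0\<^esub>l\<in>{..<n}. b l (a l x)) = x"
    using facP[OF k] unfolding fac_def by blast
  have p1: "(\<lambda>x\<in>carrier (X 0). p x 1[G]) : functionals K G (X 0)"
    by (rule dual_regular_hom_one(1)[OF KG lX p_hom])
  let ?\<eta> = "%l. \<lambda>x\<in>carrier P. compose (carrier P) p (b l) x 1[G]"
  have \<eta>: "?\<eta> l : functionals K G P" if "l < n" for l
    by (rule dual_regular_hom_one(1)[OF KG lP hom_compose[OF lP ab(2)[OF that] p_hom]])
  have fa: "compose (carrier C) (a l) f : Hom G C P" if "l < n" for l by (rule hom_compose[OF lC f(1) ab(1)[OF that]])
  have "\<xi> c = (\<Oplus>\<^bsub>K\<^esub>l\<in>{..<n}. ?\<eta> l (compose (carrier C) (a l) f c))" if c: "c :. C" for c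
  proof -
    have fc: "f c :. (X 0)" by (rule hom_closed[OF f(1) c])
    have cc: "a l (f c) :. P" "b l (a l (f c)) :. (X 0)" if "l < n" for l
      using hom_closed[OF ab(1)[OF that] fc] hom_closed[OF ab(2)[OF that]] by auto
    have "\<xi> c = p (f c) 1[G]" unfolding f(2)[symmetric] using f(1) c by (simp add: pstar_def)
    also have "... = (\<lambda>x\<in>carrier (X 0). p x 1[G]) (\<Oplus>\<^bsub>X 0\<^esub>l\<in>{..<n}. b l (a l (f c)))"
      unfolding ab(3)[OF fc] using fc by simp
    also have "... = (\<Oplus>\<^bsub>K\<^esub>l\<in>{..<n}. (\<lambda>x\<in>carrier (X 0). p x 1[G]) (b l (a l (f c))))"
      by (rule functional_finsum[OF fd_algebraD(1)[OF KG] X.M_group p1]) (use cc in auto)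
    also have "... = (\<Oplus>\<^bsub>K\<^esub>l\<in>{..<n}. ?\<eta> l (compose (carrier C) (a l) f c))"
      using cc c functionalD(1)[OF p1] functionalD(1)[OF \<eta>] by (intro fK.finsum_cong') (auto simp: compose_eq)
    finally show ?thesis .
  qed
  then show ?thesis using \<eta> fa by (intro exI[of _ n] exI[of _ ?\<eta>] exI[of _ "%l. compose (carrier C) (a l) f"]) blast
qed

text \<open>By \<open>ev1_surj\<close>, \<open>c\<close> is the value at \<open>jj 1\<close> of a
  map on \<open>I 0\<close>, and the identity of \<open>I 0\<close> is a sum of maps through
  \<open>P\<close>.\<close>

lemma (in cogen_cmod) element_decomposition:
  assumes c: "c :. C"
  shows "EX (n :: nat) u x. (ALL l<n. u l : Hom G P C & x l :. P) & c = (\<Oplus>\<^bsub>C\<^esub>l\<in>{..<n}. u l (x l))"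
proof -
  interpret I: left_module G "I 0" by (rule lI)
  obtain u where u: "u : Hom G (I 0) C" "ev1 u = c" using ev1_surj[OF c] by blast
  obtain n a b where ab: "!!l. l < (n::nat) ==> a l : Hom G (I 0) P" "!!l. l < n ==> b l : Hom G P (I 0)"
    "!!x. x :. (I 0) ==> (\<Oplus>\<^bsub>I 0\<^esub>l\<in>{..<n}. b l (a l x)) = x"
    using facI[of 0] unfolding fac_def by blast
  let ?x = "%l. a l (jj 1[G])" and ?u = "%l. compose (carrier P) u (b l)"
  have x: "?x l :. P" and ub: "?u l : Hom G P C" and bx: "b l (?x l) :. (I 0)" if "l < n" for l
    using hom_closed[OF ab(1)[OF that] jj_closed] hom_compose[OF lP ab(2)[OF that] u(1)] hom_closed[OF ab(2)[OF that]] by auto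
  have "c = u (\<Oplus>\<^bsub>I 0\<^esub>l\<in>{..<n}. b l (?x l))" unfolding ab(3)[OF jj_closed] u(2)[symmetric] using u(1) by (simp add: ev1_def)
  also have "... = (\<Oplus>\<^bsub>C\<^esub>l\<in>{..<n}. u (b l (?x l)))"
    by (rule hom_finsum[OF u(1) I.M_group C.M_group]) (use bx in auto)
  also have "... = (\<Oplus>\<^bsub>C\<^esub>l\<in>{..<n}. ?u l (?x l))"
    using x hom_closed[OF ub x] by (intro C.M.finsum_cong') (auto simp: compose_eq)
  finally show ?thesis using x ub by (intro exI[of _ n] exI[of _ ?u] exI[of _ ?x]) blast
qed

text \<open>Right multiplications identify \<open>A\<close> with the opposite endomorphism algebra
  of its regular module, and the family found there is pulled back.\<close>

lemma basic_family_of_basic_regular: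
  fixes A :: "('k, 'a) module"
  assumes K: "fd_algebra K A" and b: "basic A (regular A)"
  shows "EX n e. basic_family A n e"
proof -
  interpret A: ring A by (rule fd_algebraD(4)[OF K])
  have l: "left_module A (regular A)" by (rule left_module_regular[OF fd_algebraD(4)[OF K]])
  have f: "fd_algebra K (opp (end_alg A (regular A)))"
    by (rule fd_algebra_opp[OF fd_algebra_end_alg[OF K fdm_regular[OF K]]])
  obtain n e where fam: "basic_family (opp (end_alg A (regular A))) n e"
    using basic_family_end_alg[OF K l b] basic_family_opp by blast
  let ?h = "%a. \<lambda>x\<in>carrier A. x *[A] a"
  have hc: "?h a : Hom A (regular A) (regular A)" if "a :. A" for a
    using smult_hom[OF l, of a] that by simp
  have "?h : ring_iso A (opp (end_alg A (regular A)))"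
  proof (rule ring_iso_memI)
    fix a assume "a :. A"
    then show "?h a :. (opp (end_alg A (regular A)))" using hc by simp
  next
    fix a b assume "a :. A" "b :. A"
    then show "?h (a *[A] b) = ?h a *[opp (end_alg A (regular A))] ?h b"
      "?h (a +[A] b) = ?h a +[opp (end_alg A (regular A))] ?h b"
      by (auto intro!: carrier_eqI[of _ A] simp: compose_def A.m_assoc A.r_distr)
  next
    show "?h 1[A] = 1[opp (end_alg A (regular A))]" by (auto intro!: restrict_ext)
    show "bij_betw ?h (carrier A) (carrier (opp (end_alg A (regular A))))"
    proof (rule bij_betw_imageI)
      show "inj_on ?h (carrier A)"
      proof (rule inj_onI)
        fix a b assume h: "a :. A" "b :. A" "?h a = ?h b"
        show "a = b" using fun_cong[OF h(3), of "1[A]"] h(1,2) by simp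
      qed
      show "?h ` carrier A = carrier (opp (end_alg A (regular A)))"
      proof (intro equalityI subsetI)
        fix t assume "t :. (opp (end_alg A (regular A)))"
        then have t: "t : Hom A (regular A) (regular A)" by simp
        have t1: "t 1[A] :. A" using hom_closed[OF t] by simp
        have "x *[A] t 1[A] = t x" if "x :. A" for x using hom_smult[OF t that, of "1[A]"] that by simp
        then have "?h (t 1[A]) = t"
          using hom_ext[OF t] by (intro carrier_eqI[of _ A]) simp_all
        then show "t : ?h ` carrier A" using imageI[OF t1, of ?h] by (simp only:)
      qed (use hc in auto)
    qed
  qed
  then show ?thesis using basic_family_iso[OF fd_algebraD(4)[OF K] fd_algebraD(4)[OF f] _ fam] by blast
qed

theorem theorem6p5:
  fixes K :: "'k ring" and A :: "('k, 'a) module" and E :: "('a, 'e) module"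
    and G :: "('k, 'g) module" and P :: "('g, 'p) module" and C :: "('g, 'c) module"
    and d k :: nat
  assumes "fd_algebra K A" and "basic A (regular A)"
    and "fg_module A E" and "basic A E" and "gen_cogen K A E"
    and "fd_algebra K G" and "alg_iso K G (opp (end_alg A E)) \<noteq> {}"
    and "domdim_eq G (d + 1)" and "d \<ge> 1"
    and "max_proj_inj_summand G P"
    and "k \<le> d + 1" and "coshifted K G P k C"
  shows "in_gen (Bk G C) (int k - 1) (Pk G P C) (DCk K G C) \<and>
    in_cogen (Bk G C) (int d - int k) (Ik K G P C) (DCk K G C) \<and>
    (1 \<le> k \<and> k \<le> d \<longrightarrow>
      (\<exists>s q \<phi>. identification K A E G P C s q \<phi>) \<and>
      (\<forall>s q \<phi>. identification K A E G P C s q \<phi> \<longrightarrow>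
        mod_iso (Bk G C) (DCk K G C) (ck A G P C s q \<phi> E)))"
proof -
  note KA = assms(1) and KG = assms(6)
  have fE: "fdm K A E" using assms(3) fg_module_iff[OF KA] by blast
  note lE = fdmD(1)[OF fE]
  obtain \<psi> where \<psi>: "\<psi> : alg_iso K G (opp (end_alg A E))" using assms(7) by blast
  have gc: "in_add A E (regular A)" "in_add A E (dual_regular K A)" using assms(5) by (simp_all add: gen_cogen_def)
  interpret gencogen K A E G \<psi>
    by (rule gencogen.intro[OF KA fE fac_of_in_add(1)[OF lE gc(1)] fac_of_in_add(1)[OF lE gc(2)] KG \<psi>])
  obtain n0 e0 where famA: "basic_family A n0 e0" using basic_family_of_basic_regular[OF KA assms(2)] by blast
  \<comment> \<open>Basicness of \<open>E\<close> passes to its endomorphism algebra and from there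
    to \<open>G\<close>.\<close>
  obtain m e where fam: "basic_family (opp (end_alg A E)) m e"
    using basic_family_end_alg[OF KA lE assms(4)] basic_family_opp by blast
  have "\<psi> : ring_iso G (opp (end_alg A E))" using \<psi> by (simp add: alg_iso_def)
  then obtain n1 e1 where famG: "basic_family G n1 e1"
    using basic_family_iso[OF fd_algebraD(4)[OF KG] fd_algebraD(4)[OF fd_algebra_opp[OF fd_algebra_end_alg[OF KA fE]]] _ fam] by blast
  obtain \<kappa> \<kappa>' where \<kappa>: "isos G P DE \<kappa> \<kappa>'" using P_iso_DE[OF famA famG assms(10)] by blast
  have P: "projective G P" "injective G P" "summand G P (regular G)"
    using assms(10) by (simp_all add: max_proj_inj_summand_def proj_inj_summand_def)
  have fP: "fdm K G P" by (rule projective_fdm[OF KG P(1)])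
  note lP = fdmD(1)[OF fP]
  have sc: "special_cotilting K G k P C" using assms(12) by (simp add: coshifted_def)
  then have cot: "cotilting K G k C" and PC: "in_add G C P" by (simp_all add: special_cotilting_def)
  have fC: "fdm K G C" using cot fg_module_iff[OF KG] by (auto simp: cotilting_def)
  note lC = fdmD(1)[OF fC]
  have lG: "left_module G (regular G)" by (rule left_module_regular[OF fd_algebraD(4)[OF KG]])
  obtain u v where uv: "u : Hom G P (regular G)" "v : Hom G (regular G) P" "!!x. x :. P ==> v (u x) = x"
    using summandE[OF P(3) lP] by blast
  \<comment> \<open>\<open>P\<close> in \<open>add C\<close> gives maps through several copies of
    \<open>C\<close>; as \<open>G\<close> is basic and \<open>P\<close> is a summand of
    \<open>G\<close>, one copy is enough.\<close>
  obtain s q where sq: "s : Hom G P C" "q : Hom G C P" "!!x. x :. P ==> q (s x) = x"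
    using retract_of_fac[OF KG famG lP lC uv fac_of_in_add(1)[OF lC PC]] by blast
  have ext: "ext_vanishes G i C C" if "i > 0" for i using cot that by (simp add: cotilting_def)
  obtain X \<delta> p where X: "cotilting_seq K G k X \<delta> p" "ALL j<=k. in_add G C (X j)" "ALL j<k. in_add G P (X j)"
    using sc unfolding special_cotilting_def by blast
  have facX: "fac G C (X k)" using fac_of_in_add(1)[OF lC] X(2) by blast
  have facP: "fac G P (X j)" if "j < k" for j using fac_of_in_add(1)[OF lP] X(3) that by blast
  obtain \<iota> J \<epsilon> where J: "inj_resolution G C \<iota> J \<epsilon>" "ALL i>k. zero_module (J i)"
    using cot unfolding cotilting_def idim_le_def by blast
  obtain jj I D where I: "inj_resolution G (regular G) jj I D" "ALL i<d + 1. projective G (I i)"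
    using assms(8) unfolding domdim_eq_def domdim_ge_def by blast
  have Ip: "projective G (I i)" if "i <= d" for i using I(2) that by simp
  \<comment> \<open>Terms that are both projective and injective lie in \<open>add (DE)\<close>, and
    \<open>DE\<close> is isomorphic to \<open>P\<close>. The range \<open>i \<le> d\<close> consists
    of the first \<open>d + 1\<close> terms.\<close>
  have facI: "fac G P (I i)" if "i <= d" for i
    by (rule fac_iso_source[OF fdmD(1)[OF projective_fdm[OF KG Ip[OF that]]] lP
          fac_DE[OF Ip[OF that] inj_resolutionD(1)[OF I(1)]] isos_sym[OF \<kappa>]])
  have cm: "cmod K G C" by (rule cmod.intro[OF KG fC])
  have sp: "special_cmod K G C P s q k X \<delta> p"
    by (intro special_cmod.intro special_cmod_axioms.intro cm fP P(2) sq X(1) facX facP ext)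
  have co: "cogen_cmod K G C P s q k d J I \<epsilon> D \<iota> jj" if "k <= d"
    by (intro cogen_cmod.intro cogen_cmod_axioms.intro cm fP sq J(1) J(2)[rule_format] I(1) Ip facI that) simp_all
  have 1: "in_gen (Bk G C) (int k - 1) (Pk G P C) (DCk K G C)" by (rule special_cmod.DC_in_gen[OF sp])
  have 2: "in_cogen (Bk G C) (int d - int k) (Ik K G P C) (DCk K G C)"
  proof (cases "k <= d")
    case True
    then show ?thesis by (rule cogen_cmod.DC_in_cogen[OF co])
  next
    \<comment> \<open>Here \<open>k = d + 1\<close>, so the index is \<open>-1\<close> and no
      sequence is required.\<close>
    case False
    have "fg_module (Bk G C) (DCk K G C)" using fg_module_iff[OF cmod.KB[OF cm]] cmod.fDC[OF cm] by blast
    then show ?thesis using False unfolding in_cogen_def by simp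
  qed
  have 3: "EX s q \<phi>. identification K A E G P C s q \<phi>" using ex_identification[OF fP \<kappa> sq] by blast
  \<comment> \<open>An arbitrary identification brings its own maps \<open>t\<close> and
    \<open>r\<close>. The two trace decompositions do not mention the splitting, so they carry over
    from \<open>s\<close> and \<open>q\<close>.\<close>
  have 4: "mod_iso (Bk G C) (DCk K G C) (ck A G P C t r \<phi> E)"
    if k: "1 <= k" "k <= d" and id: "identification K A E G P C t r \<phi>" for t r \<phi>
  proof -
    have tr: "t : Hom G P C" "r : Hom G C P" "!!x. x :. P ==> r (t x) = x"
      "\<phi> : alg_iso K A (opp (end_alg G P))"
      and iso: "mod_iso A E (with_smult (%a x. \<phi> a .[DCk K G P] x) (DCk K G P))"
      using id unfolding identification_def Let_def DCk_def Bk_def by blast+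
    obtain \<theta> \<theta>' where \<theta>: "isos A E (with_smult (%a x. \<phi> a .[DCk K G P] x) (DCk K G P)) \<theta> \<theta>'"
      using mod_iso_isos[OF lE iso] by blast
    have k0: "0 < k" using k by simp
    have "ck_data K G C P t r A E \<phi> \<theta> \<theta>'"
      by (intro ck_data.intro ck_data_axioms.intro cm fP tr lE \<theta> special_cmod.functional_decomposition[OF sp k0]
          cogen_cmod.element_decomposition[OF co[OF k(2)]])
    then show ?thesis by (rule ck_data.DC_iso_ck)
  qed
  show ?thesis using 1 2 3 4 by blast
qed

end
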